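(* Let $H\in(\frac12,1)$, $T>0$, $d,m\ge 1$, $x\in\mathbb{R}^d$, and assume that $V=(V_0,V_1,\dots,V_m)\in C^3_b$. Let $X$ be the solution of $$X_t = x+\int_0^t V(X_s)\,dB_s,\qquad t\in[0,T],$$ and for each $n\in\mathbb{N}$ let $X^n=\{X^n_t, t\in[0,T]\}$ be the continuous-time interpolation of the Crank-Nicolson scheme (both defined in the context). Then for any $p\ge 1$ there exists a constant $K=K_p$ independent of $n$ such that for all $n\in\mathbb{N}$ $$\sup_{t\in[0,T]}\big(\mathbb{E}|X_t-X^n_t|^p\big)^{1/p}\le K/\vartheta_n,$$ where $$\vartheta_n=\begin{cases} n^{2H-\frac12} & \text{when } m>1,\\ n^{H+\frac12} & \text{when } m=1 \text{ and } V_0\not\equiv 0,\\ n^{2H} & \text{when } m=1 \text{ and } V_0\equiv 0.\end{cases}$$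
   Context: $B=(B^0,B^1,\dots,B^m)$, where $B^0_t=t$ and $(B^1,\dots,B^m)$ is an $m$-dimensional fractional Brownian motion with Hurst parameter $H\in(\frac12,1)$, i.e. $B^1,\dots,B^m$ are independent centered Gaussian processes (with continuous paths) with covariance $\mathbb{E}(B^j_sB^j_t)=\frac12(t^{2H}+s^{2H}-|t-s|^{2H})$. The vector field is $V=(V_0,V_1,\dots,V_m):\mathbb{R}^d\to\mathcal{L}(\mathbb{R}^{m+1},\mathbb{R}^d)$, and $V(X_s)\,dB_s=\sum_{j=0}^m V_j(X_s)\,dB^j_s$; integrals are pathwise Riemann-Stieltjes (Young) integrals. $V\in C^3_b$ means that $V$ is three times continuously differentiable and $V$ and its partial derivatives up to order 3 are bounded. For $n\in\mathbb{N}$ let $t_k=kT/n$, $k=0,\dots,n$. The Crank-Nicolson scheme $\{X^n_{t_0},\dots,X^n_{t_n}\}$ is defined by the implicit recursion $X^n_0=x$, $$X^n_{t_{k+1}}=X^n_{t_k}+\tfrac12\big[V(X^n_{t_{k+1}})+V(X^n_{t_k})\big](B_{t_{k+1}}-B_{t_k}),\quad k=0,\dots,n-1.$$ Its continuous-time interpolation is, for $t\in[t_k,t_{k+1})$, $k=0,\dots,n-1$, $$X^n_t=X^n_{t_k}+\tfrac12\big[V(X^n_{t_k})+V(X^n_{t_{k+1}})\big](B_t-B_{t_k}),$$ with $X^n_T=X^n_{t_n}$. *)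

theory Defs
  imports "HOL-Probability.Probability"
begin

section \<open>Fractional Brownian motion\<close>

text \<open>Almost surely constant variables count as (degenerate) Gaussian.\<close>

definition gaussian_rv :: "'w measure \<Rightarrow> ('w \<Rightarrow> real) \<Rightarrow> bool" where
  "gaussian_rv M Z \<longleftrightarrow>
     Z \<in> borel_measurable M \<and>
     ((\<exists>\<mu> \<sigma>. 0 < \<sigma> \<and> distributed M lborel Z (normal_density \<mu> \<sigma>)) \<or>
      (\<exists>c. AE \<omega> in M. Z \<omega> = c))"

definition centered_gaussian_process ::
    "'w measure \<Rightarrow> real set \<Rightarrow> (real \<Rightarrow> 'w \<Rightarrow> real) \<Rightarrow> bool" where
  "centered_gaussian_process M S Z \<longleftrightarrow>
     (\<forall>F a. finite F \<and> F \<subseteq> S \<longrightarrow> gaussian_rv M (\<lambda>\<omega>. \<Sum>t\<in>F. a t * Z t \<omega>)) \<and>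
     (\<forall>t\<in>S. prob_space.expectation M (Z t) = 0)"

definition fbm :: "'w measure \<Rightarrow> real \<Rightarrow> real \<Rightarrow> (real \<Rightarrow> 'w \<Rightarrow> real) \<Rightarrow> bool" where
  "fbm M T H Z \<longleftrightarrow>
     centered_gaussian_process M {0..T} Z \<and>
     (AE \<omega> in M. continuous_on {0..T} (\<lambda>t. Z t \<omega>)) \<and>
     (\<forall>s\<in>{0..T}. \<forall>t\<in>{0..T}.
        prob_space.expectation M (\<lambda>\<omega>. Z s \<omega> * Z t \<omega>) =
          (1 / 2) * (s powr (2 * H) + t powr (2 * H) - \<bar>t - s\<bar> powr (2 * H)))"

text \<open>Component 0 of the driver is time; components 1 to \<open>m\<close> are independent as processes,
  i.e. as random elements of the product space over the time interval.\<close>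

definition fbm_driver ::
    "'w measure \<Rightarrow> real \<Rightarrow> real \<Rightarrow> nat \<Rightarrow> (nat \<Rightarrow> real \<Rightarrow> 'w \<Rightarrow> real) \<Rightarrow> bool" where
  "fbm_driver M T H m B \<longleftrightarrow>
     (\<forall>t\<in>{0..T}. \<forall>\<omega>\<in>space M. B 0 t \<omega> = t) \<and>
     (\<forall>j\<in>{1..m}. fbm M T H (B j)) \<and>
     prob_space.indep_vars M (\<lambda>j. \<Pi>\<^sub>M t\<in>{0..T}. borel)
       (\<lambda>j \<omega>. \<lambda>t\<in>{0..T}. B j t \<omega>) {1..m}"

section \<open>Vector fields of class $C^k_b$\<close>

text \<open>\<open>Cb k f\<close>: \<open>f\<close> is \<open>k\<close> times continuously differentiable, and \<open>f\<close> and its partial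
  derivatives up to order \<open>k\<close> are bounded.  The \<open>i\<close>-th partial derivative is the value of
  the derivative on the \<open>i\<close>-th unit vector.\<close>

primrec Cb :: "nat \<Rightarrow> (real ^ 'd \<Rightarrow> real ^ 'e) \<Rightarrow> bool" where
  "Cb 0 f \<longleftrightarrow> continuous_on UNIV f \<and> bounded (range f)"
| "Cb (Suc k) f \<longleftrightarrow>
     bounded (range f) \<and> (\<forall>y. f differentiable (at y)) \<and>
     (\<forall>i. Cb k (\<lambda>y. frechet_derivative f (at y) (axis i 1)))"

section \<open>The equation\<close>

text \<open>Riemann-Stieltjes integral of \<open>f\<close> against \<open>g\<close> as the limit of tagged sums over
  partitions whose mesh tends to 0.\<close>

definition has_rs_integral ::
    "(real \<Rightarrow> 'a::real_normed_vector) \<Rightarrow> (real \<Rightarrow> real) \<Rightarrow> 'a \<Rightarrow> real \<Rightarrow> real \<Rightarrow> bool" where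
  "has_rs_integral f g I a b \<longleftrightarrow>
     (\<forall>\<epsilon>>0. \<exists>\<delta>>0. \<forall>p. p tagged_division_of {a..b} \<and> (\<forall>(\<xi>, K)\<in>p. diameter K < \<delta>) \<longrightarrow>
        norm ((\<Sum>(\<xi>, K)\<in>p. (g (Sup K) - g (Inf K)) *\<^sub>R f \<xi>) - I) < \<epsilon>)"

text \<open>A path \<open>X\<close> solving $X_t = x + \sum_{j=0}^m \int_0^t V_j(X_s)\,db^j_s$ on \<open>[0,T]\<close>.
  The solution is sought in the class where the integrals are Young integrals: the driver has
  Hoelder order arbitrarily close to \<open>H\<close>, so \<open>X\<close> needs some Hoelder order above \<open>1 - H\<close>.\<close>

definition young_solution ::
    "real \<Rightarrow> real \<Rightarrow> nat \<Rightarrow> (nat \<Rightarrow> real ^ 'd \<Rightarrow> real ^ 'd) \<Rightarrow> (nat \<Rightarrow> real \<Rightarrow> real) \<Rightarrow>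
     real ^ 'd \<Rightarrow> (real \<Rightarrow> real ^ 'd) \<Rightarrow> bool" where
  "young_solution T H m V b x X \<longleftrightarrow>
     (\<exists>\<alpha> > 1 - H. \<exists>C. \<forall>s\<in>{0..T}. \<forall>t\<in>{0..T}. norm (X t - X s) \<le> C * \<bar>t - s\<bar> powr \<alpha>) \<and>
     (\<forall>t\<in>{0..T}. \<exists>I. (\<forall>j\<le>m. has_rs_integral (\<lambda>s. V j (X s)) (b j) (I j) 0 t) \<and>
                     X t = x + (\<Sum>j\<le>m. I j))"

section \<open>The Crank-Nicolson scheme\<close>

definition grid :: "real \<Rightarrow> nat \<Rightarrow> nat \<Rightarrow> real" where
  "grid T n k = real k * T / real n"

text \<open>\<open>Y\<close> is the interpolated path on \<open>[0,T]\<close>; the scheme itself consists of its values at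
  the grid points.  The implicit recursion need not have a unique solution when the increments
  of \<open>b\<close> are large, so this is a predicate rather than a function.\<close>

definition crank_nicolson ::
    "real \<Rightarrow> nat \<Rightarrow> nat \<Rightarrow> (nat \<Rightarrow> real ^ 'd \<Rightarrow> real ^ 'd) \<Rightarrow> (nat \<Rightarrow> real \<Rightarrow> real) \<Rightarrow>
     real ^ 'd \<Rightarrow> (real \<Rightarrow> real ^ 'd) \<Rightarrow> bool" where
  "crank_nicolson T n m V b x Y \<longleftrightarrow>
     Y 0 = x \<and>
     (\<forall>k<n. Y (grid T n (Suc k)) = Y (grid T n k) +
        (1 / 2) *\<^sub>R (\<Sum>j\<le>m. (b j (grid T n (Suc k)) - b j (grid T n k)) *\<^sub>R
                           (V j (Y (grid T n (Suc k))) + V j (Y (grid T n k))))) \<and>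
     (\<forall>k<n. \<forall>t\<in>{grid T n k..<grid T n (Suc k)}. Y t = Y (grid T n k) +
        (1 / 2) *\<^sub>R (\<Sum>j\<le>m. (b j t - b j (grid T n k)) *\<^sub>R
                           (V j (Y (grid T n k)) + V j (Y (grid T n (Suc k))))))"

section \<open>The error bound\<close>

text \<open>$(E|Z|^p)^{1/p}$, with value \<open>\<infinity>\<close> if the \<open>p\<close>-th moment is infinite.\<close>

definition Lp_norm :: "'w measure \<Rightarrow> real \<Rightarrow> ('w \<Rightarrow> 'a::real_normed_vector) \<Rightarrow> ennreal" where
  "Lp_norm M p Z =
     (let I = \<integral>\<^sup>+ \<omega>. ennreal (norm (Z \<omega>) powr p) \<partial>M
      in if I = \<infinity> then \<infinity> else ennreal (enn2real I powr (1 / p)))"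

text \<open>Used for \<open>m \<ge> 1\<close> only; \<open>V0\<close> is the drift.\<close>

definition rate :: "real \<Rightarrow> nat \<Rightarrow> (real ^ 'd \<Rightarrow> real ^ 'd) \<Rightarrow> nat \<Rightarrow> real" where
  "rate H m V0 n =
     (if m > 1 then real n powr (2 * H - 1 / 2)
      else if \<exists>y. V0 y \<noteq> 0 then real n powr (H + 1 / 2)
      else real n powr (2 * H))"

end

theory Submission
 imports Defs "HOL-Computational_Algebra.Formal_Power_Series"
begin

text \<open>On a grid cell the error of the trapezoidal rule expands, by Young estimates, into antisymmetric areas of the
 driver (for one noise: the time-noise area and the cube of the increment) times smooth coefficients, plus a remainder of
 order above the rate. Areas and cubes are replaced by finite Gaussian sums; Gaussian integration by parts bounds their
 high moments over blocks of cells, and a chaining argument turns these into a bound, Hoelder in the block, with a random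
 constant \<open>Tht\<close> of the size of the rate in every moment. A discrete sewing argument gives stability of the implicit
 scheme on blocks whose length depends on the Hoelder constant \<open>G\<close> of the driver, so the error is at most
 \<open>exp (const * G powr (1 / be)) * Tht\<close>. As \<open>1 / be < 2\<close> and \<open>G\<close> has Gaussian tails, the exponential has all moments, and no
 conditions on the size of the increments of the driver are needed.\<close>

text \<open>The rates are the orders of sums of n = T / h cell errors. The symmetric part of the
  second order terms cancels against the trapezoidal rule, and the variance of a sum of areas is
  linear in the number of cells: two noises give n * h powr (4 * H), time and noise n * h powr (2 +
  2 * H), which explains the first two rates. With one noise and no drift no area is left and the
  cubes lead; they are positively correlated over the whole interval, and their sum has variance of
  order h powr (4 * H). The obstacle is that pathwise only exponents \<open>be\<close> < H are
  available. Terms at the rate itself must be kept explicit until expectations are taken; only terms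
  with an order to spare are estimated pathwise. Likewise the moment bounds give blocks the exponent
  1/2, chaining only some \<open>tht\<close> < 1/2, and \<open>be\<close> must be so close to H that
  \<open>tht + be\<close> > 1, else sums weighted with coefficients along the solution cannot be
  sewn. A constant \<open>L0\<close>, equal to 0 without drift, lets both cases of one noise share
  one argument.\<close>

section \<open>Sewing estimates, a bootstrap for constants, and dyadic chaining\<close>

definition sewc :: "real => real" where
 "sewc \<gamma> = 1 / (1 - (2/3) powr (\<gamma> - 1))"

lemma sewc_ge1: assumes "1 < \<gamma>" shows "1 <= sewc \<gamma>" "(2/3::real) powr (\<gamma> - 1) < 1"
proof -
 show *: "(2/3::real) powr (\<gamma> - 1) < 1"
  using powr_less_mono2[of "\<gamma> - 1" "2/3" 1] assms by simp
 show "1 <= sewc \<gamma>"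
  unfolding sewc_def using * by (simp add: field_simps)
qed

text \<open>Split at the middle. The halves have lengths at most 2/3 of the whole (1/2 fails by
  rounding, as 3 = 1 + 2 shows), and since \<gamma> > 1 both together carry only the fraction (2/3)
  powr (\<gamma> - 1) of the bound. The constant \<open>C = sewc \<gamma> * K\<close> is the fixed
  point of \<open>K + C * la = C\<close>, so the induction reproduces it.\<close>

lemma discrete_sewing:
 fixes X :: "nat => nat => 'a::real_normed_vector"
 assumes "1 < \<gamma>" "0 <= K"
  and dlt: "!!k i l. p <= k ==> k <= i ==> i <= l ==> l <= q ==>
       norm (X k l - X k i - X i l) <= K * real (l - k) powr \<gamma>"
  and "p <= k" "k < l" "l <= q"
 shows "norm (X k l - (\<Sum>i=k..<l. X i (Suc i))) <= sewc \<gamma> * K * real (l - k) powr \<gamma>"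
 using assms(4-6)
proof (induction "l - k" arbitrary: k l rule: less_induct)
 case less
 define C where "C = sewc \<gamma> * K"
 define la where "la = (2/3::real) powr (\<gamma> - 1)"
 have la: "la < 1" using sewc_ge1[OF assms(1)] by (simp add: la_def)
 have CK: "K + C * la = C"
  unfolding C_def sewc_def la_def[symmetric] using la by (simp add: field_simps)
 have C0: "0 <= C" unfolding C_def using sewc_ge1[OF assms(1)] assms(2) by simp
 show ?case
 proof (cases "l = Suc k")
  case True
  then show ?thesis using C0 by (simp add: C_def)
 next
  case False
  define N where "N = l - k"
  define i where "i = k + N div 2"
  have N2: "2 <= N" using False less.prems by (simp add: N_def)
  have il: "k < i" "i < l" using N2 less.prems by (auto simp: i_def N_def)
  have e1: "norm (X k i - (\<Sum>j=k..<i. X j (Suc j))) <= C * real (i - k) powr \<gamma>"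
   unfolding C_def using less.hyps[of i k] il less.prems by auto
  have e2: "norm (X i l - (\<Sum>j=i..<l. X j (Suc j))) <= C * real (l - i) powr \<gamma>"
   unfolding C_def using less.hyps[of l i] il less.prems by auto
  have sp: "(\<Sum>j=k..<l. X j (Suc j)) = (\<Sum>j=k..<i. X j (Suc j)) + (\<Sum>j=i..<l. X j (Suc j))"
   using il by (simp add: sum.atLeastLessThan_concat)
  have e3: "norm (X k l - X k i - X i l) <= K * real N powr \<gamma>"
   unfolding N_def using il less.prems by (intro dlt) auto
  have part: "real u powr \<gamma> <= real u * (la * real N powr (\<gamma> - 1))"
   if "u \<ge> 1" "3 * u <= 2 * N" for u
  proof -
   have "real u powr \<gamma> = real u powr (1 + (\<gamma> - 1))" by simp
   also have "... = real u * real u powr (\<gamma> - 1)"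
    using that by (subst powr_add) simp
   also have "real u powr (\<gamma> - 1) <= (2/3 * real N) powr (\<gamma> - 1)"
    using that assms(1) by (intro powr_mono2) auto
   also have "... = la * real N powr (\<gamma> - 1)" by (subst powr_mult) (auto simp: la_def)
   finally show ?thesis using that by (simp add: mult_left_mono)
  qed
  have "real (i - k) powr \<gamma> <= real (i - k) * (la * real N powr (\<gamma> - 1))"
   by (rule part) (use N2 in \<open>auto simp: i_def\<close>)
  moreover have "real (l - i) powr \<gamma> <= real (l - i) * (la * real N powr (\<gamma> - 1))"
   by (rule part) (use N2 less.prems in \<open>auto simp: i_def N_def\<close>)
  ultimately have "real (i - k) powr \<gamma> + real (l - i) powr \<gamma>
    <= (real (i - k) + real (l - i)) * (la * real N powr (\<gamma> - 1))"
   by (simp add: distrib_right)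
  also have "real (i - k) + real (l - i) = real N" using il by (simp add: N_def)
  also have "real N * (la * real N powr (\<gamma> - 1)) = la * real N powr (1 + (\<gamma> - 1))"
   using N2 by (subst powr_add) simp
  finally have s: "real (i - k) powr \<gamma> + real (l - i) powr \<gamma> <= la * real N powr \<gamma>" by simp
  have "norm (X k l - (\<Sum>j=k..<l. X j (Suc j)))
    = norm ((X k l - X k i - X i l) + (X k i - (\<Sum>j=k..<i. X j (Suc j))) + (X i l - (\<Sum>j=i..<l. X j (Suc j))))"
   unfolding sp by (simp add: algebra_simps)
  also have "... <= norm (X k l - X k i - X i l) + norm (X k i - (\<Sum>j=k..<i. X j (Suc j)))
    + norm (X i l - (\<Sum>j=i..<l. X j (Suc j)))"
   by (intro norm_triangle_le add_mono norm_triangle_ineq order_refl)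
  also have "... <= K * real N powr \<gamma> + C * (real (i - k) powr \<gamma> + real (l - i) powr \<gamma>)"
   using e1 e2 e3 by (simp add: algebra_simps)
  also have "... <= K * real N powr \<gamma> + C * (la * real N powr \<gamma>)"
   using s C0 by (simp add: mult_left_mono)
  also have "... = (K + C * la) * real N powr \<gamma>" by (simp add: algebra_simps)
  finally show ?thesis using CK by (simp add: C_def N_def)
 qed
qed

text \<open>The form used on grids: the germ is compared with a path whose increments match it up to \<open>err\<close>.\<close>

lemma discrete_sewing_path:
 fixes X :: "nat => nat => 'a::real_normed_vector" and F :: "nat => 'a"
 assumes "1 < \<gamma>" "0 <= K" "0 <= h"
  and dlt: "!!k i l. p <= k ==> k <= i ==> i <= l ==> l <= q ==>
       norm (X k l - X k i - X i l) <= K * (real (l - k) * h) powr \<gamma>"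
  and F: "!!i. p <= i ==> i < q ==> norm (F (Suc i) - F i - X i (Suc i)) <= err"
  and X0: "!!k. X k k = 0"
  and "p <= k" "k <= l" "l <= q"
 shows "norm (F l - F k - X k l) <= sewc \<gamma> * K * (real (l - k) * h) powr \<gamma> + real (l - k) * err"
proof (cases "k = l")
 case True
 then show ?thesis using X0 by simp
next
 case False
 then have kl: "k < l" using assms by simp
 have "norm (X k l - (\<Sum>i=k..<l. X i (Suc i))) <= sewc \<gamma> * (K * h powr \<gamma>) * real (l - k) powr \<gamma>"
 proof (rule discrete_sewing[where p = p and q = q])
  fix k i l assume "p <= k" "k <= i" "i <= l" "l <= q"
  then show "norm (X k l - X k i - X i l) <= K * h powr \<gamma> * real (l - k) powr \<gamma>"
   using dlt[of k i l] assms(3) by (simp add: powr_mult mult_ac)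
 qed (use assms kl in auto)
 moreover have "norm ((F l - F k) - (\<Sum>i=k..<l. X i (Suc i))) <= real (l - k) * err"
 proof -
  have "(F l - F k) = (\<Sum>i=k..<l. F (Suc i) - F i)"
   using kl by (simp add: sum_Suc_diff')
  then have "norm ((F l - F k) - (\<Sum>i=k..<l. X i (Suc i))) = norm (\<Sum>i=k..<l. F (Suc i) - F i - X i (Suc i))"
   by (simp add: sum_subtractf)
  also have "... <= (\<Sum>i=k..<l. err)"
   using assms kl by (intro sum_norm_le F) auto
  finally show ?thesis by simp
 qed
 moreover have "norm (F l - F k - X k l) <= norm ((F l - F k) - (\<Sum>i=k..<l. X i (Suc i))) + norm (X k l - (\<Sum>i=k..<l. X i (Suc i)))"
  using norm_triangle_ineq4[of "(F l - F k) - (\<Sum>i=k..<l. X i (Suc i))" "X k l - (\<Sum>i=k..<l. X i (Suc i))"] by simp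
 moreover have "sewc \<gamma> * (K * h powr \<gamma>) * real (l - k) powr \<gamma> = sewc \<gamma> * K * (real (l - k) * h) powr \<gamma>"
  using assms by (simp add: powr_mult mult_ac)
 ultimately show ?thesis by linarith
qed

text \<open>\<open>Q\<close> and \<gamma>' give a merely qualitative bound. The interval is cut into
  N equal pieces; discrete sewing pays \<open>K\<close> for the defects, while the N local errors
  contribute Q * (t - s) powr \<gamma>' * N powr (1 - \<gamma>'), which vanishes as N grows. So the
  conclusion is free of \<open>Q\<close>.\<close>

lemma cont_sewing:
 fixes X :: "real => real => 'a::real_normed_vector" and F :: "real => 'a"
 assumes "1 < \<gamma>" "1 < \<gamma>'" "0 <= K"
  and q: "!!s t. a <= s ==> s <= t ==> t <= b ==> norm (F t - F s - X s t) <= Q * (t - s) powr \<gamma>'"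
  and dlt: "!!s u t. a <= s ==> s <= u ==> u <= t ==> t <= b ==>
       norm (X s t - X s u - X u t) <= K * (t - s) powr \<gamma>"
  and "a <= s" "s <= t" "t <= b"
 shows "norm (F t - F s - X s t) <= sewc \<gamma> * K * (t - s) powr \<gamma>"
proof (cases "s = t")
 case True
 then show ?thesis using q[of s t] assms by simp
next
 case False
 then have st: "s < t" using assms by simp
 define B where "B = sewc \<gamma> * K * (t - s) powr \<gamma>"
 have bound: "norm (F t - F s - X s t) <= B + Q * (t - s) powr \<gamma>' * real N powr (1 - \<gamma>')" if N: "1 <= N" for N
 proof -
  define h where "h = (t - s) / real N"
  have h: "h > 0" using st N by (simp add: h_def)
  have Nh: "real N * h = t - s" using N by (simp add: h_def)
  define u where "u i = s + real i * h" for i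
  have uu: "u j - u i = real (j - i) * h" if "i <= j" for i j
   using that by (simp add: u_def algebra_simps of_nat_diff)
  have um: "u i <= u j" if "i <= j" for i j using that h by (simp add: u_def)
  have ub: "u i <= b" if "i <= N" for i
  proof -
   have "u i <= u N" by (rule um[OF that])
   then show ?thesis using Nh assms by (simp add: u_def)
  qed
  have ua: "a <= u i" for i using assms h by (simp add: u_def add_increasing2)
  have X0: "X v v = 0" if "a <= v" "v <= b" for v
   using q[of v v] that assms by simp
  \<comment> \<open>The germ is known to vanish on the diagonal only inside \<open>{a..b}\<close>;
    setting it to 0 there by force meets the unrestricted hypothesis of
    \<open>discrete_sewing_path\<close>.\<close>
  define X' where "X' i j = (if i = j then 0 else X (u i) (u j))" for i j
  have "norm (F (u N) - F (u 0) - X' 0 N) <= sewc \<gamma> * K * (real (N - 0) * h) powr \<gamma> + real (N - 0) * (Q * h powr \<gamma>')"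
  proof (rule discrete_sewing_path[where p = 0 and q = N and F = "%i. F (u i)"])
   fix k i l :: nat assume *: "k <= i" "i <= l" "l <= N"
   show "norm (X' k l - X' k i - X' i l) <= K * (real (l - k) * h) powr \<gamma>"
   proof (cases "k = i \<or> i = l")
    case True
    then show ?thesis using assms by (auto simp: X'_def)
   next
    case False
    with * have "k < i" "i < l" by auto
    then show ?thesis unfolding X'_def
     using dlt[of "u k" "u i" "u l"] ua ub[of l] um[of k i] um[of i l] uu[of k l] * by simp
   qed
  next
   fix i assume "i < N"
   then show "norm (F (u (Suc i)) - F (u i) - X' i (Suc i)) <= Q * h powr \<gamma>'"
    unfolding X'_def using q[of "u i" "u (Suc i)"] ua ub[of "Suc i"] um[of i "Suc i"] uu[of i "Suc i"] by simp
  qed (use assms h in \<open>auto simp: X'_def\<close>)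
  moreover have "u N = t" "u 0 = s" using Nh by (auto simp: u_def)
  moreover have "real N * (Q * h powr \<gamma>') = Q * (t - s) powr \<gamma>' * real N powr (1 - \<gamma>')"
   using N st by (simp add: h_def powr_divide powr_diff)
  ultimately show ?thesis using N by (simp add: X'_def Nh B_def)
 qed
 have "(%N. B + Q * (t - s) powr \<gamma>' * real N powr (1 - \<gamma>')) \<longlonglongrightarrow> B + Q * (t - s) powr \<gamma>' * 0"
  using assms(2)
  by (intro tendsto_intros tendsto_neg_powr filterlim_real_sequentially) auto
 then have "(%N. B + Q * (t - s) powr \<gamma>' * real N powr (1 - \<gamma>')) \<longlonglongrightarrow> B" by simp
 then have "norm (F t - F s - X s t) <= B"
  by (rule Lim_bounded2[where N = 1]) (use bound in auto)
 then show ?thesis by (simp add: B_def)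
qed

text \<open>A bootstrap: if every valid constant Q may be improved to A + Q / 2, then after n rounds
  2 * A + Q / 2 ^ n is valid, and the unknown initial constant is lost in the limit. Only its
  existence has to be supplied.\<close>

lemma halving:
 fixes f w :: "'z => real"
 assumes "0 <= Q" and 0: "!!z. z \<in> Z ==> f z <= Q * w z"
  and step: "!!Q z. 0 <= Q ==> (!!z. z \<in> Z ==> f z <= Q * w z) ==> z \<in> Z ==> f z <= (A + Q / 2) * w z"
  and "0 <= A" and w: "!!z. z \<in> Z ==> 0 <= w z" and "z \<in> Z"
 shows "f z <= 2 * A * w z"
proof -
 have *: "\<forall>z\<in>Z. f z <= (2 * A + Q / 2 ^ n) * w z" for n
 proof (induction n)
  case 0
  show ?case
  proof
   fix z assume z: "z \<in> Z"
   have "Q * w z <= (2 * A + Q / 2 ^ 0) * w z"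
    using assms w[OF z] by (intro mult_right_mono) auto
   then show "f z <= (2 * A + Q / 2 ^ 0) * w z" using assms(2)[OF z] by simp
  qed
 next
  case (Suc n)
  show ?case
  proof
   fix z assume z: "z \<in> Z"
   have "f z <= (A + (2 * A + Q / 2 ^ n) / 2) * w z"
    using Suc assms z by (intro step) auto
   then show "f z <= (2 * A + Q / 2 ^ Suc n) * w z" by (simp add: field_simps)
  qed
 qed
 have "(%n. (2 * A + Q * (1/2) ^ n) * w z) \<longlonglongrightarrow> (2 * A + Q * 0) * w z"
  by (intro tendsto_intros LIMSEQ_power_zero) auto
 then have "(%n. (2 * A + Q * (1/2) ^ n) * w z) \<longlonglongrightarrow> 2 * A * w z" by simp
 then show ?thesis
  by (rule Lim_bounded2[where N = 0]) (use * assms in \<open>auto simp: power_divide\<close>)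
qed

text \<open>Induction by thinning out the sequence: the even members satisfy the hypothesis again
  with \<open>z * 2 powr tht\<close>, and an interval of indices is shrunk to even end points at the
  price of at most one unit step at either end.\<close>

lemma dyadic_chain_aux:
 fixes S :: "nat => 'a::real_normed_vector"
 assumes "!!i j. norm (S ((i + 1) * 2 ^ j) - S (i * 2 ^ j)) <= z * 2 powr (real j * tht)"
  and "k <= l" "l - k < 2 ^ J" "0 <= z"
 shows "norm (S l - S k) <= 2 * z * (\<Sum>j<J. 2 powr (real j * tht))"
 using assms
proof (induction J arbitrary: S k l z)
 case 0
 then show ?case by simp
next
 case (Suc J)
 show ?case
 proof (cases "k = l")
  case True
  then show ?thesis using Suc.prems by (simp add: sum_nonneg)
 next
  case False
  define k' l' where "k' = (k + 1) div 2" and "l' = l div 2"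
  have kl: "k' <= l'" using False Suc.prems by (auto simp: k'_def l'_def)
  have step1: "norm (S (Suc i) - S i) <= z" for i
   using Suc.prems(1)[of i 0] by simp
  have "norm (S (2 * l') - S (2 * k')) <= 2 * (z * 2 powr tht) * (\<Sum>j<J. 2 powr (real j * tht))"
  proof (rule Suc.IH[where S = "%i. S (2 * i)"])
   fix i j :: nat
   show "norm (S (2 * ((i + 1) * 2 ^ j)) - S (2 * (i * 2 ^ j))) <= z * 2 powr tht * 2 powr (real j * tht)"
    using Suc.prems(1)[of i "Suc j"] by (simp add: powr_add algebra_simps)
  qed (use kl Suc.prems in \<open>auto simp: k'_def l'_def\<close>)
  moreover have "norm (S l - S (2 * l')) <= z"
  proof (cases "even l")
   case True then show ?thesis using Suc.prems by (simp add: l'_def)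
  next
   case False then show ?thesis using step1[of "2 * l'"] by (simp add: l'_def)
  qed
  moreover have "norm (S (2 * k') - S k) <= z"
  proof (cases "even k")
   case True then show ?thesis using Suc.prems by (simp add: k'_def)
  next
   case False then show ?thesis using step1[of k] by (simp add: k'_def)
  qed
  moreover have "norm (S l - S k) <= norm (S l - S (2 * l')) + norm (S (2 * l') - S (2 * k')) + norm (S (2 * k') - S k)"
   using norm_triangle_ineq[of "S l - S (2 * l')" "S (2 * l') - S k"]
    norm_triangle_ineq[of "S (2 * l') - S (2 * k')" "S (2 * k') - S k"] by simp
  moreover have "2 * z * (\<Sum>j<Suc J. 2 powr (real j * tht)) = 2 * z + 2 * (z * 2 powr tht) * (\<Sum>j<J. 2 powr (real j * tht))"
   by (subst sum.lessThan_Suc_shift) (simp add: powr_add sum_distrib_left algebra_simps)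
  ultimately show ?thesis by simp
 qed
qed

text \<open>The dyadic levels up to the length of the interval form a geometric series with ratio 2
  powr tht > 1, so the largest level dominates.\<close>

lemma dyadic_chain:
 fixes S :: "nat => 'a::real_normed_vector"
 assumes "!!i j. norm (S ((i + 1) * 2 ^ j) - S (i * 2 ^ j)) <= z * 2 powr (real j * tht)"
  and "k <= l" "0 < tht" "0 <= z"
 shows "norm (S l - S k) <= 2 * 2 powr tht / (2 powr tht - 1) * z * real (l - k) powr tht"
proof (cases "k = l")
 case True
 then show ?thesis by simp
next
 case False
 have "\<exists>J. 2 ^ J <= l - k \<and> l - k < 2 ^ (J + 1)"
  using ex_power_ivl1[of 2 "l - k"] assms(2) False by simp
 then obtain J where J: "2 ^ J <= l - k" "l - k < 2 ^ Suc J" by auto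
 have p: "2 powr tht > (1::real)" using assms by simp
 have "(\<Sum>j<Suc J. 2 powr (real j * tht)) = (\<Sum>j<Suc J. (2 powr tht) ^ j)"
  by (intro sum.cong refl) (simp add: powr_realpow[symmetric] powr_powr mult.commute)
 also have "... = ((2 powr tht) ^ Suc J - 1) / (2 powr tht - 1)"
  using p by (subst geometric_sum) auto
 also have "... <= (2 powr tht) ^ Suc J / (2 powr tht - 1)"
  using p by (intro divide_right_mono) auto
 also have "(2 powr tht) ^ Suc J = 2 powr tht * (2 ^ J) powr tht"
  by (simp add: powr_realpow[symmetric] powr_powr mult.commute)
 also have "... <= 2 powr tht * real (l - k) powr tht"
  using J(1) assms(3) by (intro mult_left_mono powr_mono2) (auto simp flip: of_nat_le_iff)
 finally have s: "(\<Sum>j<Suc J. 2 powr (real j * tht)) <= 2 powr tht * real (l - k) powr tht / (2 powr tht - 1)"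
  using p by (simp add: divide_right_mono)
 have "norm (S l - S k) <= 2 * z * (\<Sum>j<Suc J. 2 powr (real j * tht))"
  by (rule dyadic_chain_aux) (use assms J in auto)
 also have "... <= 2 * z * (2 powr tht * real (l - k) powr tht / (2 powr tht - 1))"
  using s assms by (intro mult_left_mono) auto
 finally show ?thesis by (simp add: algebra_simps)
qed

section \<open>Calculus of vector fields with bounded derivatives\<close>

lemma frechet_derivative_eq: "(f has_derivative f') (at x) ==> frechet_derivative f (at x) = f'"
 by (metis frechet_derivative_at)

lemma Cb_Suc_has_derivative:
 "Cb (Suc k) f ==> (f has_derivative frechet_derivative f (at y)) (at y)"
 using frechet_derivative_works by auto

lemma Cb_bound: assumes "Cb k f" obtains B where "0 <= B" "!!x. norm (f x) <= B"
proof -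
 have "bounded (range f)" using assms by (cases k) auto
 then obtain B where B: "!!x. norm (f x) <= B" by (auto simp: bounded_iff)
 moreover have "0 <= B" using B[of 0] norm_ge_zero order_trans by blast
 ultimately show ?thesis using that by blast
qed

lemma Cb_SucD: "Cb (Suc k) f ==> Cb k f"
proof (induction k arbitrary: f)
 case 0
 then have "!!y. isCont f y" by (auto intro: differentiable_imp_continuous_within)
 then show ?case using 0 by (auto simp: continuous_on_eq_continuous_within continuous_at_imp_continuous_at_within)
next
 case (Suc k)
 then have "Cb k (%y. frechet_derivative f (at y) (axis i 1))" for i by auto
 moreover have "!!i. Cb (Suc k) (%y. frechet_derivative f (at y) (axis i 1))"
  using Suc.prems by (subst (asm) Cb.simps(2)) blast
 ultimately show ?case using Suc.prems by simp
qed

lemma Cb_const: "Cb k (%_. c)"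
proof (induction k arbitrary: c)
 case (Suc k)
 have "frechet_derivative (%_. c) (at y) = (%_. 0)" for y :: "real ^ 'd"
  by (intro frechet_derivative_eq derivative_eq_intros) auto
 then show ?case using Suc by (auto simp: image_def)
qed (auto simp: image_def)

lemma Cb_add: "Cb k f ==> Cb k g ==> Cb k (%y. f y + g y)"
proof (induction k arbitrary: f g)
 case 0
 then show ?case by (auto intro!: continuous_intros bounded_plus_comp)
next
 case (Suc k)
 have "frechet_derivative (%y. f y + g y) (at y) v = frechet_derivative f (at y) v + frechet_derivative g (at y) v" for y v
  using frechet_derivative_eq[OF has_derivative_add[OF Cb_Suc_has_derivative[OF Suc.prems(1), of y] Cb_Suc_has_derivative[OF Suc.prems(2), of y]]]
  by simp
 then show ?case using Suc by (auto intro!: bounded_plus_comp)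
qed

lemma Cb_sum: "finite I ==> (!!i. i \<in> I ==> Cb k (f i)) ==> Cb k (%y. \<Sum>i\<in>I. f i y)"
 by (induction I rule: finite_induct) (auto intro: Cb_const Cb_add)

text \<open>\<open>Cb\<close> is available for vector-valued maps only, so a scalar factor is
  represented as a coordinate of such a map. This form suits directional derivatives, which are sums
  of coordinates times partial derivatives.\<close>

lemma Cb_mult:
 fixes f :: "real ^ 'd => real ^ 'e" and g :: "real ^ 'd => real ^ 'c"
 shows "Cb k f ==> Cb k g ==> Cb k (%y. (g y $ a) *\<^sub>R f y)"
proof (induction k arbitrary: f g)
 case 0
 obtain B where B: "0 <= B" "!!x. norm (f x) <= B" using Cb_bound[OF 0(1)] by blast
 obtain B' where B': "0 <= B'" "!!x. norm (g x) <= B'" using Cb_bound[OF 0(2)] by blast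
 have "norm ((g x $ a) *\<^sub>R f x) <= B' * B" for x
  using B B' order_trans[OF component_le_norm_cart[of "g x" a] B'(2)] by (simp add: mult_mono)
 then have "bounded (range (%y. (g y $ a) *\<^sub>R f y))" unfolding bounded_iff by blast
 then show ?case using 0 by (auto intro!: continuous_intros)
next
 case (Suc k)
 let ?h = "%y. (g y $ a) *\<^sub>R f y"
 have d: "(?h has_derivative (%v. (g y $ a) *\<^sub>R frechet_derivative f (at y) v + (frechet_derivative g (at y) v $ a) *\<^sub>R f y)) (at y)" for y
  by (intro has_derivative_scaleR Cb_Suc_has_derivative[OF Suc.prems(1)]
    bounded_linear.has_derivative[OF bounded_linear_vec_nth] Cb_Suc_has_derivative[OF Suc.prems(2)])
 have e: "frechet_derivative ?h (at y) v = (g y $ a) *\<^sub>R frechet_derivative f (at y) v + (frechet_derivative g (at y) v $ a) *\<^sub>R f y" for y v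
  using frechet_derivative_eq[OF d] by simp
 have "Cb k (%y. frechet_derivative ?h (at y) (axis i 1))" for i
  unfolding e using Suc.prems Cb_SucD[OF Suc.prems(1)] Cb_SucD[OF Suc.prems(2)]
  by (intro Cb_add Suc.IH) auto
 moreover have "bounded (range ?h)"
 proof -
  obtain B where B: "0 <= B" "!!x. norm (f x) <= B" using Cb_bound[OF Suc.prems(1)] by blast
  obtain B' where B': "0 <= B'" "!!x. norm (g x) <= B'" using Cb_bound[OF Suc.prems(2)] by blast
  have "norm (?h x) <= B' * B" for x
   using B B' order_trans[OF component_le_norm_cart[of "g x" a] B'(2)] by (simp add: mult_mono)
  then show ?thesis unfolding bounded_iff by blast
 qed
 ultimately show ?case using d by (auto simp: differentiable_def)
qed

lemma frechet_derivative_axis: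
 assumes "Cb (Suc k) f"
 shows "frechet_derivative f (at y) v = (\<Sum>i\<in>UNIV. (v $ i) *\<^sub>R frechet_derivative f (at y) (axis i 1))"
proof -
 have l: "linear (frechet_derivative f (at y))"
  using Cb_Suc_has_derivative[OF assms, of y] has_derivative_bounded_linear bounded_linear.linear by blast
 have "(\<Sum>i\<in>UNIV. (v $ i) *\<^sub>R axis i 1) = v"
  using basis_expansion[of v] by (simp add: scalar_mult_eq_scaleR)
 then have "frechet_derivative f (at y) v = frechet_derivative f (at y) (\<Sum>i\<in>UNIV. (v $ i) *\<^sub>R axis i 1)"
  by simp
 also have "... = (\<Sum>i\<in>UNIV. (v $ i) *\<^sub>R frechet_derivative f (at y) (axis i 1))"
  by (simp add: linear_sum[OF l] linear_scale[OF l])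
 finally show ?thesis .
qed

text \<open>Writing the direction in the unit basis turns the derivative into a sum of coordinates
  of \<open>g\<close> times partial derivatives of \<open>f\<close>, to which \<open>Cb_mult\<close>
  applies. One order of smoothness of \<open>f\<close> is consumed.\<close>

lemma Cb_dir:
 assumes "Cb (Suc k) f" "Cb k g"
 shows "Cb k (%y. frechet_derivative f (at y) (g y))"
 unfolding frechet_derivative_axis[OF assms(1), where v = "g _"]
 using assms by (intro Cb_sum Cb_mult) auto

lemma frechet_bound:
 fixes f :: "real ^ 'd => real ^ 'e"
 assumes "Cb (Suc k) f"
 obtains L where "0 <= L" "!!y v. norm (frechet_derivative f (at y) v) <= L * norm v"
proof -
 have "\<exists>B. 0 <= B \<and> (\<forall>y. norm (frechet_derivative f (at y) (axis i 1)) <= B)" for i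
 proof -
  have "Cb k (%y. frechet_derivative f (at y) (axis i 1))" using assms by simp
  then show ?thesis by (rule Cb_bound) blast
 qed
 then obtain B where B: "!!i. 0 <= B i" "!!i y. norm (frechet_derivative f (at y) (axis i 1)) <= B i" by metis
 show ?thesis
 proof (rule that)
  show "0 <= (\<Sum>i\<in>UNIV. B i)" using B by (simp add: sum_nonneg)
  fix y v
  have "norm (frechet_derivative f (at y) v) <= (\<Sum>i\<in>UNIV. norm v * B i)"
   unfolding frechet_derivative_axis[OF assms, of y v]
   by (intro sum_norm_le) (simp, intro mult_mono, auto simp: B component_le_norm_cart)
  then show "norm (frechet_derivative f (at y) v) <= (\<Sum>i\<in>UNIV. B i) * norm v"
   by (simp add: sum_distrib_left mult.commute)
 qed
qed

lemma Cb_lipschitz: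
 assumes "Cb (Suc k) f"
 obtains L where "0 <= L" "!!x y. norm (f x - f y) <= L * norm (x - y)"
proof -
 obtain L where L: "0 <= L" "!!y v. norm (frechet_derivative f (at y) v) <= L * norm v"
  using frechet_bound[OF assms] by blast
 have "norm (f x - f y) <= L * norm (x - y)" for x y
  by (rule differentiable_bound[of UNIV f "%y. frechet_derivative f (at y)"])
   (use L Cb_Suc_has_derivative[OF assms] in \<open>auto intro!: onorm_bound\<close>)
 then show ?thesis using that L by blast
qed

lemma Cb_frechet_lipschitz:
 fixes f :: "real ^ 'd => real ^ 'e"
 assumes "Cb (Suc (Suc k)) f"
 obtains L where "0 <= L" "!!x y v. norm (frechet_derivative f (at x) v - frechet_derivative f (at y) v) <= L * norm (x - y) * norm v"
proof -
 have "\<exists>B. 0 <= B \<and> (\<forall>x y. norm (frechet_derivative f (at x) (axis i 1) - frechet_derivative f (at y) (axis i 1)) <= B * norm (x - y))" for i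
 proof -
  have "Cb (Suc k) (%y. frechet_derivative f (at y) (axis i 1))" using assms by (subst (asm) Cb.simps(2)) blast
  then show ?thesis by (rule Cb_lipschitz) blast
 qed
 then obtain B where B: "!!i. 0 <= B i" "!!i x y. norm (frechet_derivative f (at x) (axis i 1) - frechet_derivative f (at y) (axis i 1)) <= B i * norm (x - y)" by metis
 show ?thesis
 proof (rule that)
  show "0 <= (\<Sum>i\<in>UNIV. B i)" using B by (simp add: sum_nonneg)
  fix x y v
  have "norm (frechet_derivative f (at x) v - frechet_derivative f (at y) v) <= (\<Sum>i\<in>UNIV. norm v * (B i * norm (x - y)))"
   unfolding frechet_derivative_axis[OF assms, of _ v] sum_subtractf[symmetric] scaleR_diff_right[symmetric]
   by (intro sum_norm_le) (simp, intro mult_mono, auto simp: B component_le_norm_cart)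
  then show "norm (frechet_derivative f (at x) v - frechet_derivative f (at y) v) <= (\<Sum>i\<in>UNIV. B i) * norm (x - y) * norm v"
   by (simp add: sum_distrib_left sum_distrib_right mult_ac)
 qed
qed

lemma Cb_taylor:
 fixes f :: "real ^ 'd => real ^ 'e"
 assumes "Cb (Suc (Suc k)) f"
 obtains L where "0 <= L" "!!x y. norm (f y - f x - frechet_derivative f (at x) (y - x)) <= L * (norm (y - x))\<^sup>2"
proof -
 obtain L where L: "0 <= L" "!!x y v. norm (frechet_derivative f (at x) v - frechet_derivative f (at y) v) <= L * norm (x - y) * norm v"
  using Cb_frechet_lipschitz[OF assms] by blast
 have "norm (f y - f x - frechet_derivative f (at x) (y - x)) <= norm (y - x) * (L * norm (y - x))" for x y
 proof (rule differentiable_bound_linearization[where S = "cball x (norm (y - x))" and f' = "%y. frechet_derivative f (at y)"])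
  fix t :: real assume t: "t \<in> {0..1}"
  then show "x + t *\<^sub>R (y - x) \<in> cball x (norm (y - x))" by (simp add: dist_norm mult_left_le_one_le)
 next
  fix z assume "z \<in> cball x (norm (y - x))"
  then have n: "norm (z - x) <= norm (y - x)" by (simp add: dist_norm norm_minus_commute)
  show "onorm (frechet_derivative f (at z) - frechet_derivative f (at x)) <= L * norm (y - x)"
  proof (rule onorm_bound)
   fix v
   have "norm (frechet_derivative f (at z) v - frechet_derivative f (at x) v) <= L * norm (z - x) * norm v" by (rule L(2))
   also have "... <= L * norm (y - x) * norm v"
    using n L(1) by (intro mult_right_mono mult_left_mono) auto
   finally show "norm ((frechet_derivative f (at z) - frechet_derivative f (at x)) v) <= L * norm (y - x) * norm v" by simp
  qed (use L in simp)
 qed (auto intro: has_derivative_at_withinI[OF Cb_Suc_has_derivative[OF assms]])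
 then show ?thesis using that L by (simp add: power2_eq_square mult_ac)
qed

text \<open>This controls how the difference of \<open>f\<close> along two paths changes in time.
  With a, a' the solution and the scheme at a later time and c, c' at an earlier one, the first term
  is the increment of the error and the second the size of the error times the increments of the two
  paths.\<close>

lemma Cb_four_point:
 fixes f :: "real ^ 'd => real ^ 'e"
 assumes "Cb (Suc (Suc k)) f"
 obtains L where "0 <= L"
  "!!a a' c c'. norm ((f a - f a') - (f c - f c')) <= L * norm ((a - a') - (c - c')) + L * norm (c - c') * (norm (a - c) + norm (a' - c'))"
proof -
 obtain L1 where L1: "0 <= L1" "!!x y v. norm (frechet_derivative f (at x) v - frechet_derivative f (at y) v) <= L1 * norm (x - y) * norm v"
  using Cb_frechet_lipschitz[OF assms] by blast
 obtain L2 where L2: "0 <= L2" "!!y v. norm (frechet_derivative f (at y) v) <= L2 * norm v"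
  using frechet_bound[OF assms] by blast
 define L where "L = L1 + L2"
 have L: "0 <= L" "L1 <= L" "L2 <= L" using L1 L2 by (auto simp: L_def)
 have "norm ((f a - f a') - (f c - f c')) <= L * norm ((a - a') - (c - c')) + L * norm (c - c') * (norm (a - c) + norm (a' - c'))" (is "_ <= ?R") for a a' c c'
 proof -
  define p where "p t = a' + t *\<^sub>R (a - a')" for t :: real
  define q where "q t = c' + t *\<^sub>R (c - c')" for t :: real
  \<comment> \<open>Both segments are run through simultaneously, so that the mean value theorem is
    applied to a single function of t.\<close>
  define g where "g t = f (p t) - f (q t)" for t
  define g' where "g' t s = s *\<^sub>R (frechet_derivative f (at (p t)) (a - a') - frechet_derivative f (at (q t)) (c - c'))" for t s :: real
  have lin: "linear (frechet_derivative f (at z))" for z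
   using Cb_Suc_has_derivative[OF assms] has_derivative_bounded_linear bounded_linear.linear by blast
  have dd: "(g has_derivative g' t) (at t within S)" for t S
  proof -
   have "(p has_derivative (%s. s *\<^sub>R (a - a'))) (at t)" "(q has_derivative (%s. s *\<^sub>R (c - c'))) (at t)"
    unfolding p_def q_def by (auto intro!: derivative_eq_intros)
   then have "(g has_derivative (%s. frechet_derivative f (at (p t)) (s *\<^sub>R (a - a')) - frechet_derivative f (at (q t)) (s *\<^sub>R (c - c')))) (at t)"
    unfolding g_def
    by (intro has_derivative_diff has_derivative_compose[of p _ _ _ f] has_derivative_compose[of q _ _ _ f]
       Cb_Suc_has_derivative[OF assms])
   moreover have "(%s. frechet_derivative f (at (p t)) (s *\<^sub>R (a - a')) - frechet_derivative f (at (q t)) (s *\<^sub>R (c - c'))) = g' t"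
    by (rule ext) (simp only: g'_def linear_scale[OF lin] scaleR_diff_right[symmetric])
   ultimately have "(g has_derivative g' t) (at t)" by simp
   then show ?thesis by (rule has_derivative_at_withinI)
  qed
  have b: "onorm (g' t) <= ?R" if t: "t \<in> {0..1}" for t
  proof (rule onorm_bound)
   show "0 <= ?R" using L by (intro add_nonneg_nonneg mult_nonneg_nonneg) auto
   fix s :: real
   have "norm (p t - q t) <= norm (a - c) + norm (a' - c')"
   proof -
    have "p t - q t = t *\<^sub>R (a - c) + (1 - t) *\<^sub>R (a' - c')" by (simp add: p_def q_def algebra_simps)
    then have "norm (p t - q t) <= norm (t *\<^sub>R (a - c)) + norm ((1 - t) *\<^sub>R (a' - c'))"
     by (simp only: norm_triangle_ineq)
    also have "... <= norm (a - c) + norm (a' - c')"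
     using t by (intro add_mono) (auto simp: mult_left_le_one_le)
    finally show ?thesis .
   qed
   then have "norm (frechet_derivative f (at (p t)) (c - c') - frechet_derivative f (at (q t)) (c - c')) <= L1 * (norm (a - c) + norm (a' - c')) * norm (c - c')"
    using L1 by (intro order_trans[OF L1(2)] mult_right_mono mult_left_mono) auto
   also have "... <= L * (norm (a - c) + norm (a' - c')) * norm (c - c')"
    using L by (intro mult_right_mono) auto
   finally have 1: "norm (frechet_derivative f (at (p t)) (c - c') - frechet_derivative f (at (q t)) (c - c')) <= L * norm (c - c') * (norm (a - c) + norm (a' - c'))"
    by (simp add: mult_ac)
   have 2: "norm (frechet_derivative f (at (p t)) ((a - a') - (c - c'))) <= L * norm ((a - a') - (c - c'))"
    using L by (intro order_trans[OF L2(2)] mult_right_mono) auto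
   \<comment> \<open>The derivative is split into the difference of the directions, seen by the
     derivative at \<open>p t\<close>, and the difference of the base points, seen by the Lipschitz
     constant of the derivative.\<close>
   have "norm (g' t s) = \<bar>s\<bar> * norm (frechet_derivative f (at (p t)) ((a - a') - (c - c')) + (frechet_derivative f (at (p t)) (c - c') - frechet_derivative f (at (q t)) (c - c')))"
    unfolding g'_def norm_scaleR by (simp add: linear_diff[OF lin, of _ "a - a'" "c - c'"])
   also have "... <= \<bar>s\<bar> * ?R"
    using 1 2 by (intro mult_left_mono order_trans[OF norm_triangle_ineq] add_mono) auto
   finally show "norm (g' t s) <= ?R * norm s" by (simp add: mult.commute)
  qed
  have "norm (g 1 - g 0) <= ?R * norm (1 - 0 :: real)"
   by (rule differentiable_bound[where S = "{0..1}" and f' = g']) (use dd b in auto)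
  then show ?thesis by (simp add: g_def p_def q_def algebra_simps)
 qed
 then show ?thesis using that L by blast
qed

section \<open>From Riemann-Stieltjes sums to Young estimates\<close>

definition rs_term :: "(real => 'a::real_normed_vector) => (real => real) => real \<times> real set => 'a" where
 "rs_term f g = (%(\<xi>, K). (g (Sup K) - g (Inf K)) *\<^sub>R f \<xi>)"

text \<open>The two divisions can share only the degenerate cell \<open>{c}\<close>, whose term is 0
  because the increment of \<open>g\<close> over it vanishes; hence the sums add up.\<close>

lemma rs_sum_Un:
 assumes "p tagged_division_of {a..c}" "q tagged_division_of {c..b}" "a <= c" "c <= (b::real)"
 shows "p \<union> q tagged_division_of {a..b}" "sum (rs_term f g) (p \<union> q) = sum (rs_term f g) p + sum (rs_term f g) q"
proof -
 have "interior {a..c} \<inter> interior {c..b} = {}" by auto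
 from tagged_division_Un[OF assms(1,2) this] show "p \<union> q tagged_division_of {a..b}"
  using assms(3,4) by (simp add: ivl_disj_un_two_touch)
 have "rs_term f g z = 0" if "z \<in> p \<inter> q" for z
 proof -
  obtain x K where z: "z = (x, K)" by force
  then have "K \<subseteq> {a..c}" "K \<subseteq> {c..b}" "x \<in> K"
   using that tagged_division_ofD(2,3)[OF assms(1), of x K] tagged_division_ofD(3)[OF assms(2), of x K] by auto
  then have "K = {c}" by fastforce
  then show ?thesis by (simp add: z rs_term_def)
 qed
 then show "sum (rs_term f g) (p \<union> q) = sum (rs_term f g) p + sum (rs_term f g) q"
  using tagged_division_ofD(1)[OF assms(1)] tagged_division_ofD(1)[OF assms(2)]
  by (intro sum.union_inter_neutral) auto
qed

lemma uniform_rs_sum: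
 assumes "0 < (h::real)"
 shows "\<exists>p. p tagged_division_of {s..s + real N * h} \<and> (\<forall>(\<xi>, K)\<in>p. diameter K <= h) \<and>
      sum (rs_term f g) p = (\<Sum>i<N. (g (s + real (Suc i) * h) - g (s + real i * h)) *\<^sub>R f (s + real i * h))"
proof (induction N)
 case 0
 have "{(s, {s..s})} tagged_division_of {s..s}" by (rule tagged_division_of_self_real) simp
 then show ?case using assms by (intro exI[of _ "{(s, {s..s})}"]) (auto simp: rs_term_def)
next
 case (Suc N)
 then obtain p where p: "p tagged_division_of {s..s + real N * h}" "\<forall>(\<xi>, K)\<in>p. diameter K <= h"
  "sum (rs_term f g) p = (\<Sum>i<N. (g (s + real (Suc i) * h) - g (s + real i * h)) *\<^sub>R f (s + real i * h))"
  by blast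
 let ?u = "s + real N * h" and ?v = "s + real (Suc N) * h"
 have uv: "?u <= ?v" "s <= ?u" "?v - ?u = h" using assms by (auto simp: algebra_simps)
 have q: "{(?u, {?u..?v})} tagged_division_of {?u..?v}"
  by (rule tagged_division_of_self_real) (use uv in auto)
 have "p \<union> {(?u, {?u..?v})} tagged_division_of {s..?v}"
  "sum (rs_term f g) (p \<union> {(?u, {?u..?v})}) = sum (rs_term f g) p + sum (rs_term f g) {(?u, {?u..?v})}"
  using rs_sum_Un[OF p(1) q] uv by auto
 moreover have "rs_term f g (?u, {?u..?v}) = (g ?v - g ?u) *\<^sub>R f ?u"
  using uv by (simp add: rs_term_def)
 moreover have "diameter {?u..?v} <= h" using uv by simp
 ultimately show ?case using p
  by (intro exI[of _ "p \<union> {(?u, {?u..?v})}"]) auto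
qed

lemma has_rs_integralE:
 assumes "has_rs_integral f g I a b" "0 < \<epsilon>"
 obtains d where "0 < d"
  "!!p. p tagged_division_of {a..b} ==> (!!x K. (x, K) \<in> p ==> diameter K < d) ==> norm (sum (rs_term f g) p - I) < \<epsilon>"
proof -
 obtain d where "0 < d" and d: "\<forall>p. p tagged_division_of {a..b} \<and> (\<forall>(\<xi>, K)\<in>p. diameter K < d) --> norm (sum (rs_term f g) p - I) < \<epsilon>"
  using assms unfolding has_rs_integral_def rs_term_def[symmetric] by meson
 then show ?thesis using that by fast
qed

text \<open>Only the integrals from 0 are given. A fine division of \<open>{0..s}\<close> prolonged
  by an equidistant one of \<open>{s..t}\<close> is fine for \<open>{0..t}\<close>, so
  \<open>It - Is\<close> is approximated by left-point sums over \<open>{s..t}\<close>; discrete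
  sewing compares these with the single increment, with a bound that does not depend on the
  mesh.\<close>

lemma rs_young:
 fixes f :: "real => 'a::real_normed_vector"
 assumes I: "has_rs_integral f g Is 0 s" "has_rs_integral f g It 0 t" and st: "0 <= s" "s <= t"
  and f: "!!u v. 0 <= u ==> u <= v ==> v <= t ==> norm (f v - f u) <= C * (v - u) powr \<alpha>"
  and g: "!!u v. 0 <= u ==> u <= v ==> v <= t ==> \<bar>g v - g u\<bar> <= G * (v - u) powr be"
  and "0 <= C" "0 <= G" "0 < \<alpha>" "0 < be" "1 < \<alpha> + be"
 shows "norm (It - Is - (g t - g s) *\<^sub>R f s) <= sewc (\<alpha> + be) * (C * G) * (t - s) powr (\<alpha> + be)" (is "_ <= ?B")
proof -
 have "norm (It - Is - (g t - g s) *\<^sub>R f s) <= ?B + \<epsilon>" if "\<epsilon> > 0" for \<epsilon>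
 proof -
  have e2: "\<epsilon> / 2 > 0" using that by simp
  obtain d1 where d1: "d1 > 0" "!!p. p tagged_division_of {0..s} ==> (!!x K. (x, K) \<in> p ==> diameter K < d1) ==> norm (sum (rs_term f g) p - Is) < \<epsilon> / 2"
   using has_rs_integralE[OF I(1) e2] by blast
  obtain d2 where d2: "d2 > 0" "!!p. p tagged_division_of {0..t} ==> (!!x K. (x, K) \<in> p ==> diameter K < d2) ==> norm (sum (rs_term f g) p - It) < \<epsilon> / 2"
   using has_rs_integralE[OF I(2) e2] by blast
  \<comment> \<open>A ball of radius d has diameter 2 * d, which is strictly below 3 * d, and 3 * d
    is at most d1 and d2.\<close>
  define d where "d = min d1 d2 / 3"
  have d: "d > 0" using d1 d2 by (simp add: d_def)
  obtain p where p: "p tagged_division_of {0..s}" "(%x. ball x d) fine p"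
   using fine_division_exists_real[of "%x. ball x d" 0 s] d by (auto simp: gauge_ball)
  have pd: "diameter K < 3 * d" if "(x, K) \<in> p" for x K
  proof -
   have "K \<subseteq> ball x d" using p(2) that by (auto simp: fine_def)
   then have "diameter K <= diameter (ball x d)" by (intro diameter_subset) auto
   also have "... < 3 * d" using d by (simp add: diameter_ball)
   finally show ?thesis .
  qed
  obtain N :: nat and h where h: "h > 0" "h < 3 * d" "real N * h = t - s" "N = 0 ==> s = t"
  proof (cases "s = t")
   case True
   then show ?thesis using that[of d 0] d by simp
  next
   case False
   obtain N :: nat where "real N > (t - s) / d" using reals_Archimedean2 by blast
   moreover have "(t - s) / d > 0" using False st d by simp
   ultimately have N: "real N > 0" "real N > (t - s) / d" by linarith+
   then have "(t - s) / real N < d" using d by (simp add: field_simps)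
   moreover have "(t - s) / real N > 0" using False st N by simp
   ultimately show ?thesis using that[of "(t - s) / real N" N] N d by simp
  qed
  obtain q where q: "q tagged_division_of {s..s + real N * h}" "\<forall>(\<xi>, K)\<in>q. diameter K <= h"
   "sum (rs_term f g) q = (\<Sum>i<N. (g (s + real (Suc i) * h) - g (s + real i * h)) *\<^sub>R f (s + real i * h))"
   using uniform_rs_sum[OF h(1), of s N f g] by blast
  have q1: "q tagged_division_of {s..t}" using q(1) h(3) by simp
  have 1: "norm (sum (rs_term f g) p - Is) < \<epsilon> / 2"
   by (rule d1(2)[OF p(1)]) (use pd in \<open>force simp: d_def\<close>)
  have "norm (sum (rs_term f g) (p \<union> q) - It) < \<epsilon> / 2"
  proof (rule d2(2))
   show "p \<union> q tagged_division_of {0..t}" using rs_sum_Un[OF p(1) q1] st by blast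
   show "diameter K < d2" if "(x, K) \<in> p \<union> q" for x K
   proof -
    have "3 * d <= d2" by (simp add: d_def)
    then show ?thesis using that pd[of x K] q(2) h by fastforce
   qed
  qed
  then have 2: "norm (sum (rs_term f g) p + sum (rs_term f g) q - It) < \<epsilon> / 2"
   using rs_sum_Un(2)[OF p(1) q1, of f g] st by simp
  define u where "u i = s + real i * h" for i
  have u: "u 0 = s" "u N = t" "0 <= u i" "u i <= u j \<longleftrightarrow> i <= j" "u j - u i = (real j - real i) * h" for i j
   using h st by (auto simp: u_def algebra_simps)
  define X where "X i j = (g (u j) - g (u i)) *\<^sub>R f (u i)" for i j
  have "norm (X 0 N - (\<Sum>i=0..<N. X i (Suc i))) <= sewc (\<alpha> + be) * (C * G * h powr (\<alpha> + be)) * real (N - 0) powr (\<alpha> + be)"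
  proof (cases "N = 0")
   case True
   then show ?thesis by (simp add: X_def)
  next
   case False
   show ?thesis
  proof (rule discrete_sewing[where p = 0 and q = N])
   fix k i l assume *: "k <= i" "i <= l" "l <= N"
   have "X k l - X k i - X i l = - ((g (u l) - g (u i)) *\<^sub>R (f (u i) - f (u k)))"
    by (simp add: X_def algebra_simps)
   then have "norm (X k l - X k i - X i l) = \<bar>g (u l) - g (u i)\<bar> * norm (f (u i) - f (u k))"
    by simp
   also have "... <= (G * (u l - u i) powr be) * (C * (u i - u k) powr \<alpha>)"
    using * u assms by (intro mult_mono f g) (auto simp: u(4) simp flip: u(2))
   also have "... <= (G * (u l - u k) powr be) * (C * (u l - u k) powr \<alpha>)"
    using * u(4) assms by (intro mult_mono powr_mono2) auto
   also have "... = C * G * (u l - u k) powr (\<alpha> + be)"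
    by (simp add: powr_add)
   also have "u l - u k = h * real (l - k)"
    using * by (simp add: u(5) of_nat_diff)
   finally show "norm (X k l - X k i - X i l) <= C * G * h powr (\<alpha> + be) * real (l - k) powr (\<alpha> + be)"
    using h by (simp add: powr_mult)
  qed (use assms False in auto)
  qed
  also have "sewc (\<alpha> + be) * (C * G * h powr (\<alpha> + be)) * real (N - 0) powr (\<alpha> + be) = sewc (\<alpha> + be) * (C * G) * (real N * h) powr (\<alpha> + be)"
   by (simp only: powr_mult of_nat_0_le_iff less_imp_le[OF h(1)] mult_ac diff_zero)
  also have "(\<Sum>i=0..<N. X i (Suc i)) = sum (rs_term f g) q"
   unfolding q(3) by (simp add: X_def u_def atLeast0LessThan)
  finally have 3: "norm ((g t - g s) *\<^sub>R f s - sum (rs_term f g) q) <= ?B"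
   unfolding h(3) by (simp add: X_def u(1,2))
  let ?P = "sum (rs_term f g) p" and ?Q = "sum (rs_term f g) q"
  have "It - Is - (g t - g s) *\<^sub>R f s = (?P - Is) - (?P + ?Q - It) - ((g t - g s) *\<^sub>R f s - ?Q)"
   by simp
  also have "norm ... <= norm (?P - Is) + norm (?P + ?Q - It) + norm ((g t - g s) *\<^sub>R f s - ?Q)"
   using norm_triangle_ineq4[of "(?P - Is) - (?P + ?Q - It)" "(g t - g s) *\<^sub>R f s - ?Q"]
    norm_triangle_ineq4[of "?P - Is" "?P + ?Q - It"] by linarith
  finally show ?thesis using 1 2 3 by linarith
 qed
 then show ?thesis by (rule field_le_epsilon)
qed

section \<open>Local expansion of a path driven by a Hoelder signal\<close>

definition germ :: "nat => (nat => real => real) => (nat => real => 'a::real_normed_vector) => real => real => 'a" where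
 "germ m b f s t = (\<Sum>j\<le>m. (b j t - b j s) *\<^sub>R f j s)"

lemma germ_self [simp]: "germ m b f s s = 0"
 by (simp add: germ_def)

lemma germ_bound:
 assumes "!!j. j <= m ==> \<bar>b j t - b j s\<bar> <= G j * w" "!!j. j <= m ==> norm (f j s) <= K j" "0 <= w" "!!j. j <= m ==> 0 <= G j"
 shows "norm (germ m b f s t) <= (\<Sum>j\<le>m. K j * G j) * w"
proof -
 have "norm (germ m b f s t) <= (\<Sum>j\<le>m. G j * w * K j)"
  unfolding germ_def using assms by (intro sum_norm_le) (auto intro!: mult_mono)
 then show ?thesis by (simp add: sum_distrib_left sum_distrib_right mult_ac)
qed

text \<open>By additivity of the increments of the driver only
  \<open>(b j t - b j u) *\<^sub>R (f j u - f j s)\<close> is left, a product of two Hoelder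
  increments. The constants depend on \<open>j\<close> because time, being Lipschitz, is later given
  a much smaller constant than the noise.\<close>

lemma germ_defect:
 fixes f :: "nat => real => 'a::real_normed_vector"
 assumes "s <= u" "u <= t" "0 < \<alpha>" "0 < be"
  and "!!j. j <= m ==> \<bar>b j t - b j u\<bar> <= G j * (t - u) powr be"
  and "!!j. j <= m ==> norm (f j u - f j s) <= K j * (u - s) powr \<alpha>"
  and "!!j. j <= m ==> 0 <= G j" "!!j. j <= m ==> 0 <= K j"
 shows "norm (germ m b f s t - germ m b f s u - germ m b f u t) <= (\<Sum>j\<le>m. K j * G j) * (t - s) powr (\<alpha> + be)"
proof -
 have "germ m b f s t - germ m b f s u - germ m b f u t = - (\<Sum>j\<le>m. (b j t - b j u) *\<^sub>R (f j u - f j s))"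
  unfolding germ_def sum_subtractf[symmetric] sum_negf[symmetric]
  by (intro sum.cong refl) (simp add: algebra_simps)
 moreover have "norm (\<Sum>j\<le>m. (b j t - b j u) *\<^sub>R (f j u - f j s)) <= (\<Sum>j\<le>m. (G j * (t - s) powr be) * (K j * (t - s) powr \<alpha>))"
 proof (rule sum_norm_le)
  fix j assume "j \<in> {..m}"
  then have j: "j <= m" by simp
  have "\<bar>b j t - b j u\<bar> <= G j * (t - s) powr be"
   using assms j by (intro order_trans[OF assms(5)] mult_left_mono powr_mono2) auto
  moreover have "norm (f j u - f j s) <= K j * (t - s) powr \<alpha>"
   using assms j by (intro order_trans[OF assms(6)] mult_left_mono powr_mono2) auto
  ultimately show "norm ((b j t - b j u) *\<^sub>R (f j u - f j s)) <= (G j * (t - s) powr be) * (K j * (t - s) powr \<alpha>)"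
   using assms j by (auto intro!: mult_mono)
 qed
 ultimately show ?thesis
  by (simp add: sum_distrib_left sum_distrib_right mult_ac powr_add)
qed

text \<open>First order Taylor formula of \<open>f\<close> along the fields \<open>V i\<close>, with
  \<open>Df i\<close> in the role of the derivative of \<open>f\<close> in direction
  \<open>V i\<close>. The numbers \<open>c i\<close> will be increments of the driver; the last term
  pays for the part of \<open>y - x\<close> which they do not explain. In this form it makes sense
  in any normed space and without derivatives.\<close>

definition expands :: "nat => (nat => 'a::real_normed_vector => 'a) => real => ('a => 'a) => (nat => 'a => 'a) => bool" where
 "expands m V L f Df \<longleftrightarrow> (\<forall>x y c. norm (f y - f x - (\<Sum>i\<le>m. c i *\<^sub>R Df i x))
   <= L * (norm (y - x))\<^sup>2 + L * norm (y - x - (\<Sum>i\<le>m. c i *\<^sub>R V i x)))"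

definition lipb :: "real => ('a::real_normed_vector => 'a) => bool" where
 "lipb L f \<longleftrightarrow> (\<forall>x. norm (f x) <= L) \<and> (\<forall>x y. norm (f x - f y) <= L * norm (x - y))"

text \<open>\<open>X_qual\<close> is the only trace of the equation: the path is locally close to
  its germ, with uncontrolled constant and order. Quantitative bounds are won back by sewing, so
  that the constants depend on \<open>be\<close>, \<open>L\<close> and \<open>m\<close> only and the
  powers of \<open>G\<close> stay visible.\<close>

locale young_path =
 fixes be T L G :: real and m :: nat
  and V :: "nat => 'a::real_normed_vector => 'a" and b :: "nat => real => real" and X :: "real => 'a"
 assumes be: "1 / 2 < be" "be < 1" and T: "0 < T" and L: "1 <= L" and G: "1 <= G"
  and V_lipb: "j <= m ==> lipb L (V j)"
  and b_hoelder: "j <= m ==> 0 <= s ==> s <= t ==> t <= T ==> \<bar>b j t - b j s\<bar> <= G * (t - s) powr be"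
  and X_qual: "\<exists>Q \<gamma>. 1 < \<gamma> \<and> 0 <= Q \<and> (\<forall>s t. 0 <= s \<and> s <= t \<and> t <= T -->
     norm (X t - X s - germ m b (%j s. V j (X s)) s t) <= Q * (t - s) powr \<gamma>)"
begin

definition "J = real (Suc m)"
definition "kap = sewc (2 * be)"
text \<open>The smallness threshold: where \<open>G * (t - s) powr be <= c0\<close>, sewing a path
  with Hoelder constant Q leaves a remainder with constant at most Q / 2, as \<open>halving\<close>
  demands. The factor 2 in \<open>C1\<close> is the one in the conclusion of
  \<open>halving\<close>.\<close>

definition "c0 = 1 / (2 * kap * J * L)"
definition "C1 = 2 * J * L"
definition "C2 = kap * J * L * C1"

lemma const_bounds: "1 <= J" "1 <= kap" "0 < c0" "1 <= C1" "1 <= C2" "c0 <= 1"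
proof -
 show J: "1 <= J" by (simp add: J_def)
 show k: "1 <= kap" unfolding kap_def using sewc_ge1(1)[of "2 * be"] be by simp
 have "1 * 1 <= J * L" using J L by (intro mult_mono) auto
 then have JL: "1 <= J * L" by simp
 then show C1: "1 <= C1" by (simp add: C1_def)
 have kJL: "1 * 1 <= kap * (J * L)" using JL k by (intro mult_mono) auto
 then have "1 * 1 <= (kap * (J * L)) * C1" using C1 by (intro mult_mono) auto
 then show "1 <= C2" by (simp add: C2_def mult_ac)
 show "0 < c0" "c0 <= 1" using kJL by (auto simp: c0_def mult_ac field_simps)
qed

lemma powr_double: "x powr (2 * be) = x powr be * x powr be" "x powr (be * 2) = x powr be * x powr be"
 by (simp_all add: powr_add[symmetric] mult.commute)

lemma germ_V_bound:
 assumes "0 <= s" "s <= t" "t <= T"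
 shows "norm (germ m b (%j s. V j (X s)) s t) <= J * L * G * (t - s) powr be"
proof -
 have "norm (germ m b (%j s. V j (X s)) s t) <= (\<Sum>j\<le>m. L * G) * (t - s) powr be"
  using assms V_lipb b_hoelder G by (intro germ_bound) (auto simp: lipb_def)
 then show ?thesis by (simp add: J_def mult_ac)
qed

lemma X_expand_aux:
 assumes "0 <= s" "s <= t" "t <= T" "0 <= Q"
  and Q: "!!u v. s <= u ==> u <= v ==> v <= t ==> norm (X v - X u) <= Q * (v - u) powr be"
 shows "norm (X t - X s - germ m b (%j s. V j (X s)) s t) <= kap * (J * L * Q * G) * (t - s) powr (2 * be)"
proof -
 obtain Q0 \<gamma> where g: "1 < \<gamma>" "0 <= Q0"
  "!!s t. 0 <= s ==> s <= t ==> t <= T ==> norm (X t - X s - germ m b (%j s. V j (X s)) s t) <= Q0 * (t - s) powr \<gamma>"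
  using X_qual by blast
 show ?thesis unfolding kap_def
 proof (rule cont_sewing[where a = s and b = t and \<gamma>' = \<gamma> and Q = Q0])
  fix r u v assume *: "s <= r" "r <= u" "u <= v" "v <= t"
  have "norm (germ m b (%j s. V j (X s)) r v - germ m b (%j s. V j (X s)) r u - germ m b (%j s. V j (X s)) u v)
    <= (\<Sum>j\<le>m. (L * Q) * G) * (v - r) powr (be + be)"
  proof (rule germ_defect)
   fix j assume j: "j <= m"
   have "norm (V j (X u) - V j (X r)) <= L * norm (X u - X r)" using V_lipb[OF j] by (simp add: lipb_def)
   also have "... <= L * (Q * (u - r) powr be)" using * L Q[of r u] by (intro mult_left_mono) auto
   finally show "norm (V j (X u) - V j (X r)) <= L * Q * (u - r) powr be" by (simp add: mult_ac)
  qed (use * assms L G be b_hoelder in auto)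
  also have "(\<Sum>j\<le>m. (L * Q) * G) = J * L * Q * G" by (simp add: J_def)
  finally show "norm (germ m b (%j s. V j (X s)) r v - germ m b (%j s. V j (X s)) r u - germ m b (%j s. V j (X s)) u v)
    <= J * L * Q * G * (v - r) powr (2 * be)" by simp
 qed (use assms g be L G const_bounds in auto)
qed

text \<open>Bootstrap over all intervals that are small in the sense of \<open>c0\<close>.
  \<open>X_qual\<close> provides some Hoelder constant to begin with; the improvement comes from
  \<open>X_expand_aux\<close>.\<close>

lemma X_hoelder:
 assumes "0 <= s" "s <= t" "t <= T" "G * (t - s) powr be <= c0"
 shows "norm (X t - X s) <= C1 * G * (t - s) powr be"
proof -
 obtain Q0 \<gamma> where g: "1 < \<gamma>" "0 <= Q0"
  "!!s t. 0 <= s ==> s <= t ==> t <= T ==> norm (X t - X s - germ m b (%j s. V j (X s)) s t) <= Q0 * (t - s) powr \<gamma>"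
  using X_qual by blast
 have nt: "norm (X t - X s) <= norm (germ m b (%j s. V j (X s)) s t) + norm (X t - X s - germ m b (%j s. V j (X s)) s t)" for s t
  using norm_triangle_ineq[of "germ m b (%j s. V j (X s)) s t" "X t - X s - germ m b (%j s. V j (X s)) s t"] by simp
 define Z where "Z = {(s, t). 0 <= s \<and> s <= t \<and> t <= T \<and> G * (t - s) powr be <= c0}"
 define f where "f = (%(s, t). norm (X t - X s))"
 define w where "w = (%(s, t). (t - s) powr be :: real)"
 have "f (s, t) <= 2 * (J * L * G) * w (s, t)"
 proof (rule halving[where Z = Z and Q = "J * L * G + Q0 * T powr (\<gamma> - be)"])
  fix z assume "z \<in> Z"
  then obtain s t where z: "z = (s, t)" "0 <= s" "s <= t" "t <= T" by (auto simp: Z_def)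
  have "(t - s) powr \<gamma> = (t - s) powr (\<gamma> - be) * (t - s) powr be"
   by (simp add: powr_add[symmetric])
  also have "... <= T powr (\<gamma> - be) * (t - s) powr be"
   using z g be by (intro mult_right_mono powr_mono2) auto
  finally have "Q0 * (t - s) powr \<gamma> <= Q0 * (T powr (\<gamma> - be) * (t - s) powr be)"
   using g by (intro mult_left_mono)
  then show "f z <= (J * L * G + Q0 * T powr (\<gamma> - be)) * w z"
   using nt[of t s] germ_V_bound[of s t] g(3)[of s t] z by (simp add: f_def w_def algebra_simps)
 next
  fix Q z assume Q: "0 <= Q" "!!z. z \<in> Z ==> f z <= Q * w z" and zZ: "z \<in> Z"
  then obtain s t where z: "z = (s, t)" "0 <= s" "s <= t" "t <= T" "G * (t - s) powr be <= c0" by (auto simp: Z_def)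
  have "norm (X t - X s - germ m b (%j s. V j (X s)) s t) <= kap * (J * L * Q * G) * (t - s) powr (2 * be)"
  proof (rule X_expand_aux)
   fix u v assume *: "s <= u" "u <= v" "v <= t"
   have "G * (v - u) powr be <= G * (t - s) powr be"
    using * G be by (intro mult_left_mono powr_mono2) auto
   then have "(u, v) \<in> Z" using * z by (auto simp: Z_def)
   then show "norm (X v - X u) <= Q * (v - u) powr be" using Q(2) by (force simp: f_def w_def)
  qed (use z Q in auto)
  also have "... = (kap * J * L * Q) * (G * (t - s) powr be) * (t - s) powr be"
   by (simp only: powr_double mult_ac)
  also have "... <= (kap * J * L * Q) * c0 * (t - s) powr be"
   using z const_bounds L Q by (intro mult_left_mono mult_right_mono mult_nonneg_nonneg) auto
  also have "(kap * J * L * Q) * c0 = Q / 2"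
   using const_bounds(1,2) L by (simp add: c0_def field_simps)
  finally show "f z <= (J * L * G + Q / 2) * w z"
   using nt[of t s] germ_V_bound[of s t] z by (simp add: f_def w_def algebra_simps)
 qed (use const_bounds L G g assms in \<open>auto simp: Z_def w_def\<close>)
 then show ?thesis by (simp add: f_def w_def C1_def)
qed

lemma small_sub:
 assumes "s <= u" "u <= v" "v <= t" "G * (t - s) powr be <= c"
 shows "G * (v - u) powr be <= c"
proof -
 have "G * (v - u) powr be <= G * (t - s) powr be"
  using assms G be by (intro mult_left_mono powr_mono2) auto
 then show ?thesis using assms by simp
qed

lemma X_expand:
 assumes "0 <= s" "s <= t" "t <= T" "G * (t - s) powr be <= c0"
 shows "norm (X t - X s - germ m b (%j s. V j (X s)) s t) <= C2 * G\<^sup>2 * (t - s) powr (2 * be)"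
proof -
 have "norm (X t - X s - germ m b (%j s. V j (X s)) s t) <= kap * (J * L * (C1 * G) * G) * (t - s) powr (2 * be)"
  by (rule X_expand_aux) (use assms const_bounds G X_hoelder small_sub[OF _ _ _ assms(4)] in auto)
 then show ?thesis by (simp add: C2_def power2_eq_square mult_ac)
qed

definition "C3 = C1\<^sup>2 + C2"

lemma C3: "1 <= C3" using const_bounds by (simp add: C3_def add_increasing)

lemma f_expand:
 assumes "expands m V L' f Df" "0 <= L'" "0 <= s" "s <= t" "t <= T" "G * (t - s) powr be <= c0"
 shows "norm (f (X t) - f (X s) - germ m b (%j s. Df j (X s)) s t) <= L' * C3 * G\<^sup>2 * (t - s) powr (2 * be)"
proof -
 have "norm (f (X t) - f (X s) - germ m b (%j s. Df j (X s)) s t)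
  <= L' * (norm (X t - X s))\<^sup>2 + L' * norm (X t - X s - germ m b (%j s. V j (X s)) s t)"
  using assms(1)[unfolded expands_def, rule_format, where x = "X s" and y = "X t" and c = "%j. b j t - b j s"]
  unfolding germ_def .
 also have "... <= L' * (C1 * G * (t - s) powr be)\<^sup>2 + L' * (C2 * G\<^sup>2 * (t - s) powr (2 * be))"
  using assms by (intro add_mono mult_left_mono power_mono X_hoelder X_expand) auto
 also have "... = L' * C3 * G\<^sup>2 * (t - s) powr (2 * be)"
  by (simp add: C3_def powr_double power2_eq_square algebra_simps)
 finally show ?thesis .
qed

lemma lipb_hoelder:
 assumes "lipb L' f" "0 <= L'" "0 <= s" "s <= t" "t <= T" "G * (t - s) powr be <= c0"
 shows "norm (f (X t) - f (X s)) <= L' * C1 * G * (t - s) powr be"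
proof -
 have "norm (f (X t) - f (X s)) <= L' * norm (X t - X s)" using assms by (simp add: lipb_def)
 also have "... <= L' * (C1 * G * (t - s) powr be)" using assms by (intro mult_left_mono X_hoelder) auto
 finally show ?thesis by (simp add: mult_ac)
qed

end

section \<open>Error of the trapezoidal rule on one cell\<close>

definition cell_pt :: "real => real => nat => nat => real" where
 "cell_pt a h N l = a + real l * (h / real N)"

text \<open>Left-point Riemann sum for \<open>\<integral> (b i - b i a) db j\<close> over the first \<open>l\<close> pieces of the cell.\<close>

definition iter_sum :: "(nat => real => real) => real => real => nat => nat => nat => nat => real" where
 "iter_sum b a h N i j l = (\<Sum>r<l. (b i (cell_pt a h N r) - b i a) * (b j (cell_pt a h N (Suc r)) - b j (cell_pt a h N r)))"

text \<open>A discrete Levy area: half the antisymmetric part of the iterated sums.\<close>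

definition area :: "(nat => real => real) => real => real => nat => nat => nat => real" where
 "area b a h N i j = (iter_sum b a h N i j N - iter_sum b a h N j i N) / 2"

definition trap_err :: "nat => (nat => 'a::real_normed_vector => 'a) => (nat => real => real) => (real => 'a) => real => real => 'a" where
 "trap_err m V b X s t = X t - X s - (1 / 2) *\<^sub>R (\<Sum>j\<le>m. (b j t - b j s) *\<^sub>R (V j (X t) + V j (X s)))"

text \<open>The sub-grid of N pieces replaces iterated integrals over the cell by finite sums.
  \<open>fine\<close> takes N so large that the quadratic variation along the sub-grid is at most of
  order h ^ 3, below every rate in question; this is possible because 2 * be > 1.\<close>

locale cell = young_path +
 fixes a h :: real and N :: nat
 assumes a: "0 <= a" and h: "0 < h" and ah: "a + h <= T" and small: "G * h powr be <= c0"
  and N: "1 <= N" and fine: "real N * (h / real N) powr (2 * be) <= h ^ 3"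
begin

abbreviation "u \<equiv> cell_pt a h N"
definition "dlt = h / real N"

lemma u_simps: "u 0 = a" "u N = a + h" "u (Suc l) - u l = dlt" "a <= u l" "0 < dlt"
 "u l - u k = (real l - real k) * dlt"
 using N h by (auto simp: cell_pt_def dlt_def field_simps)

lemma u_mono: "k <= l ==> u k <= u l"
 using h by (simp add: cell_pt_def divide_right_mono)

lemma u_le: "l <= N ==> u l <= a + h"
 using u_mono[of l N] u_simps(2) by simp

lemma smallI: "a <= s ==> s <= t ==> t <= a + h ==> G * (t - s) powr be <= c0"
 using small_sub[of a s t "a + h" c0] small by simp

lemma incr_le: "a <= s ==> s <= t ==> t <= a + h ==> (t - s) powr be <= h powr be"
 using be by (intro powr_mono2) auto

definition resid :: "('a => 'a) => (nat => 'a => 'a) => real => 'a" where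
 "resid f Df s = f (X s) - f (X a) - (\<Sum>i\<le>m. (b i s - b i a) *\<^sub>R Df i (X a))"

definition "C4 = L * (J * C1 + C3)"

lemma C4: "1 <= C4"
proof -
 have "1 * 1 <= L * (J * C1 + C3)" using L C3 const_bounds by (intro mult_mono) (auto intro: add_increasing)
 then show ?thesis by (simp add: C4_def)
qed

text \<open>The increment of the residual is the first order expansion error started at s, plus the
  change of the coefficients \<open>Df j\<close> from a to s times the increments of the driver.
  Both contain h powr be besides (t - s) powr be. The separate constant \<open>L'\<close> allows the
  bound of the drift to be inserted.\<close>

lemma resid_hoelder':
 assumes f: "expands m V L' f Df" "!!i. i <= m ==> lipb L' (Df i)" "0 <= L'" and st: "a <= s" "s <= t" "t <= a + h"
 shows "norm (resid f Df t - resid f Df s) <= L' * (J * C1 + C3) * G\<^sup>2 * h powr be * (t - s) powr be"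
proof -
 have e: "resid f Df t - resid f Df s = (f (X t) - f (X s) - germ m b (%j s. Df j (X s)) s t)
   + germ m b (%j s. Df j (X s) - Df j (X a)) s t"
  unfolding resid_def germ_def
  by (simp add: sum_subtractf[symmetric] sum.distrib[symmetric] algebra_simps)
 have "norm (f (X t) - f (X s) - germ m b (%j s. Df j (X s)) s t) <= L' * C3 * G\<^sup>2 * (t - s) powr (2 * be)"
  using f st a ah smallI[of s t] by (intro f_expand) auto
 also have "... <= L' * C3 * G\<^sup>2 * (h powr be * (t - s) powr be)"
  unfolding powr_double using f C3 incr_le[OF st] by (intro mult_left_mono mult_right_mono) auto
 finally have 1: "norm (f (X t) - f (X s) - germ m b (%j s. Df j (X s)) s t) <= L' * C3 * G\<^sup>2 * (h powr be * (t - s) powr be)" .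
 have "norm (germ m b (%j s. Df j (X s) - Df j (X a)) s t) <= (\<Sum>j\<le>m. (L' * C1 * G * h powr be) * G) * (t - s) powr be"
 proof (rule germ_bound)
  fix j assume j: "j <= m"
  have "norm (Df j (X s) - Df j (X a)) <= L' * C1 * G * (s - a) powr be"
   using f j st a ah smallI[of a s] by (intro lipb_hoelder) auto
  also have "... <= L' * C1 * G * h powr be"
   using f const_bounds G incr_le[of a s] st by (intro mult_left_mono) auto
  finally show "norm (Df j (X s) - Df j (X a)) <= L' * C1 * G * h powr be" .
 qed (use st a ah G b_hoelder in auto)
 also have "... = J * L' * C1 * G\<^sup>2 * (h powr be * (t - s) powr be)"
  by (simp add: J_def power2_eq_square)
 finally have 2: "norm (germ m b (%j s. Df j (X s) - Df j (X a)) s t) <= J * L' * C1 * G\<^sup>2 * (h powr be * (t - s) powr be)" .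
 show ?thesis unfolding e using 1 2 by (intro norm_triangle_le) (simp add: algebra_simps)
qed

lemma resid_hoelder:
 assumes "expands m V L f Df" "!!i. i <= m ==> lipb L (Df i)" "a <= s" "s <= t" "t <= a + h"
 shows "norm (resid f Df t - resid f Df s) <= C4 * G\<^sup>2 * h powr be * (t - s) powr be"
 using resid_hoelder'[OF assms(1,2) _ assms(3-5)] L by (simp add: C4_def)

lemma resid_a [simp]: "resid f Df a = 0"
 by (simp add: resid_def)

lemma resid_bound:
 assumes "expands m V L f Df" "!!i. i <= m ==> lipb L (Df i)" "a <= t" "t <= a + h"
 shows "norm (resid f Df t) <= C4 * G\<^sup>2 * h powr be * h powr be"
proof -
 have "norm (resid f Df t) <= C4 * G\<^sup>2 * h powr be * (t - a) powr be"
  using resid_hoelder[OF assms(1,2), of a t] assms by simp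
 also have "... <= C4 * G\<^sup>2 * h powr be * h powr be"
  using C4 incr_le[of a t] assms by (intro mult_left_mono) auto
 finally show ?thesis .
qed

text \<open>Summation by parts; the last sum is the discrete quadratic covariation.\<close>

lemma iter_sum_parts:
 "iter_sum b a h N i j l + iter_sum b a h N j i l
  = (b i (u l) - b i a) * (b j (u l) - b j a) - (\<Sum>r<l. (b i (u (Suc r)) - b i (u r)) * (b j (u (Suc r)) - b j (u r)))"
 by (induction l) (simp_all add: iter_sum_def u_simps algebra_simps)

lemma qv_bound:
 assumes "i <= m" "j <= m"
 shows "\<bar>\<Sum>r<N. (b i (u (Suc r)) - b i (u r)) * (b j (u (Suc r)) - b j (u r))\<bar> <= G\<^sup>2 * h ^ 3"
proof -
 have "\<bar>\<Sum>r<N. (b i (u (Suc r)) - b i (u r)) * (b j (u (Suc r)) - b j (u r))\<bar> <= (\<Sum>r<N. (G * dlt powr be) * (G * dlt powr be))"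
 proof (rule order_trans[OF sum_abs sum_mono])
  fix r assume "r \<in> {..<N}"
  then have "\<bar>b i (u (Suc r)) - b i (u r)\<bar> <= G * dlt powr be" "\<bar>b j (u (Suc r)) - b j (u r)\<bar> <= G * dlt powr be"
   using assms b_hoelder[of _ "u r" "u (Suc r)"] u_mono[of r "Suc r"] u_le[of "Suc r"] u_simps(3,4)[of r] a ah by auto
  then show "\<bar>(b i (u (Suc r)) - b i (u r)) * (b j (u (Suc r)) - b j (u r))\<bar> <= (G * dlt powr be) * (G * dlt powr be)"
   unfolding abs_mult by (intro mult_mono) auto
 qed
 also have "... = G\<^sup>2 * (real N * dlt powr (2 * be))"
  by (simp add: powr_double power2_eq_square mult_ac)
 also have "... <= G\<^sup>2 * h ^ 3" using fine by (intro mult_left_mono) (auto simp: dlt_def)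
 finally show ?thesis .
qed

text \<open>Split into symmetric and antisymmetric part: by \<open>iter_sum_parts\<close> the former
  is half the product of the increments up to the quadratic covariation, which \<open>fine\<close>
  makes small.\<close>

lemma iter_sum_area:
 assumes "i <= m" "j <= m"
 shows "\<bar>iter_sum b a h N i j N - (b i (a + h) - b i a) * (b j (a + h) - b j a) / 2 - area b a h N i j\<bar> <= G\<^sup>2 * h ^ 3"
proof -
 have "iter_sum b a h N i j N - (b i (a + h) - b i a) * (b j (a + h) - b j a) / 2 - area b a h N i j
   = - (\<Sum>r<N. (b i (u (Suc r)) - b i (u r)) * (b j (u (Suc r)) - b j (u r))) / 2"
  using iter_sum_parts[of i j N] by (simp add: area_def u_simps field_simps)
 then show ?thesis using qv_bound[OF assms] by simp
qed

definition "C5 = kap * J * C4 + C2 + J\<^sup>2 * L + J * C4"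

lemma C5: "1 <= C5"
proof -
 have "0 <= kap * J * C4" "0 <= J\<^sup>2 * L" "0 <= J * C4"
  using const_bounds C4 L by (auto intro!: mult_nonneg_nonneg)
 then show ?thesis using const_bounds by (simp add: C5_def)
qed

text \<open>On the subdivided cell the second order expansion of \<open>X\<close> is compared, by sewing, with the
 germ of the residuals of the \<open>V j\<close>, which vanish at the left end point.\<close>

lemma trap_err_second_order:
 assumes V: "!!j. j <= m ==> expands m V L (V j) (%i. D i j)"
  and D: "!!i j. i <= m ==> j <= m ==> lipb L (D i j)"
 shows "norm (trap_err m V b X a (a + h) - (\<Sum>j\<le>m. \<Sum>i\<le>m. area b a h N i j *\<^sub>R D i j (X a)))
      <= C5 * (G ^ 3 * h powr (3 * be) + G\<^sup>2 * h ^ 3)"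
proof -
 define g where "g j = resid (V j) (%i. D i j)" for j
 \<comment> \<open>\<open>F\<close> is the deviation of X from its second order expansion at the
   left end point. On each sub-interval it moves by the germ of the residuals, up to the first order
   expansion error of X.\<close>
 define F where "F l = X (u l) - X a - (\<Sum>j\<le>m. (b j (u l) - b j a) *\<^sub>R V j (X a))
   - (\<Sum>j\<le>m. \<Sum>i\<le>m. iter_sum b a h N i j l *\<^sub>R D i j (X a))" for l
 have gh: "norm (g j t - g j s) <= C4 * G\<^sup>2 * h powr be * (t - s) powr be"
  if "j <= m" "a <= s" "s <= t" "t <= a + h" for j s t
  unfolding g_def using that V D by (intro resid_hoelder) auto
 have 3: "h powr (3 * be) = h powr be * h powr (2 * be)" by (simp add: powr_add[symmetric])
 have e0: "norm (F N - F 0 - germ m b g (u 0) (u N)) <= sewc (2 * be) * (J * (C4 * G\<^sup>2 * h powr be) * G) * (real (N - 0) * dlt) powr (2 * be)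
   + real (N - 0) * (C2 * G\<^sup>2 * dlt powr (2 * be))"
 proof (rule discrete_sewing_path[where p = 0 and q = N and X = "%k l. germ m b g (u k) (u l)"])
  fix k i l assume *: "k <= i" "i <= l" "l <= N"
  have "norm (germ m b g (u k) (u l) - germ m b g (u k) (u i) - germ m b g (u i) (u l))
    <= (\<Sum>j\<le>m. (C4 * G\<^sup>2 * h powr be) * G) * (u l - u k) powr (be + be)"
   using * u_mono[of k i] u_mono[of i l] u_le[of i] u_le[of l] u_simps(4) be G C4 a ah
   by (intro germ_defect gh b_hoelder) (auto intro: order_trans)
  also have "u l - u k = real (l - k) * dlt" using * by (simp add: u_simps(6) of_nat_diff)
  finally show "norm (germ m b g (u k) (u l) - germ m b g (u k) (u i) - germ m b g (u i) (u l))
    <= J * (C4 * G\<^sup>2 * h powr be) * G * (real (l - k) * dlt) powr (2 * be)" by (simp add: J_def mult_ac)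
 next
  fix l assume l: "l < N"
  define S where "S j = (\<Sum>i\<le>m. (b i (u l) - b i a) *\<^sub>R D i j (X a))" for j
  have "(\<Sum>i\<le>m. iter_sum b a h N i j (Suc l) *\<^sub>R D i j (X a)) - (\<Sum>i\<le>m. iter_sum b a h N i j l *\<^sub>R D i j (X a))
    = (b j (u (Suc l)) - b j (u l)) *\<^sub>R S j" for j
   unfolding S_def scaleR_sum_right sum_subtractf[symmetric]
   by (intro sum.cong refl) (simp add: iter_sum_def scaleR_left_distrib mult.commute)
  then have "(\<Sum>j\<le>m. \<Sum>i\<le>m. iter_sum b a h N i j (Suc l) *\<^sub>R D i j (X a)) - (\<Sum>j\<le>m. \<Sum>i\<le>m. iter_sum b a h N i j l *\<^sub>R D i j (X a))
    = (\<Sum>j\<le>m. (b j (u (Suc l)) - b j (u l)) *\<^sub>R S j)"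
   by (simp add: sum_subtractf[symmetric])
  moreover have "(\<Sum>j\<le>m. (b j (u (Suc l)) - b j a) *\<^sub>R V j (X a)) - (\<Sum>j\<le>m. (b j (u l) - b j a) *\<^sub>R V j (X a))
    = (\<Sum>j\<le>m. (b j (u (Suc l)) - b j (u l)) *\<^sub>R V j (X a))"
   unfolding sum_subtractf[symmetric] by (intro sum.cong refl) (simp add: algebra_simps)
  moreover have "germ m b g (u l) (u (Suc l)) = germ m b (%j s. V j (X s)) (u l) (u (Suc l))
    - (\<Sum>j\<le>m. (b j (u (Suc l)) - b j (u l)) *\<^sub>R V j (X a)) - (\<Sum>j\<le>m. (b j (u (Suc l)) - b j (u l)) *\<^sub>R S j)"
   unfolding germ_def sum_subtractf[symmetric]
   by (intro sum.cong refl) (simp add: g_def resid_def S_def scaleR_right_diff_distrib)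
  ultimately have "F (Suc l) - F l - germ m b g (u l) (u (Suc l)) = X (u (Suc l)) - X (u l) - germ m b (%j s. V j (X s)) (u l) (u (Suc l))"
   unfolding F_def by (simp add: algebra_simps)
  also have "norm ... <= C2 * G\<^sup>2 * (u (Suc l) - u l) powr (2 * be)"
   using l u_mono[of l "Suc l"] u_le[of "Suc l"] u_simps(4)[of l] a ah smallI by (intro X_expand) auto
  finally show "norm (F (Suc l) - F l - germ m b g (u l) (u (Suc l))) <= C2 * G\<^sup>2 * dlt powr (2 * be)"
   by (simp add: u_simps(3))
 qed (use be const_bounds C4 G u_simps N in \<open>auto intro!: mult_nonneg_nonneg\<close>)
 have e1: "F N - F 0 - germ m b g (u 0) (u N) = F N" by (simp add: F_def iter_sum_def germ_def g_def u_simps)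
 have e2: "real (N - 0) * dlt = h" using N by (simp add: dlt_def)
 have e3: "sewc (2 * be) * (J * (C4 * G\<^sup>2 * h powr be) * G) * h powr (2 * be) = kap * J * C4 * (G ^ 3 * h powr (3 * be))"
  unfolding kap_def[symmetric] 3 by (simp only: power2_eq_square power3_eq_cube mult_ac)
 have e4: "real (N - 0) * (C2 * G\<^sup>2 * dlt powr (2 * be)) <= C2 * (G\<^sup>2 * h ^ 3)"
 proof -
  have "real (N - 0) * (C2 * G\<^sup>2 * dlt powr (2 * be)) = (C2 * G\<^sup>2) * (real N * dlt powr (2 * be))" by simp
  also have "... <= (C2 * G\<^sup>2) * h ^ 3" using fine const_bounds by (intro mult_left_mono) (auto simp: dlt_def)
  finally show ?thesis by (simp add: mult_ac)
 qed
 have FN: "norm (F N) <= kap * J * C4 * (G ^ 3 * h powr (3 * be)) + C2 * (G\<^sup>2 * h ^ 3)"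
  using e0[unfolded e1 e2 e3] e4 by linarith
 let ?d = "%j. b j (a + h) - b j a"
 define Q where "Q i j = iter_sum b a h N i j N - ?d i * ?d j / 2 - area b a h N i j" for i j
 \<comment> \<open>The half products \<open>?d i * ?d j / 2\<close> in the iterated sums are exactly
   those produced by the trapezoidal mean, so at second order only the areas remain.\<close>
 have decomp: "trap_err m V b X a (a + h) - (\<Sum>j\<le>m. \<Sum>i\<le>m. area b a h N i j *\<^sub>R D i j (X a))
   = F N + (\<Sum>j\<le>m. \<Sum>i\<le>m. Q i j *\<^sub>R D i j (X a)) - (\<Sum>j\<le>m. (?d j / 2) *\<^sub>R g j (a + h))"
 proof -
  define S where "S j = (\<Sum>i\<le>m. ?d i *\<^sub>R D i j (X a))" for j
  define I where "I j = (\<Sum>i\<le>m. iter_sum b a h N i j N *\<^sub>R D i j (X a))" for j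
  define R where "R j = (\<Sum>i\<le>m. area b a h N i j *\<^sub>R D i j (X a))" for j
  have pq: "(p - q * r / 2 - s) *\<^sub>R v = p *\<^sub>R v - (r / 2) *\<^sub>R (q *\<^sub>R v) - s *\<^sub>R v" for p q r s :: real and v :: 'a
   by (simp add: scaleR_left_diff_distrib mult.commute)
  have Q: "(\<Sum>i\<le>m. Q i j *\<^sub>R D i j (X a)) = I j - (?d j / 2) *\<^sub>R S j - R j" for j
   unfolding I_def S_def R_def Q_def scaleR_sum_right sum_subtractf[symmetric]
   by (intro sum.cong refl pq)
  have g: "g j (a + h) = V j (X (a + h)) - V j (X a) - S j" for j
   by (simp add: g_def resid_def S_def)
  have pt: "(1 / 2) *\<^sub>R (d *\<^sub>R (v + w)) + r = d *\<^sub>R w + i - (i - (d / 2) *\<^sub>R s - r) + (d / 2) *\<^sub>R (v - w - s)"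
   for d :: real and v w r i s :: 'a
  proof -
   define e where "e = d / 2"
   have d: "d = e + e" "d / 2 = e" "(1 / 2) *\<^sub>R (d *\<^sub>R (v + w)) = e *\<^sub>R (v + w)" by (simp_all add: e_def)
   show ?thesis unfolding d(2,3) unfolding d(1) by (simp add: algebra_simps) (simp add: scaleR_left_distrib[symmetric])
  qed
  have "(1 / 2) *\<^sub>R (\<Sum>j\<le>m. ?d j *\<^sub>R (V j (X (a + h)) + V j (X a))) + (\<Sum>j\<le>m. R j)
   = (\<Sum>j\<le>m. ?d j *\<^sub>R V j (X a)) + (\<Sum>j\<le>m. I j) - (\<Sum>j\<le>m. I j - (?d j / 2) *\<^sub>R S j - R j)
     + (\<Sum>j\<le>m. (?d j / 2) *\<^sub>R g j (a + h))"
   unfolding scaleR_sum_right g sum.distrib[symmetric] sum_subtractf[symmetric] by (intro sum.cong refl pt)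
  then show ?thesis
   unfolding trap_err_def F_def u_simps(2) Q I_def[symmetric] R_def[symmetric] by (simp add: algebra_simps)
 qed
 have QD: "norm (\<Sum>j\<le>m. \<Sum>i\<le>m. Q i j *\<^sub>R D i j (X a)) <= (\<Sum>j\<le>m. \<Sum>i\<le>m. (G\<^sup>2 * h ^ 3) * L)"
 proof (intro sum_norm_le)
  fix i j assume "j \<in> {..m}" "i \<in> {..m}"
  then show "norm (Q i j *\<^sub>R D i j (X a)) <= G\<^sup>2 * h ^ 3 * L"
   using iter_sum_area[of i j] D[of i j] h by (auto simp: Q_def lipb_def intro!: mult_mono)
 qed
 have gd: "norm (\<Sum>j\<le>m. (?d j / 2) *\<^sub>R g j (a + h)) <= (\<Sum>j\<le>m. (G * h powr be) * (C4 * G\<^sup>2 * h powr be * h powr be))"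
 proof (intro sum_norm_le)
  fix j assume "j \<in> {..m}"
  then have "\<bar>?d j / 2\<bar> <= G * h powr be" "norm (g j (a + h)) <= C4 * G\<^sup>2 * h powr be * h powr be"
   using b_hoelder[of j a "a + h"] a h ah V D unfolding g_def by (auto intro!: resid_bound)
  then show "norm ((?d j / 2) *\<^sub>R g j (a + h)) <= (G * h powr be) * (C4 * G\<^sup>2 * h powr be * h powr be)"
   unfolding norm_scaleR by (intro mult_mono) auto
 qed
 have "norm (trap_err m V b X a (a + h) - (\<Sum>j\<le>m. \<Sum>i\<le>m. area b a h N i j *\<^sub>R D i j (X a)))
   <= norm (F N) + norm (\<Sum>j\<le>m. \<Sum>i\<le>m. Q i j *\<^sub>R D i j (X a)) + norm (\<Sum>j\<le>m. (?d j / 2) *\<^sub>R g j (a + h))"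
  unfolding decomp by (intro norm_triangle_le_diff norm_triangle_le add_mono order_refl)
 also have "... <= (kap * J * C4 * (G ^ 3 * h powr (3 * be)) + C2 * (G\<^sup>2 * h ^ 3)) + J\<^sup>2 * L * (G\<^sup>2 * h ^ 3)
   + J * C4 * (G ^ 3 * h powr (3 * be))"
 proof -
  have "(\<Sum>j\<le>m. \<Sum>i\<le>m. (G\<^sup>2 * h ^ 3) * L) = J\<^sup>2 * L * (G\<^sup>2 * h ^ 3)"
   by (simp add: J_def power2_eq_square)
  moreover have "(\<Sum>j\<le>m. (G * h powr be) * (C4 * G\<^sup>2 * h powr be * h powr be)) = J * C4 * (G ^ 3 * h powr (3 * be))"
   unfolding 3 powr_double sum_constant by (simp add: J_def power2_eq_square power3_eq_cube mult_ac)
  ultimately show ?thesis using FN QD gd by linarith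
 qed
 also have "... <= C5 * (G ^ 3 * h powr (3 * be) + G\<^sup>2 * h ^ 3)"
 proof -
  have "0 <= C2 * (G ^ 3 * h powr (3 * be))" "0 <= J\<^sup>2 * L * (G ^ 3 * h powr (3 * be))"
   "0 <= kap * J * C4 * (G\<^sup>2 * h ^ 3)" "0 <= J * C4 * (G\<^sup>2 * h ^ 3)"
   using const_bounds C4 L G h by (auto intro!: mult_nonneg_nonneg)
  then show ?thesis by (simp add: C5_def algebra_simps)
 qed
 finally show ?thesis .
qed

end

lemma half_square_add: "((x + d)\<^sup>2 / 2 :: real) = x\<^sup>2 / 2 + d * x + d\<^sup>2 / 2"
 by (simp add: power2_eq_square field_simps)

lemma sixth_cube_add: "((x + d) ^ 3 / 6 :: real) = x ^ 3 / 6 + d * (x\<^sup>2 / 2) + (x * d\<^sup>2 / 2 + d ^ 3 / 6)"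
 by (simp add: power2_eq_square power3_eq_cube field_simps)

lemma norm_scaleR_le: "\<bar>x\<bar> <= p ==> norm v <= q ==> norm (x *\<^sub>R v) <= p * q"
 by (simp add: mult_mono')

context cell begin

definition "C6 = (kap + 1)\<^sup>2 * (C4 + 1 + C1) + (kap + 1) * (J * C1 + C3) + C2 + 4 * L"

text \<open>With a single noise the area of the noise with itself vanishes, so one order more is
  expanded. For d the increment of the noise, X contributes d ^ 3 / 6 times \<open>E 1\<close> and
  the trapezoidal mean d / 2 * (d ^ 2 / 2) = d ^ 3 / 4, whence the coefficient -1/12. As the area is
  antisymmetric, it multiplies \<open>D 0 1 - D 1 0\<close>, in the intended use the Lie bracket of
  drift and noise field. The error of order 1 + 2 * be involves the drift and carries the factor
  \<open>L0\<close>.\<close>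

lemma trap_err_third_order:
 assumes m: "m = 1" and L0: "0 <= L0" "L0 <= L"
  and V: "!!j. j <= m ==> expands m V (if j = 0 then L0 else L) (V j) (%i. D i j)"
  and D: "!!i j. i <= m ==> j <= m ==> lipb (if i = 0 \<or> j = 0 then L0 else L) (D i j)"
  and DV: "expands m V L (D 1 1) E" "!!i. i <= m ==> lipb L (E i)" "!!x. norm (E 0 x) <= L0"
  and time: "!!t. 0 <= t ==> t <= T ==> b 0 t = t"
 shows "norm (trap_err m V b X a (a + h)
      - (area b a h N 0 1 *\<^sub>R (D 0 1 (X a) - D 1 0 (X a)) - ((b 1 (a + h) - b 1 a) ^ 3 / 12) *\<^sub>R E 1 (X a)))
      <= C6 * (G ^ 4 * h powr (4 * be) + L0 * G\<^sup>2 * h powr (1 + 2 * be) + G\<^sup>2 * h ^ 3)"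
proof -
 have sum2: "(\<Sum>j\<le>m. f j) = f 0 + f 1" for f :: "nat => 'z::comm_monoid_add"
  by (simp add: m)
 have L_ge: "lipb L' f ==> L' <= L ==> lipb L f" for L' f
  unfolding lipb_def by (meson mult_right_mono norm_ge_zero order_trans)
 have D': "lipb L (D i j)" if "i <= m" "j <= m" for i j
  using L_ge[OF D[OF that]] L0 by simp
 have t0: "b 0 t = t" if "a <= t" "t <= a + h" for t using that a ah by (intro time) auto
 have EL: "norm (E 1 x) <= L" for x using DV(2)[of 1] m by (simp add: lipb_def)
 have DL: "norm (D i j x) <= L" if "i <= m" "j <= m" for i j x using D'[OF that] by (simp add: lipb_def)
 define B where "B s = b 1 s - b 1 a" for s
 \<comment> \<open>Time is Lipschitz; as a be-Hoelder function on the cell its constant is only h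
   powr (1 - be).\<close>
 define Gf where "Gf j = (if j = 0 then h powr (1 - be) else G)" for j :: nat
 have bH: "\<bar>b j t - b j s\<bar> <= Gf j * (t - s) powr be" if "j <= m" "a <= s" "s <= t" "t <= a + h" for j s t
 proof (cases "j = 0")
  case True
  have "t - s = (t - s) powr (1 - be) * (t - s) powr be" using that by (simp add: powr_add[symmetric])
  also have "... <= h powr (1 - be) * (t - s) powr be" using that be by (intro mult_right_mono powr_mono2) auto
  finally show ?thesis using True that t0 by (simp add: Gf_def)
 next
  case False
  then show ?thesis using that a ah b_hoelder[of j s t] by (simp add: Gf_def)
 qed
 have Gf0: "0 <= Gf j" for j using G by (simp add: Gf_def)
 have B1: "\<bar>B s\<bar> <= 1" if "a <= s" "s <= a + h" for s
 proof -
  have "\<bar>B s\<bar> <= G * (s - a) powr be" using that a ah m b_hoelder[of 1 a s] by (simp add: B_def)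
  also have "... <= c0" using that by (intro smallI) auto
  finally show ?thesis using const_bounds by simp
 qed
 define K1 where "K1 = C4 * G\<^sup>2 * h powr be + L0 * h powr (1 - be)"
 define K0 where "K0 = L0 * C1 * G"
 define Kf where "Kf j = (if j = 0 then K0 else K1)" for j :: nat
 have K: "0 <= K1" "0 <= K0" "0 <= Kf j" for j using C4 L0 const_bounds G by (auto simp: K1_def K0_def Kf_def)
 \<comment> \<open>The germ coefficients for the residual \<open>g1\<close> of \<open>V 1\<close>
   below: the derivatives of \<open>V 1\<close> along time and noise, reduced by what the expansion
   at a accounts for.\<close>
 define f where "f j s = (if j = 0 then D 0 1 (X s) - D 0 1 (X a) else D 1 1 (X s) - D 1 1 (X a) - B s *\<^sub>R E 1 (X a))" for j :: nat and s
 have fH: "norm (f j t - f j s) <= Kf j * (t - s) powr be" if "j <= m" "a <= s" "s <= t" "t <= a + h" for j s t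
 proof (cases "j = 0")
  case True
  have "norm (D 0 1 (X t) - D 0 1 (X s)) <= L0 * C1 * G * (t - s) powr be"
   using D[of 0 1] m L0 that a ah smallI[of s t] by (intro lipb_hoelder) auto
  then show ?thesis using True by (simp add: f_def Kf_def K0_def)
 next
  case False
  have "f j t - f j s = (resid (D 1 1) E t - resid (D 1 1) E s) + (t - s) *\<^sub>R E 0 (X a)"
   using False that by (simp add: f_def resid_def sum2 t0 B_def algebra_simps h less_imp_le)
  also have "norm ... <= C4 * G\<^sup>2 * h powr be * (t - s) powr be + (t - s) * L0"
   using that DV by (intro norm_triangle_mono resid_hoelder) (auto intro!: mult_left_mono)
  finally have 1: "norm (f j t - f j s) <= C4 * G\<^sup>2 * h powr be * (t - s) powr be + (t - s) * L0" .
  have "t - s <= h powr (1 - be) * (t - s) powr be"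
   using bH[of 0 s t] that t0 by (simp add: Gf_def)
  then have "(t - s) * L0 <= h powr (1 - be) * (t - s) powr be * L0" using L0 by (intro mult_right_mono) auto
  with 1 show ?thesis using False by (simp add: Kf_def K1_def algebra_simps)
 qed
 have fa: "f j a = 0" for j by (simp add: f_def B_def)
 have fb: "norm (f j s) <= Kf j * h powr be" if "j <= m" "a <= s" "s <= a + h" for j s
 proof -
  have "norm (f j s) <= Kf j * (s - a) powr be" using fH[of j a s] fa that by simp
  also have "... <= Kf j * h powr be" using incr_le[of a s] that K by (intro mult_left_mono) auto
  finally show ?thesis .
 qed
 define KK where "KK = K0 * h powr (1 - be) + K1 * G"
 have KK: "(\<Sum>j\<le>m. Kf j * Gf j) = KK" unfolding sum2 by (simp add: Kf_def Gf_def KK_def)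
 have KK0: "0 <= KK" using K G by (simp add: KK_def)
 \<comment> \<open>The residual of \<open>V 1\<close> has to be one order smaller than that of
   \<open>V 0\<close>, because it is integrated against the noise and not against time; hence the
   quadratic term in the noise and the linear term in time.\<close>
 define g1 where "g1 s = V 1 (X s) - V 1 (X a) - B s *\<^sub>R D 1 1 (X a) - ((B s)\<^sup>2 / 2) *\<^sub>R E 1 (X a) - (s - a) *\<^sub>R D 0 1 (X a)" for s
 have V1: "expands m V L (V 1) (%i. D i 1)" using V[of 1] m by simp
 have g1_sew: "norm (g1 t - g1 s - germ m b f s t) <= kap * KK * (t - s) powr (2 * be)"
  if "a <= s" "s <= t" "t <= a + h" for s t
  unfolding kap_def
 proof (rule cont_sewing[where a = a and b = "a + h" and \<gamma>' = "2 * be" and Q = "L * C3 * G\<^sup>2 + G\<^sup>2 * L"])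
  fix s t assume st: "a <= s" "s <= t" "t <= a + h"
  have "g1 t - g1 s - germ m b f s t = (V 1 (X t) - V 1 (X s) - germ m b (%j s. D j 1 (X s)) s t) - ((b 1 t - b 1 s)\<^sup>2 / 2) *\<^sub>R E 1 (X a)"
  proof -
   define d where "d = b 1 t - b 1 s"
   have Bt: "B t = B s + d" by (simp add: B_def d_def)
   have t: "b 0 t - b 0 s = t - s" using st t0 by simp
   show ?thesis unfolding g1_def germ_def sum2 Bt half_square_add d_def[symmetric] t
    by (simp add: f_def algebra_simps)
  qed
  also have "norm ... <= L * C3 * G\<^sup>2 * (t - s) powr (2 * be) + G\<^sup>2 * (t - s) powr (2 * be) * L"
  proof (rule order_trans[OF norm_triangle_ineq4 add_mono])
   show "norm (V 1 (X t) - V 1 (X s) - germ m b (%j s. D j 1 (X s)) s t) <= L * C3 * G\<^sup>2 * (t - s) powr (2 * be)"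
    using V1 L st a ah smallI[of s t] by (intro f_expand) auto
   have "(b 1 t - b 1 s)\<^sup>2 / 2 <= (G * (t - s) powr be)\<^sup>2"
   proof -
    have "\<bar>b 1 t - b 1 s\<bar>\<^sup>2 <= (G * (t - s) powr be)\<^sup>2"
     using st a ah m by (intro power_mono b_hoelder) auto
    then show ?thesis unfolding power2_abs using zero_le_power2[of "b 1 t - b 1 s"] by linarith
   qed
   also have "... = G\<^sup>2 * (t - s) powr (2 * be)" by (simp add: powr_double power2_eq_square)
   finally show "norm (((b 1 t - b 1 s)\<^sup>2 / 2) *\<^sub>R E 1 (X a)) <= G\<^sup>2 * (t - s) powr (2 * be) * L"
    by (intro norm_scaleR_le EL) simp
  qed
  finally show "norm (g1 t - g1 s - germ m b f s t) <= (L * C3 * G\<^sup>2 + G\<^sup>2 * L) * (t - s) powr (2 * be)"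
   by (simp add: algebra_simps)
 next
  fix r u v assume *: "a <= r" "r <= u" "u <= v" "v <= a + h"
  show "norm (germ m b f r v - germ m b f r u - germ m b f u v) <= KK * (v - r) powr (2 * be)"
   using germ_defect[of r u v be be m b Gf f Kf] * bH fH be Gf0 K unfolding KK by (simp add: mult.commute)
 qed (use be that KK0 in auto)
 define M1 where "M1 = (kap + 1) * KK * h powr be"
 have g1H: "norm (g1 t - g1 s) <= M1 * (t - s) powr be" if "a <= s" "s <= t" "t <= a + h" for s t
 proof -
  have "norm (germ m b f s t) <= (\<Sum>j\<le>m. (Kf j * h powr be) * Gf j) * (t - s) powr be"
   using that bH fb Gf0 by (intro germ_bound) auto
  also have "(\<Sum>j\<le>m. (Kf j * h powr be) * Gf j) = KK * h powr be"
   unfolding KK[symmetric] sum_distrib_right by (simp add: mult_ac)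
  finally have 1: "norm (germ m b f s t) <= KK * h powr be * (t - s) powr be" .
  have "kap * KK * (t - s) powr (2 * be) <= kap * KK * (h powr be * (t - s) powr be)"
   unfolding powr_double using incr_le[OF that] const_bounds KK0 by (intro mult_left_mono mult_right_mono) auto
  then have 2: "norm (g1 t - g1 s - germ m b f s t) <= kap * KK * (h powr be * (t - s) powr be)"
   using g1_sew[OF that] by simp
  have "norm (g1 t - g1 s) <= norm (g1 t - g1 s - germ m b f s t) + norm (germ m b f s t)"
   using norm_triangle_sub[of "g1 t - g1 s" "germ m b f s t"] by simp
  then show ?thesis using 1 2 by (simp add: M1_def algebra_simps)
 qed
 define g0 where "g0 = resid (V 0) (%i. D i 0)"
 define M0 where "M0 = L0 * (J * C1 + C3) * G\<^sup>2 * h powr be"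
 have g0H: "norm (g0 t - g0 s) <= M0 * (t - s) powr be" if "a <= s" "s <= t" "t <= a + h" for s t
  unfolding g0_def M0_def using that V[of 0] D[of _ 0] L0 by (intro resid_hoelder') auto
 define g where "g j = (if j = 0 then g0 else g1)" for j :: nat
 define Mf where "Mf j = (if j = 0 then M0 else M1)" for j :: nat
 have M: "0 <= M0" "0 <= M1" using L0 const_bounds C3 KK0 by (auto simp: M0_def M1_def)
 have gH: "norm (g j t - g j s) <= Mf j * (t - s) powr be" if "a <= s" "s <= t" "t <= a + h" for j s t
  using g0H[OF that] g1H[OF that] by (simp add: g_def Mf_def)
 have ga: "g j a = 0" for j by (simp add: g_def g0_def g1_def B_def)
 have gb: "norm (g j (a + h)) <= Mf j * h powr be" for j
  using gH[of a "a + h" j] ga h by simp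
 define MM where "MM = M0 * h powr (1 - be) + M1 * G"
 have MM: "(\<Sum>j\<le>m. Mf j * Gf j) = MM" unfolding sum2 by (simp add: Mf_def Gf_def MM_def)
 have MM0: "0 <= MM" using M G by (simp add: MM_def)
 \<comment> \<open>Everything above the order of the remainder is taken out of X: the powers of the
   noise increment up to the cube, the two mixed iterated sums, and the first two powers of
   time.\<close>
 define F where "F l = X (u l) - X a - (B (u l) *\<^sub>R V 1 (X a) + ((B (u l))\<^sup>2 / 2) *\<^sub>R D 1 1 (X a) + ((B (u l)) ^ 3 / 6) *\<^sub>R E 1 (X a)
   + iter_sum b a h N 0 1 l *\<^sub>R D 0 1 (X a) + (u l - a) *\<^sub>R V 0 (X a) + iter_sum b a h N 1 0 l *\<^sub>R D 1 0 (X a)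
   + ((u l - a)\<^sup>2 / 2) *\<^sub>R D 0 0 (X a))" for l
 define err where "err = (C2 + 2 * L) * G\<^sup>2 * dlt powr (2 * be)"
 have e0: "norm (F N - F 0 - germ m b g (u 0) (u N)) <= sewc (2 * be) * MM * (real (N - 0) * dlt) powr (2 * be) + real (N - 0) * err"
 proof (rule discrete_sewing_path[where p = 0 and q = N and X = "%k l. germ m b g (u k) (u l)"])
  fix k i l assume *: "k <= i" "i <= l" "l <= N"
  have "norm (germ m b g (u k) (u l) - germ m b g (u k) (u i) - germ m b g (u i) (u l))
    <= (\<Sum>j\<le>m. Mf j * Gf j) * (u l - u k) powr (be + be)"
   using * u_mono[of k i] u_mono[of i l] u_le[of i] u_le[of l] u_simps(4) be Gf0 M
   by (intro germ_defect gH bH) (auto simp: Mf_def)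
  also have "u l - u k = real (l - k) * dlt" using * by (simp add: u_simps(6) of_nat_diff)
  finally show "norm (germ m b g (u k) (u l) - germ m b g (u k) (u i) - germ m b g (u i) (u l))
    <= MM * (real (l - k) * dlt) powr (2 * be)" unfolding MM by simp
 next
  fix l assume l: "l < N"
  have ul: "a <= u l" "u l <= u (Suc l)" "u (Suc l) <= a + h" "u l <= a + h" "a <= u (Suc l)"
   using l u_mono[of l "Suc l"] u_le[of "Suc l"] u_le[of l] u_simps(4) by auto
  define d where "d = b 1 (u (Suc l)) - b 1 (u l)"
  define B0 where "B0 = B (u l)"
  define s where "s = u l - a"
  have Bs: "B (u (Suc l)) = B0 + d" by (simp add: B_def d_def B0_def)
  have us: "u (Suc l) - a = s + dlt" using u_simps(3)[of l] by (simp add: s_def)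
  have I1: "iter_sum b a h N 0 1 (Suc l) = iter_sum b a h N 0 1 l + s * d"
   using t0[of "u l"] t0[of a] ul h by (simp add: iter_sum_def d_def s_def)
  have I0: "iter_sum b a h N 1 0 (Suc l) = iter_sum b a h N 1 0 l + B0 * dlt"
   using t0[of "u l"] t0[of "u (Suc l)"] ul u_simps(3)[of l] by (simp add: iter_sum_def B0_def B_def)
  have G1: "germ m b g (u l) (u (Suc l)) = dlt *\<^sub>R g0 (u l) + d *\<^sub>R g1 (u l)"
   unfolding germ_def sum2 using t0[of "u l"] t0[of "u (Suc l)"] ul u_simps(3)[of l] by (simp add: g_def d_def)
  have GV: "germ m b (%j s. V j (X s)) (u l) (u (Suc l)) = dlt *\<^sub>R V 0 (X (u l)) + d *\<^sub>R V 1 (X (u l))"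
   unfolding germ_def sum2 using t0[of "u l"] t0[of "u (Suc l)"] ul u_simps(3)[of l] by (simp add: d_def)
  have g0l: "g0 (u l) = V 0 (X (u l)) - V 0 (X a) - s *\<^sub>R D 0 0 (X a) - B0 *\<^sub>R D 1 0 (X a)"
   unfolding g0_def resid_def sum2 using t0[of "u l"] t0[of a] ul h by (simp add: s_def B0_def B_def)
  have g1l: "g1 (u l) = V 1 (X (u l)) - V 1 (X a) - B0 *\<^sub>R D 1 1 (X a) - (B0\<^sup>2 / 2) *\<^sub>R E 1 (X a) - s *\<^sub>R D 0 1 (X a)"
   by (simp add: g1_def B0_def s_def)
  have p2: "((B0 + d)\<^sup>2 / 2) *\<^sub>R v = (B0\<^sup>2 / 2) *\<^sub>R v + (d * B0) *\<^sub>R v + (d\<^sup>2 / 2) *\<^sub>R v" for v :: 'a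
   by (simp only: half_square_add scaleR_left_distrib)
  have p3: "((B0 + d) ^ 3 / 6) *\<^sub>R v = (B0 ^ 3 / 6) *\<^sub>R v + (d * (B0\<^sup>2 / 2)) *\<^sub>R v + (B0 * d\<^sup>2 / 2 + d ^ 3 / 6) *\<^sub>R v" for v :: 'a
   by (simp only: sixth_cube_add scaleR_left_distrib)
  have q2: "((s + dlt)\<^sup>2 / 2) *\<^sub>R v = (s\<^sup>2 / 2) *\<^sub>R v + (dlt * s) *\<^sub>R v + (dlt\<^sup>2 / 2) *\<^sub>R v" for v :: 'a
   by (simp only: half_square_add scaleR_left_distrib)
  \<comment> \<open>What survives is the first order expansion error of X and the diagonal terms,
    which contain a square or cube of an increment over one sub-interval; summed over the sub-grid
    they are small by \<open>fine\<close>.\<close>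
  have "F (Suc l) - F l - germ m b g (u l) (u (Suc l)) = (X (u (Suc l)) - X (u l) - germ m b (%j s. V j (X s)) (u l) (u (Suc l)))
    - ((d\<^sup>2 / 2) *\<^sub>R D 1 1 (X a) + (B0 * d\<^sup>2 / 2 + d ^ 3 / 6) *\<^sub>R E 1 (X a) + (dlt\<^sup>2 / 2) *\<^sub>R D 0 0 (X a))"
   unfolding F_def Bs us I1 I0 G1 GV g0l g1l p2 p3 q2 B0_def[symmetric] s_def[symmetric]
   by (simp add: scaleR_right_diff_distrib scaleR_left_distrib scaleR_add_right mult_ac)
  also have "norm ... <= C2 * G\<^sup>2 * dlt powr (2 * be) + ((L / 2) * (G\<^sup>2 * dlt powr (2 * be)) + (2 / 3 * L) * (G\<^sup>2 * dlt powr (2 * be)) + (L / 2) * (G\<^sup>2 * dlt powr (2 * be)))"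
  proof (rule order_trans[OF norm_triangle_ineq4 add_mono[OF _ norm_triangle_mono[OF norm_triangle_mono]]])
   show "norm (X (u (Suc l)) - X (u l) - germ m b (%j s. V j (X s)) (u l) (u (Suc l))) <= C2 * G\<^sup>2 * dlt powr (2 * be)"
    using X_expand[of "u l" "u (Suc l)"] ul a ah smallI[of "u l" "u (Suc l)"] u_simps(3)[of l] by simp
   have gd: "\<bar>b j (u (Suc l)) - b j (u l)\<bar> <= G * dlt powr be" if "j <= m" for j
    using b_hoelder[OF that, of "u l" "u (Suc l)"] ul a ah u_simps(3)[of l] by simp
   have sq: "x\<^sup>2 <= G\<^sup>2 * dlt powr (2 * be)" if "\<bar>x\<bar> <= G * dlt powr be" for x
    using power_mono[OF that, of 2] by (simp add: powr_double power2_eq_square mult_ac)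
   have d: "d\<^sup>2 <= G\<^sup>2 * dlt powr (2 * be)" using gd[of 1] m by (intro sq) (simp add: d_def)
   have de: "dlt\<^sup>2 <= G\<^sup>2 * dlt powr (2 * be)" using gd[of 0] ul t0[of "u l"] t0[of "u (Suc l)"] u_simps(3)[of l] by (intro sq) simp
   have d1: "\<bar>d\<bar> <= 1"
   proof -
    have "\<bar>d\<bar> <= G * dlt powr be" using gd[of 1] m by (simp add: d_def)
    also have "... <= c0" using smallI[of "u l" "u (Suc l)"] ul u_simps(3)[of l] by simp
    finally show ?thesis using const_bounds by simp
   qed
   have "\<bar>B0 * d\<^sup>2 / 2 + d ^ 3 / 6\<bar> <= \<bar>B0\<bar> * d\<^sup>2 / 2 + \<bar>d\<bar> * d\<^sup>2 / 6"
    by (rule order_trans[OF abs_triangle_ineq]) (simp add: abs_mult power2_eq_square power3_eq_cube)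
   also have "... <= 1 * d\<^sup>2 / 2 + 1 * d\<^sup>2 / 6"
    using d1 B1[of "u l"] ul by (intro add_mono divide_right_mono mult_right_mono) (auto simp: B0_def)
   finally have "\<bar>B0 * d\<^sup>2 / 2 + d ^ 3 / 6\<bar> <= 2 / 3 * (G\<^sup>2 * dlt powr (2 * be))" using d by simp
   then have "norm ((B0 * d\<^sup>2 / 2 + d ^ 3 / 6) *\<^sub>R E 1 (X a)) <= 2 / 3 * (G\<^sup>2 * dlt powr (2 * be)) * L"
    by (intro norm_scaleR_le EL)
   then show "norm ((B0 * d\<^sup>2 / 2 + d ^ 3 / 6) *\<^sub>R E 1 (X a)) <= 2 / 3 * L * (G\<^sup>2 * dlt powr (2 * be))"
    by (simp only: mult_ac)
   show "norm ((d\<^sup>2 / 2) *\<^sub>R D 1 1 (X a)) <= L / 2 * (G\<^sup>2 * dlt powr (2 * be))"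
   proof -
    have "norm ((d\<^sup>2 / 2) *\<^sub>R D 1 1 (X a)) <= (G\<^sup>2 * dlt powr (2 * be)) / 2 * L"
     using d m by (intro norm_scaleR_le DL) auto
    then show ?thesis by (simp only: mult_ac times_divide_eq_left times_divide_eq_right)
   qed
   show "norm ((dlt\<^sup>2 / 2) *\<^sub>R D 0 0 (X a)) <= L / 2 * (G\<^sup>2 * dlt powr (2 * be))"
   proof -
    have "norm ((dlt\<^sup>2 / 2) *\<^sub>R D 0 0 (X a)) <= (G\<^sup>2 * dlt powr (2 * be)) / 2 * L"
     using de m by (intro norm_scaleR_le DL) auto
    then show ?thesis by (simp only: mult_ac times_divide_eq_left times_divide_eq_right)
   qed
  qed
  also have "... = (C2 + 5 / 3 * L) * (G\<^sup>2 * dlt powr (2 * be))" by (simp add: algebra_simps)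
  also have "... <= (C2 + 2 * L) * (G\<^sup>2 * dlt powr (2 * be))" using L by (intro mult_right_mono) auto
  finally show "norm (F (Suc l) - F l - germ m b g (u l) (u (Suc l))) <= err" by (simp add: err_def mult_ac)
 qed (use be MM0 u_simps N in auto)
 have e1: "F N - F 0 - germ m b g (u 0) (u N) = F N"
  by (simp add: F_def iter_sum_def germ_def ga u_simps B_def)
 have e2: "real (N - 0) * dlt = h" using N by (simp add: dlt_def)
 have e4: "real (N - 0) * err <= (C2 + 2 * L) * (G\<^sup>2 * h ^ 3)"
 proof -
  have "real (N - 0) * err = ((C2 + 2 * L) * G\<^sup>2) * (real N * dlt powr (2 * be))" by (simp add: err_def)
  also have "... <= ((C2 + 2 * L) * G\<^sup>2) * h ^ 3" using fine const_bounds L by (intro mult_left_mono) (auto simp: dlt_def)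
  finally show ?thesis by (simp add: mult_ac)
 qed
 have FN: "norm (F N) <= kap * MM * h powr (2 * be) + (C2 + 2 * L) * (G\<^sup>2 * h ^ 3)"
  using e0[unfolded e1 e2 kap_def[symmetric]] e4 by linarith
 define d where "d = b 1 (a + h) - b 1 a"
 define Q1 where "Q1 = iter_sum b a h N 0 1 N - h * d / 2 - area b a h N 0 1"
 define Q0 where "Q0 = iter_sum b a h N 1 0 N - h * d / 2 + area b a h N 0 1"
 have Q: "\<bar>Q1\<bar> <= G\<^sup>2 * h ^ 3" "\<bar>Q0\<bar> <= G\<^sup>2 * h ^ 3"
  using iter_sum_area[of 0 1] iter_sum_area[of 1 0] m t0[of a] t0[of "a + h"] h
  by (auto simp: Q1_def Q0_def d_def area_def algebra_simps diff_divide_distrib)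
 have decomp: "trap_err m V b X a (a + h) - (area b a h N 0 1 *\<^sub>R (D 0 1 (X a) - D 1 0 (X a)) - (d ^ 3 / 12) *\<^sub>R E 1 (X a))
   = F N + Q1 *\<^sub>R D 0 1 (X a) + Q0 *\<^sub>R D 1 0 (X a) - (d / 2) *\<^sub>R g1 (a + h) - (h / 2) *\<^sub>R g0 (a + h)"
 proof -
  have gB: "B (a + h) = d" by (simp add: B_def d_def)
  have g0b: "g0 (a + h) = V 0 (X (a + h)) - V 0 (X a) - h *\<^sub>R D 0 0 (X a) - d *\<^sub>R D 1 0 (X a)"
   unfolding g0_def resid_def sum2 using t0[of "a + h"] t0[of a] h by (simp add: d_def)
  have g1b: "g1 (a + h) = V 1 (X (a + h)) - V 1 (X a) - d *\<^sub>R D 1 1 (X a) - (d\<^sup>2 / 2) *\<^sub>R E 1 (X a) - h *\<^sub>R D 0 1 (X a)"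
   by (simp add: g1_def gB)
  have tr: "trap_err m V b X a (a + h) = X (a + h) - X a - (h / 2) *\<^sub>R (V 0 (X (a + h)) + V 0 (X a)) - (d / 2) *\<^sub>R (V 1 (X (a + h)) + V 1 (X a))"
   unfolding trap_err_def sum2 using t0[of "a + h"] t0[of a] h by (simp add: d_def scaleR_add_right)
  have h1: "d *\<^sub>R v = (d / 2) *\<^sub>R v + (d / 2) *\<^sub>R v" "h *\<^sub>R v = (h / 2) *\<^sub>R v + (h / 2) *\<^sub>R v" for v :: 'a
   by (simp_all only: scaleR_left_distrib[symmetric] field_sum_of_halves)
  have h2: "(d ^ 3 / 12) *\<^sub>R v + (d ^ 3 / 6) *\<^sub>R v = (d / 2 * (d\<^sup>2 / 2)) *\<^sub>R v" for v :: 'a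
  proof -
   have "d ^ 3 / 12 + d ^ 3 / 6 = d / 2 * (d\<^sup>2 / 2)" by (simp add: power2_eq_square power3_eq_cube)
   then show ?thesis by (simp only: scaleR_left_distrib[symmetric])
  qed
  have h3: "(d / 2 * d) *\<^sub>R v = (d\<^sup>2 / 2) *\<^sub>R v" "(h / 2 * h) *\<^sub>R v = (h\<^sup>2 / 2) *\<^sub>R v" "(d / 2 * h) *\<^sub>R v = (h * d / 2) *\<^sub>R v" "(h / 2 * d) *\<^sub>R v = (h * d / 2) *\<^sub>R v" for v :: 'a
   by (simp_all add: power2_eq_square)
  have g0c: "(h / 2) *\<^sub>R g0 (a + h) = (h / 2) *\<^sub>R V 0 (X (a + h)) - (h / 2) *\<^sub>R V 0 (X a) - (h\<^sup>2 / 2) *\<^sub>R D 0 0 (X a) - (h * d / 2) *\<^sub>R D 1 0 (X a)"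
   unfolding g0b scaleR_right_diff_distrib scaleR_scaleR h3 ..
  have g1c: "(d / 2) *\<^sub>R g1 (a + h) = (d / 2) *\<^sub>R V 1 (X (a + h)) - (d / 2) *\<^sub>R V 1 (X a) - (d\<^sup>2 / 2) *\<^sub>R D 1 1 (X a) - ((d ^ 3 / 12) *\<^sub>R E 1 (X a) + (d ^ 3 / 6) *\<^sub>R E 1 (X a)) - (h * d / 2) *\<^sub>R D 0 1 (X a)"
   unfolding g1b scaleR_right_diff_distrib scaleR_scaleR h3 h2 ..
  have FNe: "F N = X (a + h) - X a - ((d / 2) *\<^sub>R V 1 (X a) + (d / 2) *\<^sub>R V 1 (X a) + (d\<^sup>2 / 2) *\<^sub>R D 1 1 (X a) + (d ^ 3 / 6) *\<^sub>R E 1 (X a)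
   + iter_sum b a h N 0 1 N *\<^sub>R D 0 1 (X a) + ((h / 2) *\<^sub>R V 0 (X a) + (h / 2) *\<^sub>R V 0 (X a)) + iter_sum b a h N 1 0 N *\<^sub>R D 1 0 (X a)
   + (h\<^sup>2 / 2) *\<^sub>R D 0 0 (X a))"
   unfolding F_def u_simps(2) gB h1[symmetric] by simp
  show ?thesis unfolding tr FNe g0c g1c Q1_def Q0_def by (simp add: algebra_simps)
 qed
 have n1: "norm (Q1 *\<^sub>R D 0 1 (X a)) <= (G\<^sup>2 * h ^ 3) * L" "norm (Q0 *\<^sub>R D 1 0 (X a)) <= (G\<^sup>2 * h ^ 3) * L"
  using norm_scaleR_le[OF Q(1) DL[of 0 1 "X a"]] norm_scaleR_le[OF Q(2) DL[of 1 0 "X a"]] m by simp_all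
 have n2: "norm ((d / 2) *\<^sub>R g1 (a + h)) <= (G * h powr be) * (M1 * h powr be)"
  using b_hoelder[of 1 a "a + h"] a h ah m gb[of 1] M unfolding norm_scaleR d_def
  by (intro mult_mono) (auto simp: g_def Mf_def)
 have hh: "h = h powr (1 - be) * h powr be" using h by (simp add: powr_add[symmetric])
 have "h * norm (g0 (a + h)) <= h * (M0 * h powr be)"
  using gb[of 0] h by (intro mult_left_mono) (auto simp: g_def Mf_def)
 also have "h * (M0 * h powr be) = (h powr (1 - be) * h powr be) * (M0 * h powr be)"
  using hh by simp
 finally have n3': "h * norm (g0 (a + h)) <= M0 * h powr (1 - be) * h powr (2 * be)"
  unfolding powr_double by (simp only: mult_ac)
 have "norm ((h / 2) *\<^sub>R g0 (a + h)) = h * norm (g0 (a + h)) / 2" "0 <= h * norm (g0 (a + h))"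
  using h by simp_all
 then have n3: "norm ((h / 2) *\<^sub>R g0 (a + h)) <= M0 * h powr (1 - be) * h powr (2 * be)"
  using n3' by linarith
 have "norm (F N + Q1 *\<^sub>R D 0 1 (X a) + Q0 *\<^sub>R D 1 0 (X a) - (d / 2) *\<^sub>R g1 (a + h) - (h / 2) *\<^sub>R g0 (a + h))
   <= norm (F N) + norm (Q1 *\<^sub>R D 0 1 (X a)) + norm (Q0 *\<^sub>R D 1 0 (X a)) + norm ((d / 2) *\<^sub>R g1 (a + h)) + norm ((h / 2) *\<^sub>R g0 (a + h))"
  by (intro norm_triangle_le_diff norm_triangle_le add_mono order_refl)
 also have "... <= (kap * MM * h powr (2 * be) + (C2 + 2 * L) * (G\<^sup>2 * h ^ 3)) + (G\<^sup>2 * h ^ 3) * L + (G\<^sup>2 * h ^ 3) * L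
   + (G * h powr be) * (M1 * h powr be) + M0 * h powr (1 - be) * h powr (2 * be)"
  using FN n1 n2 n3 by linarith
 also have "... = (kap + 1) * MM * h powr (2 * be) + (C2 + 4 * L) * (G\<^sup>2 * h ^ 3)"
  by (simp add: MM_def powr_double algebra_simps)
 finally have fin: "norm (F N + Q1 *\<^sub>R D 0 1 (X a) + Q0 *\<^sub>R D 1 0 (X a) - (d / 2) *\<^sub>R g1 (a + h) - (h / 2) *\<^sub>R g0 (a + h))
   <= (kap + 1) * MM * h powr (2 * be) + (C2 + 4 * L) * (G\<^sup>2 * h ^ 3)" .
 define P where "P = L0 * G\<^sup>2 * h powr (1 + 2 * be)"
 define P4 where "P4 = G ^ 4 * h powr (4 * be)"
 have P0: "0 <= P" "0 <= P4" using L0 by (auto simp: P_def P4_def)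
 have x1: "h powr (1 + 2 * be) = h powr (1 - be) * (h powr be * h powr be * h powr be)" by (simp add: powr_add[symmetric] add.commute)
 have x4: "h powr (4 * be) = h powr be * (h powr be * h powr be * h powr be)" by (simp add: powr_add[symmetric])
 have "MM * h powr (2 * be) = (J * C1 + C3) * P + (kap + 1) * (C1 * P + C4 * P4 + P)"
  unfolding MM_def M0_def M1_def KK_def K0_def K1_def P_def P4_def x1 x4 powr_double power2_eq_square power4_eq_xxxx
  by (simp only: distrib_left distrib_right mult_ac add_ac mult_1_left mult_1_right)
 also have "... <= (J * C1 + C3) * (P4 + P) + (kap + 1) * ((C4 + 1 + C1) * (P4 + P))"
 proof -
  have JC: "0 <= J * C1 + C3" using const_bounds C3 by (intro add_nonneg_nonneg mult_nonneg_nonneg) auto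
  have "0 <= C1 * P4" "0 <= C4 * P"
   using const_bounds C4 P0 by (auto intro!: mult_nonneg_nonneg)
  then have "C1 * P + C4 * P4 + P <= (C4 + 1 + C1) * (P4 + P)" using P0 by (simp add: algebra_simps)
  then show ?thesis using const_bounds P0 JC by (intro add_mono mult_left_mono) auto
 qed
 finally have "(kap + 1) * (MM * h powr (2 * be)) <= (kap + 1) * ((J * C1 + C3) * (P4 + P) + (kap + 1) * ((C4 + 1 + C1) * (P4 + P)))"
  using const_bounds by (intro mult_left_mono) auto
 also have "... = ((kap + 1)\<^sup>2 * (C4 + 1 + C1) + (kap + 1) * (J * C1 + C3)) * (P4 + P)"
  by (simp add: power2_eq_square algebra_simps)
 finally have y: "(kap + 1) * MM * h powr (2 * be) <= ((kap + 1)\<^sup>2 * (C4 + 1 + C1) + (kap + 1) * (J * C1 + C3)) * (P4 + P)"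
  by (simp add: mult_ac)
 have k1: "0 <= (kap + 1)\<^sup>2 * (C4 + 1 + C1) + (kap + 1) * (J * C1 + C3)" "0 <= C2 + 4 * L"
  using const_bounds C3 C4 L by (auto intro!: add_nonneg_nonneg mult_nonneg_nonneg)
 have "(kap + 1) * MM * h powr (2 * be) + (C2 + 4 * L) * (G\<^sup>2 * h ^ 3) <= C6 * (P4 + P + G\<^sup>2 * h ^ 3)"
 proof -
  have "0 <= ((kap + 1)\<^sup>2 * (C4 + 1 + C1) + (kap + 1) * (J * C1 + C3)) * (G\<^sup>2 * h ^ 3)" "0 <= (C2 + 4 * L) * (P4 + P)"
   using k1 P0 h by (auto intro!: mult_nonneg_nonneg)
  then show ?thesis using y by (simp add: C6_def algebra_simps)
 qed
 then show ?thesis using fin unfolding decomp[unfolded d_def] P_def P4_def d_def by linarith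
qed

end

section \<open>Stability of the implicit scheme\<close>

text \<open>On finitely many points an initial constant always exists, namely the sum of the
  quotients f / w. This is how sequences given only by an implicit recursion get their first Hoelder
  constant.\<close>

lemma halving_finite:
 fixes f w :: "'z => real"
 assumes "finite Z" and f: "!!z. z \<in> Z ==> 0 <= f z" and w: "!!z. z \<in> Z ==> 0 <= w z"
  and 0: "!!z. z \<in> Z ==> w z = 0 ==> f z = 0"
  and step: "!!Q z. 0 <= Q ==> (!!z. z \<in> Z ==> f z <= Q * w z) ==> z \<in> Z ==> f z <= (A + Q / 2) * w z"
  and "0 <= A" "z \<in> Z"
 shows "f z <= 2 * A * w z"
proof (rule halving[where Z = Z and Q = "\<Sum>z\<in>Z. f z / w z"])
 show "0 <= (\<Sum>z\<in>Z. f z / w z)" using f w by (intro sum_nonneg divide_nonneg_nonneg)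
 fix z assume z: "z \<in> Z"
 show "f z <= (\<Sum>z\<in>Z. f z / w z) * w z"
 proof (cases "w z = 0")
  case True
  then show ?thesis using 0 z by simp
 next
  case False
  have "f z / w z <= (\<Sum>z\<in>Z. f z / w z)" using f w z assms(1) by (intro member_le_sum) auto
  then have "f z / w z * w z <= (\<Sum>z\<in>Z. f z / w z) * w z" using w[OF z] by (intro mult_right_mono)
  then show ?thesis using False by simp
 qed
qed (use assms in auto)

text \<open>The trapezoidal germ involves both end values, so the recursion matches it exactly in
  one step and the local error in the sewing is 0. In its defect the products regroup into
  increments of \<open>bb\<close> times increments of \<open>D\<close>, of total order
  \<open>tht + be\<close> > 1. It serves both the error and the scheme itself.\<close>

lemma trap_sum_bound:
 fixes F :: "nat => 'a::real_normed_vector" and D :: "nat => nat => 'a" and bb :: "nat => nat => real"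
 assumes e: "0 < tht" "0 < be" "1 < tht + be" and nn: "0 <= h" "0 <= G" "0 <= M" "0 <= E"
  and F: "!!i. p <= i ==> i < q ==> F (Suc i) - F i = (1 / 2) *\<^sub>R (\<Sum>j\<le>m. (bb j (Suc i) - bb j i) *\<^sub>R (D j (Suc i) + D j i))"
  and b: "!!j k l. j <= m ==> p <= k ==> k <= l ==> l <= q ==> \<bar>bb j l - bb j k\<bar> <= G * (real (l - k) * h) powr be"
  and DH: "!!j k l. j <= m ==> p <= k ==> k <= l ==> l <= q ==> norm (D j l - D j k) <= M * (real (l - k) * h) powr tht"
  and DB: "!!j k. j <= m ==> p <= k ==> k <= q ==> norm (D j k) <= E"
  and kl: "p <= k" "k <= l" "l <= q"
 shows "norm (F l - F k) <= real (Suc m) * G * E * (real (l - k) * h) powr be + sewc (tht + be) * (real (Suc m) * G * M) * (real (l - k) * h) powr (tht + be)"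
proof -
 define X where "X k l = (1 / 2) *\<^sub>R (\<Sum>j\<le>m. (bb j l - bb j k) *\<^sub>R (D j l + D j k))" for k l
 have "norm (F l - F k - X k l) <= sewc (tht + be) * (real (Suc m) * G * M) * (real (l - k) * h) powr (tht + be) + real (l - k) * 0"
 proof (rule discrete_sewing_path[where p = p and q = q])
  fix k i l assume *: "p <= k" "k <= i" "i <= l" "l <= q"
  have pt: "(bb j l - bb j k) *\<^sub>R (D j l + D j k) - (bb j i - bb j k) *\<^sub>R (D j i + D j k) - (bb j l - bb j i) *\<^sub>R (D j l + D j i)
    = (bb j i - bb j k) *\<^sub>R (D j l - D j i) - (bb j l - bb j i) *\<^sub>R (D j i - D j k)" for j
   by (simp add: algebra_simps)
  have "X k l - X k i - X i l = (1 / 2) *\<^sub>R (\<Sum>j\<le>m. (bb j i - bb j k) *\<^sub>R (D j l - D j i) - (bb j l - bb j i) *\<^sub>R (D j i - D j k))"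
   unfolding X_def scaleR_right_diff_distrib[symmetric] sum_subtractf[symmetric]
   by (intro arg_cong[where f = "%x. (1 / 2) *\<^sub>R x"] sum.cong refl pt)
  moreover have "norm (\<Sum>j\<le>m. (bb j i - bb j k) *\<^sub>R (D j l - D j i) - (bb j l - bb j i) *\<^sub>R (D j i - D j k))
    <= (\<Sum>j\<le>m. 2 * (G * M * (real (l - k) * h) powr (tht + be)))"
  proof (rule sum_norm_le)
   fix j assume "j \<in> {..m}"
   then have j: "j <= m" by simp
   have mono: "(real (v - u) * h) powr \<alpha> <= (real (l - k) * h) powr \<alpha>" if "k <= u" "u <= v" "v <= l" "0 < \<alpha>" for u v \<alpha>
    using that nn by (intro powr_mono2 mult_right_mono) auto
   have t: "norm ((bb j v - bb j u) *\<^sub>R (D j v' - D j u')) <= (G * (real (l - k) * h) powr be) * (M * (real (l - k) * h) powr tht)"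
    if "k <= u" "u <= v" "v <= l" "k <= u'" "u' <= v'" "v' <= l" for u v u' v'
    using that * j nn e
    by (intro norm_scaleR_le order_trans[OF b] order_trans[OF DH] mult_left_mono mono) auto
   have "norm ((bb j i - bb j k) *\<^sub>R (D j l - D j i) - (bb j l - bb j i) *\<^sub>R (D j i - D j k))
     <= norm ((bb j i - bb j k) *\<^sub>R (D j l - D j i)) + norm ((bb j l - bb j i) *\<^sub>R (D j i - D j k))"
    by (rule norm_triangle_ineq4)
   also have "... <= (G * (real (l - k) * h) powr be) * (M * (real (l - k) * h) powr tht) + (G * (real (l - k) * h) powr be) * (M * (real (l - k) * h) powr tht)"
    using * by (intro add_mono t) auto
   also have "... = 2 * (G * M * (real (l - k) * h) powr (tht + be))" by (simp add: powr_add mult_ac)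
   finally show "norm ((bb j i - bb j k) *\<^sub>R (D j l - D j i) - (bb j l - bb j i) *\<^sub>R (D j i - D j k)) <= 2 * (G * M * (real (l - k) * h) powr (tht + be))" .
  qed
  ultimately show "norm (X k l - X k i - X i l) <= real (Suc m) * G * M * (real (l - k) * h) powr (tht + be)"
   by (simp add: mult_ac)
 next
  fix i assume "p <= i" "i < q"
  then show "norm (F (Suc i) - F i - X i (Suc i)) <= 0" using F by (simp add: X_def)
 qed (use assms in \<open>auto simp: X_def\<close>)
 moreover have "norm (X k l) <= real (Suc m) * G * E * (real (l - k) * h) powr be"
 proof -
  have "norm (\<Sum>j\<le>m. (bb j l - bb j k) *\<^sub>R (D j l + D j k)) <= (\<Sum>j\<le>m. (G * (real (l - k) * h) powr be) * (E + E))"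
   using kl by (intro sum_norm_le norm_scaleR_le b norm_triangle_mono DB) auto
  then show ?thesis by (simp add: X_def mult_ac)
 qed
 ultimately show ?thesis using norm_triangle_sub[of "F l - F k" "X k l"] by simp
qed

text \<open>A discrete Young integral, by sewing the germ \<open>(S l - S k) *\<^sub>R f k\<close>.
  It converts Hoelder bounds for sums of areas or cubes into bounds for the same sums weighted with
  coefficients along X.\<close>

lemma weighted_sum_hoelder:
 fixes f :: "nat => 'a::real_normed_vector" and S :: "nat => real"
 assumes e: "0 < tht" "0 < be" "1 < tht + be" and nn: "0 <= h" "0 <= Tht" "0 <= M"
  and S: "!!k l. p <= k ==> k <= l ==> l <= q ==> \<bar>S l - S k\<bar> <= Tht * (real (l - k) * h) powr tht"
  and fH: "!!k l. p <= k ==> k <= l ==> l <= q ==> norm (f l - f k) <= M * (real (l - k) * h) powr be"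
  and fB: "!!k. p <= k ==> k <= q ==> norm (f k) <= E"
  and kl: "p <= k" "k <= l" "l <= q"
 shows "norm (\<Sum>i=k..<l. (S (Suc i) - S i) *\<^sub>R f i) <= (E + sewc (tht + be) * M * (real (l - k) * h) powr be) * Tht * (real (l - k) * h) powr tht"
proof -
 define X where "X k l = (S l - S k) *\<^sub>R f k" for k l
 define F where "F l = (\<Sum>i<l. (S (Suc i) - S i) *\<^sub>R f i)" for l
 have "norm (F l - F k - X k l) <= sewc (tht + be) * (Tht * M) * (real (l - k) * h) powr (tht + be) + real (l - k) * 0"
 proof (rule discrete_sewing_path[where p = p and q = q])
  fix k i l assume *: "p <= k" "k <= i" "i <= l" "l <= q"
  have mono: "(real (v - u) * h) powr \<alpha> <= (real (l - k) * h) powr \<alpha>" if "k <= u" "u <= v" "v <= l" "0 < \<alpha>" for u v \<alpha>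
   using that nn by (intro powr_mono2 mult_right_mono) auto
  have "X k l - X k i - X i l = - ((S l - S i) *\<^sub>R (f i - f k))" by (simp add: X_def algebra_simps)
  then have "norm (X k l - X k i - X i l) = norm ((S l - S i) *\<^sub>R (f i - f k))" by (simp only: norm_minus_cancel)
  also have "... <= (Tht * (real (l - k) * h) powr tht) * (M * (real (l - k) * h) powr be)"
   using * e nn by (intro norm_scaleR_le order_trans[OF S] order_trans[OF fH] mult_left_mono mono) auto
  also have "... = Tht * M * (real (l - k) * h) powr (tht + be)" unfolding powr_add by (simp only: mult_ac)
  finally show "norm (X k l - X k i - X i l) <= Tht * M * (real (l - k) * h) powr (tht + be)" .
 qed (use assms in \<open>auto simp: X_def F_def\<close>)
 moreover have "norm (X k l) <= (Tht * (real (l - k) * h) powr tht) * E"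
  unfolding X_def using kl by (intro norm_scaleR_le S fB) auto
 moreover have "F l - F k = (\<Sum>i=k..<l. (S (Suc i) - S i) *\<^sub>R f i)"
  unfolding F_def using kl by (simp add: sum_diff_nat_ivl lessThan_atLeast0)
 ultimately show ?thesis using norm_triangle_sub[of "F l - F k" "X k l"] by (simp add: powr_add algebra_simps)
qed

text \<open>\<open>c\<close> will bound \<open>G * d powr be\<close> for the block length d. The
  three summands in \<open>c_small\<close> are the ways in which the error acts back on itself in
  \<open>stability_block\<close>.\<close>

locale small_const =
 fixes be tht L C1 c :: real and m :: nat
 assumes exps: "0 < tht" "tht < be" "be < 1" "1 < tht + be" and L: "1 <= L" and C1: "1 <= C1" and c: "0 < c" "c <= 1"
  and c_small: "real (Suc m) * L * c * (1 + sewc (tht + be) + 2 * sewc (tht + be) * C1) <= 1 / 2"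
begin

abbreviation "J \<equiv> real (Suc m)"
abbreviation "\<kappa> \<equiv> sewc (tht + be)"

lemma kappa: "1 <= \<kappa>" using sewc_ge1(1)[OF exps(4)] .

lemma c_small': "J * L * c + \<kappa> * J * L * c + 2 * \<kappa> * J * L * C1 * (c * c) <= 1 / 2"
proof -
 have "c * c <= c" using c by (simp add: mult_left_le)
 then have "2 * \<kappa> * J * L * C1 * (c * c) <= 2 * \<kappa> * J * L * C1 * c"
  using kappa L C1 by (intro mult_left_mono) (auto intro!: mult_nonneg_nonneg)
 then show ?thesis using c_small by (simp add: algebra_simps)
qed

text \<open>In place of Gronwall, a bootstrap for the tht-Hoelder constant of e on the block; the
  order tht is all that the forcing R allows. The smallness of \<open>c\<close> makes the feedback
  at most Q / 2, and also keeps the change caused by the initial error below that error, whence the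
  factor 2.\<close>

lemma stability_block:
 fixes e x y R :: "nat => 'a::real_normed_vector" and D :: "nat => nat => 'a" and bb :: "nat => nat => real"
 assumes h: "0 < h" and G: "1 <= G" and d: "0 < d" "G * d powr be <= c" and Th: "0 <= Tht"
  and pq: "p <= q" "real (q - p) * h <= d"
  and DH: "!!j k l. j <= m ==> p <= k ==> k <= l ==> l <= q ==>
    norm (D j l - D j k) <= L * norm (e l - e k) + L * norm (e k) * (norm (x l - x k) + norm (y l - y k))"
  and DB: "!!j k. j <= m ==> p <= k ==> k <= q ==> norm (D j k) <= L * norm (e k)"
  and rec: "!!i. p <= i ==> i < q ==> e (Suc i) - e i = (1 / 2) *\<^sub>R (\<Sum>j\<le>m. (bb j (Suc i) - bb j i) *\<^sub>R (D j (Suc i) + D j i)) + (R (Suc i) - R i)"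
  and b: "!!j k l. j <= m ==> p <= k ==> k <= l ==> l <= q ==> \<bar>bb j l - bb j k\<bar> <= G * (real (l - k) * h) powr be"
  and xy: "!!k l. p <= k ==> k <= l ==> l <= q ==> norm (x l - x k) <= C1 * G * (real (l - k) * h) powr be"
   "!!k l. p <= k ==> k <= l ==> l <= q ==> norm (y l - y k) <= C1 * G * (real (l - k) * h) powr be"
  and RH: "!!k l. p <= k ==> k <= l ==> l <= q ==> norm (R l - R k) <= Tht * (real (l - k) * h) powr tht"
  and k: "p <= k" "k <= q"
 shows "norm (e k) <= 2 * norm (e p) + 2 * Tht * d powr tht"
proof -
 \<comment> \<open>On the block the be-Hoelder constant \<open>G\<close> yields the tht-Hoelder
   constant \<open>\<rho>\<close>: the surplus be - tht of the exponent is traded for the block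
   length.\<close>
 define \<rho> where "\<rho> = G * d powr (be - tht)"
 have rho0: "0 <= \<rho>" using G by (simp add: \<rho>_def)
 have rho: "\<rho> * d powr tht <= c" using d by (simp add: \<rho>_def powr_add[symmetric] mult.assoc)
 define E where "E = norm (e p)"
 \<comment> \<open>The part of the improved constant that does not contain Q: the effect of the
   initial error \<open>E\<close> and of the forcing.\<close>
 define A where "A = J * L * \<rho> * E * (1 + 2 * \<kappa> * C1 * c) + Tht"
 define Z where "Z = {(k, l). p <= k \<and> k <= l \<and> l <= q}"
 define f where "f = (%(k, l). norm (e l - e k))"
 define w where "w = (%(k, l). (real (l - k) * h) powr tht)"
 have Zfin: "finite Z"
 proof (rule finite_subset)
  show "Z \<subseteq> {..q} \<times> {..q}" by (auto simp: Z_def)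
 qed simp
 have wd: "real (l - k) * h <= d" if "p <= k" "k <= l" "l <= q" for k l
 proof -
  have "real (l - k) * h <= real (q - p) * h" using that h by (intro mult_right_mono) auto
  then show ?thesis using pq by simp
 qed
 have A0: "0 <= A" unfolding A_def E_def using L rho0 kappa C1 c Th by (intro add_nonneg_nonneg mult_nonneg_nonneg) auto
 have key: "f (k, l) <= 2 * A * w (k, l)" if "(k, l) \<in> Z" for k l
 proof (rule halving_finite[OF Zfin])
  fix z assume "z \<in> Z" "w z = 0"
  then show "f z = 0" using h by (auto simp: Z_def w_def f_def split: prod.splits)
 next
  fix Q z assume Q: "0 <= Q" "!!z. z \<in> Z ==> f z <= Q * w z" and z: "z \<in> Z"
  obtain k l where kl: "z = (k, l)" "p <= k" "k <= l" "l <= q" using z by (auto simp: Z_def)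
  have eH: "norm (e l - e k) <= Q * (real (l - k) * h) powr tht" if "p <= k" "k <= l" "l <= q" for k l
   using Q(2)[of "(k, l)"] that by (simp add: Z_def f_def w_def)
  define E' where "E' = E + Q * d powr tht"
  have E'0: "0 <= E'" using Q by (simp add: E'_def E_def)
  have eB: "norm (e k) <= E'" if "p <= k" "k <= q" for k
  proof -
   have "norm (e k - e p) <= Q * (real (k - p) * h) powr tht" using eH[of p k] that by simp
   also have "... <= Q * d powr tht" using Q wd[of p k] that h exps by (intro mult_left_mono powr_mono2) auto
   finally show ?thesis using norm_triangle_sub[of "e k" "e p"] by (simp add: E'_def E_def)
  qed
  define M where "M = L * Q + 2 * L * E' * C1 * \<rho>"
  have M0: "0 <= M" unfolding M_def using L Q E'0 C1 rho0 by (intro add_nonneg_nonneg mult_nonneg_nonneg) auto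
  have up: "G * (real (l - k) * h) powr be <= \<rho> * (real (l - k) * h) powr tht" if "p <= k" "k <= l" "l <= q" for k l
  proof -
   have "(real (l - k) * h) powr be = (real (l - k) * h) powr (be - tht) * (real (l - k) * h) powr tht"
    by (simp add: powr_add[symmetric])
   also have "... <= d powr (be - tht) * (real (l - k) * h) powr tht"
    using wd[OF that] h exps by (intro mult_right_mono powr_mono2) auto
   finally have "G * (real (l - k) * h) powr be <= G * (d powr (be - tht) * (real (l - k) * h) powr tht)"
    using G by (intro mult_left_mono) auto
   then show ?thesis by (simp add: \<rho>_def mult_ac)
  qed
  have DH': "norm (D j l - D j k) <= M * (real (l - k) * h) powr tht" if "j <= m" "p <= k" "k <= l" "l <= q" for j k l
  proof -
   let ?u = "(real (l - k) * h) powr tht"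
   have xr: "norm (x l - x k) + norm (y l - y k) <= 2 * (C1 * (\<rho> * ?u))"
   proof -
    have "C1 * G * (real (l - k) * h) powr be <= C1 * (\<rho> * ?u)"
     using up[OF that(2-)] C1 by (simp add: mult_left_mono mult.assoc)
    then show ?thesis using xy(1)[OF that(2-)] xy(2)[OF that(2-)] by simp
   qed
   have "norm (D j l - D j k) <= L * (Q * ?u) + L * E' * (2 * (C1 * (\<rho> * ?u)))"
    using that L E'0 by (intro order_trans[OF DH] add_mono mult_left_mono mult_mono eH eB xr) auto
   then show ?thesis by (simp add: M_def algebra_simps)
  qed
  have "norm ((%k. e k - R k) l - (%k. e k - R k) k) <= J * G * (L * E') * (real (l - k) * h) powr be + \<kappa> * (J * G * M) * (real (l - k) * h) powr (tht + be)"
  proof (rule trap_sum_bound[where p = p and q = q and D = D and bb = bb])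
   fix j k assume "j <= m" "p <= k" "k <= q"
   then show "norm (D j k) <= L * E'" using L by (intro order_trans[OF DB] mult_left_mono eB) auto
  qed (use exps h G M0 L E'0 b DH' kl rec in \<open>auto simp: algebra_simps\<close>)
  moreover have "norm (e l - e k) <= norm ((%k. e k - R k) l - (%k. e k - R k) k) + norm (R l - R k)"
   using norm_triangle_ineq[of "(e l - R l) - (e k - R k)" "R l - R k"] by simp
  moreover have "norm (R l - R k) <= Tht * (real (l - k) * h) powr tht" using RH kl by simp
  moreover have "J * G * (L * E') * (real (l - k) * h) powr be <= J * L * E' * \<rho> * (real (l - k) * h) powr tht"
   using mult_left_mono[OF up[OF kl(2-)], of "J * L * E'"] L E'0 by (simp add: mult_ac)
  moreover have "\<kappa> * (J * G * M) * (real (l - k) * h) powr (tht + be) <= \<kappa> * J * M * c * (real (l - k) * h) powr tht"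
  proof -
   have "G * (real (l - k) * h) powr be <= G * d powr be"
    using wd[OF kl(2-)] h G exps by (intro mult_left_mono powr_mono2) auto
   then have "G * (real (l - k) * h) powr be <= c" using d by simp
   then have "(\<kappa> * J * M * (real (l - k) * h) powr tht) * (G * (real (l - k) * h) powr be) <= (\<kappa> * J * M * (real (l - k) * h) powr tht) * c"
    using kappa M0 by (intro mult_left_mono mult_nonneg_nonneg) auto
   then show ?thesis unfolding powr_add by (simp only: mult_ac)
  qed
  ultimately have "norm (e l - e k) <= (J * L * E' * \<rho> + \<kappa> * J * M * c + Tht) * (real (l - k) * h) powr tht"
   by (simp add: algebra_simps)
  also have "... <= (A + Q / 2) * (real (l - k) * h) powr tht"
  proof (intro mult_right_mono)
   have r1: "E' * \<rho> <= E * \<rho> + Q * c"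
    using mult_left_mono[OF rho, of Q] Q by (simp add: E'_def algebra_simps)
   have "J * L * E' * \<rho> + \<kappa> * J * M * c = J * L * (E' * \<rho>) + \<kappa> * J * L * c * Q + 2 * \<kappa> * J * L * C1 * c * (E' * \<rho>)"
    by (simp add: M_def algebra_simps)
   also have "... <= J * L * (E * \<rho> + Q * c) + \<kappa> * J * L * c * Q + 2 * \<kappa> * J * L * C1 * c * (E * \<rho> + Q * c)"
    using r1 L kappa C1 c by (intro add_mono mult_left_mono order_refl mult_nonneg_nonneg) auto
   also have "... = A - Tht + Q * (J * L * c + \<kappa> * J * L * c + 2 * \<kappa> * J * L * C1 * (c * c))"
    by (simp add: A_def algebra_simps)
   also have "... <= A - Tht + Q * (1 / 2)" using c_small' Q by (intro add_mono mult_left_mono) auto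
   finally show "J * L * E' * \<rho> + \<kappa> * J * M * c + Tht <= A + Q / 2" by simp
  qed simp
  finally show "f z <= (A + Q / 2) * w z" by (simp add: kl f_def w_def)
 qed (use A0 that in \<open>auto simp: f_def w_def\<close>)
 have "norm (e k - e p) <= 2 * A * (real (k - p) * h) powr tht"
  using key[of p k] k by (simp add: Z_def f_def w_def)
 also have "... <= 2 * A * d powr tht" using A0 wd[of p k] k h exps by (intro mult_left_mono powr_mono2) auto
 also have "... = 2 * (J * L * (\<rho> * d powr tht) * (1 + 2 * \<kappa> * C1 * c)) * E + 2 * Tht * d powr tht"
  by (simp add: A_def algebra_simps)
 also have "2 * (J * L * (\<rho> * d powr tht) * (1 + 2 * \<kappa> * C1 * c)) * E <= 1 * E"
 proof (intro mult_right_mono)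
  have "J * L * (\<rho> * d powr tht) * (1 + 2 * \<kappa> * C1 * c) <= J * L * c * (1 + 2 * \<kappa> * C1 * c)"
   using rho L kappa C1 c by (intro mult_right_mono mult_left_mono add_nonneg_nonneg mult_nonneg_nonneg) auto
  also have "... = J * L * c + 2 * \<kappa> * J * L * C1 * (c * c)" by (simp add: algebra_simps)
  also have "... <= 1 / 2"
  proof -
   have "0 <= \<kappa> * J * L * c" using kappa L c by (intro mult_nonneg_nonneg) auto
   then show ?thesis using c_small' by linarith
  qed
  finally show "2 * (J * L * (\<rho> * d powr tht) * (1 + 2 * \<kappa> * C1 * c)) <= 1" by simp
 qed (simp add: E_def)
 finally have "norm (e k - e p) <= E + 2 * Tht * d powr tht" by simp
 then show ?thesis using norm_triangle_sub[of "e k" "e p"] by (simp add: E_def)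
qed

text \<open>The blocks are iterated. Each has N = floor (d / h) steps, which is at least d / (2 * h)
  because h <= d. The bound x -> 2 * x + a, started at 0, gives (2 ^ i - 1) * a after i
  blocks.\<close>

lemma stability:
 fixes e x y R :: "nat => 'a::real_normed_vector" and D :: "nat => nat => 'a" and bb :: "nat => nat => real"
 assumes h: "0 < h" and G: "1 <= G" and d: "0 < d" "G * d powr be <= c" "h <= d" and Th: "0 <= Tht"
  and DH: "!!j k l. j <= m ==> k <= l ==> l <= n ==>
    norm (D j l - D j k) <= L * norm (e l - e k) + L * norm (e k) * (norm (x l - x k) + norm (y l - y k))"
  and DB: "!!j k. j <= m ==> k <= n ==> norm (D j k) <= L * norm (e k)"
  and rec: "!!i. i < n ==> e (Suc i) - e i = (1 / 2) *\<^sub>R (\<Sum>j\<le>m. (bb j (Suc i) - bb j i) *\<^sub>R (D j (Suc i) + D j i)) + (R (Suc i) - R i)"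
  and b: "!!j k l. j <= m ==> k <= l ==> l <= n ==> \<bar>bb j l - bb j k\<bar> <= G * (real (l - k) * h) powr be"
  and xy: "!!k l. k <= l ==> l <= n ==> real (l - k) * h <= d ==> norm (x l - x k) <= C1 * G * (real (l - k) * h) powr be"
   "!!k l. k <= l ==> l <= n ==> real (l - k) * h <= d ==> norm (y l - y k) <= C1 * G * (real (l - k) * h) powr be"
  and RH: "!!k l. k <= l ==> l <= n ==> real (l - k) * h <= d ==> norm (R l - R k) <= Tht * (real (l - k) * h) powr tht"
  and e0: "e 0 = 0" and k: "k <= n"
 shows "norm (e k) <= 2 powr (2 * (real n * h) / d + 1) * (2 * Tht * d powr tht)"
proof -
 define N where "N = nat \<lfloor>d / h\<rfloor>"
 have dh: "1 <= d / h" using d h by simp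
 have N: "real N <= d / h" "d / h < real N + 1" "1 <= N" using dh by (auto simp: N_def le_nat_floor)
 have N2: "d / h <= 2 * real N" using N by linarith
 have block: "norm (e k) <= (2 ^ i - 1) * (2 * Tht * d powr tht)" if "k <= i * N" "k <= n" for i k
  using that
 proof (induction i arbitrary: k)
  case 0
  then show ?case using e0 by simp
 next
  case (Suc i)
  show ?case
  proof (cases "k <= i * N")
   case True
   have "norm (e k) <= (2 ^ i - 1) * (2 * Tht * d powr tht)" using Suc True by simp
   also have "... <= (2 ^ Suc i - 1) * (2 * Tht * d powr tht)"
    using Th by (intro mult_right_mono) auto
   finally show ?thesis .
  next
   case False
   have kN: "real (k - i * N) * h <= d"
   proof -
    have "real (k - i * N) <= real N" using Suc.prems by simp
    then have "real (k - i * N) <= d / h" using N by linarith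
    then show ?thesis using h by (simp add: field_simps)
   qed
   have sub: "real (l' - k') * h <= d" if "i * N <= k'" "k' <= l'" "l' <= k" for k' l'
   proof -
    have "l' - k' <= k - i * N" using that by linarith
    then have "real (l' - k') * h <= real (k - i * N) * h" using h by (intro mult_right_mono) (simp_all only: of_nat_le_iff less_imp_le)
    then show ?thesis using kN by simp
   qed
   have "norm (e k) <= 2 * norm (e (i * N)) + 2 * Tht * d powr tht"
   proof (rule stability_block[where p = "i * N" and q = k and D = D and x = x and y = y and R = R and bb = bb])
    show "real (k - i * N) * h <= d" by (rule kN)
   qed (use False Suc.prems h G d Th DH DB rec b xy RH sub in auto)
   also have "... <= 2 * ((2 ^ i - 1) * (2 * Tht * d powr tht)) + 2 * Tht * d powr tht"
    using Suc.IH[of "i * N"] False Suc.prems Th by (intro add_mono mult_left_mono) auto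
   also have "... = (2 ^ Suc i - 1) * (2 * Tht * d powr tht)" by (simp add: algebra_simps)
   finally show ?thesis .
  qed
 qed
 define i where "i = nat \<lceil>real n / real N\<rceil>"
 have i: "real n / real N <= real i" "real i <= real n / real N + 1" 
 proof -
  show "real n / real N <= real i" unfolding i_def by (rule real_nat_ceiling_ge)
  have "0 <= real n / real N" by simp
  then show "real i <= real n / real N + 1" unfolding i_def by linarith
 qed
 have "real k <= real i * real N" using i N k by (simp add: field_simps)
 then have "k <= i * N" by (metis of_nat_le_iff of_nat_mult)
 then have "norm (e k) <= (2 ^ i - 1) * (2 * Tht * d powr tht)" using block k by simp
 also have "... <= 2 powr (2 * (real n * h) / d + 1) * (2 * Tht * d powr tht)"
 proof (intro mult_right_mono)
  have "real n / real N <= 2 * (real n * h) / d"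
  proof -
   have "real n * d <= real n * (2 * real N * h)" using N2 h by (intro mult_left_mono) (auto simp: field_simps)
   then show ?thesis using N d h by (simp add: field_simps)
  qed
  then have "2 powr real i <= (2::real) powr (2 * (real n * h) / d + 1)" using i by (intro powr_mono) auto
  then show "2 ^ i - 1 <= (2::real) powr (2 * (real n * h) / d + 1)" by (simp add: powr_realpow)
 qed (use Th in auto)
 finally show ?thesis .
qed

end

text \<open>The same bootstrap as for X, with the trapezoidal germ. The threshold is the
  \<open>c0\<close> and the constant the \<open>C1 * G\<close> of \<open>young_path\<close>, so that
  X and the scheme can be treated alike.\<close>

lemma scheme_hoelder:
 fixes y :: "nat => 'a::real_normed_vector" and bb :: "nat => nat => real"
 assumes be: "1 / 2 < be" and h: "0 < h" and G: "1 <= G" and L: "1 <= L"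
  and V: "!!j. j <= m ==> lipb L (V j)"
  and rec: "!!i. i < n ==> y (Suc i) - y i = (1 / 2) *\<^sub>R (\<Sum>j\<le>m. (bb j (Suc i) - bb j i) *\<^sub>R (V j (y (Suc i)) + V j (y i)))"
  and b: "!!j k l. j <= m ==> k <= l ==> l <= n ==> \<bar>bb j l - bb j k\<bar> <= G * (real (l - k) * h) powr be"
  and kl: "k <= l" "l <= n" "G * (real (l - k) * h) powr be <= 1 / (2 * sewc (2 * be) * real (Suc m) * L)"
 shows "norm (y l - y k) <= 2 * real (Suc m) * L * G * (real (l - k) * h) powr be"
proof -
 let ?J = "real (Suc m)"
 define Z where "Z = {(p, q). k <= p \<and> p <= q \<and> q <= l}"
 define f where "f = (%(k, l). norm (y l - y k))"
 define w where "w = (%(k, l). (real (l - k) * h) powr be)"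
 have kap: "1 <= sewc (2 * be)" using sewc_ge1(1)[of "2 * be"] be by simp
 have Zfin: "finite Z"
 proof (rule finite_subset)
  show "Z \<subseteq> {..l} \<times> {..l}" by (auto simp: Z_def)
 qed simp
 have "f (k, l) <= 2 * (?J * L * G) * w (k, l)"
 proof (rule halving_finite[OF Zfin])
  fix z assume "z \<in> Z" "w z = 0"
  then show "f z = 0" using h by (auto simp: Z_def w_def f_def split: prod.splits)
 next
  fix Q z assume Q: "0 <= Q" "!!z. z \<in> Z ==> f z <= Q * w z" and z: "z \<in> Z"
  obtain p q where pq: "z = (p, q)" "k <= p" "p <= q" "q <= l" using z by (auto simp: Z_def)
  have yH: "norm (y q - y p) <= Q * (real (q - p) * h) powr be" if "k <= p" "p <= q" "q <= l" for p q
   using Q(2)[of "(p, q)"] that by (simp add: Z_def f_def w_def)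
  have "norm (y q - y p) <= ?J * G * L * (real (q - p) * h) powr be + sewc (be + be) * (?J * G * (L * Q)) * (real (q - p) * h) powr (be + be)"
  proof (rule trap_sum_bound[where p = k and q = l and D = "%j i. V j (y i)" and bb = bb])
   fix j p q assume *: "j <= m" "k <= p" "p <= q" "q <= l"
   have "norm (V j (y q) - V j (y p)) <= L * norm (y q - y p)" using V[OF *(1)] by (simp add: lipb_def)
   also have "... <= L * (Q * (real (q - p) * h) powr be)" using * L by (intro mult_left_mono yH) auto
   finally show "norm (V j (y q) - V j (y p)) <= L * Q * (real (q - p) * h) powr be" by (simp add: mult_ac)
  qed (use assms pq Q in \<open>auto simp: lipb_def\<close>)
  also have "sewc (be + be) * (?J * G * (L * Q)) * (real (q - p) * h) powr (be + be)
    = (sewc (2 * be) * ?J * L * Q) * (G * (real (q - p) * h) powr be) * (real (q - p) * h) powr be"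
   unfolding powr_add mult_2 by (simp only: mult_ac)
  also have "... <= (sewc (2 * be) * ?J * L * Q) * (1 / (2 * sewc (2 * be) * ?J * L)) * (real (q - p) * h) powr be"
  proof (intro mult_right_mono mult_left_mono)
   have "G * (real (q - p) * h) powr be <= G * (real (l - k) * h) powr be"
    using pq G h be by (intro mult_left_mono powr_mono2 mult_right_mono) auto
   then show "G * (real (q - p) * h) powr be <= 1 / (2 * sewc (2 * be) * ?J * L)" using kl by simp
  qed (use kap L Q in \<open>auto intro!: mult_nonneg_nonneg\<close>)
  also have "(sewc (2 * be) * ?J * L * Q) * (1 / (2 * sewc (2 * be) * ?J * L)) = Q / 2"
  proof -
   have "sewc (2 * be) * ?J * L ~= 0" using kap L by simp
   then show ?thesis by (simp add: field_simps)
  qed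
  finally show "f z <= (?J * L * G + Q / 2) * w z" by (simp add: pq f_def w_def algebra_simps)
 qed (use L G kl in \<open>auto simp: Z_def f_def w_def intro!: mult_nonneg_nonneg\<close>)
 then show ?thesis by (simp add: f_def w_def mult_ac)
qed

section \<open>Gaussian moments and integration by parts\<close>

definition mom :: "'w measure => ('w => real) => bool" where
 "mom M f \<longleftrightarrow> f \<in> borel_measurable M \<and> (\<forall>k::nat. integrable M (%om. f om ^ k))"

lemma mom_measurable: "mom M f ==> f \<in> borel_measurable M"
 and mom_integrable: "mom M f ==> integrable M f"
 and mom_integrable_power: "mom M f ==> integrable M (%om. f om ^ k)"
 unfolding mom_def by (auto dest: spec[of _ 1])

lemma mom_const: "prob_space M ==> mom M (%_. c)"
 by (auto simp: mom_def prob_space.finite_measure finite_measure.integrable_const)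

lemma mom_power: "mom M f ==> mom M (%om. f om ^ n)"
 by (auto simp: mom_def power_mult[symmetric])

lemma mom_mult:
 assumes "mom M f" "mom M g"
 shows "mom M (%om. f om * g om)"
proof -
 note [measurable] = mom_measurable[OF assms(1)] mom_measurable[OF assms(2)]
 have "integrable M (%om. (f om * g om) ^ k)" for k
 proof (rule Bochner_Integration.integrable_bound)
  show "integrable M (%om. f om ^ (2 * k) + g om ^ (2 * k))"
   using assms by (auto simp: mom_def)
  have "\<bar>(a * b) ^ k\<bar> <= \<bar>a ^ (2 * k) + b ^ (2 * k)\<bar>" for a b :: real
  proof -
   have "0 <= (\<bar>a ^ k\<bar> - \<bar>b ^ k\<bar>)\<^sup>2" by simp
   then have "2 * (\<bar>a ^ k\<bar> * \<bar>b ^ k\<bar>) <= (a ^ k)\<^sup>2 + (b ^ k)\<^sup>2"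
    by (simp add: power2_eq_square algebra_simps abs_mult_self_eq)
   moreover have "0 <= \<bar>a ^ k\<bar> * \<bar>b ^ k\<bar>" by simp
   ultimately have "\<bar>a ^ k\<bar> * \<bar>b ^ k\<bar> <= (a ^ k)\<^sup>2 + (b ^ k)\<^sup>2" by linarith
   then show ?thesis by (simp add: power_mult_distrib abs_mult power_mult[symmetric] mult.commute)
  qed
  then show "AE om in M. norm ((f om * g om) ^ k) <= norm (f om ^ (2 * k) + g om ^ (2 * k))"
   by simp
 qed measurable
 then show ?thesis by (simp add: mom_def)
qed

lemma abs_add_power_le: "\<bar>(a + b) ^ k\<bar> <= 2 ^ k * (\<bar>a\<bar> ^ k + \<bar>b\<bar> ^ k)" for a b :: real
proof -
 have "\<bar>a + b\<bar> ^ k <= (2 * max \<bar>a\<bar> \<bar>b\<bar>) ^ k" by (intro power_mono) auto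
 also have "... <= 2 ^ k * (\<bar>a\<bar> ^ k + \<bar>b\<bar> ^ k)" by (auto simp: power_mult_distrib max_def)
 finally show ?thesis by (simp add: power_abs)
qed

lemma mom_add:
 assumes "mom M f" "mom M g"
 shows "mom M (%om. f om + g om)"
proof -
 note [measurable] = mom_measurable[OF assms(1)] mom_measurable[OF assms(2)]
 have "integrable M (%om. (f om + g om) ^ k)" for k
 proof (rule Bochner_Integration.integrable_bound)
  have "integrable M (%om. \<bar>f om ^ k\<bar>)" "integrable M (%om. \<bar>g om ^ k\<bar>)"
   using assms by (auto simp: mom_def)
  then show "integrable M (%om. 2 ^ k * (\<bar>f om\<bar> ^ k + \<bar>g om\<bar> ^ k))" by (auto simp: power_abs)
  show "AE om in M. norm ((f om + g om) ^ k) <= norm (2 ^ k * (\<bar>f om\<bar> ^ k + \<bar>g om\<bar> ^ k))"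
   using abs_add_power_le by (auto intro!: AE_I2 order_trans[OF abs_add_power_le])
 qed measurable
 then show ?thesis by (simp add: mom_def)
qed

lemma mom_cmult: "prob_space M ==> mom M f ==> mom M (%om. c * f om)"
 using mom_mult[OF mom_const] by blast

lemma mom_sum:
 "prob_space M ==> finite F ==> (!!i. i \<in> F ==> mom M (f i)) ==> mom M (%om. \<Sum>i\<in>F. f i om)"
proof -
 assume "prob_space M" "finite F" "!!i. i \<in> F ==> mom M (f i)"
 from this(2,3) show ?thesis
  by (induction F rule: finite_induct) (auto intro: mom_add mom_const[OF \<open>prob_space M\<close>])
qed

lemma mom_prod:
 "prob_space M ==> finite F ==> (!!i. i \<in> F ==> mom M (f i)) ==> mom M (%om. \<Prod>i\<in>F. f i om)"
proof -
 assume "prob_space M" "finite F" "!!i. i \<in> F ==> mom M (f i)"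
 from this(2,3) show ?thesis
  by (induction F rule: finite_induct) (auto intro: mom_mult mom_const[OF \<open>prob_space M\<close>])
qed

text \<open>The double factorial (2 * r - 1)!!, the even moments of a standard normal
  variable.\<close>

definition gmom :: "nat => real" where "gmom r = fact (2 * r) / (2 ^ r * fact r)"

lemma gmom_Suc: "gmom (Suc r) = (2 * real r + 1) * gmom r"
proof -
 have "fact (2 * Suc r) = (2 * real r + 2) * (2 * real r + 1) * (fact (2 * r) :: real)"
  by (simp add: algebra_simps)
 moreover have "(2::real) ^ Suc r * fact (Suc r) = (2 * real r + 2) * (2 ^ r * fact r)" by (simp add: algebra_simps)
 ultimately show ?thesis by (simp add: gmom_def del: fact_Suc power_Suc mult_Suc_right)
qed

lemma gmom_0 [simp]: "gmom 0 = 1" by (simp add: gmom_def)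

lemma gmom_pos: "0 < gmom r" by (simp add: gmom_def)

text \<open>Centered Gaussian, encoded by its moments alone. This covers the constant 0, hence
  degenerate linear combinations of increments, and it is all that integration by parts for
  polynomials relies on.\<close>

definition cgauss :: "'w measure => ('w => real) => bool" where
 "cgauss M Z \<longleftrightarrow> mom M Z \<and> (\<forall>r. integral\<^sup>L M (%om. Z om ^ (2 * r)) = gmom r * (integral\<^sup>L M (%om. (Z om)\<^sup>2)) ^ r)
   \<and> (\<forall>r. integral\<^sup>L M (%om. Z om ^ (2 * r + 1)) = 0)"

lemma cgauss_cong_AE:
 assumes "cgauss M Z" "AE om in M. Z om = Z' om" "Z' \<in> borel_measurable M"
 shows "cgauss M Z'"
proof -
 have [measurable]: "Z \<in> borel_measurable M" "Z' \<in> borel_measurable M" using assms by (auto simp: cgauss_def mom_def)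
 have "integrable M (%om. Z' om ^ k) \<longleftrightarrow> integrable M (%om. Z om ^ k)" for k
  by (rule integrable_cong_AE) (use assms(2) in auto)
 moreover have "integral\<^sup>L M (%om. Z' om ^ k) = integral\<^sup>L M (%om. Z om ^ k)" for k
  by (rule integral_cong_AE) (use assms(2) in auto)
 ultimately show ?thesis using assms by (simp add: cgauss_def mom_def del: power_Suc)
qed

lemma normal_cgauss:
 assumes "prob_space M" "0 < \<sigma>" "distributed M lborel Z (normal_density 0 \<sigma>)"
 shows "cgauss M Z"
proof -
 have meas: "Z \<in> borel_measurable M" using assms(3) by (auto dest: distributed_measurable)
 have int: "integrable M (%om. Z om ^ k)" for k
  using distributed_integrable[OF assms(3), of "%x. x ^ k"] integrable_normal_moment[OF assms(2), of 0 k] by simp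
 have ev: "integral\<^sup>L M (%om. Z om ^ (2 * r)) = fact (2 * r) / ((2 / \<sigma>\<^sup>2) ^ r * fact r)" for r
  using distributed_integral[OF assms(3), of "%x. x ^ (2 * r)"] integral_normal_moment_even[OF assms(2), of 0 r] by simp
 have od: "integral\<^sup>L M (%om. Z om ^ (2 * r + 1)) = 0" for r
  using distributed_integral[OF assms(3), of "%x. x ^ (2 * r + 1)"] integral_normal_moment_odd[OF assms(2), of 0 r] by simp
 have v: "integral\<^sup>L M (%om. (Z om)\<^sup>2) = \<sigma>\<^sup>2" using ev[of 1] assms(2) by simp
 have "integral\<^sup>L M (%om. Z om ^ (2 * r)) = gmom r * (\<sigma>\<^sup>2) ^ r" for r
  unfolding ev gmom_def using assms(2) by (simp add: power_divide field_simps)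
 then show ?thesis using int od meas v by (simp add: cgauss_def mom_def)
qed

lemma const_cgauss_zero:
 assumes "prob_space M" shows "cgauss M (%_. 0)"
proof -
 have "(0::real) = gmom r * 0 ^ r" if "0 < r" for r using that by simp
 moreover have "gmom r * 0 ^ r = 0 ^ (2 * r)" for r by (cases r) (simp_all add: gmom_def)
 ultimately show ?thesis using mom_const[OF assms, of 0] prob_space.prob_space[OF assms]
  by (auto simp: cgauss_def)
qed

lemma gaussian_rv_cgauss:
 assumes "prob_space M" "gaussian_rv M Z" "integral\<^sup>L M Z = 0"
 shows "cgauss M Z"
proof -
 interpret prob_space M by fact
 consider \<mu> \<sigma> where "0 < \<sigma>" "distributed M lborel Z (normal_density \<mu> \<sigma>)" | c where "AE om in M. Z om = c"
  using assms(2) unfolding gaussian_rv_def by auto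
 then show ?thesis
 proof cases
  case 1
  have "\<mu> = 0" using normal_distributed_expectation[OF 1] assms(3) by simp
  then show ?thesis using normal_cgauss[OF assms(1) 1(1)] 1(2) by simp
 next
  case 2
  have m: "Z \<in> borel_measurable M" using assms(2) by (simp add: gaussian_rv_def)
  have "integral\<^sup>L M Z = integral\<^sup>L M (%_. c)" by (rule integral_cong_AE) (use 2 m in auto)
  then have "c = 0" using assms(3) prob_space by simp
  then show ?thesis
   using cgauss_cong_AE[OF const_cgauss_zero[OF assms(1)], of Z] 2 m by auto
 qed
qed

lemma prod_fps_nth_card:
 fixes f :: "'j => 'a::comm_ring_1 fps"
 assumes "finite J" "!!j. j \<in> J ==> fps_nth (f j) 0 = 0"
 shows "(\<Prod>j\<in>J. f j) = fps_X ^ card J * (\<Prod>j\<in>J. fps_shift 1 (f j))"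
proof -
 have "(\<Prod>j\<in>J. f j) = (\<Prod>j\<in>J. fps_X * fps_shift 1 (f j))"
  by (intro prod.cong refl fps_ext) (use assms in \<open>simp add: fps_X_mult_nth\<close>)
 then show ?thesis by (simp add: prod.distrib)
qed

text \<open>Compare the coefficients of order card J in the power series exp (t X) times the product
  of the exp (z j X) - 1. Each factor of the product starts with z j X, so the coefficient is the
  product of the z j whatever t is; multiplying out gives exponentials of the shifted partial
  sums.\<close>

lemma polarization:
 fixes z :: "'j => real"
 assumes "finite J"
 shows "(\<Sum>A\<in>Pow J. (-1) ^ card (J - A) * (t + (\<Sum>j\<in>A. z j)) ^ card J) = fact (card J) * (\<Prod>j\<in>J. z j)"
proof -
 let ?q = "card J"
 have exp_sum: "fps_exp (\<Sum>j\<in>A. z j) = (\<Prod>j\<in>A. fps_exp (z j))" if "A \<subseteq> J" for A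
  using finite_subset[OF that assms] by (induction A rule: finite_induct) (auto simp: fps_exp_add_mult)
 have "fps_exp t * (\<Prod>j\<in>J. fps_exp (z j) - 1) = (\<Sum>X\<in>Pow J. (-1) ^ card X * (fps_exp t * (\<Prod>j\<in>J - X. fps_exp (z j))))"
  by (simp add: prod_diff_conv_sum[OF assms] sum_distrib_left mult_ac)
 also have "... = (\<Sum>A\<in>Pow J. (-1) ^ card (J - A) * (fps_exp t * (\<Prod>j\<in>A. fps_exp (z j))))"
  by (rule sum.reindex_bij_witness[where i = "%A. J - A" and j = "%A. J - A"])
    (auto simp: double_diff)
 also have "... = (\<Sum>A\<in>Pow J. fps_const ((-1) ^ card (J - A)) * fps_exp (t + (\<Sum>j\<in>A. z j)))"
  by (intro sum.cong refl) (simp add: fps_exp_add_mult exp_sum fps_const_power[symmetric] fps_const_neg[symmetric] del: fps_const_neg fps_const_power)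
 finally have "fps_nth (fps_exp t * (\<Prod>j\<in>J. fps_exp (z j) - 1)) ?q
   = (\<Sum>A\<in>Pow J. (-1) ^ card (J - A) * ((t + (\<Sum>j\<in>A. z j)) ^ ?q / fact ?q))"
  by (simp add: fps_sum_nth)
 moreover have "fps_nth (fps_exp t * (\<Prod>j\<in>J. fps_exp (z j) - 1)) ?q = (\<Prod>j\<in>J. z j)"
 proof -
  have "fps_exp t * (\<Prod>j\<in>J. fps_exp (z j) - 1) = fps_X ^ ?q * (fps_exp t * (\<Prod>j\<in>J. fps_shift 1 (fps_exp (z j) - 1)))"
   by (subst prod_fps_nth_card[OF assms]) (auto simp: mult_ac)
  moreover have "fps_nth (\<Prod>j\<in>J. fps_shift 1 (fps_exp (z j) - 1)) 0 = (\<Prod>j\<in>J. z j)"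
   using assms by (induction J rule: finite_induct) auto
  ultimately show ?thesis by (simp only: fps_X_power_mult_nth) simp
 qed
 ultimately have "(\<Prod>j\<in>J. z j) = (\<Sum>A\<in>Pow J. (-1) ^ card (J - A) * ((t + (\<Sum>j\<in>A. z j)) ^ ?q / fact ?q))" by simp
 then show ?thesis by (simp add: sum_divide_distrib[symmetric])
qed

locale gfam = prob_space M for M :: "'w measure" +
 fixes I :: "'i set" and x :: "'i => 'w => real"
 assumes lin: "!!a F. finite F ==> F \<subseteq> I ==> cgauss M (%om. \<Sum>i\<in>F. a i * x i om)"
begin

definition "c i j = expectation (%om. x i om * x j om)"

lemma x_cgauss: "i \<in> I ==> cgauss M (x i)"
 using lin[of "{i}" "%_. 1"] by simp

lemma x_mom: "i \<in> I ==> mom M (x i)"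
 using x_cgauss by (simp add: cgauss_def)

lemma prob: "prob_space M" by unfold_locales

lemma c_sym: "c i j = c j i" by (simp add: c_def mult.commute)

text \<open>Read off the linear coefficient of the polynomial s -> E (y + s * z) ^ (q + 1). On the
  one hand it is (q + 1) * E (z * y ^ q). On the other hand, for odd q the Gaussian moment formula
  expresses the polynomial through the variance v + 2 * w * s + u * s ^ 2, and for even q it is
  identically 0.\<close>

lemma cgauss_pair_power:
 assumes yz: "!!s. cgauss M (%om. y om + s * z om)" and z: "cgauss M z"
 shows "expectation (%om. z om * y om ^ q) = real q * expectation (%om. z om * y om) * expectation (%om. y om ^ (q - 1))"
proof -
 have my: "mom M y" using yz[of 0] by (simp add: cgauss_def)
 have mz: "mom M z" using z by (simp add: cgauss_def)
 have mzy: "mom M (%om. z om ^ k * y om ^ l)" for k l by (intro mom_mult mom_power my mz)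
 define p where "p k = expectation (%om. z om ^ k * y om ^ (Suc q - k)) * real (Suc q choose k)" for k
 have poly: "expectation (%om. (y om + s * z om) ^ Suc q) = (\<Sum>k\<le>Suc q. p k * s ^ k)" for s
 proof -
  have "(y om + s * z om) ^ Suc q = (\<Sum>k\<le>Suc q. (real (Suc q choose k) * s ^ k) * (z om ^ k * y om ^ (Suc q - k)))" for om
   by (subst add.commute, subst binomial_ring) (simp add: power_mult_distrib mult_ac)
  then have "expectation (%om. (y om + s * z om) ^ Suc q) = expectation (%om. \<Sum>k\<le>Suc q. (real (Suc q choose k) * s ^ k) * (z om ^ k * y om ^ (Suc q - k)))"
   by presburger
  also have "... = (\<Sum>k\<le>Suc q. (real (Suc q choose k) * s ^ k) * expectation (%om. z om ^ k * y om ^ (Suc q - k)))"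
   by (subst Bochner_Integration.integral_sum)
     (intro integrable_mult_right mom_integrable mzy, simp only: integral_mult_right_zero)
  also have "... = (\<Sum>k\<le>Suc q. p k * s ^ k)"
   by (intro sum.cong refl) (simp add: p_def)
  finally show ?thesis .
 qed
 have d1: "((%s. expectation (%om. (y om + s * z om) ^ Suc q)) has_real_derivative p 1) (at 0)"
 proof -
  have "((%s. \<Sum>k\<le>Suc q. p k * s ^ k) has_real_derivative (\<Sum>k\<le>Suc q. p k * (real k * 0 ^ (k - 1)))) (at 0)"
   by (auto intro!: derivative_eq_intros simp: mult_ac)
  also have "(\<Sum>k\<le>Suc q. p k * (real k * 0 ^ (k - 1))) = (\<Sum>k\<in>{1}. p k * (real k * 0 ^ (k - 1)))"
   by (rule sum.mono_neutral_right) (auto simp: power_0_left)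
  finally show ?thesis unfolding poly by simp
 qed
 have p1: "p 1 = real (Suc q) * expectation (%om. z om * y om ^ q)" by (simp add: p_def)
 show ?thesis
 proof (cases "even q")
  case False
  then obtain r where q: "q = 2 * r + 1" by (elim oddE)
  define v w u where "v = expectation (%om. (y om)\<^sup>2)" and "w = expectation (%om. z om * y om)" and "u = expectation (%om. (z om)\<^sup>2)"
  have var: "expectation (%om. (y om + s * z om)\<^sup>2) = v + 2 * w * s + u * s\<^sup>2" for s
  proof -
   have e: "(y om + s * z om)\<^sup>2 = (y om)\<^sup>2 + (2 * s) * (z om * y om) + s\<^sup>2 * (z om)\<^sup>2" for om
    by (simp add: power2_eq_square algebra_simps)
   have ints: "integrable M (%om. (y om)\<^sup>2)" "integrable M (%om. z om * y om)" "integrable M (%om. (z om)\<^sup>2)"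
    using mom_integrable[OF mzy[of 0 2]] mom_integrable[OF mzy[of 1 1]] mom_integrable[OF mzy[of 2 0]] by simp_all
   have "expectation (%om. (y om + s * z om)\<^sup>2) = v + (2 * s) * w + s\<^sup>2 * u"
    unfolding e v_def w_def u_def using ints by simp
   then show ?thesis by simp
  qed
  have "expectation (%om. (y om + s * z om) ^ Suc q) = gmom (Suc r) * (v + 2 * w * s + u * s\<^sup>2) ^ Suc r" for s
  proof -
   have Sq: "Suc q = 2 * Suc r" using q by simp
   show ?thesis using yz[of s] unfolding Sq cgauss_def var by blast
  qed
  then have "((%s. gmom (Suc r) * (v + 2 * w * s + u * s\<^sup>2) ^ Suc r) has_real_derivative p 1) (at 0)" using d1 by simp
  moreover have "((%s. gmom (Suc r) * (v + 2 * w * s + u * s\<^sup>2) ^ Suc r) has_real_derivative gmom (Suc r) * (real (Suc r) * v ^ r * (2 * w))) (at 0)"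
  proof -
   have "((%s. v + 2 * w * s + u * s\<^sup>2) has_real_derivative 2 * w) (at 0)"
    by (auto intro!: derivative_eq_intros)
   from DERIV_cmult[OF DERIV_power_Suc[OF this, of r], of "gmom (Suc r)"] show ?thesis
    by (rule DERIV_cong) (simp add: algebra_simps)
  qed
  ultimately have "p 1 = gmom (Suc r) * (real (Suc r) * v ^ r * (2 * w))" by (rule DERIV_unique)
  then have "real (Suc q) * expectation (%om. z om * y om ^ q) = real (Suc q) * (real q * w * (gmom r * v ^ r))"
   unfolding p1 gmom_Suc using q by (simp add: algebra_simps)
  then have "expectation (%om. z om * y om ^ q) = real q * w * (gmom r * v ^ r)" by (simp only: mult_cancel_left) auto
  moreover have "expectation (%om. y om ^ (q - 1)) = gmom r * v ^ r" using yz[of 0] q by (simp add: cgauss_def v_def)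
  ultimately show ?thesis by (simp add: w_def)
 next
  case True
  then obtain r where q: "q = 2 * r" by (elim evenE)
  have "expectation (%om. (y om + s * z om) ^ Suc q) = 0" for s using yz[of s] q by (simp add: cgauss_def)
  then have "((%s. 0) has_real_derivative p 1) (at 0)" using d1 by simp
  then have "p 1 = 0" using DERIV_unique[OF _ DERIV_const] by blast
  then have 1: "expectation (%om. z om * y om ^ q) = 0" using p1 by simp
  have "real q * expectation (%om. y om ^ (q - 1)) = 0"
  proof (cases r)
   case (Suc r')
   then have "q - 1 = 2 * r' + 1" using q by simp
   then show ?thesis using yz[of 0] by (simp add: cgauss_def)
  qed (simp add: q)
  moreover have "real q * expectation (%om. z om * y om) * expectation (%om. y om ^ (q - 1))
    = expectation (%om. z om * y om) * (real q * expectation (%om. y om ^ (q - 1)))" by simp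
  ultimately show ?thesis using 1 by auto
 qed
qed

text \<open>Polarization writes the product as a signed sum of powers of partial sums, the pair
  formula is applied to each power, and polarization backwards recovers the shorter products.
  Indexing through \<phi> admits repeated variables.\<close>

lemma wick_set:
 assumes J: "finite J" "!!j. j \<in> J ==> \<phi> j \<in> I" and i: "i \<in> I"
 shows "expectation (%om. x i om * (\<Prod>j\<in>J. x (\<phi> j) om)) = (\<Sum>j\<in>J. c i (\<phi> j) * expectation (%om. \<Prod>k\<in>J - {j}. x (\<phi> k) om))"
proof -
 define q where "q = card J"
 define y where "y A om = (\<Sum>j\<in>A. x (\<phi> j) om)" for A om
 have gen: "cgauss M (%om. y A om + s * x i om)" if "A \<subseteq> J" for A s
 proof -
  let ?F = "insert i (\<phi> ` A)"
  have fA: "finite A" using that J finite_subset by blast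
  let ?a = "%l. real (card {j\<in>A. \<phi> j = l}) + (if l = i then s else 0)"
  have 1: "(\<Sum>l\<in>?F. real (card {j\<in>A. \<phi> j = l}) * x l om) = y A om" for om
  proof -
   have "y A om = (\<Sum>l\<in>?F. \<Sum>j\<in>{j\<in>A. \<phi> j = l}. x (\<phi> j) om)"
    unfolding y_def by (rule sum.group[symmetric]) (use fA in auto)
   also have "... = (\<Sum>l\<in>?F. real (card {j\<in>A. \<phi> j = l}) * x l om)" by (intro sum.cong refl) simp
   finally show ?thesis by simp
  qed
  have 2: "(\<Sum>l\<in>?F. (if l = i then s else 0) * x l om) = s * x i om" for om
  proof -
   have "(\<Sum>l\<in>?F. (if l = i then s else 0) * x l om) = (\<Sum>l\<in>?F. if l = i then s * x l om else 0)" by (intro sum.cong) auto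
   then show ?thesis using fA by (simp add: sum.delta)
  qed
  have "cgauss M (%om. \<Sum>l\<in>?F. ?a l * x l om)" by (rule lin) (use fA that J i in auto)
  then show ?thesis by (simp only: distrib_right sum.distrib 1 2)
 qed
 have y_mom: "mom M (y A)" if "A \<subseteq> J" for A using gen[OF that, of 0] by (simp add: cgauss_def)
 have step: "expectation (%om. x i om * y A om ^ q) = (\<Sum>j\<in>A. real q * (c i (\<phi> j) * expectation (%om. y A om ^ (q - 1))))" if "A \<subseteq> J" for A
 proof -
  have fA: "finite A" using that J finite_subset by blast
  have "expectation (%om. x i om * y A om) = (\<Sum>j\<in>A. c i (\<phi> j))"
   unfolding y_def c_def sum_distrib_left
   by (subst Bochner_Integration.integral_sum) (use that J i in \<open>auto intro!: mom_integrable mom_mult x_mom\<close>)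
  then show ?thesis
   using cgauss_pair_power[OF gen[OF that] x_cgauss[OF i], of q] by (simp add: sum_distrib_left sum_distrib_right mult_ac)
 qed
 have "fact q * expectation (%om. x i om * (\<Prod>j\<in>J. x (\<phi> j) om)) = expectation (%om. x i om * (fact q * (\<Prod>j\<in>J. x (\<phi> j) om)))"
  by (simp add: mult_ac)
 also have "... = expectation (%om. \<Sum>A\<in>Pow J. (-1) ^ card (J - A) * (x i om * y A om ^ q))"
  unfolding q_def polarization[OF J(1), of 0, symmetric] y_def by (simp add: sum_distrib_left mult_ac)
 also have "... = (\<Sum>A\<in>Pow J. (-1) ^ card (J - A) * expectation (%om. x i om * y A om ^ q))"
  by (subst Bochner_Integration.integral_sum) (use i in \<open>auto intro!: mom_integrable mom_mult mom_power x_mom y_mom\<close>)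
 also have "... = (\<Sum>A\<in>Pow J. \<Sum>j\<in>J. if j \<in> A then (-1) ^ card (J - A) * (real q * (c i (\<phi> j) * expectation (%om. y A om ^ (q - 1)))) else 0)"
 proof (intro sum.cong refl)
  fix A assume A: "A \<in> Pow J"
  then have "(\<Sum>j\<in>J. if j \<in> A then (-1) ^ card (J - A) * (real q * (c i (\<phi> j) * expectation (%om. y A om ^ (q - 1)))) else 0)
    = (\<Sum>j\<in>A. (-1) ^ card (J - A) * (real q * (c i (\<phi> j) * expectation (%om. y A om ^ (q - 1)))))"
   using J by (intro sum.mono_neutral_cong_right) auto
  then show "(-1) ^ card (J - A) * expectation (%om. x i om * y A om ^ q) = (\<Sum>j\<in>J. if j \<in> A then (-1) ^ card (J - A) * (real q * (c i (\<phi> j) * expectation (%om. y A om ^ (q - 1)))) else 0)"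
   using A step[of A] by (simp add: sum_distrib_left)
 qed
 also have "... = (\<Sum>j\<in>J. \<Sum>A\<in>Pow J. if j \<in> A then (-1) ^ card (J - A) * (real q * (c i (\<phi> j) * expectation (%om. y A om ^ (q - 1)))) else 0)"
  by (rule sum.swap)
 also have "... = (\<Sum>j\<in>J. fact q * (c i (\<phi> j) * expectation (%om. \<Prod>k\<in>J - {j}. x (\<phi> k) om)))"
 proof (intro sum.cong refl)
  fix j assume j: "j \<in> J"
  let ?J = "J - {j}"
  have cq: "card ?J = q - 1" "q \<ge> 1" using j J by (auto simp: q_def card_gt_0_iff Suc_le_eq)
  have "(\<Sum>A\<in>Pow J. if j \<in> A then (-1) ^ card (J - A) * (real q * (c i (\<phi> j) * expectation (%om. y A om ^ (q - 1)))) else 0)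
   = (\<Sum>A\<in>{A\<in>Pow J. j \<in> A}. (-1) ^ card (J - A) * (real q * (c i (\<phi> j) * expectation (%om. y A om ^ (q - 1)))))"
   using J by (intro sum.mono_neutral_cong_right) auto
  \<comment> \<open>The subsets containing j correspond to the subsets of \<open>J - {j}\<close>.
    The additional summand \<open>x (\<phi> j)\<close> plays the role of the shift t in
    \<open>polarization\<close>, on which the result does not depend.\<close>
  also have "... = (\<Sum>A\<in>Pow ?J. (-1) ^ card (?J - A) * (real q * (c i (\<phi> j) * expectation (%om. (x (\<phi> j) om + y A om) ^ (q - 1)))))"
  proof (rule sum.reindex_bij_witness[where i = "insert j" and j = "%A. A - {j}"])
   fix A assume A: "A \<in> {A \<in> Pow J. j \<in> A}"
   then have f: "finite A" using J finite_subset by blast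
   have "y A om = x (\<phi> j) om + y (A - {j}) om" for om unfolding y_def using A f by (subst sum.remove[of _ j]) auto
   moreover have "J - {j} - (A - {j}) = J - A" using A by auto
   ultimately show "(-1) ^ card (?J - (A - {j})) * (real q * (c i (\<phi> j) * expectation (%om. (x (\<phi> j) om + y (A - {j}) om) ^ (q - 1))))
     = (-1) ^ card (J - A) * (real q * (c i (\<phi> j) * expectation (%om. y A om ^ (q - 1))))" by simp
  qed (use j in auto)
  also have "... = real q * (c i (\<phi> j) * expectation (%om. \<Sum>A\<in>Pow ?J. (-1) ^ card (?J - A) * (x (\<phi> j) om + y A om) ^ (q - 1)))"
   by (subst Bochner_Integration.integral_sum)
     (use j J in \<open>auto simp: sum_distrib_left mult_ac intro!: mom_integrable_power mom_add x_mom y_mom\<close>)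
  also have "(%om. \<Sum>A\<in>Pow ?J. (-1) ^ card (?J - A) * (x (\<phi> j) om + y A om) ^ (q - 1)) = (%om. fact (q - 1) * (\<Prod>k\<in>?J. x (\<phi> k) om))"
   using polarization[of ?J] J cq unfolding y_def by simp
  finally show "(\<Sum>A\<in>Pow J. if j \<in> A then (-1) ^ card (J - A) * (real q * (c i (\<phi> j) * expectation (%om. y A om ^ (q - 1)))) else 0)
    = fact q * (c i (\<phi> j) * expectation (%om. \<Prod>k\<in>?J. x (\<phi> k) om))"
   using cq by (simp add: fact_reduce[of q] mult_ac)
 qed
 finally show ?thesis by (simp add: sum_distrib_left[symmetric])
qed

definition "mprod ls om = prod_list (map (%l. x l om) ls)"

text \<open>The derivative of the monomial \<open>mprod ls\<close> along the i-th row of the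
  covariance, by the product rule.\<close>

primrec mprodd where
 "mprodd i [] om = 0"
| "mprodd i (l # ls) om = c i l * mprod ls om + x l om * mprodd i ls om"

lemma mprod_append: "mprod (ls @ ls') om = mprod ls om * mprod ls' om" by (simp add: mprod_def)

lemma mprodd_append: "mprodd i (ls @ ls') om = mprodd i ls om * mprod ls' om + mprod ls om * mprodd i ls' om"
 by (induction ls) (simp_all add: mprod_append algebra_simps, simp_all add: mprod_def)

lemma mprod_mom: "set ls \<subseteq> I ==> mom M (mprod ls)"
proof (induction ls)
 case Nil
 then show ?case using mom_const[OF prob, of 1] by (simp add: mprod_def[abs_def])
next
 case (Cons l ls)
 then have "mom M (%om. x l om * mprod ls om)" by (intro mom_mult x_mom) auto
 then show ?case by (simp add: mprod_def[abs_def])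
qed

lemma mprodd_mom: "set ls \<subseteq> I ==> mom M (mprodd i ls)"
proof (induction ls)
 case Nil
 then show ?case using mom_const[OF prob, of 0] by (simp add: fun_eq_iff)
next
 case (Cons l ls)
 then have "mom M (%om. c i l * mprod ls om + x l om * mprodd i ls om)"
  by (intro mom_add mom_mult mom_const[OF prob] x_mom mprod_mom) auto
 then show ?case by simp
qed

lemma mprodd_eq_sum:
 "mprodd i ls om = (\<Sum>j<length ls. c i (ls ! j) * (\<Prod>k\<in>{..<length ls} - {j}. x (ls ! k) om))"
proof (induction ls)
 case (Cons l ls)
 let ?n = "length ls"
 have pr: "mprod ls om = (\<Prod>k<?n. x (ls ! k) om)" by (simp add: mprod_def prod.list_conv_set_nth atLeast0LessThan)
 have z: "{..<Suc ?n} - {0} = Suc ` {..<?n}" by (auto simp: image_def gr0_conv_Suc)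
 have s: "{..<Suc ?n} - {Suc j} = insert 0 (Suc ` ({..<?n} - {j}))" for j
  by (auto simp: lessThan_Suc_eq_insert_0)
 have p0: "(\<Prod>k\<in>{..<Suc ?n} - {0}. x ((l # ls) ! k) om) = mprod ls om"
  unfolding z pr by (subst prod.reindex) auto
 have p1: "(\<Prod>k\<in>{..<Suc ?n} - {Suc j}. x ((l # ls) ! k) om) = x l om * (\<Prod>k\<in>{..<?n} - {j}. x (ls ! k) om)" for j
  unfolding s by (subst prod.insert) (auto simp: prod.reindex)
 have "(\<Sum>j<Suc ?n. c i ((l # ls) ! j) * (\<Prod>k\<in>{..<Suc ?n} - {j}. x ((l # ls) ! k) om))
   = c i l * mprod ls om + (\<Sum>j<?n. c i (ls ! j) * (x l om * (\<Prod>k\<in>{..<?n} - {j}. x (ls ! k) om)))"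
  by (subst sum.lessThan_Suc_shift) (simp only: p0 p1 nth_Cons_0 nth_Cons_Suc)
 then show ?case using Cons by (simp add: sum_distrib_left mult_ac)
qed simp

lemma wick_list:
 assumes "i \<in> I" "set ls \<subseteq> I"
 shows "expectation (%om. x i om * mprod ls om) = expectation (mprodd i ls)"
proof -
 have pr: "mprod ls om = (\<Prod>k<length ls. x (ls ! k) om)" for om by (simp add: mprod_def prod.list_conv_set_nth atLeast0LessThan)
 have I: "ls ! j \<in> I" if "j < length ls" for j using assms that nth_mem by blast
 have "expectation (%om. x i om * mprod ls om) = (\<Sum>j<length ls. c i (ls ! j) * expectation (%om. \<Prod>k\<in>{..<length ls} - {j}. x (ls ! k) om))"
  unfolding pr by (rule wick_set) (use assms I in auto)
 also have "... = expectation (%om. mprodd i ls om)"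
  unfolding mprodd_eq_sum
  by (subst Bochner_Integration.integral_sum) (use I in \<open>auto intro!: mom_integrable mom_prod[OF prob] x_mom\<close>)
 finally show ?thesis by simp
qed

text \<open>\<open>ibp i P P'\<close>: \<open>P\<close> is a polynomial in the family and \<open>P'\<close> its derivative along the \<open>i\<close>-th row of
 the covariance, i.e. \<open>\<Sum>l. c i l * \<partial>\<^sub>l P\<close>.\<close>

inductive ibp for i where
 zero: "ibp i (%_. 0) (%_. 0)"
| mprod: "ibp i P P' ==> set ls \<subseteq> I ==> ibp i (%om. P om + a * mprod ls om) (%om. P' om + a * mprodd i ls om)"

lemma ibp_add: "ibp i P P' ==> ibp i Q Q' ==> ibp i (%om. P om + Q om) (%om. P' om + Q' om)"
proof (induction rule: ibp.induct)
 case (mprod P P' ls a)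
 then show ?case using ibp.mprod[OF mprod(3)[OF mprod(4)] mprod(2), where a = a] by (simp add: add_ac)
qed simp

lemma ibp_mult_mprod:
 "ibp i P P' ==> set ls \<subseteq> I ==> ibp i (%om. a * mprod ls om * P om) (%om. a * mprodd i ls om * P om + a * mprod ls om * P' om)"
proof (induction rule: ibp.induct)
 case zero
 then show ?case using ibp.zero by simp
next
 case (mprod P P' ls' b)
 have "ibp i (%om. a * mprod ls om * P om + (a * b) * mprod (ls @ ls') om)
   (%om. a * mprodd i ls om * P om + a * mprod ls om * P' om + (a * b) * mprodd i (ls @ ls') om)"
  using ibp.mprod[OF mprod.IH[OF mprod.prems], where ls = "ls @ ls'" and a = "a * b"] mprod by simp
 then show ?case by (simp add: mprod_append mprodd_append algebra_simps)
qed

lemma ibp_mult: "ibp i P P' ==> ibp i Q Q' ==> ibp i (%om. P om * Q om) (%om. P' om * Q om + P om * Q' om)"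
proof (induction rule: ibp.induct)
 case zero
 then show ?case using ibp.zero by simp
next
 case (mprod P P' ls a)
 from ibp_add[OF mprod.IH[OF mprod.prems] ibp_mult_mprod[OF mprod.prems mprod.hyps(2), where a = a]]
 show ?case by (simp add: algebra_simps)
qed

lemma ibp_const: "ibp i (%_. a) (%_. 0)"
 using ibp.mprod[OF ibp.zero, where ls = "[]" and a = a] by (simp add: mprod_def)

lemma ibp_var: "l \<in> I ==> ibp i (x l) (%_. c i l)"
 using ibp.mprod[OF ibp.zero, where ls = "[l]" and a = 1] by (simp add: mprod_def)

lemma ibp_cmult: "ibp i P P' ==> ibp i (%om. a * P om) (%om. a * P' om)"
 using ibp_mult[OF ibp_const, of i P P' a] by simp

lemma ibp_sum: "finite F ==> (!!k. k \<in> F ==> ibp i (P k) (P' k)) ==> ibp i (%om. \<Sum>k\<in>F. P k om) (%om. \<Sum>k\<in>F. P' k om)"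
 by (induction F rule: finite_induct) (auto intro: ibp_add ibp_const)

lemma ibp_power: "ibp i P P' ==> ibp i (%om. P om ^ n) (%om. real n * P om ^ (n - 1) * P' om)"
proof (induction n)
 case 0
 then show ?case using ibp_const by simp
next
 case (Suc n)
 from ibp_mult[OF Suc.prems Suc.IH[OF Suc.prems]]
 have "ibp i (%om. P om * P om ^ n) (%om. P' om * P om ^ n + P om * (real n * P om ^ (n - 1) * P' om))" .
 moreover have "P' om * P om ^ n + P om * (real n * P om ^ (n - 1) * P' om) = real (Suc n) * P om ^ (Suc n - 1) * P' om" for om
  by (cases n) (simp_all add: algebra_simps)
 ultimately show ?case by simp
qed

lemma ibp_mom: "ibp i P P' ==> mom M P \<and> mom M P'"
 by (induction rule: ibp.induct) (auto intro!: mom_add mom_cmult[OF prob] mprod_mom mprodd_mom mom_const[OF prob])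

text \<open>Gaussian integration by parts for polynomials: \<open>wick_list\<close> settles the
  monomials, and linearity follows the generation of \<open>ibp\<close>.\<close>

theorem ibp_expectation:
 assumes "i \<in> I"
 shows "ibp i P P' ==> expectation (%om. x i om * P om) = expectation P'"
proof (induction rule: ibp.induct)
 case (mprod P P' ls a)
 have m: "mom M P" "mom M P'" using ibp_mom[OF mprod(1)] by auto
 have "expectation (%om. x i om * (P om + a * mprod ls om)) = expectation (%om. x i om * P om + a * (x i om * mprod ls om))"
  by (simp add: algebra_simps)
 also have "... = expectation P' + a * expectation (mprodd i ls)"
  using wick_list[OF assms mprod(2)] mprod(3) m mprod(2) assms
  by (subst Bochner_Integration.integral_add) (auto intro!: mom_integrable mom_mult x_mom mprod_mom mom_const[OF prob])
 also have "... = expectation (%om. P' om + a * mprodd i ls om)"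
  using m mprod(2) by (subst Bochner_Integration.integral_add) (auto intro!: mom_integrable mom_cmult[OF prob] mprodd_mom)
 finally show ?case .
qed simp

end

section \<open>Moments of cubic and bilinear Gaussian sums\<close>

text \<open>A convex power lies above its tangent; after scaling by m this is Bernoulli's
  inequality.\<close>

lemma power_tangent:
 fixes y m :: real
 assumes "0 <= y" "0 <= m" "1 <= r"
 shows "m ^ r + real r * m ^ (r - 1) * (y - m) <= y ^ r"
proof (cases "m = 0")
 case True
 then show ?thesis using assms by (cases r) (auto simp: power_0_left)
next
 case False
 then have m: "0 < m" using assms by simp
 have "1 + real r * (y / m - 1) <= (1 + (y / m - 1)) ^ r"
  using assms m by (intro Bernoulli_inequality) auto
 then have "m ^ r * (1 + real r * (y / m - 1)) <= m ^ r * (y / m) ^ r"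
  using m by (intro mult_left_mono) auto
 moreover have "m ^ r * (y / m) ^ r = y ^ r" using m by (simp add: power_divide)
 moreover have "m ^ r * (1 + real r * (y / m - 1)) = m ^ r + real r * m ^ (r - 1) * (y - m)"
 proof -
  define p where "p = m ^ (r - 1)"
  have "m ^ r = m * p" using assms by (cases r) (auto simp: p_def)
  then show ?thesis unfolding p_def[symmetric] using m by (simp add: field_simps)
 qed
 ultimately show ?thesis by simp
qed

text \<open>Jensen's inequality for weights of arbitrary total mass: sum the tangent at the weighted
  mean.\<close>

lemma weighted_power_mean:
 fixes w y :: "'z => real"
 assumes "finite Z" and w: "!!z. z \<in> Z ==> 0 <= w z" and y: "!!z. z \<in> Z ==> 0 <= y z" and r: "1 <= r"
 shows "(\<Sum>z\<in>Z. w z * y z) ^ r <= (\<Sum>z\<in>Z. w z) ^ (r - 1) * (\<Sum>z\<in>Z. w z * y z ^ r)"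
proof (cases "(\<Sum>z\<in>Z. w z) = 0")
 case True
 then have "w z = 0" if "z \<in> Z" for z using sum_nonneg_eq_0_iff[of Z w] assms(1) w that by auto
 then show ?thesis using r by (simp add: power_0_left)
next
 case False
 define W where "W = (\<Sum>z\<in>Z. w z)"
 have W: "0 < W" using False w by (simp add: W_def sum_nonneg less_le)
 define m where "m = (\<Sum>z\<in>Z. w z * y z) / W"
 have m: "0 <= m" unfolding m_def using W w y by (intro divide_nonneg_pos sum_nonneg) auto
 have Wm: "(\<Sum>z\<in>Z. w z * y z) = W * m" using W by (simp add: m_def)
 have "(\<Sum>z\<in>Z. w z * (m ^ r + real r * m ^ (r - 1) * (y z - m))) <= (\<Sum>z\<in>Z. w z * y z ^ r)"
  using w y m r by (intro sum_mono mult_left_mono power_tangent) auto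
 moreover have "(\<Sum>z\<in>Z. w z * (m ^ r + real r * m ^ (r - 1) * (y z - m))) = W * m ^ r + real r * m ^ (r - 1) * ((\<Sum>z\<in>Z. w z * y z) - W * m)"
  by (simp add: W_def sum_distrib_left sum_distrib_right sum_subtractf sum.distrib algebra_simps)
 ultimately have "W * m ^ r <= (\<Sum>z\<in>Z. w z * y z ^ r)" using Wm by simp
 then have "W ^ (r - 1) * (W * m ^ r) <= W ^ (r - 1) * (\<Sum>z\<in>Z. w z * y z ^ r)" using W by (intro mult_left_mono) auto
 moreover have "(W * m) ^ r = W ^ (r - 1) * (W * m ^ r)" using r by (cases r) (auto simp: power_mult_distrib)
 ultimately show ?thesis using Wm by (simp add: W_def)
qed

text \<open>If F dominates 8 * u, then u is at most an eighth of one more factor F; otherwise F is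
  bounded by 8 * u. The summand with F ^ (2 * r) is meant to be absorbed into a left-hand
  side.\<close>

lemma absorb_odd:
 fixes u F :: real
 assumes "1 <= r"
 shows "u * F ^ (2 * r - 1) <= (8 * u) ^ (2 * r) + F ^ (2 * r) / 8"
proof (cases "\<bar>F\<bar> <= 8 * \<bar>u\<bar>")
 case True
 have "u * F ^ (2 * r - 1) <= \<bar>u\<bar> * \<bar>F\<bar> ^ (2 * r - 1)" by (metis abs_ge_self abs_mult power_abs)
 also have "... <= (8 * \<bar>u\<bar>) * (8 * \<bar>u\<bar>) ^ (2 * r - 1)" using True by (intro mult_mono power_mono) auto
 also have "... = (8 * \<bar>u\<bar>) ^ (2 * r)" using assms by (subst power_Suc[symmetric]) simp
 also have "... = (8 * u) ^ (2 * r)" by (simp add: power_mult power_mult_distrib)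
 finally show ?thesis by (simp add: add_increasing2)
next
 case False
 have "u * F ^ (2 * r - 1) <= \<bar>u\<bar> * \<bar>F\<bar> ^ (2 * r - 1)" by (metis abs_ge_self abs_mult power_abs)
 also have "... <= (\<bar>F\<bar> / 8) * \<bar>F\<bar> ^ (2 * r - 1)" using False by (intro mult_right_mono) auto
 also have "... = \<bar>F\<bar> ^ (2 * r) / 8" using assms by (simp add: power_Suc[symmetric] del: power_Suc)
 also have "... = F ^ (2 * r) / 8" by (simp add: power_mult)
 finally show ?thesis by (simp add: add_increasing)
qed

lemma absorb_even:
 fixes W F A :: real
 assumes "1 <= r" "0 <= W" "1 <= A"
 shows "W * F ^ (2 * r - 2) <= (A * W) ^ r + F ^ (2 * r) / A"
proof -
 obtain r' where r: "r = Suc r'" using assms by (cases r) auto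
 have e: "F ^ (2 * r - 2) = (F\<^sup>2) ^ r'" "F ^ (2 * r) = F\<^sup>2 * (F\<^sup>2) ^ r'" by (simp_all add: r power_mult[symmetric] power_add[symmetric])
 show ?thesis
 proof (cases "F\<^sup>2 <= A * W")
  case True
  have "W * (F\<^sup>2) ^ r' <= (A * W) * (A * W) ^ r'"
   using assms True by (intro mult_mono power_mono) (auto simp: mult_le_cancel_right1)
  moreover have "0 <= F\<^sup>2 * (F\<^sup>2) ^ r' / A" using assms by (intro divide_nonneg_nonneg mult_nonneg_nonneg) auto
  ultimately show ?thesis unfolding e by (simp add: r)
 next
  case False
  then have "W <= F\<^sup>2 / A" using assms by (simp add: field_simps)
  then have "W * (F\<^sup>2) ^ r' <= F\<^sup>2 / A * (F\<^sup>2) ^ r'" by (intro mult_right_mono) auto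
  moreover have "0 <= (A * W) ^ r" using assms by simp
  ultimately show ?thesis unfolding e by simp
 qed
qed

lemma half_sum_le: "e / 2 <= u + v ==> v <= v' ==> e <= 2 * (u + v')" for e u v v' :: real
 by simp

context gfam begin

lemma pmom: "mom M P ==> integrable M P" by (rule mom_integrable)

lemma mom_divide: "mom M P ==> mom M (%om. P om / a)"
 using mom_cmult[OF prob, of P "inverse a"] by (simp add: divide_inverse mult.commute)

lemmas mom_intros = mom_add mom_mult mom_power mom_sum[OF prob] mom_const[OF prob] mom_cmult[OF prob] x_mom

lemma expect_mono: "mom M P ==> mom M Q ==> (!!om. P om <= Q om) ==> expectation P <= expectation Q"
 by (intro integral_mono mom_integrable) auto

text \<open>One factor of each cube is integrated by parts. The derivative hits either the remaining
  square, which gives the linear sum \<open>La\<close>, or the power of F, which gives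
  \<open>W\<close>. Both are separated from F by the absorption lemmas. \<open>La\<close> is
  Gaussian with variance the sum of all covariances; \<open>W\<close> is estimated by Jensen, where
  the covariances are the weights and therefore have to be nonnegative.\<close>

lemma cubic_sum_moment:
 assumes K: "finite K" "K \<subseteq> I" and s: "!!k. k \<in> K ==> c k k = s" and c: "!!k l. k \<in> K ==> l \<in> K ==> 0 <= c k l"
  and r: "1 <= r"
 shows "expectation (%om. (\<Sum>k\<in>K. x k om ^ 3) ^ (2 * r))
   <= (4 * 8 ^ (2 * r) * gmom r + 6 * (2 * real r - 1) * (12 * (2 * real r - 1)) ^ r * gmom (2 * r)) * s ^ (2 * r) * (\<Sum>k\<in>K. \<Sum>l\<in>K. c k l) ^ r"
proof -
 define F where "F om = (\<Sum>k\<in>K. x k om ^ 3)" for om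
 define La where "La om = (\<Sum>k\<in>K. x k om)" for om
 define W where "W om = (\<Sum>k\<in>K. \<Sum>l\<in>K. c k l * ((x k om)\<^sup>2 * (x l om)\<^sup>2))" for om
 \<comment> \<open>Chosen so that 3 * (2 * r - 1) / A = 1/4; with the 2/8 from
   \<open>absorb_odd\<close>, half of the moment of F is absorbed.\<close>
 define A where "A = 12 * (2 * real r - 1)"
 define EF where "EF = expectation (%om. F om ^ (2 * r))"
 define C where "C = (\<Sum>k\<in>K. \<Sum>l\<in>K. c k l)"
 have A1: "1 <= A" using r by (simp add: A_def)
 have C0: "0 <= C" unfolding C_def by (intro sum_nonneg c)
 have KI: "k \<in> I" if "k \<in> K" for k using that K by auto
 have mF: "mom M F" unfolding F_def[abs_def] using KI K by (intro mom_intros) auto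
 have mL: "mom M La" unfolding La_def[abs_def] using KI K by (intro mom_intros) auto
 have mW: "mom M W" unfolding W_def[abs_def] using KI K by (intro mom_intros) auto
 have W0: "0 <= W om" for om unfolding W_def by (intro sum_nonneg mult_nonneg_nonneg c) auto
 have ibpF: "ibp k F (%om. \<Sum>l\<in>K. 3 * (x l om)\<^sup>2 * c k l)" for k
  unfolding F_def[abs_def] using ibp_power[OF ibp_var, of _ k 3] KI by (intro ibp_sum K) (auto simp: numeral_eq_Suc)
 have step: "expectation (%om. x k om * ((x k om)\<^sup>2 * F om ^ (2 * r - 1)))
   = expectation (%om. 2 * s * (x k om * F om ^ (2 * r - 1)) + 3 * (2 * real r - 1) * ((\<Sum>l\<in>K. c k l * ((x k om)\<^sup>2 * (x l om)\<^sup>2)) * F om ^ (2 * r - 2)))" if "k \<in> K" for k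
 proof -
  have "ibp k (%om. (x k om)\<^sup>2 * F om ^ (2 * r - 1)) (%om. (real 2 * x k om ^ (2 - 1) * c k k) * F om ^ (2 * r - 1)
    + (x k om)\<^sup>2 * (real (2 * r - 1) * F om ^ (2 * r - 1 - 1) * (\<Sum>l\<in>K. 3 * (x l om)\<^sup>2 * c k l)))"
   by (intro ibp_mult ibp_power ibp_var ibpF KI that)
  note ex = ibp_expectation[OF KI[OF that] this]
  define R where "R = 2 * real r - 1"
  have e: "2 * r - 1 - 1 = 2 * r - 2" "real (2 * r - 1) = R" using r by (auto simp: R_def of_nat_diff)
  show ?thesis unfolding ex e R_def[symmetric]
   by (rule arg_cong[where f = expectation], rule ext) (simp add: s[OF that] sum_distrib_left sum_distrib_right mult_ac)
 qed
 have "EF = expectation (%om. \<Sum>k\<in>K. x k om * ((x k om)\<^sup>2 * F om ^ (2 * r - 1)))"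
 proof -
  have "F om ^ (2 * r) = (\<Sum>k\<in>K. x k om * ((x k om)\<^sup>2 * F om ^ (2 * r - 1)))" for om
  proof -
   have "F om * g = (\<Sum>k\<in>K. x k om * ((x k om)\<^sup>2 * g))" for g
    by (simp add: F_def sum_distrib_left sum_distrib_right power3_eq_cube power2_eq_square mult_ac)
   moreover have "F om ^ (2 * r) = F om * F om ^ (2 * r - 1)" using r by (subst power_Suc[symmetric]) simp
   ultimately show ?thesis by presburger
  qed
  then show ?thesis by (simp add: EF_def)
 qed
 also have "... = (\<Sum>k\<in>K. expectation (%om. x k om * ((x k om)\<^sup>2 * F om ^ (2 * r - 1))))"
  by (intro Bochner_Integration.integral_sum pmom) (auto intro!: mom_intros mF KI)
 also have "... = (\<Sum>k\<in>K. expectation (%om. 2 * s * (x k om * F om ^ (2 * r - 1)) + 3 * (2 * real r - 1) * ((\<Sum>l\<in>K. c k l * ((x k om)\<^sup>2 * (x l om)\<^sup>2)) * F om ^ (2 * r - 2))))"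
  by (intro sum.cong refl step)
 also have "... = expectation (%om. \<Sum>k\<in>K. 2 * s * (x k om * F om ^ (2 * r - 1)) + 3 * (2 * real r - 1) * ((\<Sum>l\<in>K. c k l * ((x k om)\<^sup>2 * (x l om)\<^sup>2)) * F om ^ (2 * r - 2)))"
  by (intro Bochner_Integration.integral_sum[symmetric] pmom) (auto intro!: mom_intros mF KI K)
 also have "(%om. \<Sum>k\<in>K. 2 * s * (x k om * F om ^ (2 * r - 1)) + 3 * (2 * real r - 1) * ((\<Sum>l\<in>K. c k l * ((x k om)\<^sup>2 * (x l om)\<^sup>2)) * F om ^ (2 * r - 2)))
   = (%om. 2 * (s * La om * F om ^ (2 * r - 1)) + 3 * (2 * real r - 1) * (W om * F om ^ (2 * r - 2)))"
  unfolding La_def W_def by (rule ext) (simp only: sum.distrib sum_distrib_left sum_distrib_right mult_ac)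
 also have "expectation ... <= expectation (%om. 2 * ((8 * (s * La om)) ^ (2 * r) + F om ^ (2 * r) / 8) + 3 * (2 * real r - 1) * ((A * W om) ^ r + F om ^ (2 * r) / A))"
 proof (rule expect_mono)
  show "2 * (s * La om * F om ^ (2 * r - 1)) + 3 * (2 * real r - 1) * (W om * F om ^ (2 * r - 2))
   <= 2 * ((8 * (s * La om)) ^ (2 * r) + F om ^ (2 * r) / 8) + 3 * (2 * real r - 1) * ((A * W om) ^ r + F om ^ (2 * r) / A)" for om
   using r A1 W0 by (intro add_mono mult_left_mono absorb_odd absorb_even) auto
 qed (intro mom_intros mom_divide mF mL mW)+
 also have "... = (2 * (8 * s) ^ (2 * r)) * expectation (%om. La om ^ (2 * r)) + (3 * (2 * real r - 1) * A ^ r) * expectation (%om. W om ^ r) + EF / 2"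
 proof -
  have e: "2 * ((8 * (s * l)) ^ (2 * r) + f / 8) + 3 * (2 * real r - 1) * ((A * w) ^ r + f / A) = (2 * (8 * s) ^ (2 * r)) * l ^ (2 * r) + (3 * (2 * real r - 1) * A ^ r) * w ^ r + (1 / 2) * f" for l f w
  proof -
   define R where "R = 2 * real r - 1"
   have R: "R ~= 0" using r by (simp add: R_def)
   have 1: "3 * R * ((12 * R * w) ^ r + f / (12 * R)) = (3 * R * (12 * R) ^ r) * w ^ r + f / 4"
    using R by (simp add: power_mult_distrib distrib_left)
   have 2: "2 * ((8 * (s * l)) ^ (2 * r) + f / 8) = (2 * (8 * s) ^ (2 * r)) * l ^ (2 * r) + f / 4"
    by (simp add: power_mult_distrib)
   show ?thesis unfolding A_def R_def[symmetric] 1 2 by simp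
  qed
  have "integrable M (%om. La om ^ (2 * r))" "integrable M (%om. W om ^ r)" "integrable M (%om. F om ^ (2 * r))"
   by (auto intro!: pmom mom_power mL mW mF)
  then show ?thesis unfolding e EF_def by simp
 qed
 finally have 1: "EF / 2 <= (2 * (8 * s) ^ (2 * r)) * expectation (%om. La om ^ (2 * r)) + (3 * (2 * real r - 1) * A ^ r) * expectation (%om. W om ^ r)"
  by simp
 have EL: "expectation (%om. La om ^ (2 * r)) = gmom r * C ^ r"
 proof -
  have g: "cgauss M La" using lin[OF K, of "%_. 1"] by (simp add: La_def[abs_def])
  have "expectation (%om. (La om)\<^sup>2) = expectation (%om. \<Sum>k\<in>K. \<Sum>l\<in>K. x k om * x l om)"
   by (simp add: La_def power2_eq_square sum_product)
  also have "... = C"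
   unfolding C_def c_def
   by (subst Bochner_Integration.integral_sum, (auto intro!: pmom mom_intros KI K)[1], intro sum.cong refl Bochner_Integration.integral_sum pmom mom_intros KI)
  finally show ?thesis using g by (simp add: cgauss_def)
 qed
 have EW: "expectation (%om. W om ^ r) <= gmom (2 * r) * s ^ (2 * r) * C ^ r"
 proof -
  have Wp: "W om ^ r <= C ^ (r - 1) * (\<Sum>k\<in>K. \<Sum>l\<in>K. c k l * ((x k om)\<^sup>2 * (x l om)\<^sup>2) ^ r)" for om
  proof -
   have "(\<Sum>z\<in>K \<times> K. c (fst z) (snd z) * ((x (fst z) om)\<^sup>2 * (x (snd z) om)\<^sup>2)) ^ r
     <= (\<Sum>z\<in>K \<times> K. c (fst z) (snd z)) ^ (r - 1) * (\<Sum>z\<in>K \<times> K. c (fst z) (snd z) * ((x (fst z) om)\<^sup>2 * (x (snd z) om)\<^sup>2) ^ r)"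
    using K c r by (intro weighted_power_mean) auto
   then show ?thesis by (simp add: W_def C_def sum.cartesian_product case_prod_beta')
  qed
  \<comment> \<open>The mixed moment is reduced to moments of single variables by a * b <= (a ^ 2 +
    b ^ 2) / 2; these agree because all variances equal s.\<close>
  have half: "expectation (%om. ((x k om)\<^sup>2 * (x l om)\<^sup>2) ^ r) <= gmom (2 * r) * s ^ (2 * r)" if "k \<in> K" "l \<in> K" for k l
  proof -
   have "expectation (%om. ((x k om)\<^sup>2 * (x l om)\<^sup>2) ^ r) <= expectation (%om. (1/2) * x k om ^ (2 * (2 * r)) + (1/2) * x l om ^ (2 * (2 * r)))"
   proof (rule expect_mono)
    fix om
    define a b where "a = x k om ^ (2 * r)" and "b = x l om ^ (2 * r)"
    have e: "((x k om)\<^sup>2 * (x l om)\<^sup>2) ^ r = a * b" "x k om ^ (2 * (2 * r)) = a\<^sup>2" "x l om ^ (2 * (2 * r)) = b\<^sup>2"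
     by (simp_all add: a_def b_def power_mult_distrib power_mult[symmetric] mult.commute)
    have "0 <= (a - b)\<^sup>2" by simp
    then show "((x k om)\<^sup>2 * (x l om)\<^sup>2) ^ r <= (1/2) * x k om ^ (2 * (2 * r)) + (1/2) * x l om ^ (2 * (2 * r))"
     unfolding e by (simp add: power2_diff)
   qed (intro mom_intros KI that)+
   also have "... = (1/2) * expectation (%om. x k om ^ (2 * (2 * r))) + (1/2) * expectation (%om. x l om ^ (2 * (2 * r)))"
    by (subst Bochner_Integration.integral_add, (intro pmom mom_intros KI that)[1], (intro pmom mom_intros KI that)[1], simp)
   also have "... = gmom (2 * r) * s ^ (2 * r)"
   proof -
    have "expectation (%om. x k om ^ (2 * (2 * r))) = gmom (2 * r) * s ^ (2 * r)" if "k \<in> K" for k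
    proof -
     have "expectation (%om. (x k om)\<^sup>2) = s" using s[OF that] by (simp add: c_def power2_eq_square)
     then show ?thesis using x_cgauss[OF KI[OF that]] unfolding cgauss_def by metis
    qed
    then show ?thesis using that by simp
   qed
   finally show ?thesis .
  qed
  have "expectation (%om. W om ^ r) <= expectation (%om. C ^ (r - 1) * (\<Sum>k\<in>K. \<Sum>l\<in>K. c k l * ((x k om)\<^sup>2 * (x l om)\<^sup>2) ^ r))"
   by (rule expect_mono[OF _ _ Wp]) (auto intro!: mom_intros mW KI K)
  also have "... = C ^ (r - 1) * (\<Sum>k\<in>K. \<Sum>l\<in>K. c k l * expectation (%om. ((x k om)\<^sup>2 * (x l om)\<^sup>2) ^ r))"
  proof -
   have "expectation (%om. \<Sum>k\<in>K. \<Sum>l\<in>K. c k l * ((x k om)\<^sup>2 * (x l om)\<^sup>2) ^ r)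
     = (\<Sum>k\<in>K. expectation (%om. \<Sum>l\<in>K. c k l * ((x k om)\<^sup>2 * (x l om)\<^sup>2) ^ r))"
    by (intro Bochner_Integration.integral_sum pmom mom_intros KI K)
   also have "... = (\<Sum>k\<in>K. \<Sum>l\<in>K. expectation (%om. c k l * ((x k om)\<^sup>2 * (x l om)\<^sup>2) ^ r))"
    by (intro sum.cong refl Bochner_Integration.integral_sum pmom mom_intros KI K)
   finally show ?thesis by simp
  qed
  also have "... <= C ^ (r - 1) * (\<Sum>k\<in>K. \<Sum>l\<in>K. c k l * (gmom (2 * r) * s ^ (2 * r)))"
   using c half C0 by (intro mult_left_mono sum_mono) auto
  also have "... = C ^ (r - 1) * (C * (gmom (2 * r) * s ^ (2 * r)))" by (simp add: C_def sum_distrib_right)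
  also have "... = gmom (2 * r) * s ^ (2 * r) * (C ^ (r - 1) * C)" by (simp only: mult_ac)
  also have "C ^ (r - 1) * C = C ^ r" using r by (metis One_nat_def le_simps(3) lessI mult.commute power_eq_if not_one_le_zero)
  finally show ?thesis .
 qed
 have "(3 * (2 * real r - 1) * A ^ r) * expectation (%om. W om ^ r) <= (3 * (2 * real r - 1) * A ^ r) * (gmom (2 * r) * s ^ (2 * r) * C ^ r)"
  using EW r A1 by (intro mult_left_mono mult_nonneg_nonneg) auto
 then have "EF <= 2 * ((2 * (8 * s) ^ (2 * r)) * (gmom r * C ^ r) + (3 * (2 * real r - 1) * A ^ r) * (gmom (2 * r) * s ^ (2 * r) * C ^ r))"
  using half_sum_le[OF 1[unfolded EL]] by blast
 also have "... = (4 * 8 ^ (2 * r) * gmom r + 6 * (2 * real r - 1) * A ^ r * gmom (2 * r)) * s ^ (2 * r) * C ^ r"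
  by (simp add: power_mult_distrib algebra_simps)
 finally show ?thesis by (simp add: EF_def F_def A_def C_def)
qed

text \<open>The second moment of a * f + b * g is nonnegative; insert a = w and b = - u. For u = 0 a
  suitable large multiple shows w = 0.\<close>

lemma form_cauchy_schwarz:
 assumes "mom M f" "mom M g"
 shows "(expectation (%om. f om * g om))\<^sup>2 <= expectation (%om. (f om)\<^sup>2) * expectation (%om. (g om)\<^sup>2)"
proof -
 define u v w where "u = expectation (%om. (f om)\<^sup>2)" and "v = expectation (%om. (g om)\<^sup>2)" and "w = expectation (%om. f om * g om)"
 have i: "integrable M (%om. (f om)\<^sup>2)" "integrable M (%om. (g om)\<^sup>2)" "integrable M (%om. f om * g om)"
  using assms by (auto intro!: pmom mom_mult mom_power)
 have q: "0 <= a\<^sup>2 * u + 2 * a * b * w + b\<^sup>2 * v" for a b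
 proof -
  have e: "(a * f om + b * g om)\<^sup>2 = a\<^sup>2 * (f om)\<^sup>2 + (2 * a * b) * (f om * g om) + b\<^sup>2 * (g om)\<^sup>2" for om
   by (simp add: power2_eq_square algebra_simps)
  have "0 <= expectation (%om. (a * f om + b * g om)\<^sup>2)" by (intro integral_nonneg_AE) auto
  also have "... = a\<^sup>2 * u + (2 * a * b) * w + b\<^sup>2 * v" unfolding e u_def v_def w_def using i by simp
  finally show ?thesis .
 qed
 have u0: "0 <= u" using q[of 1 0] by simp
 have "w\<^sup>2 <= u * v"
 proof (cases "u = 0")
  case True
  have "w = 0"
  proof (rule ccontr)
   assume "w ~= 0"
   then have "2 * (- (v + 1) / w) * 1 * w = - 2 * (v + 1)" by simp
   moreover have "0 <= v" using q[of 0 1] by simp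
   ultimately show False using q[of "- (v + 1) / w" 1] True by (simp only: mult_zero_right) simp
  qed
  then show ?thesis using True by simp
 next
  case False
  have "0 <= w\<^sup>2 * u + 2 * w * (- u) * w + (- u)\<^sup>2 * v" by (rule q)
  also have "... = u * (u * v - w\<^sup>2)" by (simp add: power2_eq_square algebra_simps)
  finally show ?thesis using False u0 by (simp add: zero_le_mult_iff)
 qed
 then show ?thesis by (simp add: u_def v_def w_def)
qed

text \<open>As the two groups of variables are uncorrelated, integrating a factor
  \<open>x (p e)\<close> by parts leaves only the derivative of the power of S, and this is a
  quadratic form Q in the \<open>x (q e)\<close>. After absorption the moments of Q remain; a second
  integration by parts bounds them by powers of its expectation \<open>tr\<close>, which is the
  variance of S.\<close>

lemma bilinear_moment:
 assumes E: "finite E" "!!e. e \<in> E ==> p e \<in> I" "!!e. e \<in> E ==> q e \<in> I"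
  and orth: "!!e e'. e \<in> E ==> e' \<in> E ==> c (p e) (q e') = 0" and r: "1 <= r"
 shows "expectation (%om. (\<Sum>e\<in>E. s e * x (p e) om * x (q e) om) ^ (2 * r))
   <= 2 * (2 * real r - 1) * (2 * (2 * real r - 1)) ^ r * gmom r *
    (\<Sum>e\<in>E. \<Sum>e'\<in>E. s e * s e' * c (p e) (p e') * c (q e) (q e')) ^ r"
proof -
 define S where "S om = (\<Sum>e\<in>E. s e * x (p e) om * x (q e) om)" for om
 define \<mu> where "\<mu> e e' = s e * s e' * c (p e) (p e')" for e e'
 define Q where "Q om = (\<Sum>e\<in>E. \<Sum>e'\<in>E. \<mu> e e' * x (q e) om * x (q e') om)" for om
 define tr where "tr = (\<Sum>e\<in>E. \<Sum>e'\<in>E. \<mu> e e' * c (q e) (q e'))"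
 define z where "z e om = (\<Sum>e'\<in>E. \<mu> e e' * x (q e') om)" for e om
 define Y where "Y a om = (\<Sum>e\<in>E. s e * a e * x (p e) om)" for a om
 have mu_sym: "\<mu> e e' = \<mu> e' e" for e e' by (simp add: \<mu>_def c_sym mult_ac)
 have mS: "mom M S" unfolding S_def[abs_def] by (intro mom_intros E)
 have mQ: "mom M Q" unfolding Q_def[abs_def] by (intro mom_intros E)
 have mz: "mom M (z e)" for e unfolding z_def[abs_def] by (intro mom_intros E)
 have mY: "mom M (Y a)" for a unfolding Y_def[abs_def] by (intro mom_intros E)
 have form: "expectation (%om'. Y a om' * Y a' om') = (\<Sum>e\<in>E. \<Sum>e'\<in>E. \<mu> e e' * a e * a' e')" for a a'
 proof -
  have "expectation (%om'. Y a om' * Y a' om') = expectation (%om'. \<Sum>e\<in>E. \<Sum>e'\<in>E. (s e * s e' * a e * a' e') * (x (p e) om' * x (p e') om'))"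
   unfolding Y_def sum_product by (simp add: mult_ac)
  also have "... = (\<Sum>e\<in>E. expectation (%om'. \<Sum>e'\<in>E. (s e * s e' * a e * a' e') * (x (p e) om' * x (p e') om')))"
   by (intro Bochner_Integration.integral_sum pmom mom_intros E)
  also have "... = (\<Sum>e\<in>E. \<Sum>e'\<in>E. expectation (%om'. (s e * s e' * a e * a' e') * (x (p e) om' * x (p e') om')))"
   by (intro sum.cong refl Bochner_Integration.integral_sum pmom mom_intros E)
  also have "... = (\<Sum>e\<in>E. \<Sum>e'\<in>E. \<mu> e e' * a e * a' e')"
   by (simp add: \<mu>_def c_def mult_ac)
  finally show ?thesis .
 qed
 \<comment> \<open>For frozen values of the \<open>x (q e)\<close> the form Q is the variance of a
   linear combination of the \<open>x (p e)\<close>. Hence it is nonnegative and satisfies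
   Cauchy-Schwarz.\<close>
 have QY: "Q om = expectation (%om'. (Y (%e. x (q e) om) om')\<^sup>2)" for om
  unfolding power2_eq_square form Q_def ..
 have Q0: "0 <= Q om" for om unfolding QY by (intro integral_nonneg_AE) auto
 have EQ: "expectation Q = tr"
 proof -
  have "expectation Q = expectation (%om. \<Sum>e\<in>E. \<Sum>e'\<in>E. \<mu> e e' * (x (q e) om * x (q e') om))"
   by (simp add: Q_def[abs_def] mult_ac)
  also have "... = (\<Sum>e\<in>E. expectation (%om. \<Sum>e'\<in>E. \<mu> e e' * (x (q e) om * x (q e') om)))"
   by (intro Bochner_Integration.integral_sum pmom mom_intros E)
  also have "... = (\<Sum>e\<in>E. \<Sum>e'\<in>E. expectation (%om. \<mu> e e' * (x (q e) om * x (q e') om)))"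
   by (intro sum.cong refl Bochner_Integration.integral_sum pmom mom_intros E)
  also have "... = tr" by (simp add: tr_def c_def)
  finally show ?thesis .
 qed
 have tr0: "0 <= tr" unfolding EQ[symmetric] using Q0 by (intro integral_nonneg_AE) auto
 define Z where "Z om = (\<Sum>e\<in>E. \<Sum>f\<in>E. c (q e) (q f) * z e om * z f om)" for om
 have mZ: "mom M Z" unfolding Z_def[abs_def] by (intro mom_intros mz E)
 \<comment> \<open>With a second sample om', Z is the mean square over om' of the bilinear form of Q
   between both samples. Cauchy-Schwarz bounds the square by Q om * Q om', and the mean of the
   second factor is \<open>tr\<close>.\<close>
 have ZQ: "Z om <= tr * Q om" for om
 proof -
  have "Z om = (\<Sum>e\<in>E. \<Sum>f\<in>E. (z e om * z f om) * expectation (%om'. x (q e) om' * x (q f) om'))"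
   by (simp add: Z_def c_def mult_ac)
  also have "... = (\<Sum>e\<in>E. \<Sum>f\<in>E. expectation (%om'. (z e om * z f om) * (x (q e) om' * x (q f) om')))"
   by simp
  also have "... = (\<Sum>e\<in>E. expectation (%om'. \<Sum>f\<in>E. (z e om * z f om) * (x (q e) om' * x (q f) om')))"
   by (intro sum.cong refl Bochner_Integration.integral_sum[symmetric] pmom mom_intros E)
  also have "... = expectation (%om'. \<Sum>e\<in>E. \<Sum>f\<in>E. (z e om * z f om) * (x (q e) om' * x (q f) om'))"
   by (intro Bochner_Integration.integral_sum[symmetric] pmom mom_intros E)
  also have "... = expectation (%om'. (expectation (%om''. Y (%e. x (q e) om') om'' * Y (%e. x (q e) om) om''))\<^sup>2)"
  proof -
   have "(\<Sum>e\<in>E. \<Sum>f\<in>E. (z e om * z f om) * (x (q e) om' * x (q f) om')) = (\<Sum>e\<in>E. z e om * x (q e) om')\<^sup>2" for om'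
    by (simp add: power2_eq_square sum_product mult_ac)
   moreover have "(\<Sum>e\<in>E. z e om * x (q e) om') = expectation (%om''. Y (%e. x (q e) om') om'' * Y (%e. x (q e) om) om'')" for om'
    unfolding form by (simp add: z_def sum_distrib_left sum_distrib_right mult_ac)
   ultimately show ?thesis by simp
  qed
  also have "... <= expectation (%om'. Q om * Q om')"
  proof (rule expect_mono)
   show "mom M (%om'. (expectation (%om''. Y (%e. x (q e) om') om'' * Y (%e. x (q e) om) om''))\<^sup>2)"
    unfolding form by (intro mom_intros E)
   show "(expectation (%om''. Y (%e. x (q e) om') om'' * Y (%e. x (q e) om) om''))\<^sup>2 <= Q om * Q om'" for om'
    using form_cauchy_schwarz[OF mY mY] unfolding QY by (simp add: mult.commute)
  qed (intro mom_intros mQ)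
  also have "... = tr * Q om" using EQ by simp
  finally show ?thesis .
 qed
 have ibpz: "ibp i (z e) (%om. \<Sum>e'\<in>E. \<mu> e e' * c i (q e'))" for i e
  unfolding z_def[abs_def] by (intro ibp_sum ibp_cmult ibp_var E)
 have Qz: "Q = (%om. \<Sum>e\<in>E. x (q e) om * z e om)"
  by (rule ext) (simp add: Q_def z_def sum_distrib_left mult_ac)
 have ibpQ: "ibp i Q (%om. 2 * (\<Sum>f\<in>E. c i (q f) * z f om))" for i
 proof -
  have "ibp i Q (%om. \<Sum>e\<in>E. c i (q e) * z e om + x (q e) om * (\<Sum>e'\<in>E. \<mu> e e' * c i (q e')))"
   unfolding Qz by (intro ibp_sum ibp_mult ibp_var ibpz E)
  moreover have "(\<Sum>e\<in>E. x (q e) om * (\<Sum>e'\<in>E. \<mu> e e' * c i (q e'))) = (\<Sum>e\<in>E. c i (q e) * z e om)" for om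
  proof -
   have "(\<Sum>e\<in>E. x (q e) om * (\<Sum>e'\<in>E. \<mu> e e' * c i (q e'))) = (\<Sum>e\<in>E. \<Sum>e'\<in>E. c i (q e') * (\<mu> e' e * x (q e) om))"
    by (simp add: sum_distrib_left mu_sym mult_ac)
   also have "... = (\<Sum>e'\<in>E. \<Sum>e\<in>E. c i (q e') * (\<mu> e' e * x (q e) om))" by (rule sum.swap)
   finally show ?thesis by (simp add: z_def sum_distrib_left)
  qed
  ultimately show ?thesis by (simp add: sum.distrib)
 qed
 \<comment> \<open>Integration by parts in the (n + 1)-st moment gives tr * Q ^ n from the linear
   factor and 2 * n * Z * Q ^ (n - 1) from the power; by \<open>ZQ\<close> the total factor is 2 * n
   + 1, which is the recursion of \<open>gmom\<close>.\<close>
 have Qmom: "expectation (%om. Q om ^ n) <= gmom n * tr ^ n" for n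
 proof (induction n)
  case 0
  then show ?case using prob_space by simp
 next
  case (Suc n)
  have st: "expectation (%om. x (q e) om * (z e om * Q om ^ n))
    = expectation (%om. (\<Sum>e'\<in>E. \<mu> e e' * c (q e) (q e')) * Q om ^ n + 2 * real n * ((\<Sum>f\<in>E. c (q e) (q f) * z e om * z f om) * Q om ^ (n - 1)))" if "e \<in> E" for e
  proof -
   have "ibp (q e) (%om. z e om * Q om ^ n) (%om. (\<Sum>e'\<in>E. \<mu> e e' * c (q e) (q e')) * Q om ^ n
      + z e om * (real n * Q om ^ (n - 1) * (2 * (\<Sum>f\<in>E. c (q e) (q f) * z f om))))"
    by (intro ibp_mult ibp_power ibpz ibpQ)
   from ibp_expectation[OF E(3)[OF that] this] show ?thesis
    by (simp add: sum_distrib_left sum_distrib_right mult_ac)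
  qed
  have "expectation (%om. Q om ^ Suc n) = expectation (%om. \<Sum>e\<in>E. x (q e) om * (z e om * Q om ^ n))"
  proof -
   have "Q om ^ Suc n = (\<Sum>e\<in>E. x (q e) om * (z e om * Q om ^ n))" for om
    using fun_cong[OF Qz, of om] by (simp add: sum_distrib_right[symmetric] mult.assoc[symmetric])
   then show ?thesis by presburger
  qed
  also have "... = (\<Sum>e\<in>E. expectation (%om. x (q e) om * (z e om * Q om ^ n)))"
   by (intro Bochner_Integration.integral_sum pmom mom_intros mz mQ E)
  also have "... = (\<Sum>e\<in>E. expectation (%om. (\<Sum>e'\<in>E. \<mu> e e' * c (q e) (q e')) * Q om ^ n + 2 * real n * ((\<Sum>f\<in>E. c (q e) (q f) * z e om * z f om) * Q om ^ (n - 1))))"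
   by (intro sum.cong refl st)
  also have "... = expectation (%om. \<Sum>e\<in>E. (\<Sum>e'\<in>E. \<mu> e e' * c (q e) (q e')) * Q om ^ n + 2 * real n * ((\<Sum>f\<in>E. c (q e) (q f) * z e om * z f om) * Q om ^ (n - 1)))"
   by (intro Bochner_Integration.integral_sum[symmetric] pmom mom_intros mz mQ E)
  also have "... = expectation (%om. tr * Q om ^ n + 2 * real n * (Z om * Q om ^ (n - 1)))"
   by (simp add: sum.distrib sum_distrib_left[symmetric] sum_distrib_right[symmetric] tr_def Z_def)
  also have "... <= expectation (%om. (2 * real n + 1) * tr * Q om ^ n)"
  proof (rule expect_mono)
   fix om
   have "real n * (Z om * Q om ^ (n - 1)) <= real n * (tr * Q om * Q om ^ (n - 1))"
    using ZQ Q0 by (intro mult_left_mono mult_right_mono) auto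
   also have "real n * (tr * Q om * Q om ^ (n - 1)) = real n * (tr * Q om ^ n)"
    by (cases n) auto
   finally show "tr * Q om ^ n + 2 * real n * (Z om * Q om ^ (n - 1)) <= (2 * real n + 1) * tr * Q om ^ n"
    by (simp add: algebra_simps)
  qed (intro mom_intros mQ mZ)+
  also have "... = (2 * real n + 1) * tr * expectation (%om. Q om ^ n)" by simp
  also have "... <= (2 * real n + 1) * tr * (gmom n * tr ^ n)"
   using Suc tr0 by (intro mult_left_mono mult_nonneg_nonneg) auto
  finally show ?case by (simp add: gmom_Suc mult_ac)
 qed
 define ES where "ES = expectation (%om. S om ^ (2 * r))"
 \<comment> \<open>The absorbed share of the moment of S is (2 * r - 1) / A = 1/2.\<close>
 define A where "A = 2 * (2 * real r - 1)"
 have A1: "1 <= A" using r by (simp add: A_def)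
 have ibpS: "ibp (p e) S (%om. \<Sum>e'\<in>E. s e' * c (p e) (p e') * x (q e') om)" if "e \<in> E" for e
 proof -
  have "ibp (p e) (%om. \<Sum>e'\<in>E. (s e' * x (p e') om) * x (q e') om) (%om. \<Sum>e'\<in>E. (s e' * c (p e) (p e')) * x (q e') om + (s e' * x (p e') om) * c (p e) (q e'))"
   by (intro ibp_sum ibp_mult ibp_cmult ibp_var E)
  then show ?thesis unfolding S_def[abs_def] using orth[OF that] by (simp cong: sum.cong)
 qed
 have st: "expectation (%om. x (p e) om * ((s e * x (q e) om) * S om ^ (2 * r - 1)))
   = expectation (%om. (2 * real r - 1) * ((\<Sum>e'\<in>E. \<mu> e e' * x (q e) om * x (q e') om) * S om ^ (2 * r - 2)))" if "e \<in> E" for e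
 proof -
  have "ibp (p e) (%om. (s e * x (q e) om) * S om ^ (2 * r - 1)) (%om. (s e * c (p e) (q e)) * S om ^ (2 * r - 1)
    + (s e * x (q e) om) * (real (2 * r - 1) * S om ^ (2 * r - 1 - 1) * (\<Sum>e'\<in>E. s e' * c (p e) (p e') * x (q e') om)))"
   by (intro ibp_mult ibp_power ibp_cmult ibp_var ibpS E that)
  note ex = ibp_expectation[OF E(2)[OF that] this]
  define R where "R = 2 * real r - 1"
  have e: "2 * r - 1 - 1 = 2 * r - 2" "real (2 * r - 1) = R" using r by (auto simp: R_def of_nat_diff)
  show ?thesis unfolding ex e R_def[symmetric]
   by (rule arg_cong[where f = expectation], rule ext) (simp add: orth[OF that that] \<mu>_def sum_distrib_left sum_distrib_right mult_ac)
 qed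
 have "ES = expectation (%om. \<Sum>e\<in>E. x (p e) om * ((s e * x (q e) om) * S om ^ (2 * r - 1)))"
 proof -
  have "S om ^ (2 * r) = (\<Sum>e\<in>E. x (p e) om * ((s e * x (q e) om) * S om ^ (2 * r - 1)))" for om
  proof -
   have "S om * g = (\<Sum>e\<in>E. x (p e) om * ((s e * x (q e) om) * g))" for g
    by (simp add: S_def sum_distrib_left sum_distrib_right mult_ac)
   moreover have "S om ^ (2 * r) = S om * S om ^ (2 * r - 1)" using r by (subst power_Suc[symmetric]) simp
   ultimately show ?thesis by presburger
  qed
  then show ?thesis by (simp add: ES_def)
 qed
 also have "... = (\<Sum>e\<in>E. expectation (%om. x (p e) om * ((s e * x (q e) om) * S om ^ (2 * r - 1))))"
  by (intro Bochner_Integration.integral_sum pmom mom_intros mS E)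
 also have "... = (\<Sum>e\<in>E. expectation (%om. (2 * real r - 1) * ((\<Sum>e'\<in>E. \<mu> e e' * x (q e) om * x (q e') om) * S om ^ (2 * r - 2))))"
  by (intro sum.cong refl st)
 also have "... = expectation (%om. \<Sum>e\<in>E. (2 * real r - 1) * ((\<Sum>e'\<in>E. \<mu> e e' * x (q e) om * x (q e') om) * S om ^ (2 * r - 2)))"
  by (intro Bochner_Integration.integral_sum[symmetric] pmom mom_intros mS E)
 also have "... = expectation (%om. (2 * real r - 1) * (Q om * S om ^ (2 * r - 2)))"
  by (simp add: Q_def sum_distrib_left[symmetric] sum_distrib_right[symmetric])
 also have "... <= expectation (%om. (2 * real r - 1) * ((A * Q om) ^ r + S om ^ (2 * r) / A))"
 proof (rule expect_mono)
  show "(2 * real r - 1) * (Q om * S om ^ (2 * r - 2)) <= (2 * real r - 1) * ((A * Q om) ^ r + S om ^ (2 * r) / A)" for om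
   using r A1 Q0 by (intro mult_left_mono absorb_even) auto
 qed (intro mom_intros mom_divide mS mQ)+
 also have "... = ((2 * real r - 1) * A ^ r) * expectation (%om. Q om ^ r) + ES / 2"
 proof -
  have e: "(2 * real r - 1) * ((A * w) ^ r + f / A) = ((2 * real r - 1) * A ^ r) * w ^ r + (1 / 2) * f" for f w
  proof -
   define R where "R = 2 * real r - 1"
   have "R ~= 0" using r by (simp add: R_def)
   then show ?thesis unfolding A_def R_def[symmetric] by (simp add: power_mult_distrib distrib_left)
  qed
  have "integrable M (%om. Q om ^ r)" "integrable M (%om. S om ^ (2 * r))"
   by (auto intro!: pmom mom_power mQ mS)
  then show ?thesis unfolding e ES_def by simp
 qed
 finally have "ES / 2 <= ((2 * real r - 1) * A ^ r) * expectation (%om. Q om ^ r)" by simp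
 also have "... <= ((2 * real r - 1) * A ^ r) * (gmom r * tr ^ r)"
  using Qmom r A1 by (intro mult_left_mono mult_nonneg_nonneg) auto
 finally have "ES <= 2 * (((2 * real r - 1) * A ^ r) * (gmom r * tr ^ r))" by linarith
 then have "ES <= 2 * (2 * real r - 1) * A ^ r * gmom r * tr ^ r" by (simp only: mult.assoc)
 then show ?thesis unfolding ES_def S_def A_def tr_def \<mu>_def .
qed

end

section \<open>Covariances of fractional increments and the variance of areas\<close>

text \<open>The covariance of two unit increments of fractional Brownian motion at distance r. The
  absolute value matters for r = 0 only.\<close>

definition rho :: "real => nat => real" where
 "rho H r = ((real r + 1) powr (2 * H) + \<bar>real r - 1\<bar> powr (2 * H) - 2 * real r powr (2 * H)) / 2"

lemma midpoint_powr_convex: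
 fixes a b p :: real
 assumes "1 <= p" "0 < a" "0 < b"
 shows "2 * ((a + b) / 2) powr p <= a powr p + b powr p"
proof -
 have "convex_on {0<..} (%x::real. x powr p)" using powr_convex[OF assms(1)] .
 from convex_onD[OF this, of "1/2" a b] assms show ?thesis by (simp add: field_simps)
qed

text \<open>The convex case with exponent 1 / q, applied to a powr q and b powr q.\<close>

lemma midpoint_powr_concave:
 fixes a b q :: real
 assumes "0 < q" "q <= 1" "0 < a" "0 < b"
 shows "a powr q + b powr q <= 2 * ((a + b) / 2) powr q"
proof -
 have "2 * ((a powr q + b powr q) / 2) powr (1 / q) <= (a powr q) powr (1 / q) + (b powr q) powr (1 / q)"
  using assms by (intro midpoint_powr_convex) auto
 also have "... = a + b" using assms by (simp add: powr_powr)
 finally have "((a powr q + b powr q) / 2) powr (1 / q) <= (a + b) / 2" by simp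
 then have "(((a powr q + b powr q) / 2) powr (1 / q)) powr q <= ((a + b) / 2) powr q"
  using assms by (intro powr_mono2) auto
 moreover have "(((a powr q + b powr q) / 2) powr (1 / q)) powr q = (a powr q + b powr q) / 2"
  using assms by (simp add: powr_powr add_pos_pos)
 ultimately show ?thesis by simp
qed

lemma rho_0: "rho H 0 = 1" by (simp add: rho_def)

text \<open>Convexity of the power 2 * H > 1 for distances at least 2, where all arguments are
  positive; the distances 0 and 1 are computed.\<close>

lemma rho_nonneg: assumes "1 / 2 < H" shows "0 <= rho H r"
proof -
 consider "r = 0" | "r = 1" | "2 <= r" by linarith
 then show ?thesis
 proof cases
  case 1 then show ?thesis by (simp add: rho_0)
 next
  case 2
  have "(2::real) powr 1 <= 2 powr (2 * H)" using assms by (intro powr_mono) auto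
  then show ?thesis using 2 by (simp add: rho_def)
 next
  case 3
  have "2 * ((real r + 1 + (real r - 1)) / 2) powr (2 * H) <= (real r + 1) powr (2 * H) + (real r - 1) powr (2 * H)"
   using assms 3 by (intro midpoint_powr_convex) auto
  then show ?thesis using 3 by (simp add: rho_def)
 qed
qed

text \<open>The derivative in r of the second difference of x powr (2 * H) is 2 * H times the second
  difference of x powr (2 * H - 1), which is concave.\<close>

lemma rho_antimono: assumes H: "1 / 2 < H" "H < 1" and "r <= s" shows "rho H s <= rho H r"
proof -
 have "decseq (rho H)"
 proof (rule decseq_SucI)
 fix r
 show "rho H (Suc r) <= rho H r"
 proof (cases "r = 0")
  case True
  have "(2::real) powr (2 * H) <= 2 powr 2" using H by (intro powr_mono) auto
  then show ?thesis using True by (simp add: rho_def)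
 next
  case False
  define f where "f x = (x + 1) powr (2 * H) + (x - 1) powr (2 * H) - 2 * x powr (2 * H)" for x :: real
  have "f (real r) \<ge> f (real r + 1)"
  proof (rule DERIV_nonpos_imp_decreasing_open[where f = f])
   fix x assume x: "real r < x" "x < real r + 1"
   then have x1: "1 < x" using False by linarith
   have "(f has_real_derivative 2 * H * ((x + 1) powr (2 * H - 1) + (x - 1) powr (2 * H - 1) - 2 * x powr (2 * H - 1))) (at x)"
    unfolding f_def using x1 by (auto intro!: derivative_eq_intros simp: algebra_simps)
   moreover have "(x + 1) powr (2 * H - 1) + (x - 1) powr (2 * H - 1) <= 2 * ((x + 1 + (x - 1)) / 2) powr (2 * H - 1)"
    using x1 H by (intro midpoint_powr_concave) auto
   then have "2 * H * ((x + 1) powr (2 * H - 1) + (x - 1) powr (2 * H - 1) - 2 * x powr (2 * H - 1)) <= 0"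
    using H by (intro mult_nonneg_nonpos) auto
   ultimately show "\<exists>y. (f has_real_derivative y) (at x) \<and> y <= 0" by blast
  next
   show "continuous_on {real r..real r + 1} f"
    unfolding f_def using H False by (intro continuous_intros continuous_on_powr') auto
  qed simp
  then show ?thesis using False by (simp add: rho_def f_def add_ac)
 qed
 qed
 then show ?thesis using assms(3) by (rule decseqD)
qed

definition ndist :: "nat => nat => nat" where "ndist p q = (p - q) + (q - p)"

lemma ndist_sym: "ndist p q = ndist q p" by (simp add: ndist_def)

lemma sum_ndist_le:
 fixes g :: "nat => real"
 assumes g: "!!i. 0 <= g i" and k: "k < m"
 shows "(\<Sum>l<m. g (ndist k l)) <= 2 * (\<Sum>i<m. g i)"
proof -
 have e: "{..<m} = {..<k} \<union> {k..<m}" using k by auto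
 have "(\<Sum>l\<in>{..<k} \<union> {k..<m}. g (ndist k l)) = (\<Sum>l<k. g (ndist k l)) + (\<Sum>l\<in>{k..<m}. g (ndist k l))"
  by (rule sum.union_disjoint) auto
 then have "(\<Sum>l<m. g (ndist k l)) = (\<Sum>l<k. g (ndist k l)) + (\<Sum>l\<in>{k..<m}. g (ndist k l))"
  unfolding e[symmetric] .
 moreover have "(\<Sum>l<k. g (ndist k l)) <= (\<Sum>i<m. g i)"
 proof -
  have "(\<Sum>l<k. g (ndist k l)) = sum g ((%l. k - l) ` {..<k})"
   by (subst sum.reindex) (auto simp: inj_on_def ndist_def)
  also have "... <= sum g {..<m}" using k g by (intro sum_mono2) auto
  finally show ?thesis .
 qed
 moreover have "(\<Sum>l\<in>{k..<m}. g (ndist k l)) <= (\<Sum>i<m. g i)"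
 proof -
  have "(\<Sum>l\<in>{k..<m}. g (ndist k l)) = sum g ((%l. l - k) ` {k..<m})"
   by (subst sum.reindex) (auto simp: inj_on_def ndist_def)
  also have "... <= sum g {..<m}" using g by (intro sum_mono2) auto
  finally show ?thesis .
 qed
 ultimately show ?thesis by simp
qed

text \<open>The kernel of the discrete area as a bilinear form in the increments over the
  sub-intervals.\<close>

definition sg :: "nat => nat => real" where
 "sg a b = (if a < b then 1 / 2 else if b < a then - (1 / 2) else 0)"

lemma sum_sg: "(\<Sum>a<N. \<Sum>b<N. sg a b) = 0"
proof -
 have "(\<Sum>a<N. \<Sum>b<N. sg a b) = (\<Sum>b<N. \<Sum>a<N. sg a b)" by (rule sum.swap)
 also have "... = (\<Sum>b<N. \<Sum>a<N. - sg b a)" by (intro sum.cong refl) (auto simp: sg_def)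
 also have "... = - (\<Sum>a<N. \<Sum>b<N. sg a b)" by (simp add: sum_negf)
 finally show ?thesis by simp
qed

text \<open>For two different blocks the distance of the points dominates the distance of
  \<open>N - Suc a\<close> and a', that is, of a block and its mirror image; reflecting the index a
  does not change the full double sum.\<close>

lemma sum_block_le:
 fixes \<rho> :: "nat => real"
 assumes anti: "!!i j. i <= j ==> \<rho> j <= \<rho> i"
 shows "(\<Sum>a<N. \<Sum>a'<N. \<rho> (ndist (k * N + a) (k' * N + a'))) <= (\<Sum>a<N. \<Sum>a'<N. \<rho> (ndist a a'))"
proof -
 have less: "(\<Sum>a<N. \<Sum>a'<N. \<rho> (ndist (k * N + a) (k' * N + a'))) <= (\<Sum>a<N. \<Sum>a'<N. \<rho> (ndist a a'))" if "k < k'" for k k'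
 proof -
  have kk: "k * N + N <= k' * N" using that mult_le_mono1[of "Suc k" k' N] by simp
  have "(\<Sum>a<N. \<Sum>a'<N. \<rho> (ndist (k * N + a) (k' * N + a'))) <= (\<Sum>a<N. \<Sum>a'<N. \<rho> (ndist (N - Suc a) a'))"
   using kk by (intro sum_mono anti) (auto simp: ndist_def)
  also have "... = (\<Sum>a<N. \<Sum>a'<N. \<rho> (ndist a a'))" by (rule sum.nat_diff_reindex)
  finally show ?thesis .
 qed
 consider "k < k'" | "k = k'" | "k' < k" by linarith
 then show ?thesis
 proof cases
  case 2 then show ?thesis by (simp add: ndist_def)
 next
  case 3
  have "(\<Sum>a<N. \<Sum>a'<N. \<rho> (ndist (k * N + a) (k' * N + a'))) = (\<Sum>a<N. \<Sum>a'<N. \<rho> (ndist (k' * N + a) (k * N + a')))"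
   by (subst sum.swap) (simp add: ndist_sym)
  then show ?thesis using less[OF 3] by simp
 qed (use less in auto)
qed

text \<open>Antisymmetry of \<open>sg\<close> lets one subtract a constant from the product of the kernels on a pair of distant
 blocks; what remains telescopes over the distance of the blocks.\<close>

lemma area_variance:
 fixes \<rho>1 \<rho>2 :: "nat => real"
 assumes anti: "!!i j. i <= j ==> \<rho>1 j <= \<rho>1 i" "!!i j. i <= j ==> \<rho>2 j <= \<rho>2 i"
  and nn: "!!i. 0 <= \<rho>1 i" "!!i. 0 <= \<rho>2 i"
  and \<sigma>: "\<sigma>1 = (\<Sum>a<N. \<Sum>a'<N. \<rho>1 (ndist a a'))" "\<sigma>2 = (\<Sum>a<N. \<Sum>a'<N. \<rho>2 (ndist a a'))"
 shows "(\<Sum>k\<in>{p..<q}. \<Sum>a<N. \<Sum>b<N. \<Sum>k'\<in>{p..<q}. \<Sum>a'<N. \<Sum>b'<N. sg a b * sg a' b' *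
      \<rho>1 (ndist (k * N + a) (k' * N + a')) * \<rho>2 (ndist (k * N + b) (k' * N + b'))) <= 2 * real (q - p) * \<sigma>1 * \<sigma>2"
proof -
 define inner where "inner k k' = (\<Sum>a<N. \<Sum>b<N. \<Sum>a'<N. \<Sum>b'<N. sg a b * sg a' b' *
      \<rho>1 (ndist (k * N + a) (k' * N + a')) * \<rho>2 (ndist (k * N + b) (k' * N + b')))" for k k'
 have s0: "0 <= \<sigma>1" "0 <= \<sigma>2" unfolding \<sigma> by (auto intro!: sum_nonneg nn)
 have sgb: "\<bar>sg a b * sg a' b'\<bar> <= 1 / 4" for a b a' b' by (auto simp: sg_def)
 \<comment> \<open>If two blocks are \<kappa> >= 2 apart, all distances between their points lie
   between (\<kappa> - 1) * N and (\<kappa> + 1) * N, so the product of the kernels varies between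
   \<open>u (\<kappa> + 1)\<close> and \<open>u (\<kappa> - 1)\<close>. Equal and neighbouring
   blocks are estimated by absolute values.\<close>
 define u where "u j = \<rho>1 (j * N) * \<rho>2 (j * N)" for j
 define g where "g \<kappa> = (if \<kappa> < 2 then \<sigma>1 * \<sigma>2 / 4 else real N ^ 4 * (u (\<kappa> - 1) - u (\<kappa> + 1)) / 4)" for \<kappa>
 have u_anti: "i <= j ==> u j <= u i" for i j
  unfolding u_def using nn by (intro mult_mono anti) auto
 have g0: "0 <= g \<kappa>" for \<kappa> using s0 u_anti[of "\<kappa> - 1" "\<kappa> + 1"] by (auto simp: g_def)
 have near: "\<bar>inner k k'\<bar> <= \<sigma>1 * \<sigma>2 / 4" for k k'
 proof -
  have "\<bar>inner k k'\<bar> <= (\<Sum>a<N. \<Sum>b<N. \<Sum>a'<N. \<Sum>b'<N. 1 / 4 * (\<rho>1 (ndist (k * N + a) (k' * N + a')) * \<rho>2 (ndist (k * N + b) (k' * N + b'))))"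
   unfolding inner_def
  proof (intro order_trans[OF sum_abs] sum_mono)
   fix a b a' b'
   show "\<bar>sg a b * sg a' b' * \<rho>1 (ndist (k * N + a) (k' * N + a')) * \<rho>2 (ndist (k * N + b) (k' * N + b'))\<bar>
    <= 1 / 4 * (\<rho>1 (ndist (k * N + a) (k' * N + a')) * \<rho>2 (ndist (k * N + b) (k' * N + b')))"
    unfolding mult.assoc[of "sg a b * sg a' b'"] abs_mult[of "sg a b * sg a' b'"]
    using sgb[of a b a' b'] nn by (intro mult_mono) (auto simp: abs_mult)
  qed
  also have "... = 1 / 4 * ((\<Sum>a<N. \<Sum>a'<N. \<rho>1 (ndist (k * N + a) (k' * N + a'))) * (\<Sum>b<N. \<Sum>b'<N. \<rho>2 (ndist (k * N + b) (k' * N + b'))))"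
  proof -
   have "(\<Sum>a<N. \<Sum>b<N. \<Sum>a'<N. \<Sum>b'<N. f a a' * h b b') = (\<Sum>a<N. \<Sum>a'<N. f a a') * (\<Sum>b<N. \<Sum>b'<N. h b b')" for f h :: "nat => nat => real"
    by (simp only: sum_product[symmetric])
   from this[of "%a a'. 1 / 4 * \<rho>1 (ndist (k * N + a) (k' * N + a'))" "%b b'. \<rho>2 (ndist (k * N + b) (k' * N + b'))"]
   show ?thesis by (simp add: sum_distrib_left[symmetric] mult.assoc sum_divide_distrib[symmetric])
  qed
  also have "... <= 1 / 4 * (\<sigma>1 * \<sigma>2)"
   unfolding \<sigma> using nn by (intro mult_left_mono mult_mono sum_block_le anti sum_nonneg) auto
  finally show ?thesis by simp
 qed
 have far: "\<bar>inner k k'\<bar> <= real N ^ 4 * (u (\<kappa> - 1) - u (\<kappa> + 1)) / 4"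
  if \<kappa>: "ndist k k' = \<kappa>" "2 <= \<kappa>" for k k' \<kappa>
 proof -
  let ?X = "%a b a' b'. \<rho>1 (ndist (k * N + a) (k' * N + a')) * \<rho>2 (ndist (k * N + b) (k' * N + b'))"
  have nd: "(\<kappa> - 1) * N <= ndist (k * N + a) (k' * N + a')" "ndist (k * N + a) (k' * N + a') <= (\<kappa> + 1) * N" if "a < N" "a' < N" for a a'
  proof -
   have "k' = k + \<kappa> \<or> k = k' + \<kappa>" using \<kappa> by (auto simp: ndist_def split: if_splits)
   moreover have "(\<kappa> - 1) * N + N = \<kappa> * N" using \<kappa> by (cases \<kappa>) auto
   ultimately show "(\<kappa> - 1) * N <= ndist (k * N + a) (k' * N + a')" "ndist (k * N + a) (k' * N + a') <= (\<kappa> + 1) * N"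
    using that by (auto simp: ndist_def add_mult_distrib)
  qed
  have X: "u (\<kappa> + 1) <= ?X a b a' b'" "?X a b a' b' <= u (\<kappa> - 1)" if "a < N" "b < N" "a' < N" "b' < N" for a b a' b'
   unfolding u_def using that nn nd by (auto intro!: mult_mono anti)
  have "(\<Sum>a<N. \<Sum>b<N. \<Sum>a'<N. \<Sum>b'<N. sg a b * sg a' b' * u (\<kappa> + 1)) = (\<Sum>a<N. \<Sum>b<N. sg a b) * ((\<Sum>a'<N. \<Sum>b'<N. sg a' b') * u (\<kappa> + 1))"
   by (simp add: sum_distrib_left sum_distrib_right mult_ac)
  then have z: "(\<Sum>a<N. \<Sum>b<N. \<Sum>a'<N. \<Sum>b'<N. sg a b * sg a' b' * u (\<kappa> + 1)) = 0" by (simp add: sum_sg)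
  have "inner k k' = (\<Sum>a<N. \<Sum>b<N. \<Sum>a'<N. \<Sum>b'<N. sg a b * sg a' b' * ?X a b a' b') - (\<Sum>a<N. \<Sum>b<N. \<Sum>a'<N. \<Sum>b'<N. sg a b * sg a' b' * u (\<kappa> + 1))"
   unfolding z by (simp add: inner_def mult.assoc)
  also have "... = (\<Sum>a<N. \<Sum>b<N. \<Sum>a'<N. \<Sum>b'<N. sg a b * sg a' b' * (?X a b a' b' - u (\<kappa> + 1)))"
   by (simp only: sum_subtractf[symmetric] right_diff_distrib)
  finally have eq: "inner k k' = (\<Sum>a<N. \<Sum>b<N. \<Sum>a'<N. \<Sum>b'<N. sg a b * sg a' b' * (?X a b a' b' - u (\<kappa> + 1)))" .
  have "\<bar>inner k k'\<bar> <= (\<Sum>a<N. \<Sum>b<N. \<Sum>a'<N. \<Sum>b'<N. 1 / 4 * (u (\<kappa> - 1) - u (\<kappa> + 1)))"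
   unfolding eq
  proof (intro order_trans[OF sum_abs] sum_mono)
   fix a b a' b' assume "a \<in> {..<N}" "b \<in> {..<N}" "a' \<in> {..<N}" "b' \<in> {..<N}"
   then have "\<bar>?X a b a' b' - u (\<kappa> + 1)\<bar> <= u (\<kappa> - 1) - u (\<kappa> + 1)" using X[of a b a' b'] by auto
   then show "\<bar>sg a b * sg a' b' * (?X a b a' b' - u (\<kappa> + 1))\<bar> <= 1 / 4 * (u (\<kappa> - 1) - u (\<kappa> + 1))"
    unfolding abs_mult[of "sg a b * sg a' b'"] using sgb[of a b a' b'] by (intro mult_mono) auto
  qed
  also have "... = real N ^ 4 * (u (\<kappa> - 1) - u (\<kappa> + 1)) / 4" by (simp add: power4_eq_xxxx)
  finally show ?thesis .
 qed
 have ig: "\<bar>inner k k'\<bar> <= g (ndist k k')" for k k'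
  using near[of k k'] far[of k k' "ndist k k'"] by (auto simp: g_def)
 have Nu: "real N ^ 4 * u 1 <= \<sigma>1 * \<sigma>2"
 proof -
  have b: "real N ^ 2 * \<rho> N <= (\<Sum>a<N. \<Sum>a'<N. \<rho> (ndist a a'))" if "!!i j. i <= j ==> \<rho> j <= \<rho> i" for \<rho> :: "nat => real"
  proof -
   have "(\<Sum>a<N. \<Sum>a'<N. \<rho> N) <= (\<Sum>a<N. \<Sum>a'<N. \<rho> (ndist a a'))"
    by (intro sum_mono that) (auto simp: ndist_def)
   then show ?thesis by (simp add: power2_eq_square mult.assoc)
  qed
  have "(real N ^ 2 * \<rho>1 N) * (real N ^ 2 * \<rho>2 N) <= \<sigma>1 * \<sigma>2"
   using b[of \<rho>1] b[of \<rho>2] anti nn s0 unfolding \<sigma> by (intro mult_mono) auto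
  then show ?thesis by (simp add: u_def power2_eq_square power4_eq_xxxx mult_ac)
 qed
 \<comment> \<open>The far terms telescope with step 2, so their total is controlled by
   \<open>u 1\<close> and \<open>u 2\<close>, and \<open>Nu\<close> bounds these by the block
   variances. The bound does not grow with n: long range correlation costs only a constant.\<close>
 have gs: "(\<Sum>\<kappa><n. g \<kappa>) <= \<sigma>1 * \<sigma>2" for n
 proof -
  have "(\<Sum>\<kappa><n + 2. g \<kappa>) = \<sigma>1 * \<sigma>2 / 2 + real N ^ 4 * (u 1 + u 2 - u (n + 1) - u (n + 2)) / 4"
  proof (induction n)
   case 0
   then show ?case by (simp add: g_def numeral_2_eq_2)
  next
   case (Suc n)
   have "(\<Sum>\<kappa><Suc n + 2. g \<kappa>) = (\<Sum>\<kappa><n + 2. g \<kappa>) + g (n + 2)" by simp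
   also have "g (n + 2) = real N ^ 4 * (u (n + 1) - u (n + 3)) / 4" by (simp add: g_def numeral_3_eq_3)
   finally show ?case unfolding Suc by (simp add: algebra_simps numeral_3_eq_3 diff_divide_distrib add_divide_distrib)
  qed
  also have "... <= \<sigma>1 * \<sigma>2 / 2 + real N ^ 4 * (u 1 + u 1) / 4"
  proof -
   have "u 1 + u 2 - u (n + 1) - u (n + 2) <= u 1 + u 1"
    using u_anti[of 1 2] mult_nonneg_nonneg[OF nn(1) nn(2), of "(n + 1) * N" "(n + 1) * N"] mult_nonneg_nonneg[OF nn(1) nn(2), of "(n + 2) * N" "(n + 2) * N"]
    unfolding u_def[of "n + 1"] u_def[of "n + 2"] by linarith
   then show ?thesis by (intro add_left_mono divide_right_mono mult_left_mono) auto
  qed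
  also have "real N ^ 4 * (u 1 + u 1) / 4 = (real N ^ 4 * u 1) / 2" by simp
  also have "\<sigma>1 * \<sigma>2 / 2 + (real N ^ 4 * u 1) / 2 <= \<sigma>1 * \<sigma>2" using Nu by linarith
  finally have "(\<Sum>\<kappa><n + 2. g \<kappa>) <= \<sigma>1 * \<sigma>2" .
  moreover have "(\<Sum>\<kappa><n. g \<kappa>) <= (\<Sum>\<kappa><n + 2. g \<kappa>)" using g0 by (intro sum_mono2) auto
  ultimately show ?thesis by simp
 qed
 have row: "(\<Sum>k'\<in>{p..<q}. \<bar>inner k k'\<bar>) <= 2 * (\<sigma>1 * \<sigma>2)" if "k \<in> {p..<q}" for k
 proof -
  have "(\<Sum>k'\<in>{p..<q}. \<bar>inner k k'\<bar>) <= (\<Sum>k'\<in>{p..<q}. g (ndist k k'))" by (intro sum_mono ig)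
  also have "... <= (\<Sum>k'<q. g (ndist k k'))" using g0 by (intro sum_mono2) auto
  also have "... <= 2 * (\<Sum>i<q. g i)" using that g0 by (intro sum_ndist_le) auto
  also have "... <= 2 * (\<sigma>1 * \<sigma>2)" using gs[of q] by simp
  finally show ?thesis .
 qed
 have "(\<Sum>k\<in>{p..<q}. \<Sum>a<N. \<Sum>b<N. \<Sum>k'\<in>{p..<q}. \<Sum>a'<N. \<Sum>b'<N. sg a b * sg a' b' *
      \<rho>1 (ndist (k * N + a) (k' * N + a')) * \<rho>2 (ndist (k * N + b) (k' * N + b'))) = (\<Sum>k\<in>{p..<q}. \<Sum>k'\<in>{p..<q}. inner k k')"
 proof (rule sum.cong[OF refl])
  fix k
  let ?f = "%a b k' a' b'. sg a b * sg a' b' * \<rho>1 (ndist (k * N + a) (k' * N + a')) * \<rho>2 (ndist (k * N + b) (k' * N + b'))"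
  have "(\<Sum>a<N. \<Sum>b<N. \<Sum>k'\<in>{p..<q}. \<Sum>a'<N. \<Sum>b'<N. ?f a b k' a' b') = (\<Sum>a<N. \<Sum>k'\<in>{p..<q}. \<Sum>b<N. \<Sum>a'<N. \<Sum>b'<N. ?f a b k' a' b')"
   by (rule sum.cong[OF refl], rule sum.swap)
  also have "... = (\<Sum>k'\<in>{p..<q}. \<Sum>a<N. \<Sum>b<N. \<Sum>a'<N. \<Sum>b'<N. ?f a b k' a' b')" by (rule sum.swap)
  finally show "(\<Sum>a<N. \<Sum>b<N. \<Sum>k'\<in>{p..<q}. \<Sum>a'<N. \<Sum>b'<N. ?f a b k' a' b') = (\<Sum>k'\<in>{p..<q}. inner k k')"
   by (simp add: inner_def)
 qed
 also have "... <= (\<Sum>k\<in>{p..<q}. \<Sum>k'\<in>{p..<q}. \<bar>inner k k'\<bar>)" by (intro sum_mono) auto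
 also have "... <= (\<Sum>k\<in>{p..<q}. 2 * (\<sigma>1 * \<sigma>2))" by (intro sum_mono row)
 also have "... = 2 * real (q - p) * \<sigma>1 * \<sigma>2" by simp
 finally show ?thesis .
qed

section \<open>Hoelder bounds for random sums over the grid\<close>

definition chainc :: "real => real" where "chainc tht = 2 * 2 powr tht / (2 powr tht - 1)"

lemma chainc_pos: "0 < tht ==> 0 < chainc tht"
 unfolding chainc_def by (intro divide_pos_pos) auto

text \<open>The random constant is \<open>chainc tht * n powr tht * Z0\<close>, where \<open>Z0 ^ (2 * r)\<close> is the sum over all dyadic
 increments of the grid of their normalised powers.\<close>

lemma kolmogorov_grid:
 fixes S :: "nat => 'w => real"
 assumes M: "prob_space M" and S: "!!k. k <= n ==> S k \<in> borel_measurable M" and n: "1 <= n" and r: "1 <= r"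
  and tht: "0 < tht" "tht < tht0" "2 <= 2 * real r * (tht0 - tht)" and K: "0 <= K"
  and mom: "!!k l. k <= l ==> l <= n ==> (\<integral>\<^sup>+om. ennreal ((S l om - S k om) ^ (2 * r)) \<partial>M) <= ennreal (K * (real (l - k) / real n) powr (2 * real r * tht0))"
 shows "\<exists>Z. Z \<in> borel_measurable M \<and> (\<forall>om. 0 <= Z om) \<and>
   (\<forall>om. \<forall>k l. k <= l --> l <= n --> \<bar>S l om - S k om\<bar> <= Z om * (real (l - k) / real n) powr tht) \<and>
   (\<integral>\<^sup>+om. ennreal (Z om ^ (2 * r)) \<partial>M) <= ennreal (chainc tht ^ (2 * r) * 2 powr (2 * real r * (tht0 - tht) + 1) * K)"
proof -
 obtain L where L: "n <= 2 ^ L" "2 ^ L < 2 * n"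
 proof (cases "n = 1")
  case True
  then show ?thesis using that[of 0] by simp
 next
  case False
  then have "\<exists>L. 2 ^ L < n \<and> n <= 2 ^ (L + 1)" using n ex_power_ivl2[of 2 n] by simp
  then obtain L where "2 ^ L < n" "n <= 2 ^ (L + 1)" by blast
  then show ?thesis using that[of "L + 1"] by simp
 qed
 define S' where "S' k om = S (min k n) om" for k om
 have S'm[measurable]: "S' k \<in> borel_measurable M" for k using S[of "min k n"] by (simp add: S'_def[abs_def])
 define D where "D i j om = S' ((i + 1) * 2 ^ j) om - S' (i * 2 ^ j) om" for i j om
 have Dm[measurable]: "D i j \<in> borel_measurable M" for i j unfolding D_def[abs_def] by measurable
 define W where "W om = (\<Sum>j\<le>L. \<Sum>i<2 ^ (L - j). D i j om ^ (2 * r) * 2 powr (- (real j * tht * real (2 * r))))" for om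
 have Wm[measurable]: "W \<in> borel_measurable M" unfolding W_def[abs_def] by measurable
 have W0: "0 <= W om" for om unfolding W_def by (intro sum_nonneg mult_nonneg_nonneg) (auto simp: power_mult)
 define Z0 where "Z0 om = W om powr (1 / real (2 * r))" for om
 have Z0m[measurable]: "Z0 \<in> borel_measurable M" unfolding Z0_def[abs_def] by measurable
 have Z0p: "Z0 om ^ (2 * r) = W om" for om
  using r W0[of om] by (cases "W om = 0") (auto simp: Z0_def powr_realpow[symmetric] powr_powr power_0_left)
 have Z00: "0 <= Z0 om" for om by (simp add: Z0_def)
 \<comment> \<open>Inside the range of \<open>W\<close> one summand is compared with the whole sum.
   Outside, the increment is 0 or, for i = 0 and j > L, equals the one at level L, since
   \<open>S'\<close> is constant from n on.\<close>
 have DZ: "\<bar>D i j om\<bar> <= Z0 om * 2 powr (real j * tht)" for i j om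
 proof -
  have main: "\<bar>D i j om\<bar> <= Z0 om * 2 powr (real j * tht)" if "j <= L" "i < 2 ^ (L - j)" for i j
  proof -
   have "D i j om ^ (2 * r) * 2 powr (- (real j * tht * real (2 * r))) <= (\<Sum>i<2 ^ (L - j). D i j om ^ (2 * r) * 2 powr (- (real j * tht * real (2 * r))))"
    using that by (intro member_le_sum[where i = i and f = "%i. D i j om ^ (2 * r) * 2 powr (- (real j * tht * real (2 * r)))"]) (auto simp: power_mult)
   also have "... <= W om" unfolding W_def
    using that by (intro member_le_sum[where i = j and f = "%j. \<Sum>i<2 ^ (L - j). D i j om ^ (2 * r) * 2 powr (- (real j * tht * real (2 * r)))"]) (auto intro!: sum_nonneg simp: power_mult)
   finally have "D i j om ^ (2 * r) <= Z0 om ^ (2 * r) * 2 powr (real j * tht * real (2 * r))"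
    unfolding Z0p by (simp add: powr_minus field_simps)
   also have "2 powr (real j * tht * real (2 * r)) = (2 powr (real j * tht)) ^ (2 * r)"
    by (simp add: powr_realpow[symmetric] powr_powr)
   finally have "\<bar>D i j om\<bar> ^ (2 * r) <= (Z0 om * 2 powr (real j * tht)) ^ (2 * r)"
    by (simp add: power_mult_distrib power_even_abs)
   then show ?thesis using r Z00[of om] by (subst (asm) power_mono_iff) auto
  qed
  show ?thesis
  proof (cases "j <= L")
   case True
   show ?thesis
   proof (cases "i < 2 ^ (L - j)")
    case False
    then have "2 ^ (L - j) * 2 ^ j <= i * (2 ^ j :: nat)" by (intro mult_right_mono) auto
    then have "2 ^ L <= i * 2 ^ j" using True by (simp add: power_add[symmetric])
    then have "n <= i * 2 ^ j" using L by linarith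
    then have "D i j om = 0" by (simp add: D_def S'_def min_def)
    then show ?thesis using Z00[of om] by simp
   qed (use main True in auto)
  next
   case False
   then have jL: "2 ^ L <= (2 ^ j :: nat)" by (intro power_increasing) auto
   then have nj: "n <= 2 ^ j" using L by linarith
   show ?thesis
   proof (cases "i = 0")
    case True
    have "D 0 j om = D 0 L om" using nj L by (simp add: D_def S'_def min_def)
    also have "\<bar>...\<bar> <= Z0 om * 2 powr (real L * tht)" by (rule main) auto
    also have "... <= Z0 om * 2 powr (real j * tht)"
     using False tht Z00[of om] by (intro mult_left_mono powr_mono mult_right_mono) auto
    finally show ?thesis using True by simp
   next
    case False
    then have "n <= i * 2 ^ j" using nj by (metis One_nat_def Suc_leI le_trans mult_le_mono1 nat_mult_1 not_gr_zero)
    then have "D i j om = 0" by (simp add: D_def S'_def min_def)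
    then show ?thesis using Z00[of om] by simp
   qed
  qed
 qed
 have hold: "\<bar>S l om - S k om\<bar> <= chainc tht * real n powr tht * Z0 om * (real (l - k) / real n) powr tht" if "k <= l" "l <= n" for k l om
 proof -
  have "norm (S' l om - S' k om) <= 2 * 2 powr tht / (2 powr tht - 1) * Z0 om * real (l - k) powr tht"
   using DZ Z00 tht that by (intro dyadic_chain) (auto simp: D_def)
  also have "real (l - k) powr tht = real n powr tht * (real (l - k) / real n) powr tht"
   using n by (simp add: powr_divide)
  finally show ?thesis using that by (simp add: S'_def min_def chainc_def mult_ac)
 qed
 let ?e = "2 * real r * (tht0 - tht)"
 have DE: "(\<integral>\<^sup>+om. ennreal (D i j om ^ (2 * r)) \<partial>M) <= ennreal (K * (2 ^ j / real n) powr (2 * real r * tht0))" for i j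
 proof -
  have "(\<integral>\<^sup>+om. ennreal (D i j om ^ (2 * r)) \<partial>M) <= ennreal (K * (real (min ((i + 1) * 2 ^ j) n - min (i * 2 ^ j) n) / real n) powr (2 * real r * tht0))"
   unfolding D_def S'_def by (rule mom) auto
  also have "... <= ennreal (K * (2 ^ j / real n) powr (2 * real r * tht0))"
  proof (intro ennreal_leI mult_left_mono powr_mono2 divide_right_mono)
   have "min ((i + 1) * 2 ^ j) n - min (i * 2 ^ j) n <= 2 ^ j" by auto
   then have "real (min ((i + 1) * 2 ^ j) n - min (i * 2 ^ j) n) <= real (2 ^ j)" by (simp only: of_nat_le_iff)
   then show "real (min ((i + 1) * 2 ^ j) n - min (i * 2 ^ j) n) <= 2 ^ j" by simp
  qed (use K tht n in auto)
  finally show ?thesis .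
 qed
 \<comment> \<open>Level j has 2 ^ (L - j) increments, each contributing the power \<open>?e\<close>
   of the ratio 2 ^ j / n. Since \<open>?e\<close> is at least 2 and the ratio at most 2, the power
   may be replaced by the square up to a constant, and the sum over j becomes geometric.\<close>
 have term_bound: "2 ^ (L - j) * (K * (2 ^ j / real n) powr (2 * real r * tht0) * (real n powr tht) ^ (2 * r) * 2 powr (- (real j * tht * real (2 * r)))) <= K * 2 powr (?e - 2) * (2 ^ L * 2 ^ j / (real n)\<^sup>2)"
  if "j <= L" for j
 proof -
  define x where "x = 2 ^ j / real n"
  have x: "0 < x" using n by (simp add: x_def)
  have "2 ^ j <= (2 ^ L :: real)" using that by (intro power_increasing) auto
  also have "(2 ^ L :: real) < 2 * real n" using L(2) by (metis of_nat_less_iff of_nat_mult of_nat_numeral of_nat_power)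
  finally have x2: "x / 2 <= 1" using n by (simp add: x_def field_simps)
  have "(real n powr tht) ^ (2 * r) * 2 powr (- (real j * tht * real (2 * r))) = x powr (- (tht * real (2 * r)))"
   using n by (simp add: x_def powr_divide powr_minus powr_realpow[symmetric] powr_powr field_simps)
  then have "K * x powr (2 * real r * tht0) * (real n powr tht) ^ (2 * r) * 2 powr (- (real j * tht * real (2 * r))) = K * (x powr (2 * real r * tht0) * x powr (- (tht * real (2 * r))))"
   by (simp add: mult.assoc)
  also have "x powr (2 * real r * tht0) * x powr (- (tht * real (2 * r))) = x powr ?e"
   by (simp add: powr_add[symmetric] algebra_simps)
  also have "x powr ?e = (x / 2) powr ?e * 2 powr ?e" using x by (simp add: powr_divide)
  also have "... <= (x / 2) powr 2 * 2 powr ?e"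
  proof (intro mult_right_mono)
   show "(x / 2) powr ?e <= (x / 2) powr 2" using powr_mono'[of 2 ?e "x / 2"] x x2 tht(3) by auto
  qed auto
  also have "... = x\<^sup>2 * 2 powr (?e - 2)" using x by (simp add: powr_divide powr_diff)
  finally have "K * x powr (2 * real r * tht0) * (real n powr tht) ^ (2 * r) * 2 powr (- (real j * tht * real (2 * r))) <= K * (x\<^sup>2 * 2 powr (?e - 2))"
   using K by (simp add: mult_left_mono)
  then have "2 ^ (L - j) * (K * x powr (2 * real r * tht0) * (real n powr tht) ^ (2 * r) * 2 powr (- (real j * tht * real (2 * r)))) <= 2 ^ (L - j) * (K * (x\<^sup>2 * 2 powr (?e - 2)))"
   by (intro mult_left_mono) auto
  also have "... = K * 2 powr (?e - 2) * (2 ^ (L - j) * 2 ^ j * 2 ^ j / (real n)\<^sup>2)"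
   by (simp add: x_def power2_eq_square)
  also have "2 ^ (L - j) * 2 ^ j = (2 ^ L :: real)" using that by (simp add: power_add[symmetric])
  finally show ?thesis by (simp add: x_def)
 qed
 define c where "c = chainc tht ^ (2 * r)"
 have c0: "0 <= c" using chainc_pos[OF tht(1)] by (simp add: c_def)
 define Z where "Z om = chainc tht * real n powr tht * Z0 om" for om
 have "(\<integral>\<^sup>+om. ennreal (Z om ^ (2 * r)) \<partial>M) = (\<integral>\<^sup>+om. (\<Sum>j\<le>L. \<Sum>i<2 ^ (L - j). ennreal (c * (real n powr tht) ^ (2 * r) * 2 powr (- (real j * tht * real (2 * r)))) * ennreal (D i j om ^ (2 * r))) \<partial>M)"
 proof (intro nn_integral_cong)
  fix om
  have "Z om ^ (2 * r) = (\<Sum>j\<le>L. \<Sum>i<2 ^ (L - j). (c * (real n powr tht) ^ (2 * r) * 2 powr (- (real j * tht * real (2 * r)))) * D i j om ^ (2 * r))"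
   unfolding Z_def power_mult_distrib Z0p c_def W_def sum_distrib_left by (simp add: mult_ac)
  moreover have "0 <= D i j om ^ (2 * r)" for i j by (simp add: power_mult)
  ultimately show "ennreal (Z om ^ (2 * r)) = (\<Sum>j\<le>L. \<Sum>i<2 ^ (L - j). ennreal (c * (real n powr tht) ^ (2 * r) * 2 powr (- (real j * tht * real (2 * r)))) * ennreal (D i j om ^ (2 * r)))"
   using c0 by (simp add: sum_ennreal[symmetric] ennreal_mult[symmetric] sum_nonneg del: sum_ennreal)
 qed
 also have "... = (\<Sum>j\<le>L. \<Sum>i<2 ^ (L - j). ennreal (c * (real n powr tht) ^ (2 * r) * 2 powr (- (real j * tht * real (2 * r)))) * (\<integral>\<^sup>+om. ennreal (D i j om ^ (2 * r)) \<partial>M))"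
  by (subst nn_integral_sum, measurable, intro sum.cong refl, subst nn_integral_sum, measurable, intro sum.cong refl nn_integral_cmult, measurable)
 also have "... <= (\<Sum>j\<le>L. \<Sum>i<2 ^ (L - j) :: nat. ennreal (c * (real n powr tht) ^ (2 * r) * 2 powr (- (real j * tht * real (2 * r)))) * ennreal (K * (2 ^ j / real n) powr (2 * real r * tht0)))"
  by (intro sum_mono mult_left_mono DE) auto
 also have "... = ennreal (\<Sum>j\<le>L. \<Sum>i<2 ^ (L - j) :: nat. (c * (real n powr tht) ^ (2 * r) * 2 powr (- (real j * tht * real (2 * r)))) * (K * (2 ^ j / real n) powr (2 * real r * tht0)))"
  using c0 K by (simp add: sum_ennreal[symmetric] ennreal_mult[symmetric] sum_nonneg del: sum_ennreal sum_constant)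
 also have "... <= ennreal (c * (\<Sum>j\<le>L. K * 2 powr (?e - 2) * (2 ^ L * 2 ^ j / (real n)\<^sup>2)))"
 proof (rule ennreal_leI)
  have "(\<Sum>j\<le>L. \<Sum>i<2 ^ (L - j) :: nat. (c * (real n powr tht) ^ (2 * r) * 2 powr (- (real j * tht * real (2 * r)))) * (K * (2 ^ j / real n) powr (2 * real r * tht0)))
   = c * (\<Sum>j\<le>L. 2 ^ (L - j) * (K * (2 ^ j / real n) powr (2 * real r * tht0) * (real n powr tht) ^ (2 * r) * 2 powr (- (real j * tht * real (2 * r)))))"
   unfolding sum_distrib_left by (intro sum.cong refl) (simp add: mult_ac)
  also have "... <= c * (\<Sum>j\<le>L. K * 2 powr (?e - 2) * (2 ^ L * 2 ^ j / (real n)\<^sup>2))"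
   using c0 by (intro mult_left_mono sum_mono term_bound) auto
  finally show "(\<Sum>j\<le>L. \<Sum>i<2 ^ (L - j) :: nat. (c * (real n powr tht) ^ (2 * r) * 2 powr (- (real j * tht * real (2 * r)))) * (K * (2 ^ j / real n) powr (2 * real r * tht0)))
    <= c * (\<Sum>j\<le>L. K * 2 powr (?e - 2) * (2 ^ L * 2 ^ j / (real n)\<^sup>2))" .
 qed
 also have "c * (\<Sum>j\<le>L. K * 2 powr (?e - 2) * (2 ^ L * 2 ^ j / (real n)\<^sup>2)) <= c * 2 powr (?e + 1) * K"
 proof -
  have g: "(\<Sum>j\<le>L. 2 ^ j) = (2 * 2 ^ L - 1 :: real)" by (induction L) auto
  have "(\<Sum>j\<le>L. K * 2 powr (?e - 2) * (2 ^ L * 2 ^ j / (real n)\<^sup>2)) = K * 2 powr (?e - 2) * (2 ^ L * (\<Sum>j\<le>L. 2 ^ j) / (real n)\<^sup>2)"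
   by (simp add: sum_distrib_left sum_divide_distrib)
  also have "... <= K * 2 powr (?e - 2) * 8"
  proof (intro mult_left_mono)
   have "(2 ^ L :: real) <= 2 * real n" using L(2) by (metis less_imp_le of_nat_le_iff of_nat_mult of_nat_numeral of_nat_power)
   moreover have o: "(0::real) <= 2 * 2 ^ L - 1" using one_le_power[of "2::real" L] by linarith
   ultimately have "2 ^ L * (\<Sum>j\<le>L. 2 ^ j) <= (2 * real n) * (2 * (2 * real n))" unfolding g using o by (intro mult_mono) auto
   then show "2 ^ L * (\<Sum>j\<le>L. 2 ^ j) / (real n)\<^sup>2 <= 8" using n by (simp add: field_simps power2_eq_square)
  qed (use K in auto)
  also have "... = 2 powr (?e + 1) * K" by (simp add: powr_add powr_diff)
  finally show ?thesis using c0 by (simp add: mult_left_mono mult.assoc)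
 qed
 finally have fin: "(\<integral>\<^sup>+om. ennreal (Z om ^ (2 * r)) \<partial>M) <= ennreal (c * 2 powr (?e + 1) * K)"
  by (simp add: ennreal_leI)
 show ?thesis
 proof (intro exI[of _ Z] conjI)
  show "Z \<in> borel_measurable M" unfolding Z_def[abs_def] by measurable
  show "\<forall>om. 0 <= Z om" using Z00 chainc_pos[OF tht(1)] by (simp add: Z_def)
  show "\<forall>om k l. k <= l --> l <= n --> \<bar>S l om - S k om\<bar> <= Z om * (real (l - k) / real n) powr tht"
   using hold by (simp add: Z_def)
 qed (use fin in \<open>simp add: c_def\<close>)
qed

section \<open>Moments of areas and cubes of the driver\<close>

lemma iter_area_eq:
 fixes b :: "nat => real => real"
 shows "area b a h N i j = (\<Sum>p<N. \<Sum>q<N. sg p q * ((b i (cell_pt a h N (Suc p)) - b i (cell_pt a h N p)) * (b j (cell_pt a h N (Suc q)) - b j (cell_pt a h N q))))"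
proof -
 define u where "u p = b i (cell_pt a h N (Suc p)) - b i (cell_pt a h N p)" for p
 define v where "v p = b j (cell_pt a h N (Suc p)) - b j (cell_pt a h N p)" for p
 have cut: "(\<Sum>p<q. f p) = (\<Sum>p<N. if p < q then f p else 0)" if "q < N" for q and f :: "nat => real"
  using that by (intro sum.mono_neutral_cong_left) auto
 have tel: "b i' (cell_pt a h N q) - b i' a = (\<Sum>p<q. b i' (cell_pt a h N (Suc p)) - b i' (cell_pt a h N p))" for i' q
  using sum_lessThan_telescope[of "%p. b i' (cell_pt a h N p)" q] by (simp add: cell_pt_def)
 have 1: "iter_sum b a h N i j N = (\<Sum>p<N. \<Sum>q<N. if p < q then u p * v q else 0)"
 proof -
  have "iter_sum b a h N i j N = (\<Sum>q<N. \<Sum>p<N. if p < q then u p * v q else 0)"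
   unfolding iter_sum_def
  proof (rule sum.cong[OF refl])
   fix q assume "q \<in> {..<N}"
   then have "b i (cell_pt a h N q) - b i a = (\<Sum>p<N. if p < q then u p else 0)" unfolding tel u_def by (intro cut) simp
   then show "(b i (cell_pt a h N q) - b i a) * (b j (cell_pt a h N (Suc q)) - b j (cell_pt a h N q)) = (\<Sum>p<N. if p < q then u p * v q else 0)"
    by (simp add: v_def sum_distrib_right if_distrib[of "%x. x * _"] cong: if_cong)
  qed
  then show ?thesis using sum.swap[of "%q p. if p < q then u p * v q else 0" "{..<N}" "{..<N}"] by simp
 qed
 have 2: "iter_sum b a h N j i N = (\<Sum>p<N. \<Sum>q<N. if q < p then u p * v q else 0)"
  unfolding iter_sum_def
 proof (rule sum.cong[OF refl])
  fix q assume "q \<in> {..<N}"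
  then have "b j (cell_pt a h N q) - b j a = (\<Sum>p<N. if p < q then v p else 0)" unfolding tel v_def by (intro cut) simp
  then show "(b j (cell_pt a h N q) - b j a) * (b i (cell_pt a h N (Suc q)) - b i (cell_pt a h N q)) = (\<Sum>p<N. if p < q then u q * v p else 0)"
   by (simp add: u_def sum_distrib_right sum_distrib_left if_distrib[of "%x. x * _"] mult.commute cong: if_cong)
 qed
 have "area b a h N i j = (\<Sum>p<N. \<Sum>q<N. (if p < q then u p * v q else 0) / 2 - (if q < p then u p * v q else 0) / 2)"
  unfolding area_def 1 2 by (simp add: sum_subtractf diff_divide_distrib sum_divide_distrib)
 also have "... = (\<Sum>p<N. \<Sum>q<N. sg p q * (u p * v q))"
  by (intro sum.cong refl) (simp add: sg_def)
 finally show ?thesis by (simp add: u_def v_def)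
qed

text \<open>\<open>rho H\<close> at the distance of a and a' is the mixed second difference of - |a
  - a'| powr (2 * H) / 2, so the double sum telescopes. Its value is the variance of N adjoining
  unit increments.\<close>

lemma sum_rho: "(\<Sum>a<N. \<Sum>a'<N. rho H (ndist a a')) = real N powr (2 * H)"
proof -
 define F where "F a a' = - (\<bar>real a - real a'\<bar> powr (2 * H)) / 2" for a a'
 have r: "rho H (ndist a a') = (F (Suc a) (Suc a') - F (Suc a) a') - (F a (Suc a') - F a a')" for a a'
 proof -
  consider "a <= a'" | "a' <= a" by linarith
  then show ?thesis
  proof cases
   case 1
   then obtain d where "a' = a + d" using le_Suc_ex by blast
   then show ?thesis by (simp add: rho_def ndist_def F_def abs_minus_commute add_divide_distrib diff_divide_distrib)
  next
   case 2
   then obtain d where "a = a' + d" using le_Suc_ex by blast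
   then show ?thesis by (simp add: rho_def ndist_def F_def add_divide_distrib diff_divide_distrib add.commute[of 1])
  qed
 qed
 have "(\<Sum>a<N. \<Sum>a'<N. rho H (ndist a a')) = (\<Sum>a<N. (F (Suc a) N - F (Suc a) 0) - (F a N - F a 0))"
  unfolding r sum_subtractf[of "%a'. F (Suc _) (Suc a') - F (Suc _) a'"] sum_lessThan_telescope[of "F _"] by simp
 also have "... = (F N N - F N 0) - (F 0 N - F 0 0)"
  using sum_lessThan_telescope[of "%a. F a N - F a 0" N] by simp
 also have "... = real N powr (2 * H)" by (simp add: F_def)
 finally show ?thesis .
qed

locale driver = prob_space M for M :: "'w measure" +
 fixes H T :: real and m :: nat and B :: "nat => real => 'w => real"
 assumes H: "1 / 2 < H" "H < 1" and T: "0 < T" and drv: "fbm_driver M T H m B"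
begin

lemma prob: "prob_space M" by unfold_locales

lemma fbm_j: "j \<in> {1..m} ==> fbm M T H (B j)" using drv by (simp add: fbm_driver_def)

lemma B_gauss:
 assumes "j \<in> {1..m}" "finite F" "F \<subseteq> {0..T}" shows "gaussian_rv M (%om. \<Sum>t\<in>F. a t * B j t om)"
proof -
 have "\<forall>F a. finite F \<and> F \<subseteq> {0..T} --> gaussian_rv M (%om. \<Sum>t\<in>F. a t * B j t om)"
  by (rule conjunct1[OF conjunct1[OF fbm_j[OF assms(1), unfolded fbm_def centered_gaussian_process_def]]])
 from mp[OF spec[OF spec[OF this, where x = F], where x = a] conjI[OF assms(2,3)]] show ?thesis .
qed

lemma B_mean: "j \<in> {1..m} ==> t \<in> {0..T} ==> expectation (B j t) = 0"
 by (rule bspec[OF conjunct2[OF conjunct1[OF fbm_j[unfolded fbm_def centered_gaussian_process_def]]]])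

lemma B_cov: "j \<in> {1..m} ==> s \<in> {0..T} ==> t \<in> {0..T} ==>
  expectation (%om. B j s om * B j t om) = (1 / 2) * (s powr (2 * H) + t powr (2 * H) - \<bar>t - s\<bar> powr (2 * H))"
 by (rule bspec[OF bspec[OF conjunct2[OF conjunct2[OF fbm_j[unfolded fbm_def]]]]])

lemma B_cont: "j \<in> {1..m} ==> AE om in M. continuous_on {0..T} (%t. B j t om)"
 by (rule conjunct1[OF conjunct2[OF fbm_j[unfolded fbm_def]]])

lemma B_time: "t \<in> {0..T} ==> om \<in> space M ==> B 0 t om = t"
 by (rule bspec[OF bspec[OF conjunct1[OF drv[unfolded fbm_driver_def]]]])

lemma B_indep: "indep_vars (%j. \<Pi>\<^sub>M t\<in>{0..T}. borel) (%j om. \<lambda>t\<in>{0..T}. B j t om) {1..m}"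
 by (rule conjunct2[OF conjunct2[OF drv[unfolded fbm_driver_def]]])

lemma B_cgauss: assumes j: "j \<in> {1..m}" and t: "t \<in> {0..T}" shows "cgauss M (B j t)"
proof -
 have "gaussian_rv M (%om. \<Sum>t\<in>{t}. (%_. 1) t * B j t om)" using t by (intro B_gauss j) auto
 then have "gaussian_rv M (B j t)" by simp
 then show ?thesis using B_mean[OF j t] by (rule gaussian_rv_cgauss[OF prob])
qed

lemma B_meas: "j \<in> {1..m} ==> t \<in> {0..T} ==> B j t \<in> borel_measurable M"
 using B_cgauss by (auto simp: cgauss_def mom_def)

lemma B_mom: "j \<in> {1..m} ==> t \<in> {0..T} ==> mom M (B j t)"
 using B_cgauss by (auto simp: cgauss_def)

definition "lcomb j Z \<longleftrightarrow> (\<exists>F a. finite F \<and> F \<subseteq> {0..T} \<and> Z = (%om. \<Sum>t\<in>F. a t * B j t om))"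

lemma lcomb_zero: "lcomb j (%_. 0)"
 unfolding lcomb_def by (rule exI[of _ "{}"]) auto

lemma lcomb_B: "t \<in> {0..T} ==> lcomb j (B j t)"
 unfolding lcomb_def by (rule exI[of _ "{t}"], rule exI[of _ "%_. 1"]) auto

lemma lcomb_cmult: assumes "lcomb j Z" shows "lcomb j (%om. c * Z om)"
proof -
 obtain F a where "finite F" "F \<subseteq> {0..T}" "Z = (%om. \<Sum>t\<in>F. a t * B j t om)" using assms by (auto simp: lcomb_def)
 then show ?thesis unfolding lcomb_def
  by (intro exI[of _ F] exI[of _ "%t. c * a t"]) (auto simp: sum_distrib_left mult.assoc)
qed

lemma lcomb_add: assumes "lcomb j Z" "lcomb j W" shows "lcomb j (%om. Z om + W om)"
proof -
 obtain F a where F: "finite F" "F \<subseteq> {0..T}" "Z = (%om. \<Sum>t\<in>F. a t * B j t om)" using assms(1) by (auto simp: lcomb_def)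
 obtain F' a' where F': "finite F'" "F' \<subseteq> {0..T}" "W = (%om. \<Sum>t\<in>F'. a' t * B j t om)" using assms(2) by (auto simp: lcomb_def)
 have 1: "(\<Sum>t\<in>F. f t) = (\<Sum>t\<in>F \<union> F'. if t \<in> F then f t else 0)" "(\<Sum>t\<in>F'. f t) = (\<Sum>t\<in>F \<union> F'. if t \<in> F' then f t else 0)" for f :: "real => real"
  using F F' by (auto intro!: sum.mono_neutral_cong_left)
 have "(%om. Z om + W om) = (%om. \<Sum>t\<in>F \<union> F'. ((if t \<in> F then a t else 0) + (if t \<in> F' then a' t else 0)) * B j t om)"
  unfolding F F' 1 sum.distrib[symmetric] by (intro ext sum.cong refl) (auto simp: distrib_right)
 then show ?thesis unfolding lcomb_def using F F' by (intro exI[of _ "F \<union> F'"] exI) auto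
qed

lemma lcomb_diff: assumes "lcomb j Z" "lcomb j W" shows "lcomb j (%om. Z om - W om)"
 using lcomb_add[OF assms(1) lcomb_cmult[OF assms(2), of "-1"]] by simp

lemma lcomb_sum: assumes "finite E" "!!e. e \<in> E ==> lcomb j (Z e)" shows "lcomb j (%om. \<Sum>e\<in>E. Z e om)"
 using assms by (induction E rule: finite_induct) (auto intro: lcomb_zero lcomb_add)

lemma lcomb_gaussian: assumes j: "j \<in> {1..m}" and Z: "lcomb j Z" shows "gaussian_rv M Z" "expectation Z = 0" "cgauss M Z"
proof -
 obtain F a where F: "finite F" "F \<subseteq> {0..T}" "Z = (%om. \<Sum>t\<in>F. a t * B j t om)" using Z by (auto simp: lcomb_def)
 show 1: "gaussian_rv M Z" unfolding F(3) by (rule B_gauss[OF j F(1,2)])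
 have "integrable M (B j t)" "expectation (B j t) = 0" if "t \<in> F" for t
  using mom_integrable[OF B_mom[OF j, of t]] B_mean[OF j, of t] that F(2) by blast+
 then show 2: "expectation Z = 0" unfolding F(3) by (subst Bochner_Integration.integral_sum) auto
 show "cgauss M Z" by (rule gaussian_rv_cgauss[OF prob 1 2])
qed

text \<open>Independence is assumed for the components as random elements of a product space; a
  finite linear combination is a measurable function of such an element, as it uses finitely many
  coordinates.\<close>

lemma lcomb_indep:
 assumes ij: "i \<in> {1..m}" "j \<in> {1..m}" "i ~= j" and Z: "lcomb i Z" and W: "lcomb j W"
 shows "indep_vars (%_. borel) (%r. if r = i then Z else W) {i, j}"
proof -
 obtain F a where F: "finite F" "F \<subseteq> {0..T}" "Z = (%om. \<Sum>t\<in>F. a t * B i t om)" using Z by (auto simp: lcomb_def)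
 obtain F' a' where F': "finite F'" "F' \<subseteq> {0..T}" "W = (%om. \<Sum>t\<in>F'. a' t * B j t om)" using W by (auto simp: lcomb_def)
 define Y where "Y r f = (if r = i then (\<Sum>t\<in>F. a t * f t) else (\<Sum>t\<in>F'. a' t * f t))" for r and f :: "real => real"
 have "indep_vars (%j. \<Pi>\<^sub>M t\<in>{0..T}. borel) (%j om. \<lambda>t\<in>{0..T}. B j t om) {i, j}"
  by (rule indep_vars_subset[OF B_indep]) (use ij in auto)
 then have "indep_vars (%_. borel) (%r. Y r \<circ> (%om. \<lambda>t\<in>{0..T}. B r t om)) {i, j}"
 proof (rule indep_vars_compose)
  fix r assume "r \<in> {i, j}"
  have "(%f. \<Sum>t\<in>K. c t * f t) \<in> borel_measurable (\<Pi>\<^sub>M t\<in>{0..T}. borel)" if "K \<subseteq> {0..T}" for K and c :: "real => real"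
   using that by (intro borel_measurable_sum borel_measurable_times measurable_const measurable_component_singleton) auto
  then show "Y r \<in> borel_measurable (\<Pi>\<^sub>M t\<in>{0..T}. borel)" using F F' by (cases "r = i") (auto simp: Y_def[abs_def])
 qed
 moreover have "(Y r \<circ> (%om. \<lambda>t\<in>{0..T}. B r t om)) = (if r = i then Z else W)" if "r \<in> {i, j}" for r
  using that ij F F' by (auto simp: Y_def fun_eq_iff intro!: sum.cong)
 ultimately show ?thesis by (subst indep_vars_cong[OF refl]) auto
qed

lemma lcomb_uncorrelated:
 assumes ij: "i \<in> {1..m}" "j \<in> {1..m}" "i ~= j" and Z: "lcomb i Z" and W: "lcomb j W"
 shows "expectation (%om. Z om * W om) = 0"
proof -
 have i: "integrable M Z" "integrable M W" using lcomb_gaussian(3)[OF ij(1) Z] lcomb_gaussian(3)[OF ij(2) W] by (auto simp: cgauss_def intro: mom_integrable)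
 have "expectation (%om. \<Prod>r\<in>{i, j}. (if r = i then Z else W) om) = (\<Prod>r\<in>{i, j}. expectation (if r = i then Z else W))"
  by (rule indep_vars_lebesgue_integral[OF _ lcomb_indep[OF assms]]) (use i in auto)
 then show ?thesis using ij lcomb_gaussian(2)[OF ij(1) Z] by (simp add: fun_eq_iff)
qed

text \<open>The sum of independent normal variables is normal. Almost surely constant combinations
  have no normal density; being centered, they are 0 and leave the other summand unchanged.\<close>

lemma lcomb_add_cgauss:
 assumes ij: "i \<in> {1..m}" "j \<in> {1..m}" "i ~= j" and Z: "lcomb i Z" and W: "lcomb j W"
 shows "cgauss M (%om. Z om + W om)"
proof -
 note z = lcomb_gaussian[OF ij(1) Z] and w = lcomb_gaussian[OF ij(2) W]
 have [measurable]: "Z \<in> borel_measurable M" "W \<in> borel_measurable M" using z(1) w(1) by (auto simp: gaussian_rv_def)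
 have zero: "c = 0" if "AE om in M. U om = c" "expectation U = 0" "U \<in> borel_measurable M" for U :: "'w => real" and c
 proof -
  have "expectation U = expectation (%_. c)" using that by (intro integral_cong_AE) auto
  then show ?thesis using that by (simp add: prob_space)
 qed
 consider c where "AE om in M. Z om = c" | c where "AE om in M. W om = c"
  | \<mu> \<sigma> \<nu> \<tau> where "0 < \<sigma>" "distributed M lborel Z (normal_density \<mu> \<sigma>)" "0 < \<tau>" "distributed M lborel W (normal_density \<nu> \<tau>)"
  using z(1) w(1) unfolding gaussian_rv_def by blast
 then show ?thesis
 proof cases
  case 1
  then have "c = 0" using z(2) zero by auto
  with 1 show ?thesis by (intro cgauss_cong_AE[OF w(3)]) auto
 next
  case 2
  then have "c = 0" using w(2) zero by auto
  with 2 show ?thesis by (intro cgauss_cong_AE[OF z(3)]) auto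
 next
  case 3
  define mu sg where "mu r = (if r = i then \<mu> else \<nu>)" and "sg r = (if r = i then \<sigma> else \<tau>)" for r
  have "distributed M lborel (%x. \<Sum>r\<in>{i, j}. (if r = i then Z else W) x) (normal_density (\<Sum>r\<in>{i, j}. mu r) (sqrt (\<Sum>r\<in>{i, j}. (sg r)\<^sup>2)))"
   by (rule sum_indep_normal[OF _ _ lcomb_indep[OF assms]]) (use 3 in \<open>auto simp: mu_def sg_def\<close>)
  then have d: "distributed M lborel (%x. Z x + W x) (normal_density (\<mu> + \<nu>) (sqrt (\<sigma>\<^sup>2 + \<tau>\<^sup>2)))"
   using ij by (simp add: mu_def sg_def)
  have "0 < sqrt (\<sigma>\<^sup>2 + \<tau>\<^sup>2)" using 3 by (simp add: add_pos_pos)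
  with d have "gaussian_rv M (%x. Z x + W x)" unfolding gaussian_rv_def
   by (intro conjI disjI1 exI[of _ "\<mu> + \<nu>"] exI[of _ "sqrt (\<sigma>\<^sup>2 + \<tau>\<^sup>2)"]) simp_all
  moreover have "expectation (%x. Z x + W x) = 0"
   using z(2,3) w(2,3) by (subst Bochner_Integration.integral_add) (auto simp: cgauss_def intro: mom_integrable)
  ultimately show ?thesis by (intro gaussian_rv_cgauss prob)
 qed
qed

definition "inc = (%(j, s, t) om. B j t om - B j s om)"

lemma inc_lcomb: "s \<in> {0..T} ==> t \<in> {0..T} ==> lcomb j (inc (j, s, t))"
 using lcomb_diff[OF lcomb_B[of t j] lcomb_B[of s j]] by (simp add: inc_def)

lemma gfam_one: assumes j: "j \<in> {1..m}" shows "gfam M ({j} \<times> {0..T} \<times> {0..T}) inc"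
proof
 fix a F assume F: "finite F" "F \<subseteq> {j} \<times> {0..T} \<times> {0..T}"
 show "cgauss M (%om. \<Sum>e\<in>F. a e * inc e om)"
  using F by (intro lcomb_gaussian(3)[OF j] lcomb_sum lcomb_cmult) (auto intro!: inc_lcomb)
qed

text \<open>Any finite combination splits into its parts belonging to i and to j, which are
  independent and Gaussian.\<close>

lemma gfam_two: assumes ij: "i \<in> {1..m}" "j \<in> {1..m}" "i ~= j" shows "gfam M ({i, j} \<times> {0..T} \<times> {0..T}) inc"
proof
 fix a F assume F: "finite F" "F \<subseteq> {i, j} \<times> {0..T} \<times> {0..T}"
 let ?I = "{e. fst e = i}"
 have "lcomb i (%om. \<Sum>e\<in>F \<inter> ?I. a e * inc e om)"
  using F by (intro lcomb_sum lcomb_cmult) (auto intro!: inc_lcomb)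
 moreover have "lcomb j (%om. \<Sum>e\<in>F - ?I. a e * inc e om)"
  using F by (intro lcomb_sum lcomb_cmult) (auto intro!: inc_lcomb)
 ultimately have "cgauss M (%om. (\<Sum>e\<in>F \<inter> ?I. a e * inc e om) + (\<Sum>e\<in>F - ?I. a e * inc e om))"
  by (rule lcomb_add_cgauss[OF ij])
 then show "cgauss M (%om. \<Sum>e\<in>F. a e * inc e om)" using F by (simp add: sum.Int_Diff[of F _ ?I])
qed

lemma inc_cov:
 assumes j: "j \<in> {1..m}" and st: "s \<in> {0..T}" "t \<in> {0..T}" "s' \<in> {0..T}" "t' \<in> {0..T}"
 shows "expectation (%om. inc (j, s, t) om * inc (j, s', t') om)
  = (\<bar>t - s'\<bar> powr (2 * H) + \<bar>s - t'\<bar> powr (2 * H) - \<bar>t - t'\<bar> powr (2 * H) - \<bar>s - s'\<bar> powr (2 * H)) / 2"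
proof -
 have I: "integrable M (%om. B j u om * B j v om)" if "u \<in> {0..T}" "v \<in> {0..T}" for u v
  using that by (intro mom_integrable mom_mult B_mom j)
 have E: "expectation (%om. B j u om * B j v om) = (1 / 2) * (u powr (2 * H) + v powr (2 * H) - \<bar>u - v\<bar> powr (2 * H))" if "u \<in> {0..T}" "v \<in> {0..T}" for u v
  using B_cov[OF j that] by (simp only: abs_minus_commute[of u v])
 have "(%om. inc (j, s, t) om * inc (j, s', t') om) = (%om. (B j t om * B j t' om - B j t om * B j s' om) - (B j s om * B j t' om - B j s om * B j s' om))"
  by (simp add: inc_def fun_eq_iff algebra_simps)
 then have "expectation (%om. inc (j, s, t) om * inc (j, s', t') om) =
   (expectation (%om. B j t om * B j t' om) - expectation (%om. B j t om * B j s' om)) - (expectation (%om. B j s om * B j t' om) - expectation (%om. B j s om * B j s' om))"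
  using I st by (simp add: Bochner_Integration.integral_diff)
 then show ?thesis unfolding E[OF st(2,4)] E[OF st(2,3)] E[OF st(1,4)] E[OF st(1,3)] by (simp add: field_simps)
qed

lemma inc_var: "j \<in> {1..m} ==> s \<in> {0..T} ==> t \<in> {0..T} ==> expectation (%om. inc (j, s, t) om * inc (j, s, t) om) = \<bar>t - s\<bar> powr (2 * H)"
 using inc_cov[of j s t s t] by (simp add: abs_minus_commute[of s t])

lemma inc_moment:
 assumes "j \<in> {1..m}" "s \<in> {0..T}" "t \<in> {0..T}"
 shows "expectation (%om. (B j t om - B j s om) ^ (2 * r)) = gmom r * (\<bar>t - s\<bar> powr (2 * H)) ^ r"
  "integrable M (%om. (B j t om - B j s om) ^ k)"
 using lcomb_gaussian(3)[OF assms(1) inc_lcomb[OF assms(2,3)]] inc_var[OF assms]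
 unfolding cgauss_def mom_def by (auto simp: inc_def power2_eq_square)

lemma inc_moment_nn:
 assumes "j \<in> {1..m}" "s \<in> {0..T}" "t \<in> {0..T}"
 shows "(\<integral>\<^sup>+om. ennreal ((B j t om - B j s om) ^ (2 * r)) \<partial>M) = ennreal (gmom r * (\<bar>t - s\<bar> powr (2 * H)) ^ r)"
proof -
 have "(\<integral>\<^sup>+om. ennreal ((B j t om - B j s om) ^ (2 * r)) \<partial>M) = ennreal (expectation (%om. (B j t om - B j s om) ^ (2 * r)))"
  by (rule nn_integral_eq_integral[OF inc_moment(2)[OF assms]]) (simp add: zero_le_even_power)
 then show ?thesis by (simp only: inc_moment(1)[OF assms])
qed

definition "ginc dlt j p = (j, real p * dlt, real (Suc p) * dlt)"

lemma ginc_cov: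
 assumes j: "j \<in> {1..m}" and dlt: "0 <= dlt" and p: "real (Suc p) * dlt <= T" and q: "real (Suc q) * dlt <= T"
 shows "expectation (%om. inc (ginc dlt j p) om * inc (ginc dlt j q) om) = dlt powr (2 * H) * rho H (ndist p q)"
proof -
 have in0: "real p * dlt \<in> {0..T}" "real q * dlt \<in> {0..T}" "real (Suc p) * dlt \<in> {0..T}" "real (Suc q) * dlt \<in> {0..T}"
  using dlt p q mult_right_mono[of "real p" "real (Suc p)" dlt] mult_right_mono[of "real q" "real (Suc q)" dlt] by auto
 have ab: "\<bar>real u * dlt - real v * dlt\<bar> powr (2 * H) = dlt powr (2 * H) * \<bar>real u - real v\<bar> powr (2 * H)" for u v
 proof -
  have "\<bar>real u * dlt - real v * dlt\<bar> = dlt * \<bar>real u - real v\<bar>" using dlt by (simp add: left_diff_distrib[symmetric] abs_mult)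
  then show ?thesis using dlt by (simp add: powr_mult)
 qed
 have "expectation (%om. inc (ginc dlt j p) om * inc (ginc dlt j q) om) =
   dlt powr (2 * H) * ((\<bar>real (Suc p) - real q\<bar> powr (2 * H) + \<bar>real p - real (Suc q)\<bar> powr (2 * H) - \<bar>real (Suc p) - real (Suc q)\<bar> powr (2 * H) - \<bar>real p - real q\<bar> powr (2 * H)) / 2)"
  unfolding ginc_def using inc_cov[OF j in0(1,3,2,4)] unfolding ab by (simp add: algebra_simps)
 also have "(\<bar>real (Suc p) - real q\<bar> powr (2 * H) + \<bar>real p - real (Suc q)\<bar> powr (2 * H) - \<bar>real (Suc p) - real (Suc q)\<bar> powr (2 * H) - \<bar>real p - real q\<bar> powr (2 * H)) / 2 = rho H (ndist p q)"
 proof -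
  consider "p <= q" | "q <= p" by linarith
  then show ?thesis
  proof cases
   case 1
   then obtain d where "q = p + d" using le_Suc_ex by blast
   then show ?thesis by (simp add: rho_def ndist_def abs_minus_commute)
  next
   case 2
   then obtain d where "p = q + d" using le_Suc_ex by blast
   then show ?thesis by (simp add: rho_def ndist_def add.commute[of 1])
  qed
 qed
 finally show ?thesis .
qed

definition "cell_area h N k i j om = area (%j t. B j t om) (real k * h) h N i j"

lemma cell_area_eq:
 assumes N: "1 <= N"
 shows "(\<Sum>r=k..<l. cell_area h N r i j om) = (\<Sum>(r, p, q)\<in>{k..<l} \<times> {..<N} \<times> {..<N}. sg p q * inc (ginc (h / real N) i (r * N + p)) om * inc (ginc (h / real N) j (r * N + q)) om)"
proof -
 have pt: "cell_pt (real r * h) h N p = real (r * N + p) * (h / real N)" for r p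
  using N by (simp add: cell_pt_def field_simps)
 show ?thesis
  unfolding cell_area_def iter_area_eq pt sum.cartesian_product[symmetric]
  by (intro sum.cong refl) (simp add: inc_def ginc_def mult.assoc)
qed

definition "sig h i = (if i = 0 then h\<^sup>2 else h powr (2 * H))"

definition "areac r = 2 * (2 * real r - 1) * (2 * (2 * real r - 1)) ^ r * gmom r"

text \<open>Time is treated as a component with constant kernel, so \<open>area_variance\<close>
  covers all pairs of components. The sum of the kernel over one cell is \<open>sig\<close>, for a
  noise by \<open>sum_rho\<close>.\<close>

lemma sg_variance:
 fixes \<rho> :: "nat => nat => real"
 assumes N: "1 <= N" and h: "0 < h" and \<rho>: "\<rho> = (%i d. if i = 0 then (h / real N)\<^sup>2 else (h / real N) powr (2 * H) * rho H d)"
 shows "(\<Sum>(r, p, q)\<in>{k..<l} \<times> {..<N} \<times> {..<N}. \<Sum>(r', p', q')\<in>{k..<l} \<times> {..<N} \<times> {..<N}. sg p q * sg p' q' * \<rho> i (ndist (r * N + p) (r' * N + p')) * \<rho> j (ndist (r * N + q) (r' * N + q')))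
   <= 2 * real (l - k) * sig h i * sig h j"
proof -
 have anti: "\<rho> i b <= \<rho> i a" if "a <= b" for i a b :: nat
  unfolding \<rho> using rho_antimono[OF H that] by (auto intro: mult_left_mono)
 have nn: "0 <= \<rho> i a" for i a :: nat unfolding \<rho> using rho_nonneg[OF H(1)] by auto
 have s: "sig h i = (\<Sum>a<N. \<Sum>a'<N. \<rho> i (ndist a a'))" for i
 proof (cases "i = 0")
  case True
  then show ?thesis using N by (simp add: \<rho> sig_def power2_eq_square)
 next
  case False
  have "(\<Sum>a<N. \<Sum>a'<N. \<rho> i (ndist a a')) = (h / real N) powr (2 * H) * (\<Sum>a<N. \<Sum>a'<N. rho H (ndist a a'))"
   using False by (simp add: \<rho> sum_distrib_left)
  then show ?thesis using False N h by (simp add: sum_rho sig_def powr_divide)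
 qed
 show ?thesis
  using area_variance[where ?\<rho>1.0 = "\<rho> i" and ?\<rho>2.0 = "\<rho> j" and ?\<sigma>1.0 = "sig h i" and ?\<sigma>2.0 = "sig h j" and p = k and q = l and N = N, OF anti anti nn nn s s]
  by (simp only: sum.cartesian_product[symmetric])
qed

text \<open>For i = 0 the area is linear in the noise j, hence Gaussian and determined by its
  variance. For two noises it is a bilinear sum over uncorrelated families. Both variances are
  bounded by \<open>sg_variance\<close>.\<close>

lemma area_moment:
 assumes ij: "i < j" "j <= m" and N: "1 <= N" and h: "0 < h" and kl: "k <= l" "real l * h <= T" and r: "1 <= r"
 shows "expectation (%om. (\<Sum>s=k..<l. cell_area h N s i j om) ^ (2 * r)) <= areac r * (2 * real (l - k) * sig h i * sig h j) ^ r"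
  "integrable M (%om. (\<Sum>s=k..<l. cell_area h N s i j om) ^ (2 * r))"
  "(%om. \<Sum>s=k..<l. cell_area h N s i j om) \<in> borel_measurable M"
proof -
 define dlt where "dlt = h / real N"
 define E where "E = {k..<l} \<times> {..<N} \<times> {..<N}"
 have dlt: "0 <= dlt" "real N * dlt = h" using h N by (auto simp: dlt_def)
 have inT: "real (Suc (s * N + p)) * dlt <= T" if "s < l" "p < N" for s p
 proof -
  have "Suc (s * N + p) <= Suc s * N" using that by simp
  also have "... <= l * N" using that by (intro mult_right_mono) auto
  finally have "real (Suc (s * N + p)) <= real (l * N)" by (simp only: of_nat_le_iff)
  then have "real (Suc (s * N + p)) * dlt <= real (l * N) * dlt" using dlt by (intro mult_right_mono)
  also have "... = real l * h" using dlt by (simp add: mult.assoc)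
  finally show ?thesis using kl by simp
 qed
 have inT0: "real (s * N + p) * dlt \<in> {0..T}" "real (Suc (s * N + p)) * dlt \<in> {0..T}" if "s < l" "p < N" for s p
  using inT[OF that] dlt mult_right_mono[of "real (s * N + p)" "real (Suc (s * N + p))" dlt] by auto
 define \<rho> :: "nat => nat => real" where "\<rho> = (%i d. if i = 0 then dlt\<^sup>2 else dlt powr (2 * H) * rho H d)"
 have var: "(\<Sum>(r, p, q)\<in>E. \<Sum>(r', p', q')\<in>E. sg p q * sg p' q' * \<rho> i (ndist (r * N + p) (r' * N + p')) * \<rho> j (ndist (r * N + q) (r' * N + q')))
   <= 2 * real (l - k) * sig h i * sig h j" for i j
  unfolding E_def by (rule sg_variance[OF N h]) (unfold \<rho>_def dlt_def, rule refl)
 have fE: "finite E" by (simp add: E_def)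
 have j: "j \<in> {1..m}" using ij by auto
 have eq: "(\<Sum>s=k..<l. cell_area h N s i j om) = (\<Sum>e\<in>E. sg (fst (snd e)) (snd (snd e)) * inc (ginc dlt i (fst e * N + fst (snd e))) om * inc (ginc dlt j (fst e * N + snd (snd e))) om)" for om
  unfolding cell_area_eq[OF N] E_def dlt_def by (simp add: split_def)
 have gr: "1 <= 2 * real r - 1" using r by simp
 have "expectation (%om. (\<Sum>s=k..<l. cell_area h N s i j om) ^ (2 * r)) <= areac r * (2 * real (l - k) * sig h i * sig h j) ^ r \<and> mom M (%om. \<Sum>s=k..<l. cell_area h N s i j om)"
 proof (cases "i = 0")
  case True
  define Z where "Z om = (\<Sum>e\<in>E. (sg (fst (snd e)) (snd (snd e)) * dlt) * inc (ginc dlt j (fst e * N + snd (snd e))) om)" for om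
  have cg: "lcomb j Z" unfolding Z_def
   using inT0 fE by (intro lcomb_sum lcomb_cmult) (auto simp: E_def ginc_def intro!: inc_lcomb)
  have inc0: "inc (ginc dlt 0 (s * N + p)) om = dlt" if "s < l" "p < N" "om \<in> space M" for s p om
   using B_time[OF inT0(1)[OF that(1,2)] that(3)] B_time[OF inT0(2)[OF that(1,2)] that(3)] by (simp add: inc_def ginc_def algebra_simps)
  have AZ: "(\<Sum>s=k..<l. cell_area h N s i j om) = Z om" if "om \<in> space M" for om
   unfolding eq Z_def by (intro sum.cong refl) (auto simp: E_def inc0 that True)
  note c = lcomb_gaussian(3)[OF j cg]
  have var0: "expectation (%om. (Z om)\<^sup>2) <= 2 * real (l - k) * sig h i * sig h j"
  proof -
   have mm: "mom M (inc (ginc dlt j (fst e * N + snd (snd e))))" if "e \<in> E" for e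
    using lcomb_gaussian(3)[OF j inc_lcomb[OF inT0]] that by (auto simp: E_def ginc_def cgauss_def)
   have "(%om. (Z om)\<^sup>2) = (%om. \<Sum>e\<in>E. \<Sum>e'\<in>E. (sg (fst (snd e)) (snd (snd e)) * sg (fst (snd e')) (snd (snd e')) * dlt\<^sup>2) * (inc (ginc dlt j (fst e * N + snd (snd e))) om * inc (ginc dlt j (fst e' * N + snd (snd e'))) om))"
    unfolding Z_def power2_eq_square sum_product by (intro ext sum.cong refl) (simp only: mult_ac)
   then have "expectation (%om. (Z om)\<^sup>2) = (\<Sum>e\<in>E. \<Sum>e'\<in>E. (sg (fst (snd e)) (snd (snd e)) * sg (fst (snd e')) (snd (snd e')) * dlt\<^sup>2) * expectation (%om. inc (ginc dlt j (fst e * N + snd (snd e))) om * inc (ginc dlt j (fst e' * N + snd (snd e'))) om))"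
    using mm by (simp add: Bochner_Integration.integral_sum mom_integrable mom_mult)
   also have "... = (\<Sum>e\<in>E. \<Sum>e'\<in>E. sg (fst (snd e)) (snd (snd e)) * sg (fst (snd e')) (snd (snd e')) * \<rho> 0 (ndist (fst e * N + fst (snd e)) (fst e' * N + fst (snd e'))) * \<rho> j (ndist (fst e * N + snd (snd e)) (fst e' * N + snd (snd e'))))"
   proof (intro sum.cong refl)
    fix e e' assume "e \<in> E" "e' \<in> E"
    then show "(sg (fst (snd e)) (snd (snd e)) * sg (fst (snd e')) (snd (snd e')) * dlt\<^sup>2) * expectation (%om. inc (ginc dlt j (fst e * N + snd (snd e))) om * inc (ginc dlt j (fst e' * N + snd (snd e'))) om)
     = sg (fst (snd e)) (snd (snd e)) * sg (fst (snd e')) (snd (snd e')) * \<rho> 0 (ndist (fst e * N + fst (snd e)) (fst e' * N + fst (snd e'))) * \<rho> j (ndist (fst e * N + snd (snd e)) (fst e' * N + snd (snd e')))"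
     using j dlt inT by (subst ginc_cov) (auto simp: E_def \<rho>_def)
   qed
   finally show ?thesis using var[of 0 j] True by (simp add: split_def)
  qed
  have e0: "0 <= expectation (%om. (Z om)\<^sup>2)" by simp
  have "expectation (%om. (\<Sum>s=k..<l. cell_area h N s i j om) ^ (2 * r)) = expectation (%om. Z om ^ (2 * r))"
   by (intro Bochner_Integration.integral_cong refl) (simp add: AZ)
  also have "... = gmom r * (expectation (%om. (Z om)\<^sup>2)) ^ r" using c by (simp add: cgauss_def)
  also have "... <= areac r * (2 * real (l - k) * sig h i * sig h j) ^ r"
  proof (intro mult_mono power_mono var0 e0)
   have "1 * 1 <= (2 * (2 * real r - 1)) * (2 * (2 * real r - 1)) ^ r" using gr by (intro mult_mono one_le_power) auto
   then have "1 * gmom r <= ((2 * (2 * real r - 1)) * (2 * (2 * real r - 1)) ^ r) * gmom r"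
    using gmom_pos[of r] by (intro mult_right_mono) auto
   then show "gmom r <= areac r" by (simp add: areac_def)
   show "0 <= areac r" using gr gmom_pos[of r] by (simp add: areac_def)
  qed (use e0 in auto)
  finally have 1: "expectation (%om. (\<Sum>s=k..<l. cell_area h N s i j om) ^ (2 * r)) <= areac r * (2 * real (l - k) * sig h i * sig h j) ^ r" .
  have "mom M Z" using c by (simp add: cgauss_def)
  then have "mom M (%om. \<Sum>s=k..<l. cell_area h N s i j om)"
   unfolding mom_def using AZ by (simp cong: measurable_cong Bochner_Integration.integrable_cong)
  with 1 show ?thesis by simp
 next
  case False
  then have i: "i \<in> {1..m}" using ij by auto
  interpret gf: gfam M "{i, j} \<times> {0..T} \<times> {0..T}" inc using ij by (intro gfam_two i j) auto
  let ?p = "%e. ginc dlt i (fst e * N + fst (snd e))" and ?q = "%e. ginc dlt j (fst e * N + snd (snd e))"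
  have pI: "?p e \<in> {i, j} \<times> {0..T} \<times> {0..T}" "?q e \<in> {i, j} \<times> {0..T} \<times> {0..T}" if "e \<in> E" for e
   using that inT0 by (auto simp: E_def ginc_def)
  have "expectation (%om. (\<Sum>e\<in>E. sg (fst (snd e)) (snd (snd e)) * inc (?p e) om * inc (?q e) om) ^ (2 * r))
   <= areac r * (\<Sum>e\<in>E. \<Sum>e'\<in>E. sg (fst (snd e)) (snd (snd e)) * sg (fst (snd e')) (snd (snd e')) * gf.c (?p e) (?p e') * gf.c (?q e) (?q e')) ^ r"
   unfolding areac_def
  proof (rule gf.bilinear_moment[OF fE pI _ r])
   fix e e' assume "e \<in> E" "e' \<in> E"
   then show "gf.c (?p e) (?q e') = 0"
    unfolding gf.c_def using inT0 ij False by (intro lcomb_uncorrelated[OF i j]) (auto simp: E_def ginc_def intro!: inc_lcomb)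
  qed
  also have "(\<Sum>e\<in>E. \<Sum>e'\<in>E. sg (fst (snd e)) (snd (snd e)) * sg (fst (snd e')) (snd (snd e')) * gf.c (?p e) (?p e') * gf.c (?q e) (?q e'))
   = (\<Sum>e\<in>E. \<Sum>e'\<in>E. sg (fst (snd e)) (snd (snd e)) * sg (fst (snd e')) (snd (snd e')) * \<rho> i (ndist (fst e * N + fst (snd e)) (fst e' * N + fst (snd e'))) * \<rho> j (ndist (fst e * N + snd (snd e)) (fst e' * N + snd (snd e'))))"
  proof (intro sum.cong refl)
   fix e e' assume e: "e \<in> E" "e' \<in> E"
   have "gf.c (?p e) (?p e') = \<rho> i (ndist (fst e * N + fst (snd e)) (fst e' * N + fst (snd e')))"
    unfolding gf.c_def using e i dlt inT False by (subst ginc_cov) (auto simp: E_def \<rho>_def)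
   moreover have "gf.c (?q e) (?q e') = \<rho> j (ndist (fst e * N + snd (snd e)) (fst e' * N + snd (snd e')))"
    unfolding gf.c_def using e j dlt inT ij by (subst ginc_cov) (auto simp: E_def \<rho>_def)
   ultimately show "sg (fst (snd e)) (snd (snd e)) * sg (fst (snd e')) (snd (snd e')) * gf.c (?p e) (?p e') * gf.c (?q e) (?q e')
    = sg (fst (snd e)) (snd (snd e)) * sg (fst (snd e')) (snd (snd e')) * \<rho> i (ndist (fst e * N + fst (snd e)) (fst e' * N + fst (snd e'))) * \<rho> j (ndist (fst e * N + snd (snd e)) (fst e' * N + snd (snd e')))"
    by simp
  qed
  finally have 1: "expectation (%om. (\<Sum>s=k..<l. cell_area h N s i j om) ^ (2 * r)) <= areac r * (\<Sum>e\<in>E. \<Sum>e'\<in>E. sg (fst (snd e)) (snd (snd e)) * sg (fst (snd e')) (snd (snd e')) * \<rho> i (ndist (fst e * N + fst (snd e)) (fst e' * N + fst (snd e'))) * \<rho> j (ndist (fst e * N + snd (snd e)) (fst e' * N + snd (snd e')))) ^ r"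
   (is "_ <= _ * ?V ^ r") unfolding eq .
  \<comment> \<open>A positive multiple of the sum bounds a second moment, by the case r = 1 of the
    moment bound; hence the sum is nonnegative and may be raised to the power r
    monotonically.\<close>
  have V0: "0 <= ?V"
  proof -
   define \<mu> where "\<mu> e e' = sg (fst (snd e)) (snd (snd e)) * sg (fst (snd e')) (snd (snd e'))" for e e' :: "nat \<times> nat \<times> nat"
   have a1: "0 < areac 1" by (simp add: areac_def gmom_pos)
   have "0 <= expectation (%om. (\<Sum>e\<in>E. sg (fst (snd e)) (snd (snd e)) * inc (?p e) om * inc (?q e) om) ^ (2 * 1))" by simp
   also have "... <= areac 1 * (\<Sum>e\<in>E. \<Sum>e'\<in>E. sg (fst (snd e)) (snd (snd e)) * sg (fst (snd e')) (snd (snd e')) * gf.c (?p e) (?p e') * gf.c (?q e) (?q e')) ^ 1"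
    unfolding areac_def
   proof (rule gf.bilinear_moment[OF fE pI])
    fix e e' assume "e \<in> E" "e' \<in> E"
    then show "gf.c (?p e) (?q e') = 0"
     unfolding gf.c_def using inT0 ij False by (intro lcomb_uncorrelated[OF i j]) (auto simp: E_def ginc_def intro!: inc_lcomb)
   qed auto
   also have "(\<Sum>e\<in>E. \<Sum>e'\<in>E. sg (fst (snd e)) (snd (snd e)) * sg (fst (snd e')) (snd (snd e')) * gf.c (?p e) (?p e') * gf.c (?q e) (?q e')) = ?V"
   proof (intro sum.cong refl)
    fix e e' assume e: "e \<in> E" "e' \<in> E"
    have "gf.c (?p e) (?p e') = \<rho> i (ndist (fst e * N + fst (snd e)) (fst e' * N + fst (snd e')))"
     unfolding gf.c_def using e i dlt inT False by (subst ginc_cov) (auto simp: E_def \<rho>_def)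
    moreover have "gf.c (?q e) (?q e') = \<rho> j (ndist (fst e * N + snd (snd e)) (fst e' * N + snd (snd e')))"
     unfolding gf.c_def using e j dlt inT ij by (subst ginc_cov) (auto simp: E_def \<rho>_def)
    ultimately show "sg (fst (snd e)) (snd (snd e)) * sg (fst (snd e')) (snd (snd e')) * gf.c (?p e) (?p e') * gf.c (?q e) (?q e')
     = sg (fst (snd e)) (snd (snd e)) * sg (fst (snd e')) (snd (snd e')) * \<rho> i (ndist (fst e * N + fst (snd e)) (fst e' * N + fst (snd e'))) * \<rho> j (ndist (fst e * N + snd (snd e)) (fst e' * N + snd (snd e')))"
     by simp
   qed
   finally show ?thesis using a1 by (simp add: zero_le_mult_iff)
  qed
  have "areac r * ?V ^ r <= areac r * (2 * real (l - k) * sig h i * sig h j) ^ r"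
   using var[of i j] V0 gr gmom_pos[of r] by (intro mult_left_mono power_mono) (auto simp: split_def areac_def)
  moreover have "mom M (%om. \<Sum>s=k..<l. cell_area h N s i j om)"
   unfolding eq using fE pI by (intro mom_sum mom_mult mom_cmult gf.x_mom prob) auto
  ultimately show ?thesis using 1 by simp
 qed
 then show "expectation (%om. (\<Sum>s=k..<l. cell_area h N s i j om) ^ (2 * r)) <= areac r * (2 * real (l - k) * sig h i * sig h j) ^ r"
  "integrable M (%om. (\<Sum>s=k..<l. cell_area h N s i j om) ^ (2 * r))"
  "(%om. \<Sum>s=k..<l. cell_area h N s i j om) \<in> borel_measurable M"
  by (auto simp: mom_def)
qed

definition "cubec r = 4 * 8 ^ (2 * r) * gmom r + 6 * (2 * real r - 1) * (12 * (2 * real r - 1)) ^ r * gmom (2 * r)"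

text \<open>What enters \<open>cubic_sum_moment\<close> is the sum of all covariances, and by
  \<open>sum_rho\<close> this is the variance of the increment over the whole range.\<close>

lemma cube_moment:
 assumes j: "j \<in> {1..m}" and h: "0 < h" and kl: "k <= l" "real l * h <= T" and r: "1 <= r"
 shows "expectation (%om. (\<Sum>s=k..<l. (B j (real (Suc s) * h) om - B j (real s * h) om) ^ 3) ^ (2 * r))
    <= cubec r * (h powr (2 * H)) ^ (2 * r) * ((real (l - k) * h) powr (2 * H)) ^ r"
  "integrable M (%om. (\<Sum>s=k..<l. (B j (real (Suc s) * h) om - B j (real s * h) om) ^ 3) ^ (2 * r))"
  "(%om. \<Sum>s=k..<l. (B j (real (Suc s) * h) om - B j (real s * h) om) ^ 3) \<in> borel_measurable M"
proof -
 interpret gf: gfam M "{j} \<times> {0..T} \<times> {0..T}" inc by (rule gfam_one[OF j])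
 have inT: "real (Suc s) * h <= T" if "s < l" for s
 proof -
  have "real (Suc s) * h <= real l * h" using that h by (intro mult_right_mono) auto
  then show ?thesis using kl by simp
 qed
 have inT0: "real s * h \<in> {0..T}" "real (Suc s) * h \<in> {0..T}" if "s < l" for s
 proof -
  have "real s * h <= real (Suc s) * h" using h by (intro mult_right_mono) auto
  from order_trans[OF this inT[OF that]] show "real s * h \<in> {0..T}" using h by simp
  show "real (Suc s) * h \<in> {0..T}" using inT[OF that] h by (simp del: of_nat_Suc)
 qed
 define K where "K = ginc h j ` {k..<l}"
 have inj: "inj_on (ginc h j) {k..<l}" using h by (auto simp: inj_on_def ginc_def)
 have eq: "(\<Sum>e\<in>K. inc e om ^ 3) = (\<Sum>s=k..<l. (B j (real (Suc s) * h) om - B j (real s * h) om) ^ 3)" for om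
  unfolding K_def sum.reindex[OF inj] by (simp add: inc_def ginc_def)
 have KI: "finite K" "K \<subseteq> {j} \<times> {0..T} \<times> {0..T}" using inT0 by (auto simp: K_def ginc_def)
 have cov: "gf.c (ginc h j s) (ginc h j s') = h powr (2 * H) * rho H (ndist s s')" if "s < l" "s' < l" for s s'
  unfolding gf.c_def using that h inT by (intro ginc_cov j) auto
 have "expectation (%om. (\<Sum>e\<in>K. inc e om ^ 3) ^ (2 * r)) <= cubec r * (h powr (2 * H)) ^ (2 * r) * (\<Sum>e\<in>K. \<Sum>e'\<in>K. gf.c e e') ^ r"
  unfolding cubec_def
  by (rule gf.cubic_sum_moment[OF KI _ _ r]) (auto simp: K_def cov rho_0 ndist_def intro!: mult_nonneg_nonneg rho_nonneg[OF H(1)])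
 also have "(\<Sum>e\<in>K. \<Sum>e'\<in>K. gf.c e e') = (real (l - k) * h) powr (2 * H)"
 proof -
  have "(\<Sum>e\<in>K. \<Sum>e'\<in>K. gf.c e e') = (\<Sum>s=k..<l. \<Sum>s'=k..<l. h powr (2 * H) * rho H (ndist s s'))"
   unfolding K_def sum.reindex[OF inj] comp_def by (intro sum.cong refl) (simp add: cov)
  also have "... = (\<Sum>s<l - k. \<Sum>s'<l - k. h powr (2 * H) * rho H (ndist s s'))"
   unfolding sum.atLeastLessThan_shift_0[of _ k l] comp_def by (simp add: ndist_def atLeast0LessThan)
  also have "... = h powr (2 * H) * real (l - k) powr (2 * H)"
   by (simp only: sum_distrib_left[symmetric] sum_rho)
  finally show ?thesis using h by (simp add: powr_mult)
 qed
 finally show "expectation (%om. (\<Sum>s=k..<l. (B j (real (Suc s) * h) om - B j (real s * h) om) ^ 3) ^ (2 * r))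
    <= cubec r * (h powr (2 * H)) ^ (2 * r) * ((real (l - k) * h) powr (2 * H)) ^ r" unfolding eq .
 have "mom M (%om. \<Sum>e\<in>K. inc e om ^ 3)" using KI by (intro mom_sum mom_power gf.x_mom prob) auto
 then show "integrable M (%om. (\<Sum>s=k..<l. (B j (real (Suc s) * h) om - B j (real s * h) om) ^ 3) ^ (2 * r))"
  "(%om. \<Sum>s=k..<l. (B j (real (Suc s) * h) om - B j (real s * h) om) ^ 3) \<in> borel_measurable M"
  unfolding eq by (auto simp: mom_def)
qed

end

section \<open>The Hoelder constant of the driver and its exponential moments\<close>

lemma ex_max_on:
 fixes z :: "'i => real"
 assumes "finite F" "F ~= {}"
 obtains i where "i \<in> F" "!!j. j \<in> F ==> z j <= z i"
proof -
 have "Max (z ` F) \<in> z ` F" using assms by (intro Max_in) auto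
 then obtain i where i: "i \<in> F" "Max (z ` F) = z i" by auto
 have "z j <= z i" if "j \<in> F" for j using Max_ge[of "z ` F" "z j"] assms(1) that i(2) by simp
 then show ?thesis using that i(1) by blast
qed

lemma sum_power_le:
 fixes z :: "'i => real"
 assumes F: "finite F" and z: "!!i. i \<in> F ==> 0 <= z i" and k: "1 <= k"
 shows "(\<Sum>i\<in>F. z i) ^ k <= real (card F) ^ k * (\<Sum>i\<in>F. z i ^ k)"
proof (cases "F = {}")
 case True
 then show ?thesis using k by (simp add: power_0_left)
next
 case False
 then obtain i where i: "i \<in> F" "!!j. j \<in> F ==> z j <= z i"
  using ex_max_on[OF F False, of z] by blast
 have "(\<Sum>j\<in>F. z j) <= real (card F) * z i" using i by (intro sum_bounded_above) auto
 then have "(\<Sum>i\<in>F. z i) ^ k <= (real (card F) * z i) ^ k" by (intro power_mono sum_nonneg z) auto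
 also have "... = real (card F) ^ k * z i ^ k" by (simp add: power_mult_distrib)
 also have "z i ^ k <= (\<Sum>i\<in>F. z i ^ k)" using i F z by (intro member_le_sum) auto
 finally show ?thesis by (simp add: mult_left_mono)
qed

lemma gmom_le: "gmom r <= 2 ^ r * fact r"
proof (induction r)
 case (Suc r)
 have "gmom (Suc r) <= (2 * real r + 2) * (2 ^ r * fact r)"
  unfolding gmom_Suc using Suc gmom_pos[of r] by (intro mult_mono) auto
 then show ?case by (simp add: algebra_simps)
qed simp

text \<open>Beyond the threshold where a * x powr (2 - q) reaches lam the square dominates; below it
  the power is at most its value at the threshold.\<close>

lemma exp_lower_power:
 fixes x q a lam :: real
 assumes "0 <= x" "0 < q" "q < 2" "0 < a" "0 <= lam"
 shows "lam * x powr q <= a * x\<^sup>2 + lam * ((lam / a) powr (1 / (2 - q))) powr q"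
proof (cases "x <= (lam / a) powr (1 / (2 - q))")
 case True
 then have "x powr q <= ((lam / a) powr (1 / (2 - q))) powr q" using assms by (intro powr_mono2) auto
 then have "lam * x powr q <= lam * ((lam / a) powr (1 / (2 - q))) powr q" using assms by (intro mult_left_mono) auto
 moreover have "0 <= a * x\<^sup>2" using assms by simp
 ultimately show ?thesis by linarith
next
 case False
 then have x: "0 < x" using powr_ge_zero[of "lam / a" "1 / (2 - q)"] by linarith
 have "((lam / a) powr (1 / (2 - q))) powr (2 - q) <= x powr (2 - q)" using False assms by (intro powr_mono2) auto
 moreover have "((lam / a) powr (1 / (2 - q))) powr (2 - q) = lam / a" using assms by (simp add: powr_powr)
 ultimately have "lam <= a * x powr (2 - q)" using assms by (simp add: field_simps)
 then have "lam * x powr q <= a * x powr (2 - q) * x powr q" by (intro mult_right_mono) auto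
 also have "... = a * x powr 2" by (simp add: mult.assoc powr_add[symmetric])
 also have "... = a * x\<^sup>2" using x by (simp add: powr_numeral)
 also have "... <= a * x\<^sup>2 + lam * ((lam / a) powr (1 / (2 - q))) powr q" using assms by simp
 finally show ?thesis .
qed

text \<open>The power 2 * r of the supremum is at most the sum of all these powers. The factor
  \<open>fact r\<close> is compensated by the exponential series, and the choice
  \<open>a * v = 1 / 2\<close> makes the series converge. Orders below \<open>r0\<close> are
  compared with the order \<open>r0\<close>.\<close>

lemma (in prob_space) sup_exp_square:
 fixes y :: "nat => nat => 'a => real" and N :: "nat => nat"
 assumes y[measurable]: "!!l i. y l i \<in> borel_measurable M" and r0: "1 <= r0" and v: "0 < v"
  and mom: "!!r l. r0 <= r ==> (\<Sum>i<N l. \<integral>\<^sup>+om. ennreal (y l i om ^ (2 * r)) \<partial>M) <= ennreal (v ^ r * fact r * (1 / 2) ^ l)"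
 shows "\<exists>Z. Z \<in> borel_measurable M \<and> (\<forall>om. 0 <= Z om) \<and> (AE om in M. \<forall>l. \<forall>i<N l. \<bar>y l i om\<bar> <= Z om)
   \<and> (\<integral>\<^sup>+om. ennreal (exp (1 / (2 * v) * (Z om)\<^sup>2)) \<partial>M) < \<infinity>"
proof -
 define W where "W r om = (\<Sum>l. \<Sum>i<N l. ennreal (y l i om ^ (2 * r)))" for r om
 have Wm[measurable]: "W r \<in> borel_measurable M" for r unfolding W_def[abs_def] by measurable
 have EW: "(\<integral>\<^sup>+om. W r om \<partial>M) <= ennreal (2 * (v ^ r * fact r))" if "r0 <= r" for r
 proof -
  have "(\<integral>\<^sup>+om. W r om \<partial>M) = (\<Sum>l. \<integral>\<^sup>+om. (\<Sum>i<N l. ennreal (y l i om ^ (2 * r))) \<partial>M)"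
   unfolding W_def by (rule nn_integral_suminf) measurable
  also have "... = (\<Sum>l. \<Sum>i<N l. \<integral>\<^sup>+om. ennreal (y l i om ^ (2 * r)) \<partial>M)"
   by (rule arg_cong[where f = suminf], rule ext, rule nn_integral_sum) measurable
  also have "... <= (\<Sum>l. ennreal (v ^ r * fact r * (1 / 2) ^ l))" by (intro suminf_le mom that) auto
  also have "... = ennreal (\<Sum>l. v ^ r * fact r * (1 / 2) ^ l)"
   using v by (intro suminf_ennreal2 summable_mult) auto
  also have "(\<Sum>l. v ^ r * fact r * (1 / 2) ^ l) = v ^ r * fact r * 2"
   by (subst suminf_mult) (auto simp: suminf_geometric)
  finally show ?thesis by (simp add: mult_ac)
 qed
 \<comment> \<open>The supremum is taken in the extended reals, since it may be infinite on a null
   set; there \<open>Z\<close> is 0.\<close>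
 define S where "S om = (SUP l. SUP i\<in>{..<N l}. ennreal \<bar>y l i om\<bar>)" for om
 have Sm[measurable]: "S \<in> borel_measurable M" unfolding S_def[abs_def] by measurable
 have yS: "ennreal \<bar>y l i om\<bar> <= S om" if "i < N l" for l i om
  unfolding S_def by (rule SUP_upper2[of l], simp, rule SUP_upper) (use that in simp)
 have SW: "\<exists>z\<ge>0. S om <= ennreal z \<and> W r om = ennreal (z ^ (2 * r))" if Wfin: "W r om ~= \<infinity>" and r1: "1 <= r" for r om
 proof -
  obtain w where w: "0 <= w" "W r om = ennreal w" using Wfin by (cases "W r om") auto
  define z where "z = root (2 * r) w"
  have z: "0 <= z" "z ^ (2 * r) = w" using w r1 by (auto simp: z_def)
  have "\<bar>y l i om\<bar> <= z" if i: "i < N l" for l i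
  proof -
   have "ennreal (y l i om ^ (2 * r)) <= (\<Sum>i<N l. ennreal (y l i om ^ (2 * r)))"
    using i by (intro member_le_sum) auto
   also have "... = sum (%l. \<Sum>i<N l. ennreal (y l i om ^ (2 * r))) {l}" by simp
   also have "... <= W r om" unfolding W_def by (intro sum_le_suminf) auto
   finally have "\<bar>y l i om\<bar> ^ (2 * r) <= z ^ (2 * r)" using w z by (simp add: power_even_abs)
   then show ?thesis using z r1 by (subst (asm) power_mono_iff) auto
  qed
  then have "S om <= ennreal z" unfolding S_def by (intro SUP_least ennreal_leI) auto
  then show ?thesis using z w by auto
 qed
 define Z where "Z om = enn2real (S om)" for om
 have Zm[measurable]: "Z \<in> borel_measurable M" unfolding Z_def[abs_def] by measurable
 have Z0: "0 <= Z om" for om by (simp add: Z_def)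
 have ZW: "ennreal (Z om ^ (2 * r)) <= W r om" if r1: "1 <= r" for r om
 proof (cases "W r om = \<infinity>")
  case False
  then obtain z where z: "0 <= z" "S om <= ennreal z" "W r om = ennreal (z ^ (2 * r))" using SW[OF _ r1] by blast
  have "Z om <= z" unfolding Z_def using z by (intro enn2real_leI) auto
  then show ?thesis unfolding z(3) by (intro ennreal_leI power_mono Z0)
 qed simp
 have EZ: "(\<integral>\<^sup>+om. ennreal (Z om ^ (2 * r)) \<partial>M) <= ennreal (2 * (v ^ r * fact r))" if "r0 <= r" for r
  using EW[OF that] ZW[of r] r0 that by (intro order_trans[OF nn_integral_mono EW]) auto
 have "AE om in M. W r0 om ~= \<infinity>" using EW[of r0] by (intro nn_integral_PInf_AE) (auto simp: top_unique)
 then have AE: "AE om in M. \<forall>l. \<forall>i<N l. \<bar>y l i om\<bar> <= Z om"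
 proof eventually_elim
  fix om assume "W r0 om ~= \<infinity>"
  then obtain z where z: "S om <= ennreal z" using SW[OF _ r0] by blast
  then have S: "S om = ennreal (Z om)" unfolding Z_def by (intro ennreal_enn2real[symmetric]) (auto simp: less_top[symmetric] top_unique)
  show "\<forall>l. \<forall>i<N l. \<bar>y l i om\<bar> <= Z om" using yS[of _ _ om] Z0[of om] unfolding S by simp
 qed
 define a where "a = 1 / (2 * v)"
 have a: "0 < a" "a * v = 1 / 2" using v by (auto simp: a_def)
 define Q where "Q = 1 + 2 * (v ^ r0 * fact r0)"
 have Q: "0 <= Q" using v by (simp add: Q_def)
 have tb: "(\<integral>\<^sup>+om. ennreal ((a * (Z om)\<^sup>2) ^ r / fact r) \<partial>M) <= ennreal (2 * (1 / 2) ^ r + Q * (a ^ r / fact r))" for r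
 proof -
  have "(\<integral>\<^sup>+om. ennreal ((a * (Z om)\<^sup>2) ^ r / fact r) \<partial>M) = (\<integral>\<^sup>+om. ennreal (a ^ r / fact r) * ennreal (Z om ^ (2 * r)) \<partial>M)"
   using a by (intro nn_integral_cong) (simp add: ennreal_mult[symmetric] power_mult_distrib power_mult[symmetric])
  also have "... = ennreal (a ^ r / fact r) * (\<integral>\<^sup>+om. ennreal (Z om ^ (2 * r)) \<partial>M)" by (rule nn_integral_cmult) measurable
  finally have eq: "(\<integral>\<^sup>+om. ennreal ((a * (Z om)\<^sup>2) ^ r / fact r) \<partial>M) = ennreal (a ^ r / fact r) * (\<integral>\<^sup>+om. ennreal (Z om ^ (2 * r)) \<partial>M)" .
  show ?thesis
  proof (cases "r0 <= r")
   case True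
   have "ennreal (a ^ r / fact r) * (\<integral>\<^sup>+om. ennreal (Z om ^ (2 * r)) \<partial>M) <= ennreal (a ^ r / fact r) * ennreal (2 * (v ^ r * fact r))"
    by (intro mult_left_mono EZ True) auto
   also have "... = ennreal (2 * (a * v) ^ r)" using a v by (simp add: ennreal_mult[symmetric] power_mult_distrib)
   also have "... <= ennreal (2 * (1 / 2) ^ r + Q * (a ^ r / fact r))" unfolding a(2) using Q a by (intro ennreal_leI) auto
   finally show ?thesis unfolding eq .
  next
   case False
   have "(\<integral>\<^sup>+om. ennreal (Z om ^ (2 * r)) \<partial>M) <= (\<integral>\<^sup>+om. 1 + ennreal (Z om ^ (2 * r0)) \<partial>M)"
   proof (rule nn_integral_mono)
    fix om
    have "Z om ^ (2 * r) <= 1 + Z om ^ (2 * r0)"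
    proof (cases "1 <= Z om")
     case True
     then have "Z om ^ (2 * r) <= Z om ^ (2 * r0)" using False by (intro power_increasing) auto
     then show ?thesis by simp
    next
     case False
     then have "Z om ^ (2 * r) <= 1" using Z0[of om] by (intro power_le_one) auto
     then show ?thesis using Z0[of om] by (simp add: add_increasing2)
    qed
    then have "ennreal (Z om ^ (2 * r)) <= ennreal (1 + Z om ^ (2 * r0))" by (rule ennreal_leI)
    then show "ennreal (Z om ^ (2 * r)) <= 1 + ennreal (Z om ^ (2 * r0))" using Z0[of om] by simp
   qed
   also have "... = 1 + (\<integral>\<^sup>+om. ennreal (Z om ^ (2 * r0)) \<partial>M)" by (subst nn_integral_add) (auto simp: emeasure_space_1)
   also have "... <= 1 + ennreal (2 * (v ^ r0 * fact r0))" by (intro add_left_mono EZ) simp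
   also have "... = ennreal Q" using v by (simp add: Q_def)
   finally have "ennreal (a ^ r / fact r) * (\<integral>\<^sup>+om. ennreal (Z om ^ (2 * r)) \<partial>M) <= ennreal (a ^ r / fact r) * ennreal Q"
    by (intro mult_left_mono) auto
   also have "... = ennreal (Q * (a ^ r / fact r))" using a Q by (simp add: ennreal_mult[symmetric] mult.commute)
   also have "... <= ennreal (2 * (1 / 2) ^ r + Q * (a ^ r / fact r))" by (intro ennreal_leI) auto
   finally show ?thesis unfolding eq .
  qed
 qed
 have ex: "ennreal (exp (a * (Z om)\<^sup>2)) = (\<Sum>r. ennreal ((a * (Z om)\<^sup>2) ^ r / fact r))" for om
 proof -
  have s: "(%r. (a * (Z om)\<^sup>2) ^ r / fact r) sums exp (a * (Z om)\<^sup>2)"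
   using exp_converges[of "a * (Z om)\<^sup>2"] by (simp add: divide_inverse_commute)
  then have "(\<Sum>r. ennreal ((a * (Z om)\<^sup>2) ^ r / fact r)) = ennreal (\<Sum>r. (a * (Z om)\<^sup>2) ^ r / fact r)"
   using a by (intro suminf_ennreal2) (auto simp: sums_iff)
  then show ?thesis using s by (simp add: sums_iff)
 qed
 have "(\<integral>\<^sup>+om. ennreal (exp (a * (Z om)\<^sup>2)) \<partial>M) = (\<Sum>r. \<integral>\<^sup>+om. ennreal ((a * (Z om)\<^sup>2) ^ r / fact r) \<partial>M)"
  unfolding ex by (rule nn_integral_suminf) measurable
 also have "... <= (\<Sum>r. ennreal (2 * (1 / 2) ^ r + Q * (a ^ r / fact r)))" by (intro suminf_le tb) auto
 also have "... = ennreal (\<Sum>r. 2 * (1 / 2) ^ r + Q * (a ^ r / fact r))"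
 proof (intro suminf_ennreal2 summable_add summable_mult)
  show "summable (%r. a ^ r / fact r)" using summable_exp[of a] by (simp add: divide_inverse_commute)
 qed (use Q a in auto)
 also have "... < \<infinity>" by simp
 finally show ?thesis using Zm Z0 AE unfolding a_def by blast
qed

text \<open>At level L the end points are rounded down to the grid, where
  \<open>dyadic_chain\<close> applies with the coarser levels as its blocks; continuity of f then
  lets L tend to infinity.\<close>

lemma dyadic_hoelder:
 fixes f :: "real => real"
 assumes cont: "continuous_on {0..T} f" and T: "0 < T" and be: "0 < be" and Z: "0 <= Z"
  and D: "!!l i. i < 2 ^ l ==> \<bar>(f (real (Suc i) * (T / 2 ^ l)) - f (real i * (T / 2 ^ l))) * 2 powr (real l * be)\<bar> <= Z"
  and st: "0 <= s" "s <= t" "t <= T"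
 shows "\<bar>f t - f s\<bar> <= chainc be * T powr (- be) * Z * (t - s) powr be"
proof (cases "s = t")
 case False
 have D': "\<bar>f (real (Suc i) * (T / 2 ^ l)) - f (real i * (T / 2 ^ l))\<bar> <= Z * 2 powr (- (real l * be))" if "i < 2 ^ l" for i l
 proof -
  define \<Delta> where "\<Delta> = f (real (Suc i) * (T / 2 ^ l)) - f (real i * (T / 2 ^ l))"
  have "\<bar>\<Delta>\<bar> * 2 powr (real l * be) <= Z" using D[OF that] by (simp add: \<Delta>_def abs_mult)
  then have "\<bar>\<Delta>\<bar> <= Z / 2 powr (real l * be)" by (simp add: pos_le_divide_eq)
  then show ?thesis unfolding \<Delta>_def[symmetric] powr_minus_divide by simp
 qed
 define p where "p s L = real (nat \<lfloor>s / (T / 2 ^ L)\<rfloor>) * (T / 2 ^ L)" for s :: real and L :: nat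
 have p: "0 <= p s L" "p s L <= s" "s - T / 2 ^ L <= p s L" if s: "0 <= s" for s L
 proof -
  define d q where "d = T / 2 ^ L" and "q = s / d"
  have d: "0 < d" using T by (simp add: d_def)
  have "0 <= q" unfolding q_def by (rule divide_nonneg_pos[OF s d])
  then have kr: "real (nat \<lfloor>q\<rfloor>) = of_int \<lfloor>q\<rfloor>" by simp
  have "real (nat \<lfloor>q\<rfloor>) <= q" unfolding kr by linarith
  then have 1: "real (nat \<lfloor>q\<rfloor>) * d <= q * d" using d by (intro mult_right_mono) auto
  have "q - 1 <= real (nat \<lfloor>q\<rfloor>)" unfolding kr by linarith
  then have 2: "(q - 1) * d <= real (nat \<lfloor>q\<rfloor>) * d" using d by (intro mult_right_mono) auto
  have qd: "q * d = s" using d by (simp add: q_def)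
  have 3: "p s L = real (nat \<lfloor>q\<rfloor>) * d" by (simp only: p_def q_def d_def)
  show "0 <= p s L" unfolding 3 using d by simp
  show "p s L <= s" using 1 unfolding 3 qd .
  show "s - T / 2 ^ L <= p s L" using 2 unfolding 3 left_diff_distrib qd d_def[symmetric] by simp
 qed
 have lim: "p s \<longlonglongrightarrow> s" if "0 <= s" for s
 proof (rule tendsto_sandwich[of "%L. s - T / 2 ^ L" _ _ "%_. s"])
  have "(%L. T / 2 ^ L) \<longlonglongrightarrow> 0" using LIMSEQ_divide_realpow_zero[of 2 T] by simp
  from tendsto_diff[OF tendsto_const[of s] this] show "(%L. s - T / 2 ^ L) \<longlonglongrightarrow> s" by simp
 qed (use p[OF that] in auto)
 have grid: "\<bar>f (p t L) - f (p s L)\<bar> <= chainc be * T powr (- be) * Z * (p t L - p s L) powr be" for L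
 proof -
  define S where "S k = f (real (min k (2 ^ L)) * (T / 2 ^ L))" for k
  have ch: "norm (S ((i + 1) * 2 ^ j) - S (i * 2 ^ j)) <= (Z * 2 powr (- (real L * be))) * 2 powr (real j * be)" for i j
  proof (cases "j <= L")
   case True
   then have two: "(2::nat) ^ L = 2 ^ (L - j) * 2 ^ j" by (simp add: power_add[symmetric])
   show ?thesis
   proof (cases "i < 2 ^ (L - j)")
    case lt: True
    then have "(i + 1) * 2 ^ j <= 2 ^ L" "i * 2 ^ j <= 2 ^ L" unfolding two by (auto intro!: mult_right_mono simp del: mult_Suc)
    moreover have "real (k * 2 ^ j) * (T / 2 ^ L) = real k * (T / 2 ^ (L - j))" for k
     using True by (simp add: power_diff)
    ultimately have "norm (S ((i + 1) * 2 ^ j) - S (i * 2 ^ j)) = \<bar>f (real (Suc i) * (T / 2 ^ (L - j))) - f (real i * (T / 2 ^ (L - j)))\<bar>"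
     by (simp only: S_def min_absorb1 Suc_eq_plus1 real_norm_def)
    also have "... <= Z * 2 powr (- (real (L - j) * be))" by (rule D'[OF lt])
    also have "... = (Z * 2 powr (- (real L * be))) * 2 powr (real j * be)"
     using True by (simp add: powr_add[symmetric] of_nat_diff algebra_simps)
    finally show ?thesis .
   next
    case False
    then have "2 ^ L <= i * 2 ^ j" unfolding two by (intro mult_right_mono) auto
    moreover from this have "2 ^ L <= (i + 1) * 2 ^ j" by (simp add: trans_le_add1)
    ultimately show ?thesis using Z by (simp add: S_def min_absorb2)
   qed
  next
   case False
   then have j: "(2::nat) ^ L <= 2 ^ j" by (intro power_increasing) auto
   show ?thesis
   proof (cases "i = 0")
    case True
    have "norm (S ((i + 1) * 2 ^ j) - S (i * 2 ^ j)) <= Z * 1"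
     using D'[of 0 0] j True by (simp add: S_def min_absorb2)
    also have "... <= Z * 2 powr (real j * be - real L * be)"
    proof (rule mult_left_mono[OF _ Z])
     have "0 <= real j * be - real L * be" using False be by (simp add: mult_right_mono)
     then show "1 <= 2 powr (real j * be - real L * be)" by (intro ge_one_powr_ge_zero) auto
    qed
    also have "... = (Z * 2 powr (- (real L * be))) * 2 powr (real j * be)" by (simp add: powr_add[symmetric])
    finally show ?thesis .
   next
    case i: False
    then have "1 * 2 ^ L <= i * 2 ^ j" using j by (intro mult_mono) auto
    moreover from this have "2 ^ L <= (i + 1) * 2 ^ j" by (simp add: trans_le_add1)
    ultimately show ?thesis using Z by (simp add: S_def min_absorb2)
   qed
  qed
  define k l where "k = nat \<lfloor>s / (T / 2 ^ L)\<rfloor>" and "l = nat \<lfloor>t / (T / 2 ^ L)\<rfloor>"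
  have kl: "k <= l" unfolding k_def l_def using st T by (intro nat_mono floor_mono divide_right_mono) auto
  have l: "l <= 2 ^ L"
  proof -
   have "t / (T / 2 ^ L) <= 2 ^ L" using st T by (simp add: field_simps)
   then have "\<lfloor>t / (T / 2 ^ L)\<rfloor> <= \<lfloor>2 ^ L :: real\<rfloor>" by (rule floor_mono)
   then show ?thesis by (simp add: l_def nat_le_iff)
  qed
  have "norm (S l - S k) <= 2 * 2 powr be / (2 powr be - 1) * (Z * 2 powr (- (real L * be))) * real (l - k) powr be"
   by (rule dyadic_chain[OF ch kl be]) (use Z in auto)
  also have "S l = f (p t L)" using l by (simp add: S_def p_def l_def min_absorb1)
  also have "S k = f (p s L)" using l kl by (simp add: S_def p_def k_def min_absorb1)
  also have "2 * 2 powr be / (2 powr be - 1) * (Z * 2 powr (- (real L * be))) * real (l - k) powr be = chainc be * T powr (- be) * Z * (p t L - p s L) powr be"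
  proof -
   have "p t L - p s L = real (l - k) * (T / 2 ^ L)" using kl by (simp add: p_def k_def l_def of_nat_diff left_diff_distrib diff_divide_distrib)
   then have e: "(p t L - p s L) powr be = real (l - k) powr be * T powr be * 2 powr (- (real L * be))"
    using T by (simp add: powr_mult powr_divide powr_realpow[symmetric] powr_powr powr_minus_divide)
   have tt: "T powr (- be) * T powr be = 1" using T by (simp add: powr_add[symmetric])
   have "chainc be * T powr (- be) * Z * (real (l - k) powr be * T powr be * 2 powr (- (real L * be)))
    = chainc be * (Z * 2 powr (- (real L * be))) * real (l - k) powr be * (T powr (- be) * T powr be)" by (simp only: mult_ac)
   then show ?thesis unfolding e tt by (simp add: chainc_def)
  qed
  finally show ?thesis by simp
 qed
 show ?thesis
 proof (rule LIMSEQ_le)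
  have fl: "(%L. f (p s L)) \<longlonglongrightarrow> f s" if "0 <= s" "s <= T" for s
   using that p[OF that(1)] order_trans[OF p(2)[OF that(1)] that(2)] by (intro continuous_on_tendsto_compose[OF cont lim]) auto
  show "(%L. \<bar>f (p t L) - f (p s L)\<bar>) \<longlonglongrightarrow> \<bar>f t - f s\<bar>" using st by (intro tendsto_intros fl) auto
  show "(%L. chainc be * T powr (- be) * Z * (p t L - p s L) powr be) \<longlonglongrightarrow> chainc be * T powr (- be) * Z * (t - s) powr be"
   using st False by (intro tendsto_intros lim) auto
 qed (use grid in auto)
qed simp

context driver
begin

text \<open>The 2 * r-th moments of the normalised increments at level l decay like 2 powr (- l * (2
  * r * (H - be))). As soon as r * (H - be) >= 1 this beats the number 2 ^ l of increments and
  leaves a factor (1 / 2) ^ l. The resulting square exponential moment dominates every power q <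
  2.\<close>

lemma component_hoelder:
 assumes j: "j \<in> {1..m}" and be: "0 < be" "be < H"
 shows "\<exists>Z. Z \<in> borel_measurable M \<and> (\<forall>om. 0 <= Z om)
   \<and> (AE om in M. \<forall>s t. 0 <= s --> s <= t --> t <= T --> \<bar>B j t om - B j s om\<bar> <= chainc be * T powr (- be) * Z om * (t - s) powr be)
   \<and> (\<forall>lam q. 0 <= lam --> 0 < q --> q < 2 --> (\<integral>\<^sup>+om. ennreal (exp (lam * Z om powr q)) \<partial>M) < \<infinity>)"
proof -
 define y where "y l i om = (if i < 2 ^ l then (B j (real (Suc i) * (T / 2 ^ l)) om - B j (real i * (T / 2 ^ l)) om) * 2 powr (real l * be) else 0)" for l i om
 have inT: "real i * (T / 2 ^ l) \<in> {0..T}" if "i <= 2 ^ l" for i l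
 proof -
  have "real i <= 2 ^ l" using that by (simp flip: of_nat_le_iff)
  then have "real i * T <= 2 ^ l * T" using T by (intro mult_right_mono) auto
  then show ?thesis using T by (simp add: field_simps)
 qed
 have ym: "y l i \<in> borel_measurable M" for l i
  using B_meas[OF j inT[of i l]] B_meas[OF j inT[of "Suc i" l]] by (cases "i < 2 ^ l") (auto simp: y_def[abs_def])
 \<comment> \<open>The 2 comes from \<open>gmom_le\<close>, the power of T from the variance at
   level 0.\<close>
 define v where "v = 2 * T powr (2 * H)"
 have v: "0 < v" using T by (simp add: v_def)
 obtain r0 :: nat where r0: "1 <= r0" "1 <= real r0 * (H - be)"
 proof -
  obtain r :: nat where "1 / (H - be) <= real r" using real_arch_simple by blast
  then have "1 <= real r * (H - be)" using be by (simp add: field_simps)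
  then show ?thesis using that[of r] by (cases r) auto
 qed
 have "\<exists>Z. Z \<in> borel_measurable M \<and> (\<forall>om. 0 <= Z om) \<and> (AE om in M. \<forall>l. \<forall>i<2 ^ l. \<bar>y l i om\<bar> <= Z om)
   \<and> (\<integral>\<^sup>+om. ennreal (exp (1 / (2 * v) * (Z om)\<^sup>2)) \<partial>M) < \<infinity>"
 proof (rule sup_exp_square[OF ym r0(1) v])
  fix r l assume r: "r0 <= r"
  have one: "(\<integral>\<^sup>+om. ennreal (y l i om ^ (2 * r)) \<partial>M) <= ennreal (v ^ r * fact r * (1 / 2) ^ l / 2 ^ l)" if "i < 2 ^ l" for i
  proof -
   have I: "real i * (T / 2 ^ l) \<in> {0..T}" "real (Suc i) * (T / 2 ^ l) \<in> {0..T}" using that by (intro inT; simp)+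
   have "(\<integral>\<^sup>+om. ennreal (y l i om ^ (2 * r)) \<partial>M) = (\<integral>\<^sup>+om. ennreal ((2 powr (real l * be)) ^ (2 * r)) * ennreal ((B j (real (Suc i) * (T / 2 ^ l)) om - B j (real i * (T / 2 ^ l)) om) ^ (2 * r)) \<partial>M)"
    using that by (intro nn_integral_cong) (simp add: y_def power_mult_distrib ennreal_mult[symmetric] power_mult mult.commute)
   also have "... = ennreal ((2 powr (real l * be)) ^ (2 * r)) * ennreal (gmom r * (\<bar>real (Suc i) * (T / 2 ^ l) - real i * (T / 2 ^ l)\<bar> powr (2 * H)) ^ r)"
    unfolding inc_moment_nn[OF j I, symmetric] using B_meas[OF j I(1)] B_meas[OF j I(2)] by (intro nn_integral_cmult) auto
   also have "\<bar>real (Suc i) * (T / 2 ^ l) - real i * (T / 2 ^ l)\<bar> = T / 2 ^ l"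
   proof -
    have sd: "real (Suc i) * c - real i * c = c" for c by (simp add: algebra_simps)
    show ?thesis unfolding sd using T by simp
   qed
   also have "ennreal ((2 powr (real l * be)) ^ (2 * r)) * ennreal (gmom r * ((T / 2 ^ l) powr (2 * H)) ^ r) = ennreal (gmom r * (T powr (2 * H)) ^ r * 2 powr (- (real l * (2 * real r * (H - be)))))"
   proof -
    have "((T / 2 ^ l) powr (2 * H)) ^ r = (T powr (2 * H)) ^ r * 2 powr (- (real l * (2 * H) * real r))"
     using T by (simp add: powr_divide powr_realpow[symmetric] powr_powr power_divide powr_minus_divide)
    moreover have "(2 powr (real l * be)) ^ (2 * r) = 2 powr (real l * be * (2 * real r))" by (simp add: powr_realpow[symmetric] powr_powr)
    ultimately have "(2 powr (real l * be)) ^ (2 * r) * (gmom r * ((T / 2 ^ l) powr (2 * H)) ^ r) = gmom r * (T powr (2 * H)) ^ r * (2 powr (real l * be * (2 * real r)) * 2 powr (- (real l * (2 * H) * real r)))"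
     by simp
    also have "2 powr (real l * be * (2 * real r)) * 2 powr (- (real l * (2 * H) * real r)) = 2 powr (- (real l * (2 * real r * (H - be))))"
     by (simp add: powr_add[symmetric] algebra_simps)
    finally show ?thesis using gmom_pos[of r] by (simp add: ennreal_mult[symmetric])
   qed
   also have "... <= ennreal ((2 ^ r * fact r) * (T powr (2 * H)) ^ r * 2 powr (- (real l * 2)))"
   proof (intro ennreal_leI mult_mono gmom_le powr_mono)
    have "real r0 * (H - be) <= real r * (H - be)" using r be by (intro mult_right_mono) auto
    then have "1 <= real r * (H - be)" using r0(2) by linarith
    then have "real l * 2 <= real l * (2 * real r * (H - be))" by (intro mult_left_mono) auto
    then show "- (real l * (2 * real r * (H - be))) <= - (real l * 2)" by simp
   qed (use gmom_pos[of r] in auto)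
   also have "(2 ^ r * fact r) * (T powr (2 * H)) ^ r * 2 powr (- (real l * 2)) = v ^ r * fact r * (1 / 2) ^ l / 2 ^ l"
   proof -
    have "2 powr (real l * 2) = 2 powr real l * (2 powr real l :: real)" by (simp add: powr_add[symmetric] mult.commute)
    also have "... = 2 ^ l * 2 ^ l" by (simp add: powr_realpow)
    finally have "2 powr (- (real l * 2)) = ((1 / 2) ^ l / 2 ^ l :: real)"
     by (simp only: powr_minus_divide power_one_over divide_divide_eq_left)
    then show ?thesis by (simp add: v_def power_mult_distrib)
   qed
   finally show ?thesis .
  qed
  have "(\<Sum>i<2 ^ l. \<integral>\<^sup>+om. ennreal (y l i om ^ (2 * r)) \<partial>M) <= (\<Sum>i<(2::nat) ^ l. ennreal (v ^ r * fact r * (1 / 2) ^ l / 2 ^ l))"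
   by (intro sum_mono one) auto
  also have "... = ennreal (v ^ r * fact r * (1 / 2) ^ l)"
   using v by (simp add: ennreal_of_nat_eq_real_of_nat ennreal_mult[symmetric])
  finally show "(\<Sum>i<2 ^ l. \<integral>\<^sup>+om. ennreal (y l i om ^ (2 * r)) \<partial>M) <= ennreal (v ^ r * fact r * (1 / 2) ^ l)" .
 qed
 then obtain Z where Z: "Z \<in> borel_measurable M" "!!om. 0 <= Z om" "AE om in M. \<forall>l. \<forall>i<2 ^ l. \<bar>y l i om\<bar> <= Z om"
  "(\<integral>\<^sup>+om. ennreal (exp (1 / (2 * v) * (Z om)\<^sup>2)) \<partial>M) < \<infinity>" by blast
 note B_cont[OF j]
 with Z(3) have "AE om in M. \<forall>s t. 0 <= s --> s <= t --> t <= T --> \<bar>B j t om - B j s om\<bar> <= chainc be * T powr (- be) * Z om * (t - s) powr be"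
 proof eventually_elim
  case (elim om)
  show ?case
  proof (intro allI impI)
   fix s t assume "0 <= s" "s <= t" "t <= T"
   then show "\<bar>B j t om - B j s om\<bar> <= chainc be * T powr (- be) * Z om * (t - s) powr be"
   proof (intro dyadic_hoelder[OF elim(2) T be(1) Z(2)])
    fix l i assume "i < (2::nat) ^ l"
    then show "\<bar>(B j (real (Suc i) * (T / 2 ^ l)) om - B j (real i * (T / 2 ^ l)) om) * 2 powr (real l * be)\<bar> <= Z om"
     using elim(1) by (auto simp: y_def dest!: spec[of _ l] spec[of _ i])
   qed
  qed
 qed
 moreover have "(\<integral>\<^sup>+om. ennreal (exp (lam * Z om powr q)) \<partial>M) < \<infinity>" if "0 <= lam" "0 < q" "q < 2" for lam q
 proof -
  define k where "k = lam * ((lam / (1 / (2 * v))) powr (1 / (2 - q))) powr q"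
  have "(\<integral>\<^sup>+om. ennreal (exp (lam * Z om powr q)) \<partial>M) <= (\<integral>\<^sup>+om. ennreal (exp k) * ennreal (exp (1 / (2 * v) * (Z om)\<^sup>2)) \<partial>M)"
  proof (rule nn_integral_mono)
   fix om
   have "lam * Z om powr q <= 1 / (2 * v) * (Z om)\<^sup>2 + k" unfolding k_def using that v Z(2) by (intro exp_lower_power) auto
   then have "exp (lam * Z om powr q) <= exp k * exp (1 / (2 * v) * (Z om)\<^sup>2)" by (simp add: exp_add[symmetric] add.commute)
   then show "ennreal (exp (lam * Z om powr q)) <= ennreal (exp k) * ennreal (exp (1 / (2 * v) * (Z om)\<^sup>2))"
    by (simp add: ennreal_mult[symmetric] ennreal_leI)
  qed
  also have "... = ennreal (exp k) * (\<integral>\<^sup>+om. ennreal (exp (1 / (2 * v) * (Z om)\<^sup>2)) \<partial>M)"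
   using Z(1) by (intro nn_integral_cmult) auto
  also have "... < \<infinity>" using Z(4) by (simp add: ennreal_mult_less_top)
  finally show ?thesis .
 qed
 ultimately show ?thesis using Z by blast
qed

text \<open>All components are put into one constant. The exponent 1 / be is admissible in
  \<open>component_hoelder\<close> because be > 1/2 makes it smaller than 2.\<close>

lemma driver_hoelder:
 assumes be: "1 / 2 < be" "be < H"
 shows "\<exists>G. G \<in> borel_measurable M \<and> (\<forall>om. 1 <= G om)
   \<and> (AE om in M. \<forall>j\<le>m. \<forall>s t. 0 <= s --> s <= t --> t <= T --> \<bar>B j t om - B j s om\<bar> <= G om * (t - s) powr be)
   \<and> (\<forall>lam\<ge>0. (\<integral>\<^sup>+om. ennreal (exp (lam * G om powr (1 / be))) \<partial>M) < \<infinity>)"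
proof -
 define cc where "cc = chainc be * T powr (- be)"
 have cc: "0 <= cc" unfolding cc_def using chainc_pos[of be] be by simp
 have "\<forall>j\<in>{1..m}. \<exists>Z. Z \<in> borel_measurable M \<and> (\<forall>om. 0 <= Z om)
   \<and> (AE om in M. \<forall>s t. 0 <= s --> s <= t --> t <= T --> \<bar>B j t om - B j s om\<bar> <= cc * Z om * (t - s) powr be)
   \<and> (\<forall>lam q. 0 <= lam --> 0 < q --> q < 2 --> (\<integral>\<^sup>+om. ennreal (exp (lam * Z om powr q)) \<partial>M) < \<infinity>)"
  unfolding cc_def using be by (intro ballI component_hoelder) auto
 from bchoice[OF this] obtain Z where Zall: "\<forall>j\<in>{1..m}. Z j \<in> borel_measurable M \<and> (\<forall>om. 0 <= Z j om)
   \<and> (AE om in M. \<forall>s t. 0 <= s --> s <= t --> t <= T --> \<bar>B j t om - B j s om\<bar> <= cc * Z j om * (t - s) powr be)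
   \<and> (\<forall>lam q. 0 <= lam --> 0 < q --> q < 2 --> (\<integral>\<^sup>+om. ennreal (exp (lam * Z j om powr q)) \<partial>M) < \<infinity>)" ..
 \<comment> \<open>Time contributes its Hoelder constant on the whole interval; the extra 1 ensures
   \<open>1 <= G\<close>.\<close>
 define z where "z j om = (if j = 0 then 1 + T powr (1 - be) else cc * Z j om)" for j om
 have zm[measurable]: "z j \<in> borel_measurable M" if "j <= m" for j
 proof (cases "j = 0")
  case False
  then have "Z j \<in> borel_measurable M" using Zall that by auto
  then show ?thesis using False by (simp add: z_def[abs_def])
 qed (simp add: z_def[abs_def])
 have z0: "0 <= z j om" if "j <= m" for j om using Zall that cc by (cases "j = 0") (auto simp: z_def)
 define G where "G om = (\<Sum>j\<le>m. z j om)" for om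
 have zG: "z j om <= G om" if "j <= m" for j om
  unfolding G_def using that z0 by (intro member_le_sum) auto
 have Gm: "G \<in> borel_measurable M" unfolding G_def[abs_def] by (intro borel_measurable_sum zm) auto
 have G1: "1 <= G om" for om using zG[of 0 om] by (simp add: z_def) (metis add_increasing2 dual_order.trans order_refl powr_ge_zero)
 have "AE om in M. \<forall>j\<in>{1..m}. \<forall>s t. 0 <= s --> s <= t --> t <= T --> \<bar>B j t om - B j s om\<bar> <= cc * Z j om * (t - s) powr be"
  using Zall by (subst AE_ball_countable) auto
 moreover have "AE om in M. om \<in> space M" by (rule AE_space)
 ultimately have "AE om in M. \<forall>j\<le>m. \<forall>s t. 0 <= s --> s <= t --> t <= T --> \<bar>B j t om - B j s om\<bar> <= G om * (t - s) powr be"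
 proof eventually_elim
  case (elim om)
  show ?case
  proof (intro allI impI)
   fix j s t assume j: "j <= m" and st: "0 <= s" "s <= t" "t <= T"
   have "\<bar>B j t om - B j s om\<bar> <= z j om * (t - s) powr be"
   proof (cases "j = 0")
    case True
    have "\<bar>B j t om - B j s om\<bar> = (t - s) powr (1 - be) * (t - s) powr be"
     using True st B_time[of t om] B_time[of s om] elim(2) by (simp add: powr_add[symmetric])
    also have "... <= T powr (1 - be) * (t - s) powr be" using st be H by (intro mult_right_mono powr_mono2) auto
    also have "... <= z j om * (t - s) powr be" using True by (intro mult_right_mono) (auto simp: z_def)
    finally show ?thesis .
   next
    case False
    then have "j \<in> {1..m}" using j by auto
    then show ?thesis using elim(1) st False by (auto simp: z_def)
   qed
   also have "... <= G om * (t - s) powr be" by (intro mult_right_mono zG j) auto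
   finally show "\<bar>B j t om - B j s om\<bar> <= G om * (t - s) powr be" .
  qed
 qed
 moreover have "(\<integral>\<^sup>+om. ennreal (exp (lam * G om powr (1 / be))) \<partial>M) < \<infinity>" if lam: "0 <= lam" for lam
 proof -
  define q where "q = 1 / be"
  have q: "0 < q" "q < 2" using be by (auto simp: q_def field_simps)
  define \<mu> where "\<mu> = lam * real (Suc m) powr q"
  have \<mu>: "0 <= \<mu>" using lam by (simp add: \<mu>_def)
  \<comment> \<open>A sum of m + 1 terms is at most m + 1 times the largest one, so the exponential
    is bounded by the sum of the exponentials for the single components.\<close>
  have "(\<integral>\<^sup>+om. ennreal (exp (lam * G om powr q)) \<partial>M) <= (\<integral>\<^sup>+om. (\<Sum>j\<le>m. ennreal (exp (\<mu> * z j om powr q))) \<partial>M)"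
  proof (rule nn_integral_mono)
   fix om
   obtain i where i: "i <= m" "!!j. j <= m ==> z j om <= z i om"
    using ex_max_on[of "{..m}" "%j. z j om"] by (metis atMost_iff finite_atMost empty_iff zero_le)
   have "G om <= real (card {..m}) * z i om" unfolding G_def using i by (intro sum_bounded_above) auto
   then have "G om powr q <= (real (Suc m) * z i om) powr q" using q G1[of om] by (intro powr_mono2) auto
   also have "... = real (Suc m) powr q * z i om powr q" by (rule powr_mult)
   finally have "lam * G om powr q <= \<mu> * z i om powr q" using lam by (simp add: \<mu>_def mult.assoc mult_left_mono)
   then have "ennreal (exp (lam * G om powr q)) <= ennreal (exp (\<mu> * z i om powr q))" by (intro ennreal_leI) simp
   also have "... <= (\<Sum>j\<le>m. ennreal (exp (\<mu> * z j om powr q)))" using i by (intro member_le_sum) auto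
   finally show "ennreal (exp (lam * G om powr q)) <= (\<Sum>j\<le>m. ennreal (exp (\<mu> * z j om powr q)))" .
  qed
  also have "... = (\<Sum>j\<le>m. \<integral>\<^sup>+om. ennreal (exp (\<mu> * z j om powr q)) \<partial>M)" by (intro nn_integral_sum) auto
  also have "... < \<infinity>"
  proof -
   have "(\<integral>\<^sup>+om. ennreal (exp (\<mu> * z j om powr q)) \<partial>M) < \<infinity>" if j: "j <= m" for j
   proof (cases "j = 0")
    case True
    then show ?thesis by (simp add: z_def emeasure_space_1)
   next
    case False
    then have "j \<in> {1..m}" using j by auto
    then have "(\<integral>\<^sup>+om. ennreal (exp ((\<mu> * cc powr q) * Z j om powr q)) \<partial>M) < \<infinity>" using Zall q \<mu> by auto
    moreover have "(\<mu> * cc powr q) * Z j om powr q = \<mu> * z j om powr q" for om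
     using False Zall \<open>j \<in> {1..m}\<close> cc by (simp add: z_def powr_mult)
    ultimately show ?thesis by simp
   qed
   then show ?thesis by simp
  qed
  finally show ?thesis by (simp add: q_def)
 qed
 ultimately show ?thesis using Gm G1 by blast
qed

section \<open>Random weights bounding the sums of areas and cubes\<close>

text \<open>The 2 * r-th moment of a sum over k..l is at most a constant times (h powr et) ^ (2 * r)
  * x ^ r, where x is the covered fraction of the grid, so chaining from the exponent 1/2 down to
  \<open>tht\<close> applies. For areas x ^ r stems from the number of cells, for cubes from x powr
  (2 * H) <= x. The flag \<open>fl\<close> tells whether areas have to be controlled.\<close>

lemma weights_exist:
 assumes tht: "0 < tht" "tht < 1 / 2" and r: "1 <= r" "2 <= 2 * real r * (1 / 2 - tht)" and et: "0 < et"
  and fl: "fl ==> et <= H + 1 / 2" "fl ==> m ~= 1 ==> et <= 2 * H - 1 / 2" "m = 1 ==> et <= 2 * H"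
 shows "\<exists>C\<ge>0. \<forall>n\<ge>1. \<forall>N\<ge>1. \<exists>Tht. Tht \<in> borel_measurable M \<and> (\<forall>om. 0 <= Tht om)
   \<and> (\<forall>om i j k l. fl --> i < j --> j <= m --> k <= l --> l <= n --> \<bar>\<Sum>s=k..<l. cell_area (T / real n) N s i j om\<bar> <= Tht om * (real (l - k) * (T / real n)) powr tht)
   \<and> (\<forall>om k l. m = 1 --> k <= l --> l <= n --> \<bar>\<Sum>s=k..<l. (B 1 (real (Suc s) * (T / real n)) om - B 1 (real s * (T / real n)) om) ^ 3\<bar> <= Tht om * (real (l - k) * (T / real n)) powr tht)
   \<and> (\<integral>\<^sup>+om. ennreal (Tht om ^ (2 * r)) \<partial>M) <= ennreal (C * ((T / real n) powr et) ^ (2 * r))"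
proof -
 define TT where "TT = (1 + T) ^ 4"
 have TT: "1 <= TT" using T by (simp add: TT_def)
 define KK where "KK = areac r * (2 * T * TT) ^ r + cubec r * (T powr (2 * H)) ^ r * TT ^ (2 * r)"
 have ac: "0 <= areac r" "0 <= cubec r"
  using r gmom_pos[of r] gmom_pos[of "2 * r"] by (auto simp: areac_def cubec_def intro!: add_nonneg_nonneg mult_nonneg_nonneg)
 have KK: "0 <= areac r * (2 * T * TT) ^ r" "0 <= cubec r * (T powr (2 * H)) ^ r * TT ^ (2 * r)"
  using ac T TT by auto
 define P where "P = chainc tht ^ (2 * r) * 2 powr (2 * real r * (1 / 2 - tht) + 1)"
 have P: "0 <= P" using chainc_pos[of tht] tht by (simp add: P_def)
 define F where "F = {..m} \<times> {..m}"
 define CC where "CC = real (card F) ^ (2 * r) * (real (card F) * ((T powr (- tht)) ^ (2 * r) * (P * KK)))"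
 \<comment> \<open>\<open>TT\<close> absorbs a surplus power of h <= T whatever the size of T; the
   surplus is at most 4 in all uses.\<close>
 have hp: "h powr \<alpha> <= TT * h powr \<alpha>'" if "0 < h" "h <= T" "\<alpha>' <= \<alpha>" "\<alpha> <= \<alpha>' + 4" for h \<alpha> \<alpha>'
 proof -
  have "h powr \<alpha> = h powr (\<alpha> - \<alpha>') * h powr \<alpha>'" by (simp add: powr_add[symmetric])
  also have "h powr (\<alpha> - \<alpha>') <= (1 + T) powr (\<alpha> - \<alpha>')" using that by (intro powr_mono2) auto
  also have "... <= (1 + T) powr 4" using that T by (intro powr_mono) auto
  also have "... = TT" using T by (simp add: TT_def powr_numeral)
  finally show ?thesis by (simp add: mult_right_mono)
 qed
 have main: "\<exists>Tht. Tht \<in> borel_measurable M \<and> (\<forall>om. 0 <= Tht om)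
   \<and> (\<forall>om i j k l. fl --> i < j --> j <= m --> k <= l --> l <= n --> \<bar>\<Sum>s=k..<l. cell_area h N s i j om\<bar> <= Tht om * (real (l - k) * h) powr tht)
   \<and> (\<forall>om k l. m = 1 --> k <= l --> l <= n --> \<bar>\<Sum>s=k..<l. (B 1 (real (Suc s) * h) om - B 1 (real s * h) om) ^ 3\<bar> <= Tht om * (real (l - k) * h) powr tht)
   \<and> (\<integral>\<^sup>+om. ennreal (Tht om ^ (2 * r)) \<partial>M) <= ennreal (CC * (h powr et) ^ (2 * r))" if n: "1 <= n" and N: "1 <= N" and hh: "h = T / real n" for n N h
 proof -
  have h: "0 < h" "h <= T" "real n * h = T" using n T by (auto simp: hh field_simps)
  have lT: "real l * h <= T" if "l <= n" for l
   using mult_right_mono[of "real l" "real n" h] h that by simp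
  \<comment> \<open>One index set serves both families: pairs with i < j carry the areas, the other
    pairs the cubes, which are later read off at (0, 0).\<close>
  define a where "a ij s om = (if fst ij < snd ij then if fl then cell_area h N s (fst ij) (snd ij) om else 0
    else if m = 1 then (B 1 (real (Suc s) * h) om - B 1 (real s * h) om) ^ 3 else 0)" for ij s om
  have one: "\<exists>Z. Z \<in> borel_measurable M \<and> (\<forall>om. 0 <= Z om) \<and>
    (\<forall>om. \<forall>k l. k <= l --> l <= n --> \<bar>\<Sum>s=k..<l. a ij s om\<bar> <= Z om * (real (l - k) / real n) powr tht) \<and>
    (\<integral>\<^sup>+om. ennreal (Z om ^ (2 * r)) \<partial>M) <= ennreal (P * (KK * (h powr et) ^ (2 * r)))" if ij: "ij \<in> F" for ij
  proof -
   obtain i j where ij': "ij = (i, j)" "i <= m" "j <= m" using ij by (auto simp: F_def)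
   have mm: "(%om. \<Sum>s=k..<l. a ij s om) \<in> borel_measurable M \<and>
     (\<integral>\<^sup>+om. ennreal ((\<Sum>s=k..<l. a ij s om) ^ (2 * r)) \<partial>M) <= ennreal (KK * (h powr et) ^ (2 * r) * (real (l - k) / real n) powr (2 * real r * (1 / 2)))" if kl: "k <= l" "l <= n" for k l
   proof -
    define x where "x = real (l - k) / real n"
    have x: "0 <= x" "x <= 1" "real (l - k) = x * real n" using n kl by (auto simp: x_def field_simps)
    have xr: "x powr (2 * real r * (1 / 2)) = x ^ r" using x r by (cases "x = 0") (auto simp: powr_realpow power_0_left)
    consider "i < j" "fl" | "~ i < j" "m = 1" | "i < j" "~ fl" | "~ i < j" "m ~= 1" by blast
    then show ?thesis
    proof cases
     case 1
     have aeq: "(\<Sum>s=k..<l. a ij s om) = (\<Sum>s=k..<l. cell_area h N s i j om)" for om using 1 by (simp add: a_def ij')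
     note A = area_moment[OF 1(1) ij'(3) N h(1) kl(1) lT[OF kl(2)] r(1)]
     have nh: "real (l - k) * h = x * T" using x(3) h(3) by simp
     have "2 * real (l - k) * sig h i * sig h j <= (2 * T * TT) * (h powr et)\<^sup>2 * x"
     proof -
      have s: "sig h i * sig h j <= h * (TT * h powr (2 * et))"
      proof (cases "i = 0")
       case True
       have "sig h i * sig h j = h powr 2 * h powr (2 * H)" using True 1 h by (simp add: sig_def powr_numeral)
       also have "... = h powr 1 * h powr (2 * H + 1)" by (simp only: powr_add[symmetric]) simp
       also have "... = h * h powr (2 * H + 1)" using h by simp
       also have "... <= h * (TT * h powr (2 * et))" using h fl(1)[OF 1(2)] H et by (intro mult_left_mono hp) auto
       finally show ?thesis .
      next
       case False
       have "m ~= 1" using False 1 ij' by auto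
       have "sig h i * sig h j = h powr (2 * H) * h powr (2 * H)" using False 1 h by (simp add: sig_def)
       also have "... = h powr 1 * h powr (4 * H - 1)" by (simp only: powr_add[symmetric]) simp
       also have "... = h * h powr (4 * H - 1)" using h by simp
       also have "... <= h * (TT * h powr (2 * et))" using h fl(2)[OF 1(2) \<open>m ~= 1\<close>] H et by (intro mult_left_mono hp) auto
       finally show ?thesis .
      qed
      have "2 * real (l - k) * sig h i * sig h j = (2 * real (l - k)) * (sig h i * sig h j)" by simp
      also have "... <= (2 * real (l - k)) * (h * (TT * h powr (2 * et)))" by (intro mult_left_mono s) auto
      also have "... = 2 * (real (l - k) * h) * (TT * h powr (2 * et))" by simp
      also have "... = (2 * T * TT) * (h powr et)\<^sup>2 * x" unfolding nh by (simp add: power2_eq_square powr_add[symmetric])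
      finally show ?thesis .
     qed
     then have "(2 * real (l - k) * sig h i * sig h j) ^ r <= ((2 * T * TT) * (h powr et)\<^sup>2 * x) ^ r"
      by (intro power_mono) (auto simp: sig_def)
     then have "areac r * (2 * real (l - k) * sig h i * sig h j) ^ r <= areac r * ((2 * T * TT) * (h powr et)\<^sup>2 * x) ^ r"
      using ac by (intro mult_left_mono) auto
     also have "... = areac r * (2 * T * TT) ^ r * ((h powr et) ^ (2 * r) * x ^ r)"
      by (simp add: power_mult_distrib power_mult[symmetric])
     also have "... <= KK * ((h powr et) ^ (2 * r) * x ^ r)" using KK x by (intro mult_right_mono) (auto simp: KK_def)
     finally have b: "areac r * (2 * real (l - k) * sig h i * sig h j) ^ r <= KK * ((h powr et) ^ (2 * r) * x ^ r)" .
     have "(\<integral>\<^sup>+om. ennreal ((\<Sum>s=k..<l. cell_area h N s i j om) ^ (2 * r)) \<partial>M) = ennreal (expectation (%om. (\<Sum>s=k..<l. cell_area h N s i j om) ^ (2 * r)))"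
      by (rule nn_integral_eq_integral[OF A(2)]) (simp add: zero_le_even_power)
     also have "... <= ennreal (KK * (h powr et) ^ (2 * r) * x ^ r)"
      using order_trans[OF A(1) b] by (intro ennreal_leI) (simp only: mult.assoc)
     finally show ?thesis unfolding aeq x_def[symmetric] xr using A(3) by (rule conjI[rotated])
    next
     case 2
     have aeq: "(\<Sum>s=k..<l. a ij s om) = (\<Sum>s=k..<l. (B 1 (real (Suc s) * h) om - B 1 (real s * h) om) ^ 3)" for om using 2 by (simp add: a_def ij')
     have m1: "1 \<in> {1..m}" using 2 by simp
     note A = cube_moment[OF m1 h(1) kl(1) lT[OF kl(2)] r(1)]
     have nh: "real (l - k) * h = x * T" using x(3) h(3) by simp
     have "cubec r * (h powr (2 * H)) ^ (2 * r) * ((real (l - k) * h) powr (2 * H)) ^ r <= cubec r * (TT * h powr et) ^ (2 * r) * (x * T powr (2 * H)) ^ r"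
     proof (intro mult_mono mult_left_mono power_mono)
      show "h powr (2 * H) <= TT * h powr et" using h fl(3)[OF 2(2)] H et by (intro hp) auto
      have "x powr (2 * H) <= x powr 1" using x H by (intro powr_mono') auto
      then show "(real (l - k) * h) powr (2 * H) <= x * T powr (2 * H)"
       unfolding nh using x T by (simp add: powr_mult mult_right_mono)
     qed (use ac x in auto)
     also have "... = (cubec r * (T powr (2 * H)) ^ r * TT ^ (2 * r)) * ((h powr et) ^ (2 * r) * x ^ r)"
      by (simp add: power_mult_distrib)
     also have "... <= KK * ((h powr et) ^ (2 * r) * x ^ r)" using KK x by (intro mult_right_mono) (auto simp: KK_def)
     finally have b: "cubec r * (h powr (2 * H)) ^ (2 * r) * ((real (l - k) * h) powr (2 * H)) ^ r <= KK * ((h powr et) ^ (2 * r) * x ^ r)" .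
     have "(\<integral>\<^sup>+om. ennreal ((\<Sum>s=k..<l. (B 1 (real (Suc s) * h) om - B 1 (real s * h) om) ^ 3) ^ (2 * r)) \<partial>M) = ennreal (expectation (%om. (\<Sum>s=k..<l. (B 1 (real (Suc s) * h) om - B 1 (real s * h) om) ^ 3) ^ (2 * r)))"
      by (rule nn_integral_eq_integral[OF A(2)]) (simp add: zero_le_even_power)
     also have "... <= ennreal (KK * (h powr et) ^ (2 * r) * x ^ r)"
      using order_trans[OF A(1) b] by (intro ennreal_leI) (simp only: mult.assoc)
     finally show ?thesis unfolding aeq x_def[symmetric] xr using A(3) by (rule conjI[rotated])
    qed (use r in \<open>auto simp: a_def ij' power_0_left\<close>)
   qed
   define S where "S k om = (\<Sum>s<k. a ij s om)" for k om
   have Sd: "S l om - S k om = (\<Sum>s=k..<l. a ij s om)" if "k <= l" for k l om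
    unfolding S_def using that by (simp add: sum_diff_nat_ivl lessThan_atLeast0)
   have "\<exists>Z. Z \<in> borel_measurable M \<and> (\<forall>om. 0 <= Z om) \<and>
     (\<forall>om. \<forall>k l. k <= l --> l <= n --> \<bar>S l om - S k om\<bar> <= Z om * (real (l - k) / real n) powr tht) \<and>
     (\<integral>\<^sup>+om. ennreal (Z om ^ (2 * r)) \<partial>M) <= ennreal (chainc tht ^ (2 * r) * 2 powr (2 * real r * (1 / 2 - tht) + 1) * (KK * (h powr et) ^ (2 * r)))"
   proof (rule kolmogorov_grid[OF prob _ n r(1) tht r(2)])
    fix k assume "k <= n"
    then show "S k \<in> borel_measurable M" using mm[of 0 k] by (simp add: S_def[abs_def] lessThan_atLeast0)
   next
    show "0 <= KK * (h powr et) ^ (2 * r)" using KK by (auto simp: KK_def)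
   next
    fix k l assume "k <= l" "l <= n"
    then show "(\<integral>\<^sup>+om. ennreal ((S l om - S k om) ^ (2 * r)) \<partial>M) <= ennreal (KK * (h powr et) ^ (2 * r) * (real (l - k) / real n) powr (2 * real r * (1 / 2)))"
     using mm[of k l] by (simp add: Sd)
   qed
   then show ?thesis using Sd by (auto simp: P_def)
  qed
  have "\<forall>ij\<in>F. \<exists>Z. Z \<in> borel_measurable M \<and> (\<forall>om. 0 <= Z om) \<and>
    (\<forall>om. \<forall>k l. k <= l --> l <= n --> \<bar>\<Sum>s=k..<l. a ij s om\<bar> <= Z om * (real (l - k) / real n) powr tht) \<and>
    (\<integral>\<^sup>+om. ennreal (Z om ^ (2 * r)) \<partial>M) <= ennreal (P * (KK * (h powr et) ^ (2 * r)))" using one by blast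
  from bchoice[OF this] obtain Z where Zall: "\<forall>ij\<in>F. Z ij \<in> borel_measurable M \<and> (\<forall>om. 0 <= Z ij om) \<and>
    (\<forall>om. \<forall>k l. k <= l --> l <= n --> \<bar>\<Sum>s=k..<l. a ij s om\<bar> <= Z ij om * (real (l - k) / real n) powr tht) \<and>
    (\<integral>\<^sup>+om. ennreal (Z ij om ^ (2 * r)) \<partial>M) <= ennreal (P * (KK * (h powr et) ^ (2 * r)))" ..
  define Tht where "Tht om = T powr (- tht) * (\<Sum>ij\<in>F. Z ij om)" for om
  have fin: "finite F" by (simp add: F_def)
  have Z0: "0 <= Z ij om" if "ij \<in> F" for ij om using Zall that by auto
  have Zm[measurable]: "Z ij \<in> borel_measurable M" if "ij \<in> F" for ij using Zall that by auto
  have use_a: "\<bar>\<Sum>s=k..<l. a ij s om\<bar> <= Tht om * (real (l - k) * h) powr tht" if "ij \<in> F" "k <= l" "l <= n" for ij k l om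
  proof -
   have e: "real (l - k) / real n = real (l - k) * h / T" using n T by (simp add: hh)
   have "(real (l - k) / real n) powr tht = T powr (- tht) * (real (l - k) * h) powr tht"
    unfolding e using T h by (simp add: powr_divide powr_minus_divide)
   then have "\<bar>\<Sum>s=k..<l. a ij s om\<bar> <= Z ij om * (T powr (- tht) * (real (l - k) * h) powr tht)" using Zall that by metis
   also have "... <= (\<Sum>ij\<in>F. Z ij om) * (T powr (- tht) * (real (l - k) * h) powr tht)"
    using that fin Z0 by (intro mult_right_mono member_le_sum) auto
   finally show ?thesis by (simp add: Tht_def mult_ac)
  qed
  have "(\<integral>\<^sup>+om. ennreal (Tht om ^ (2 * r)) \<partial>M) <= (\<integral>\<^sup>+om. ennreal ((T powr (- tht)) ^ (2 * r) * real (card F) ^ (2 * r)) * (\<Sum>ij\<in>F. ennreal (Z ij om ^ (2 * r))) \<partial>M)"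
  proof (rule nn_integral_mono)
   fix om
   have "Tht om ^ (2 * r) <= (T powr (- tht)) ^ (2 * r) * (real (card F) ^ (2 * r) * (\<Sum>ij\<in>F. Z ij om ^ (2 * r)))"
    unfolding Tht_def power_mult_distrib using r fin Z0 by (intro mult_left_mono sum_power_le) auto
   then have "ennreal (Tht om ^ (2 * r)) <= ennreal (((T powr (- tht)) ^ (2 * r) * real (card F) ^ (2 * r)) * (\<Sum>ij\<in>F. Z ij om ^ (2 * r)))"
    by (intro ennreal_leI) (simp add: mult.assoc)
   also have "... = ennreal ((T powr (- tht)) ^ (2 * r) * real (card F) ^ (2 * r)) * (\<Sum>ij\<in>F. ennreal (Z ij om ^ (2 * r)))"
    using Z0 by (subst ennreal_mult) (auto simp: sum_ennreal intro!: sum_nonneg)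
   finally show "ennreal (Tht om ^ (2 * r)) <= ennreal ((T powr (- tht)) ^ (2 * r) * real (card F) ^ (2 * r)) * (\<Sum>ij\<in>F. ennreal (Z ij om ^ (2 * r)))" .
  qed
  also have "... = ennreal ((T powr (- tht)) ^ (2 * r) * real (card F) ^ (2 * r)) * (\<Sum>ij\<in>F. \<integral>\<^sup>+om. ennreal (Z ij om ^ (2 * r)) \<partial>M)"
  proof -
   have "(\<integral>\<^sup>+om. (\<Sum>ij\<in>F. ennreal (Z ij om ^ (2 * r))) \<partial>M) = (\<Sum>ij\<in>F. \<integral>\<^sup>+om. ennreal (Z ij om ^ (2 * r)) \<partial>M)"
    by (rule nn_integral_sum) auto
   then show ?thesis by (subst nn_integral_cmult) (auto simp del: sum_ennreal)
  qed
  also have "... <= ennreal ((T powr (- tht)) ^ (2 * r) * real (card F) ^ (2 * r)) * (\<Sum>ij\<in>F. ennreal (P * (KK * (h powr et) ^ (2 * r))))"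
   using Zall by (intro mult_left_mono sum_mono) auto
  also have "... = ennreal (CC * (h powr et) ^ (2 * r))"
  proof -
   have "0 <= P * (KK * (h powr et) ^ (2 * r))" using P KK by (auto simp: KK_def)
   then have "ennreal ((T powr (- tht)) ^ (2 * r) * real (card F) ^ (2 * r)) * (\<Sum>ij\<in>F. ennreal (P * (KK * (h powr et) ^ (2 * r))))
    = ennreal ((T powr (- tht)) ^ (2 * r) * real (card F) ^ (2 * r) * (real (card F) * (P * (KK * (h powr et) ^ (2 * r)))))"
    by (simp add: ennreal_of_nat_eq_real_of_nat ennreal_mult[symmetric])
   then show ?thesis by (simp add: CC_def mult_ac)
  qed
  finally have E: "(\<integral>\<^sup>+om. ennreal (Tht om ^ (2 * r)) \<partial>M) <= ennreal (CC * (h powr et) ^ (2 * r))" .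
  show ?thesis
  proof (intro exI[of _ Tht] conjI allI impI)
   show "Tht \<in> borel_measurable M" unfolding Tht_def[abs_def] by (intro borel_measurable_times borel_measurable_const borel_measurable_sum Zm)
   show "0 <= Tht om" for om unfolding Tht_def using Z0 by (intro mult_nonneg_nonneg sum_nonneg) auto
   fix om i j k l assume "fl" "i < j" "j <= m" "k <= l" "l <= n"
   then show "\<bar>\<Sum>s=k..<l. cell_area h N s i j om\<bar> <= Tht om * (real (l - k) * h) powr tht"
    using use_a[of "(i, j)" k l om] by (simp add: a_def F_def)
  next
   fix om k l assume "m = 1" "k <= l" "l <= n"
   then show "\<bar>\<Sum>s=k..<l. (B 1 (real (Suc s) * h) om - B 1 (real s * h) om) ^ 3\<bar> <= Tht om * (real (l - k) * h) powr tht"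
    using use_a[of "(0, 0)" k l om] by (simp add: a_def F_def)
  qed (rule E)
 qed
 have "0 <= CC" unfolding CC_def using P KK by (auto simp: KK_def)
 then show ?thesis using main by blast
qed

end

section \<open>Pathwise error of the scheme\<close>

lemma abs_half_diff_le:
 fixes x y z :: real
 assumes "2 * z <= x + y" "- (2 * z) <= x + y" "0 <= x" "0 <= y"
 shows "\<bar>(x - z) / 2\<bar> <= x + y"
 using assms by (simp add: abs_le_iff field_simps)

context cell begin

definition "C7 = kap * J * C4 + C4"

text \<open>Without drift and with one noise the intermediate points of the scheme are also accurate, up to the explicit
 quadratic term \<open>(1 / 2) * b\<^sub>t * (b\<^sub>t - b\<^sub>h)\<close>.\<close>

lemma interpolation_third_order:
 assumes m: "m = 1" and V: "!!j. j <= m ==> expands m V L (V j) (%i. D i j)"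
  and D: "!!i j. i <= m ==> j <= m ==> lipb L (D i j)"
  and zero: "!!y. V 0 y = 0" "!!y. D 0 1 y = 0" "!!y. D 0 0 y = 0" "!!y. D 1 0 y = 0"
  and t: "a <= t" "t <= a + h"
 shows "norm (X t - X a - (1 / 2) *\<^sub>R (\<Sum>j\<le>m. (b j t - b j a) *\<^sub>R (V j (X a) + V j (X (a + h)))))
   <= L * ((b 1 t - b 1 a)\<^sup>2 + (b 1 (a + h) - b 1 a)\<^sup>2) + C7 * G ^ 3 * h powr (3 * be)"
proof -
 have sum2: "(\<Sum>j\<le>m. f j) = f 0 + f 1" for f :: "nat => 'z::comm_monoid_add" by (simp add: m)
 define g where "g j = resid (V j) (%i. D i j)" for j
 define B where "B s = b 1 s - b 1 a" for s
 have g0: "g 0 s = 0" for s using zero by (simp add: g_def resid_def sum2)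
 have g1: "g 1 s = V 1 (X s) - V 1 (X a) - B s *\<^sub>R D 1 1 (X a)" for s using zero by (simp add: g_def resid_def sum2 B_def)
 have gH: "norm (g j v - g j u) <= C4 * G\<^sup>2 * h powr be * (v - u) powr be" if "j <= m" "a <= u" "u <= v" "v <= a + h" for j u v
  unfolding g_def using that V D by (intro resid_hoelder) auto
 define F where "F s = X s - B s *\<^sub>R V 1 (X a) - ((B s)\<^sup>2 / 2) *\<^sub>R D 1 1 (X a)" for s
 have "norm (F t - F a - germ m b g a t) <= sewc (2 * be) * (J * (C4 * G\<^sup>2 * h powr be) * G) * (t - a) powr (2 * be)"
 proof (rule cont_sewing[where a = a and b = "a + h" and \<gamma>' = "2 * be" and Q = "C2 * G\<^sup>2 + G\<^sup>2 * L"])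
  fix s t assume st: "a <= s" "s <= t" "t <= a + h"
  define d where "d = b 1 t - b 1 s"
  have Bt: "B t = B s + d" by (simp add: B_def d_def)
  have gV: "germ m b (%j s. V j (X s)) s t = d *\<^sub>R V 1 (X s)" using zero by (simp add: germ_def sum2 d_def)
  have gg: "germ m b g s t = d *\<^sub>R g 1 s" using g0 by (simp add: germ_def sum2 d_def)
  have "F t - F s - germ m b g s t = (X t - X s - germ m b (%j s. V j (X s)) s t) - (d\<^sup>2 / 2) *\<^sub>R D 1 1 (X a)"
   unfolding F_def gV gg g1 Bt half_square_add by (simp add: algebra_simps)
  also have "norm ... <= C2 * G\<^sup>2 * (t - s) powr (2 * be) + G\<^sup>2 * (t - s) powr (2 * be) * L"
  proof (rule order_trans[OF norm_triangle_ineq4 add_mono])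
   show "norm (X t - X s - germ m b (%j s. V j (X s)) s t) <= C2 * G\<^sup>2 * (t - s) powr (2 * be)"
    using st a ah smallI[of s t] by (intro X_expand) auto
   have "\<bar>d\<bar>\<^sup>2 <= (G * (t - s) powr be)\<^sup>2"
    unfolding d_def using st a ah m by (intro power_mono b_hoelder) auto
   then have "d\<^sup>2 / 2 <= G\<^sup>2 * (t - s) powr (2 * be)"
    using zero_le_power2[of d] unfolding powr_double power_mult_distrib power2_eq_square[of "_ powr _"] power2_abs by linarith
   moreover have "norm (D 1 1 (X a)) <= L" using D[of 1 1] m by (simp add: lipb_def)
   ultimately show "norm ((d\<^sup>2 / 2) *\<^sub>R D 1 1 (X a)) <= G\<^sup>2 * (t - s) powr (2 * be) * L" by (intro norm_scaleR_le) auto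
  qed
  finally show "norm (F t - F s - germ m b g s t) <= (C2 * G\<^sup>2 + G\<^sup>2 * L) * (t - s) powr (2 * be)" by (simp add: algebra_simps)
 next
  fix r u v assume *: "a <= r" "r <= u" "u <= v" "v <= a + h"
  have "norm (germ m b g r v - germ m b g r u - germ m b g u v) <= (\<Sum>j\<le>m. (C4 * G\<^sup>2 * h powr be) * G) * (v - r) powr (be + be)"
   using * be G C4 a ah by (intro germ_defect gH b_hoelder) auto
  then show "norm (germ m b g r v - germ m b g r u - germ m b g u v) <= J * (C4 * G\<^sup>2 * h powr be) * G * (v - r) powr (2 * be)"
   by (simp add: J_def mult_ac)
 qed (use be t C4 G const_bounds in \<open>auto intro!: mult_nonneg_nonneg\<close>)
 moreover have "germ m b g a t = 0" by (simp add: germ_def g_def)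
 moreover have "F a = X a" by (simp add: F_def B_def)
 ultimately have F1: "norm (F t - X a) <= kap * (J * (C4 * G\<^sup>2 * h powr be) * G) * (t - a) powr (2 * be)" by (simp add: kap_def)
 have h3: "h powr (3 * be) = h powr be * h powr (2 * be)" by (simp add: powr_add[symmetric])
 have "(t - a) powr (2 * be) <= h powr (2 * be)" using t be by (intro powr_mono2) auto
 then have "kap * (J * (C4 * G\<^sup>2 * h powr be) * G) * (t - a) powr (2 * be) <= kap * (J * (C4 * G\<^sup>2 * h powr be) * G) * h powr (2 * be)"
  using const_bounds C4 G by (intro mult_left_mono mult_nonneg_nonneg) auto
 also have "... = kap * J * C4 * (G ^ 3 * h powr (3 * be))"
  unfolding h3 by (simp only: power2_eq_square power3_eq_cube mult_ac)
 finally have F2: "norm (F t - X a) <= kap * J * C4 * (G ^ 3 * h powr (3 * be))" using F1 by linarith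
 define d where "d = b 1 (a + h) - b 1 a"
 define e where "e = B t / 2"
 have Be: "B t = e + e" by (simp add: e_def)
 \<comment> \<open>At an intermediate t the quadratic terms, B t squared and B t * d, do not cancel;
   the mismatch is zero at t = a + h and is otherwise kept as an explicit term.\<close>
 have eq: "X t - X a - (1 / 2) *\<^sub>R (\<Sum>j\<le>m. (b j t - b j a) *\<^sub>R (V j (X a) + V j (X (a + h))))
   = (F t - X a) + (((B t)\<^sup>2 - B t * d) / 2) *\<^sub>R D 1 1 (X a) - (B t / 2) *\<^sub>R g 1 (a + h)"
 proof -
  have 1: "(1 / 2) *\<^sub>R (\<Sum>j\<le>m. (b j t - b j a) *\<^sub>R (V j (X a) + V j (X (a + h)))) = e *\<^sub>R (V 1 (X a) + V 1 (X (a + h)))"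
   using zero by (simp add: sum2 e_def B_def)
  have 2: "(((B t)\<^sup>2 - B t * d) / 2) *\<^sub>R v = ((B t)\<^sup>2 / 2) *\<^sub>R v - (e * d) *\<^sub>R v" for v :: 'a
   by (simp add: e_def diff_divide_distrib scaleR_left_diff_distrib)
  have 3: "g 1 (a + h) = V 1 (X (a + h)) - V 1 (X a) - d *\<^sub>R D 1 1 (X a)" unfolding g1 by (simp add: B_def d_def)
  have 4: "B t *\<^sub>R v = e *\<^sub>R v + e *\<^sub>R v" for v :: 'a unfolding Be by (rule scaleR_left_distrib)
  show ?thesis unfolding 1 2 3 F_def 4 e_def[symmetric] by (simp add: algebra_simps)
 qed
 have n1: "norm ((((B t)\<^sup>2 - B t * d) / 2) *\<^sub>R D 1 1 (X a)) <= ((B t)\<^sup>2 + d\<^sup>2) * L"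
 proof (rule norm_scaleR_le)
  have "0 <= (B t - d)\<^sup>2" "0 <= (B t + d)\<^sup>2" by simp_all
  then have "2 * (B t * d) <= (B t)\<^sup>2 + d\<^sup>2" "- (2 * (B t * d)) <= (B t)\<^sup>2 + d\<^sup>2" by (auto simp: power2_diff power2_sum)
  then show "\<bar>((B t)\<^sup>2 - B t * d) / 2\<bar> <= (B t)\<^sup>2 + d\<^sup>2" by (rule abs_half_diff_le) auto
  show "norm (D 1 1 (X a)) <= L" using D[of 1 1] m by (simp add: lipb_def)
 qed
 have n2: "norm ((B t / 2) *\<^sub>R g 1 (a + h)) <= (G * h powr be) * (C4 * G\<^sup>2 * h powr be * h powr be)"
 proof (rule norm_scaleR_le)
  have "\<bar>B t\<bar> <= G * (t - a) powr be" unfolding B_def using t a ah m by (intro b_hoelder) auto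
  also have "... <= G * h powr be" using incr_le[of a t] t G by (intro mult_left_mono) auto
  finally show "\<bar>B t / 2\<bar> <= G * h powr be" by simp
  show "norm (g 1 (a + h)) <= C4 * G\<^sup>2 * h powr be * h powr be"
   unfolding g_def using V[of 1] D m h by (intro resid_bound) auto
 qed
 have n3: "(G * h powr be) * (C4 * G\<^sup>2 * h powr be * h powr be) = C4 * (G ^ 3 * h powr (3 * be))"
  unfolding h3 powr_double by (simp only: power2_eq_square power3_eq_cube mult_ac)
 have "norm (X t - X a - (1 / 2) *\<^sub>R (\<Sum>j\<le>m. (b j t - b j a) *\<^sub>R (V j (X a) + V j (X (a + h)))))
   <= norm (F t - X a) + norm ((((B t)\<^sup>2 - B t * d) / 2) *\<^sub>R D 1 1 (X a)) + norm ((B t / 2) *\<^sub>R g 1 (a + h))"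
  unfolding eq by (intro norm_triangle_le_diff norm_triangle_le add_mono order_refl)
 also have "... <= kap * J * C4 * (G ^ 3 * h powr (3 * be)) + ((B t)\<^sup>2 + d\<^sup>2) * L + C4 * (G ^ 3 * h powr (3 * be))"
  using F2 n1 n2 n3 by linarith
 also have "... = L * ((B t)\<^sup>2 + d\<^sup>2) + C7 * G ^ 3 * h powr (3 * be)" by (simp add: C7_def algebra_simps)
 finally show ?thesis by (simp add: B_def d_def)
qed

end

text \<open>The deterministic setting for one path: X, any solution Y of the scheme, and bounds for
  the sums of areas and cubes. The conditions \<open>rate\<close> say that \<open>et\<close> is at
  most the order of the one-cell remainder minus 1. For one noise \<open>L0\<close> bounds the drift
  and everything derived from it, and \<open>L0 = 0\<close> means that there is none.\<close>

locale cn = young_path be T L G m V b X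
 for be T L G :: real and m :: nat and V :: "nat => real ^ 'd => real ^ 'd" and b :: "nat => real => real" and X :: "real => real ^ 'd" +
 fixes tht et L0 Tht :: real and D :: "nat => nat => real ^ 'd => real ^ 'd" and E :: "nat => real ^ 'd => real ^ 'd"
  and x :: "real ^ 'd" and Y :: "real => real ^ 'd" and n N :: nat
 assumes tht: "0 < tht" "tht < be" "1 < tht + be"
  and V_exp: "!!j. j <= m ==> expands m V L (V j) (%i. D i j)"
  and D_lipb: "!!i j. i <= m ==> j <= m ==> lipb L (D i j)"
  and V4: "!!j a a' c c'. j <= m ==> norm ((V j a - V j a') - (V j c - V j c')) <= L * norm ((a - a') - (c - c')) + L * norm (c - c') * (norm (a - c) + norm (a' - c'))"
  and L0: "0 <= L0" "L0 <= L"
  and third: "m = 1 ==> lipb L0 (V 0)" "m = 1 ==> expands m V L0 (V 0) (%i. D i 0)"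
   "!!i j. m = 1 ==> i <= m ==> j <= m ==> i = 0 \<or> j = 0 ==> lipb L0 (D i j)"
   "m = 1 ==> expands m V L (D 1 1) E" "!!i. m = 1 ==> i <= m ==> lipb L (E i)" "!!y. m = 1 ==> norm (E 0 y) <= L0"
  and rate: "0 < et" "et <= 2" "m ~= 1 ==> et <= 3 * be - 1" "m = 1 ==> et <= 4 * be - 1" "m = 1 ==> L0 ~= 0 ==> et <= 2 * be"
  and time: "!!t. 0 <= t ==> t <= T ==> b 0 t = t"
  and n: "1 <= n" and N: "1 <= N" and fine: "real N * ((T / real n) / real N) powr (2 * be) <= (T / real n) ^ 3"
  and Th: "0 <= Tht"
  and area_sum: "!!i j k l. (m = 1 ==> L0 ~= 0) ==> i < j ==> j <= m ==> k <= l ==> l <= n ==>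
    \<bar>\<Sum>r=k..<l. area b (grid T n r) (T / real n) N i j\<bar> <= Tht * (real (l - k) * (T / real n)) powr tht"
  and cube_sum: "!!k l. m = 1 ==> k <= l ==> l <= n ==>
    \<bar>\<Sum>r=k..<l. (b 1 (grid T n (Suc r)) - b 1 (grid T n r)) ^ 3\<bar> <= Tht * (real (l - k) * (T / real n)) powr tht"
  and X0: "X 0 = x" and Y: "crank_nicolson T n m V b x Y"
begin

definition "h = T / real n"
definition "\<kappa>2 = sewc (tht + be)"
text \<open>It meets the threshold of the local expansions as well as \<open>c_small\<close>. The
  block length d then solves \<open>G * d powr be = c\<close>.\<close>

definition "c = min c0 (1 / (2 * J * L * (1 + \<kappa>2 + 2 * \<kappa>2 * C1)))"
definition "d = (c / G) powr (1 / be)"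

abbreviation "g \<equiv> grid T n"

lemma k2: "1 <= \<kappa>2" unfolding \<kappa>2_def using sewc_ge1(1) tht by simp

lemma c: "0 < c" "c <= c0" "c <= 1" "J * L * c * (1 + \<kappa>2 + 2 * \<kappa>2 * C1) <= 1 / 2"
proof -
 let ?K = "1 + \<kappa>2 + 2 * \<kappa>2 * C1"
 have K: "0 < ?K" using k2 const_bounds by (intro add_pos_nonneg mult_nonneg_nonneg) auto
 have JLK: "0 < J * L * ?K" using const_bounds L K by (intro mult_pos_pos) auto
 show "0 < c" using const_bounds JLK by (simp add: c_def mult.assoc)
 show "c <= c0" by (simp add: c_def)
 then show "c <= 1" using const_bounds by simp
 have "c <= 1 / (2 * J * L * ?K)" by (simp add: c_def)
 then have "(J * L * ?K) * c <= (J * L * ?K) * (1 / (2 * J * L * ?K))" using JLK by (intro mult_left_mono) auto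
 also have "... = 1 / 2" using JLK by (simp add: field_simps)
 finally show "J * L * c * ?K <= 1 / 2" by (simp only: mult_ac)
qed

lemma h0: "0 < h" using T n by (simp add: h_def)

lemma hT: "h <= T" using T n by (simp add: h_def field_simps)

lemma nh: "real n * h = T" using n by (simp add: h_def)

lemma d: "0 < d" "G * d powr be = c" "d <= 1"
proof -
 show "0 < d" using c G by (simp add: d_def)
 show "G * d powr be = c" using c G be by (simp add: d_def powr_powr)
 have "(c / G) powr (1 / be) <= 1 powr (1 / be)" using c G be by (intro powr_mono2) (auto simp: field_simps)
 then show "d <= 1" by (simp add: d_def)
qed

lemma g_eq: "g k = real k * h" by (simp add: grid_def h_def)

lemma g_diff: "k <= l ==> g l - g k = real (l - k) * h"
 by (simp add: g_eq of_nat_diff algebra_simps)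

lemma g_mono: "k <= l ==> g k <= g l" using h0 by (simp add: g_eq)

lemma g_range: "k <= n ==> 0 <= g k" "k <= n ==> g k <= T"
 using h0 g_mono[of k n] nh by (auto simp: g_eq)

lemma g_Suc: "g k + h = g (Suc k)" by (simp add: g_eq algebra_simps)

lemma small_d: "0 <= u ==> u <= d ==> G * u powr be <= c"
 using mult_left_mono[OF powr_mono2[of be u d], of G] be G d by simp

definition "e k = X (g k) - Y (g k)"
text \<open>The accumulated errors of X when inserted into the scheme; they are the forcing in the
  recursion of e.\<close>

definition "R k = (\<Sum>i<k. trap_err m V b X (g i) (g (Suc i)))"

lemma Y_rec: "i < n ==> Y (g (Suc i)) - Y (g i) = (1 / 2) *\<^sub>R (\<Sum>j\<le>m. (b j (g (Suc i)) - b j (g i)) *\<^sub>R (V j (Y (g (Suc i))) + V j (Y (g i))))"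
proof -
 assume "i < n"
 then have e: "Y (g (Suc i)) = Y (g i) + (1 / 2) *\<^sub>R (\<Sum>j\<le>m. (b j (g (Suc i)) - b j (g i)) *\<^sub>R (V j (Y (g (Suc i))) + V j (Y (g i))))"
  using Y unfolding crank_nicolson_def by blast
 show ?thesis by (rule iffD2[OF diff_eq_eq trans[OF e add.commute]])
qed

lemma Y_interp:
 assumes "k < n" "g k <= t" "t < g (Suc k)"
 shows "Y t = Y (g k) + (1 / 2) *\<^sub>R (\<Sum>j\<le>m. (b j t - b j (g k)) *\<^sub>R (V j (Y (g k)) + V j (Y (g (Suc k)))))"
 by (rule conjunct2[OF conjunct2[OF Y[unfolded crank_nicolson_def]], rule_format]) (use assms in auto)

lemma e_rec:
 assumes "i < n"
 shows "e (Suc i) - e i = (1 / 2) *\<^sub>R (\<Sum>j\<le>m. (b j (g (Suc i)) - b j (g i)) *\<^sub>R ((V j (X (g (Suc i))) - V j (Y (g (Suc i)))) + (V j (X (g i)) - V j (Y (g i)))))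
   + (R (Suc i) - R i)"
proof -
 let ?b = "%j. b j (g (Suc i)) - b j (g i)"
 have s: "(\<Sum>j\<le>m. ?b j *\<^sub>R ((V j (X (g (Suc i))) - V j (Y (g (Suc i)))) + (V j (X (g i)) - V j (Y (g i)))))
   = (\<Sum>j\<le>m. ?b j *\<^sub>R (V j (X (g (Suc i))) + V j (X (g i)))) - (\<Sum>j\<le>m. ?b j *\<^sub>R (V j (Y (g (Suc i))) + V j (Y (g i))))"
  unfolding sum_subtractf[symmetric] by (intro sum.cong refl) (simp add: algebra_simps)
 have "R (Suc i) - R i = X (g (Suc i)) - X (g i) - (1 / 2) *\<^sub>R (\<Sum>j\<le>m. ?b j *\<^sub>R (V j (X (g (Suc i))) + V j (X (g i))))"
  by (simp add: R_def trap_err_def)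
 moreover have "e (Suc i) - e i = (X (g (Suc i)) - X (g i)) - (Y (g (Suc i)) - Y (g i))" by (simp add: e_def)
 ultimately show ?thesis using Y_rec[OF assms] unfolding s scaleR_right_diff_distrib by simp
qed

lemma powr_le_rate: "et <= \<alpha> ==> h powr \<alpha> <= T powr (\<alpha> - et) * h powr et"
proof -
 assume a: "et <= \<alpha>"
 have "h powr \<alpha> = h powr (\<alpha> - et) * h powr et" by (simp add: powr_add[symmetric])
 also have "... <= T powr (\<alpha> - et) * h powr et" using a h0 hT by (intro mult_right_mono powr_mono2) auto
 finally show ?thesis .
qed

definition "TT = (1 + T) ^ 4"

lemma T_powr_le: "0 <= \<alpha> ==> \<alpha> <= 4 ==> T powr \<alpha> <= TT"
proof -
 assume a: "0 <= \<alpha>" "\<alpha> <= 4"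
 have "T powr \<alpha> <= (1 + T) powr \<alpha>" using T a by (intro powr_mono2) auto
 also have "... <= (1 + T) powr 4" using T a by (intro powr_mono) auto
 also have "... = TT" using T by (simp add: TT_def powr_numeral)
 finally show ?thesis .
qed

lemma TT1: "1 <= TT" using T by (simp add: TT_def)

lemma h_powr_le: "et <= \<alpha> ==> \<alpha> <= 4 ==> h powr \<alpha> <= TT * h powr et"
proof -
 assume a: "et <= \<alpha>" "\<alpha> <= 4"
 have "T powr (\<alpha> - et) * h powr et <= TT * h powr et" using a rate(1) by (intro mult_right_mono T_powr_le) auto
 then show ?thesis using powr_le_rate[OF a(1)] by linarith
qed

definition "C8 = 3 * J\<^sup>2 * (L + \<kappa>2 * L * C1) + TT * (cell.C5 be L m + cell.C6 be L m) * (3 * L * TT)"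

text \<open>With one noise and no drift the rate 2 * H exceeds 2 * be, which is all that Hoelder
  continuity gives for squared increments. The squares are therefore carried along explicitly, and
  their moments come from the exact variance.\<close>

definition "sq k t = (if m = 1 \<and> L0 = 0 then (b 1 t - b 1 (g k))\<^sup>2 + (b 1 (g (Suc k)) - b 1 (g k))\<^sup>2 else 0)"

context
 assumes hd: "h <= d"
begin

lemma cell_k: assumes "k < n" shows "cell be T L G m V b X (g k) h N"
proof
 show "0 <= g k" using g_range assms by simp
 show "g k + h <= T" unfolding g_Suc using g_range assms by simp
 show "G * h powr be <= young_path.c0 be L m" using small_d[of h] h0 hd c by simp
 show "real N * (h / real N) powr (2 * be) <= h ^ 3" using fine by (simp add: h_def)
qed (use h0 N in auto)

lemma Xg_hoelder: "k <= l ==> l <= n ==> real (l - k) * h <= d ==> norm (X (g l) - X (g k)) <= C1 * G * (real (l - k) * h) powr be"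
 using X_hoelder[of "g k" "g l"] g_range g_mono[of k l] g_diff[of k l] small_d[of "real (l - k) * h"] c h0 by simp

lemma weighted:
 fixes A :: "nat => real"
 assumes f: "lipb L f" and A: "!!k l. k <= l ==> l <= n ==> \<bar>\<Sum>r=k..<l. A r\<bar> <= Tht * (real (l - k) * h) powr tht"
  and kl: "k <= l" "l <= n" "real (l - k) * h <= d"
 shows "norm (\<Sum>r=k..<l. A r *\<^sub>R f (X (g r))) <= (L + \<kappa>2 * L * C1) * Tht * (real (l - k) * h) powr tht"
proof -
 define S where "S l = (\<Sum>r<l. A r)" for l
 have Sd: "S v - S u = (\<Sum>r=u..<v. A r)" if "u <= v" for u v
  unfolding S_def using that by (simp add: sum_diff_nat_ivl lessThan_atLeast0)
 have sub: "real (v - u) * h <= d" if "k <= u" "u <= v" "v <= l" for u v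
 proof -
  have "v - u <= l - k" using that by linarith
  then have "real (v - u) * h <= real (l - k) * h" using h0 by (intro mult_right_mono) (simp_all only: of_nat_le_iff less_imp_le)
  then show ?thesis using kl by simp
 qed
 have "norm (\<Sum>i=k..<l. (S (Suc i) - S i) *\<^sub>R f (X (g i))) <= (L + sewc (tht + be) * (L * C1 * G) * (real (l - k) * h) powr be) * Tht * (real (l - k) * h) powr tht"
 proof (rule weighted_sum_hoelder[where p = k and q = l])
  fix u v assume uv: "k <= u" "u <= v" "v <= l"
  show "\<bar>S v - S u\<bar> <= Tht * (real (v - u) * h) powr tht" using A[of u v] uv kl Sd by simp
  have "norm (f (X (g v)) - f (X (g u))) <= L * C1 * G * (g v - g u) powr be"
   using f L uv kl g_range g_mono[of u v] sub[OF uv] small_d[of "real (v - u) * h"] c h0 g_diff[of u v] by (intro lipb_hoelder) auto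
  then show "norm (f (X (g v)) - f (X (g u))) <= L * C1 * G * (real (v - u) * h) powr be" using g_diff uv by simp
 next
  fix u show "norm (f (X (g u))) <= L" using f by (simp add: lipb_def)
 qed (use tht be h0 Th L const_bounds G kl in auto)
 also have "... <= (L + \<kappa>2 * L * C1) * Tht * (real (l - k) * h) powr tht"
 proof (intro mult_right_mono add_left_mono)
  have "G * (real (l - k) * h) powr be <= 1" using small_d[of "real (l - k) * h"] kl c h0 by simp
  then have "(\<kappa>2 * L * C1) * (G * (real (l - k) * h) powr be) <= (\<kappa>2 * L * C1) * 1"
   using k2 L const_bounds by (intro mult_left_mono mult_nonneg_nonneg) auto
  then show "sewc (tht + be) * (L * C1 * G) * (real (l - k) * h) powr be <= \<kappa>2 * L * C1" by (simp add: \<kappa>2_def mult_ac)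
 qed (use Th in auto)
 finally show ?thesis by (simp add: S_def)
qed

lemma area_all:
 assumes "m = 1 ==> L0 ~= 0" "i <= m" "j <= m" "k <= l" "l <= n"
 shows "\<bar>\<Sum>r=k..<l. area b (g r) h N i j\<bar> <= Tht * (real (l - k) * h) powr tht"
proof -
 consider "i < j" | "j < i" | "i = j" by linarith
 then show ?thesis
 proof cases
  case 1 then show ?thesis using area_sum[OF assms(1), of i j k l] assms(2-) by (simp add: h_def)
 next
  case 2
  have "area b (g r) h N i j = - area b (g r) h N j i" for r by (simp add: area_def field_simps)
  then show ?thesis using area_sum[OF assms(1), of j i k l] 2 assms(2-) by (simp add: h_def sum_negf)
 next
  case 3 then show ?thesis using Th by (simp add: area_def)
 qed
qed

text \<open>Summing l - k remainders of order h powr (1 + et) gives the length of the stretch times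
  h powr et, and a length below T is at most \<open>TT\<close> times its power
  \<open>tht\<close>.\<close>

lemma R_from_rem:
 assumes main: "!!k. k < n ==> norm (trap_err m V b X (g k) (g (Suc k)) - Q k) <= K * (h * h powr et)" and K: "0 <= K"
  and Q: "!!k l. k <= l ==> l <= n ==> real (l - k) * h <= d ==> norm (\<Sum>r=k..<l. Q r) <= K' * Tht * (real (l - k) * h) powr tht"
  and kl: "k <= l" "l <= n" "real (l - k) * h <= d"
 shows "norm (R l - R k) <= (K' * Tht + TT * K * h powr et) * (real (l - k) * h) powr tht"
proof -
 have "R l - R k = (\<Sum>r=k..<l. trap_err m V b X (g r) (g (Suc r)))"
  unfolding R_def using kl by (simp add: sum_diff_nat_ivl lessThan_atLeast0)
 also have "... = (\<Sum>r=k..<l. trap_err m V b X (g r) (g (Suc r)) - Q r) + (\<Sum>r=k..<l. Q r)" by (simp add: sum_subtractf)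
 also have "norm ... <= real (l - k) * (K * (h * h powr et)) + K' * Tht * (real (l - k) * h) powr tht"
 proof (rule norm_triangle_mono)
  have "norm (\<Sum>r=k..<l. trap_err m V b X (g r) (g (Suc r)) - Q r) <= (\<Sum>r=k..<l. K * (h * h powr et))"
   using kl by (intro sum_norm_le main) auto
  then show "norm (\<Sum>r=k..<l. trap_err m V b X (g r) (g (Suc r)) - Q r) <= real (l - k) * (K * (h * h powr et))" by simp
 qed (rule Q[OF kl])
 also have "real (l - k) * (K * (h * h powr et)) = K * h powr et * ((real (l - k) * h) powr (1 - tht) * (real (l - k) * h) powr tht)"
  using h0 by (simp add: powr_add[symmetric])
 also have "K * h powr et * ((real (l - k) * h) powr (1 - tht) * (real (l - k) * h) powr tht) <= K * h powr et * (TT * (real (l - k) * h) powr tht)"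
 proof (intro mult_left_mono mult_right_mono)
  have "real (l - k) * h <= T" using g_diff[OF kl(1)] g_range[of k] g_range[of l] kl by simp
  then have "(real (l - k) * h) powr (1 - tht) <= T powr (1 - tht)" using tht be h0 by (intro powr_mono2) auto
  also have "... <= TT" using tht be by (intro T_powr_le) auto
  finally show "(real (l - k) * h) powr (1 - tht) <= TT" .
 qed (use K in auto)
 finally show ?thesis by (simp add: algebra_simps)
qed

text \<open>For several noises the second order formula with areas is summed, for one noise the
  third order formula with area and cube; the leading terms go through \<open>weighted\<close>.
  Without drift the coefficients of the areas are 0, so that only the cubes remain.\<close>

lemma R_bound:
 assumes kl: "k <= l" "l <= n" "real (l - k) * h <= d"
 shows "norm (R l - R k) <= C8 * G ^ 4 * (Tht + h powr et) * (real (l - k) * h) powr tht"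
proof -
 have G4: "1 <= G ^ 4" "G ^ 3 <= G ^ 4" "G\<^sup>2 <= G ^ 4" using G by (auto intro: power_increasing)
 have h3: "h ^ 3 = h * h powr 2" using h0 by (simp add: powr_realpow[symmetric] power3_eq_cube power2_eq_square)
 have hp: "h powr (1 + \<alpha>) = h * h powr \<alpha>" for \<alpha> using h0 by (simp add: powr_add)
 obtain K K' where K: "0 <= K" "K <= (cell.C5 be L m + cell.C6 be L m) * (3 * L * TT) * G ^ 4" "0 <= K'" "K' <= 3 * J\<^sup>2 * (L + \<kappa>2 * L * C1)"
  and R: "norm (R l - R k) <= (K' * Tht + TT * K * h powr et) * (real (l - k) * h) powr tht"
 proof -
  interpret c0: cell be T L G m V b X "g 0" h N using cell_k[of 0] n by simp
  have C56: "1 <= c0.C5" "0 <= c0.C6"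
  proof -
   show "1 <= c0.C5" by (rule c0.C5)
   show "0 <= c0.C6" unfolding c0.C6_def using const_bounds c0.C4 C3 L by (intro add_nonneg_nonneg mult_nonneg_nonneg) auto
  qed
  have LT: "1 <= L * TT" using mult_mono[of 1 L 1 TT] L TT1 by simp
  have wL: "0 <= L + \<kappa>2 * L * C1" using L k2 const_bounds by (intro add_nonneg_nonneg mult_nonneg_nonneg) auto
  show ?thesis
  proof (cases "m = 1")
   case False
   define K where "K = c0.C5 * (2 * TT) * G ^ 4"
   show ?thesis
   proof (rule that[of K "J\<^sup>2 * (L + \<kappa>2 * L * C1)"])
    show "0 <= K" using C56 TT1 by (simp add: K_def)
    show "K <= (c0.C5 + c0.C6) * (3 * L * TT) * G ^ 4"
     unfolding K_def using C56 LT L TT1 G4 by (intro mult_right_mono mult_mono) auto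
    show "0 <= J\<^sup>2 * (L + \<kappa>2 * L * C1)" "J\<^sup>2 * (L + \<kappa>2 * L * C1) <= 3 * J\<^sup>2 * (L + \<kappa>2 * L * C1)"
     using wL by (auto intro!: mult_right_mono)
    show "norm (R l - R k) <= (J\<^sup>2 * (L + \<kappa>2 * L * C1) * Tht + TT * K * h powr et) * (real (l - k) * h) powr tht"
    proof (rule R_from_rem[OF _ _ _ kl])
     fix k assume k: "k < n"
     interpret ck: cell be T L G m V b X "g k" h N by (rule cell_k[OF k])
     have "norm (trap_err m V b X (g k) (g k + h) - (\<Sum>j\<le>m. \<Sum>i\<le>m. area b (g k) h N i j *\<^sub>R D i j (X (g k))))
       <= c0.C5 * (G ^ 3 * h powr (3 * be) + G\<^sup>2 * h ^ 3)"
      using V_exp D_lipb by (rule ck.trap_err_second_order)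
     also have "... <= c0.C5 * (G ^ 4 * (h * (TT * h powr et)) + G ^ 4 * (h * (TT * h powr et)))"
     proof (intro mult_left_mono add_mono mult_mono)
      have "h powr (3 * be) = h * h powr (3 * be - 1)" using hp[of "3 * be - 1"] by simp
      also have "... <= h * (TT * h powr et)" using h0 rate False be by (intro mult_left_mono h_powr_le) auto
      finally show "h powr (3 * be) <= h * (TT * h powr et)" .
      show "h ^ 3 <= h * (TT * h powr et)" unfolding h3 using h0 rate by (intro mult_left_mono h_powr_le) auto
     qed (use C56 G4 h0 in auto)
     also have "... = K * (h * h powr et)" by (simp add: K_def algebra_simps)
     finally show "norm (trap_err m V b X (g k) (g (Suc k)) - (\<Sum>j\<le>m. \<Sum>i\<le>m. area b (g k) h N i j *\<^sub>R D i j (X (g k)))) <= K * (h * h powr et)"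
      by (simp only: g_Suc)
    next
     fix k l assume kl: "k <= l" "l <= n" "real (l - k) * h <= d"
     have "(\<Sum>r=k..<l. \<Sum>j\<le>m. \<Sum>i\<le>m. area b (g r) h N i j *\<^sub>R D i j (X (g r)))
       = (\<Sum>j\<le>m. \<Sum>r=k..<l. \<Sum>i\<le>m. area b (g r) h N i j *\<^sub>R D i j (X (g r)))" by (rule sum.swap)
     also have "... = (\<Sum>j\<le>m. \<Sum>i\<le>m. \<Sum>r=k..<l. area b (g r) h N i j *\<^sub>R D i j (X (g r)))"
      by (rule sum.cong[OF refl], rule sum.swap)
     finally have sw: "(\<Sum>r=k..<l. \<Sum>j\<le>m. \<Sum>i\<le>m. area b (g r) h N i j *\<^sub>R D i j (X (g r)))
       = (\<Sum>j\<le>m. \<Sum>i\<le>m. \<Sum>r=k..<l. area b (g r) h N i j *\<^sub>R D i j (X (g r)))" .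
     have "norm (\<Sum>j\<le>m. \<Sum>i\<le>m. \<Sum>r=k..<l. area b (g r) h N i j *\<^sub>R D i j (X (g r))) <= (\<Sum>j\<le>m. \<Sum>i\<le>m. (L + \<kappa>2 * L * C1) * Tht * (real (l - k) * h) powr tht)"
      using kl False by (intro sum_norm_le weighted D_lipb area_all) auto
     also have "... = J\<^sup>2 * (L + \<kappa>2 * L * C1) * Tht * (real (l - k) * h) powr tht"
      by (simp add: J_def power2_eq_square)
     finally show "norm (\<Sum>r=k..<l. \<Sum>j\<le>m. \<Sum>i\<le>m. area b (g r) h N i j *\<^sub>R D i j (X (g r))) <= J\<^sup>2 * (L + \<kappa>2 * L * C1) * Tht * (real (l - k) * h) powr tht" unfolding sw .
    qed (use C56 TT1 in \<open>auto simp: K_def\<close>)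
   qed
  next
   case True
   define K where "K = c0.C6 * (3 * L * TT) * G ^ 4"
   have Vi: "expands m V (if j = 0 then L0 else L) (V j) (%i. D i j)" if "j <= m" for j
    using third(2)[OF True] V_exp[OF that] by auto
   have Di: "lipb (if i = 0 \<or> j = 0 then L0 else L) (D i j)" if "i <= m" "j <= m" for i j
    using third(3)[OF True that] D_lipb[OF that] by auto
   show ?thesis
   proof (rule that[of K "3 * (L + \<kappa>2 * L * C1)"])
    show "0 <= K" using C56 TT1 L by (simp add: K_def)
    show "K <= (c0.C5 + c0.C6) * (3 * L * TT) * G ^ 4"
     unfolding K_def using C56 LT L TT1 G4 by (intro mult_right_mono) auto
    show "0 <= 3 * (L + \<kappa>2 * L * C1)" using wL by simp
    have "1 <= J\<^sup>2" using const_bounds by simp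
    then have "3 * (L + \<kappa>2 * L * C1) * 1 <= 3 * (L + \<kappa>2 * L * C1) * J\<^sup>2" using wL by (intro mult_left_mono) auto
    then show "3 * (L + \<kappa>2 * L * C1) <= 3 * J\<^sup>2 * (L + \<kappa>2 * L * C1)" by (simp only: mult_1_right mult_ac)
    show "norm (R l - R k) <= (3 * (L + \<kappa>2 * L * C1) * Tht + TT * K * h powr et) * (real (l - k) * h) powr tht"
    proof (rule R_from_rem[OF _ _ _ kl])
     fix k assume k: "k < n"
     interpret ck: cell be T L G m V b X "g k" h N by (rule cell_k[OF k])
     have "norm (trap_err m V b X (g k) (g k + h) - (area b (g k) h N 0 1 *\<^sub>R (D 0 1 (X (g k)) - D 1 0 (X (g k))) - ((b 1 (g k + h) - b 1 (g k)) ^ 3 / 12) *\<^sub>R E 1 (X (g k))))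
       <= c0.C6 * (G ^ 4 * h powr (4 * be) + L0 * G\<^sup>2 * h powr (1 + 2 * be) + G\<^sup>2 * h ^ 3)"
      using True L0 Vi Di third(4)[OF True] third(5)[OF True] third(6)[OF True] time by (rule ck.trap_err_third_order)
     also have "... <= c0.C6 * (G ^ 4 * (h * (TT * h powr et)) + L * G ^ 4 * (h * (TT * h powr et)) + G ^ 4 * (h * (TT * h powr et)))"
     proof (rule mult_left_mono[OF _ C56(2)], intro add_mono)
      have "h powr (4 * be) = h * h powr (4 * be - 1)" using hp[of "4 * be - 1"] by simp
      also have "... <= h * (TT * h powr et)" using h0 rate True be by (intro mult_left_mono h_powr_le) auto
      finally show "G ^ 4 * h powr (4 * be) <= G ^ 4 * (h * (TT * h powr et))" by (intro mult_left_mono) auto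
      show "G\<^sup>2 * h ^ 3 <= G ^ 4 * (h * (TT * h powr et))"
       unfolding h3 using h0 rate G4 by (intro mult_mono mult_left_mono h_powr_le) auto
      show "L0 * G\<^sup>2 * h powr (1 + 2 * be) <= L * G ^ 4 * (h * (TT * h powr et))"
      proof (cases "L0 = 0")
       case True
       then show ?thesis using L h0 TT1 G4 by simp
      next
       case False
       show ?thesis unfolding hp using L0 L h0 rate G4 \<open>m = 1\<close> False be
        by (intro mult_mono mult_left_mono h_powr_le) auto
      qed
     qed
     also have "... <= K * (h * h powr et)"
     proof -
      define z where "z = c0.C6 * G ^ 4 * (h * (TT * h powr et))"
      have "0 <= z" using C56 G4 h0 TT1 by (simp add: z_def)
      then have "z * 2 <= z * (2 * L)" using L by (intro mult_left_mono) auto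
      then have "z + L * z + z <= 3 * L * z" by (simp add: algebra_simps)
      then show ?thesis by (simp add: z_def K_def algebra_simps)
     qed
     finally show "norm (trap_err m V b X (g k) (g (Suc k)) - (area b (g k) h N 0 1 *\<^sub>R (D 0 1 (X (g k)) - D 1 0 (X (g k))) - ((b 1 (g (Suc k)) - b 1 (g k)) ^ 3 / 12) *\<^sub>R E 1 (X (g k)))) <= K * (h * h powr et)"
      by (simp only: g_Suc)
    next
     fix k l assume kl: "k <= l" "l <= n" "real (l - k) * h <= d"
     let ?w = "(L + \<kappa>2 * L * C1) * Tht * (real (l - k) * h) powr tht"
     let ?c = "%r. (b 1 (g (Suc r)) - b 1 (g r)) ^ 3"
     have w0: "0 <= ?w" using wL Th by simp
     have sw: "(\<Sum>r=k..<l. area b (g r) h N 0 1 *\<^sub>R (D 0 1 (X (g r)) - D 1 0 (X (g r))) - (?c r / 12) *\<^sub>R E 1 (X (g r)))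
       = (\<Sum>r=k..<l. area b (g r) h N 0 1 *\<^sub>R D 0 1 (X (g r))) - (\<Sum>r=k..<l. area b (g r) h N 0 1 *\<^sub>R D 1 0 (X (g r))) - (1 / 12) *\<^sub>R (\<Sum>r=k..<l. ?c r *\<^sub>R E 1 (X (g r)))"
      by (simp add: sum_subtractf scaleR_right_diff_distrib scaleR_sum_right)
     have "norm ((\<Sum>r=k..<l. area b (g r) h N 0 1 *\<^sub>R D 0 1 (X (g r))) - (\<Sum>r=k..<l. area b (g r) h N 0 1 *\<^sub>R D 1 0 (X (g r))) - (1 / 12) *\<^sub>R (\<Sum>r=k..<l. ?c r *\<^sub>R E 1 (X (g r)))) <= ?w + ?w + ?w"
     proof (intro norm_triangle_le_diff add_mono)
      show "norm (\<Sum>r=k..<l. area b (g r) h N 0 1 *\<^sub>R D 0 1 (X (g r))) <= ?w"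
      proof (cases "L0 = 0")
       case zero: True
       then show ?thesis using third(3)[OF True, of 0 1] True w0 by (simp add: lipb_def)
      next
       case False
       then show ?thesis using kl True by (intro weighted D_lipb area_all) auto
      qed
      show "norm (\<Sum>r=k..<l. area b (g r) h N 0 1 *\<^sub>R D 1 0 (X (g r))) <= ?w"
      proof (cases "L0 = 0")
       case zero: True
       then show ?thesis using third(3)[OF True, of 1 0] True w0 by (simp add: lipb_def)
      next
       case False
       then show ?thesis using kl True by (intro weighted D_lipb area_all) auto
      qed
      have "norm (\<Sum>r=k..<l. ?c r *\<^sub>R E 1 (X (g r))) <= ?w"
       using kl True third(5)[OF True, of 1] cube_sum[OF True] by (intro weighted) (auto simp: h_def)
      then show "norm ((1 / 12) *\<^sub>R (\<Sum>r=k..<l. ?c r *\<^sub>R E 1 (X (g r)))) <= ?w"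
       using norm_ge_zero[of "\<Sum>r=k..<l. ?c r *\<^sub>R E 1 (X (g r))"] unfolding norm_scaleR by linarith
     qed
     then show "norm (\<Sum>r=k..<l. area b (g r) h N 0 1 *\<^sub>R (D 0 1 (X (g r)) - D 1 0 (X (g r))) - (?c r / 12) *\<^sub>R E 1 (X (g r))) <= 3 * (L + \<kappa>2 * L * C1) * Tht * (real (l - k) * h) powr tht"
      unfolding sw by (simp add: algebra_simps)
    qed (use C56 TT1 L in \<open>auto simp: K_def\<close>)
   qed
  qed
 qed
 note R
 also have "(K' * Tht + TT * K * h powr et) * (real (l - k) * h) powr tht <= (C8 * G ^ 4 * (Tht + h powr et)) * (real (l - k) * h) powr tht"
 proof (rule mult_right_mono)
  define K2 where "K2 = TT * (cell.C5 be L m + cell.C6 be L m) * (3 * L * TT)"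
  define K1 where "K1 = 3 * J\<^sup>2 * (L + \<kappa>2 * L * C1)"
  have a: "TT * K <= K2 * G ^ 4" using mult_left_mono[OF K(2), of TT] TT1 by (simp add: K2_def mult_ac)
  have TK: "0 <= TT * K" using TT1 K by simp
  have K2: "0 <= K2 * G ^ 4" using a TK by linarith
  have K1: "0 <= K1" "K' <= K1 * G ^ 4"
  proof -
   show "0 <= K1" using K by (simp add: K1_def)
   then have "K1 * 1 <= K1 * G ^ 4" using G4 by (intro mult_left_mono) auto
   then show "K' <= K1 * G ^ 4" using K by (simp add: K1_def)
  qed
  have "K' * Tht + TT * K * h powr et <= K1 * G ^ 4 * Tht + K2 * G ^ 4 * h powr et"
   using a K1 Th by (intro add_mono mult_right_mono) auto
  also have "... <= C8 * G ^ 4 * (Tht + h powr et)"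
  proof -
   have "0 <= K1 * G ^ 4 * h powr et" "0 <= K2 * G ^ 4 * Tht" using K1 K2 Th G4 by auto
   moreover have "C8 = K1 + K2" by (simp add: C8_def K1_def K2_def)
   ultimately show ?thesis by (simp add: algebra_simps)
  qed
  finally show "K' * Tht + TT * K * h powr et <= C8 * G ^ 4 * (Tht + h powr et)" .
 qed simp
 finally show ?thesis .
qed

text \<open>\<open>stability\<close> with the Hoelder constant of R as forcing: \<open>V4\<close>
  bounds the increments of V (X) - V (Y) by those of e, and \<open>scheme_hoelder\<close> gives Y
  the Hoelder constant of X.\<close>

lemma grid_error:
 assumes k: "k <= n"
 shows "norm (e k) <= 2 powr (2 * T / d + 1) * (2 * (C8 * G ^ 4 * (Tht + h powr et)))"
proof -
 interpret sc: small_const be tht L C1 c m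
  using tht be L const_bounds c by unfold_locales (auto simp: J_def \<kappa>2_def)
 define Th where "Th = C8 * G ^ 4 * (Tht + h powr et)"
 \<comment> \<open>The sign is read off from \<open>R_bound\<close> on a single step, where
   \<open>Th\<close> times a positive number bounds a norm.\<close>
 have Th0: "0 <= Th"
 proof -
  have "0 <= Th * (real (1 - 0) * h) powr tht"
   unfolding Th_def by (rule order_trans[OF norm_ge_zero R_bound]) (use n hd in auto)
  then show ?thesis using h0 by (simp add: zero_le_mult_iff)
 qed
 have bH: "\<bar>b j (g l) - b j (g k)\<bar> <= G * (real (l - k) * h) powr be" if "j <= m" "k <= l" "l <= n" for j k l
  using b_hoelder[of j "g k" "g l"] that g_range g_mono[of k l] g_diff[of k l] by simp
 have "norm (e k) <= 2 powr (2 * (real n * h) / d + 1) * (2 * Th * d powr tht)"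
 proof (rule sc.stability[OF h0 G d(1) eq_refl[OF d(2)] hd Th0, where n = n and x = "%k. X (g k)" and y = "%k. Y (g k)"
    and R = R and bb = "%j k. b j (g k)" and D = "%j k. V j (X (g k)) - V j (Y (g k))"])
  fix j k l assume "j <= m" "k <= l" "l <= n"
  then show "norm (V j (X (g l)) - V j (Y (g l)) - (V j (X (g k)) - V j (Y (g k)))) <= L * norm (e l - e k) + L * norm (e k) * (norm (X (g l) - X (g k)) + norm (Y (g l) - Y (g k)))"
   unfolding e_def by (intro V4)
 next
  fix j k assume "j <= m" "k <= n"
  then show "norm (V j (X (g k)) - V j (Y (g k))) <= L * norm (e k)" using V_lipb[of j] by (simp add: lipb_def e_def)
 next
  fix k l assume kl: "k <= l" "l <= n" "real (l - k) * h <= d"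
  then show "norm (X (g l) - X (g k)) <= C1 * G * (real (l - k) * h) powr be" by (rule Xg_hoelder)
  have "norm (Y (g l) - Y (g k)) <= 2 * real (Suc m) * L * G * (real (l - k) * h) powr be"
  proof (rule scheme_hoelder[OF be(1) h0 G L V_lipb, where n = n and m = m and bb = "%j k. b j (g k)"])
   show "G * (real (l - k) * h) powr be <= 1 / (2 * sewc (2 * be) * real (Suc m) * L)"
    using small_d[of "real (l - k) * h"] kl c h0 by (simp add: c0_def kap_def J_def)
  qed (use bH Y_rec kl in auto)
  then show "norm (Y (g l) - Y (g k)) <= C1 * G * (real (l - k) * h) powr be" by (simp add: C1_def J_def)
 next
  show "e 0 = 0" using X0 Y by (simp add: e_def grid_def crank_nicolson_def)
 qed (use bH e_rec R_bound k in \<open>auto simp: Th_def\<close>)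
 also have "... <= 2 powr (2 * (real n * h) / d + 1) * (2 * Th * 1)"
 proof -
  have "d powr tht <= 1 powr tht" using d tht by (intro powr_mono2) auto
  then show ?thesis using Th0 by (intro mult_left_mono) auto
 qed
 finally show ?thesis by (simp add: nh Th_def)
qed

lemma incr_bound:
 assumes "k < n" "g k <= t" "t <= g (Suc k)" "j <= m"
 shows "\<bar>b j t - b j (g k)\<bar> <= G * h powr be"
proof -
 have "\<bar>b j t - b j (g k)\<bar> <= G * (t - g k) powr be"
  using assms g_range[of k] g_range[of "Suc k"] by (intro b_hoelder) auto
 also have "... <= G * h powr be"
  using assms G be g_Suc[of k] by (intro mult_left_mono powr_mono2) auto
 finally show ?thesis .
qed

text \<open>With one noise and no drift \<open>et\<close> may exceed 2 * be, so the third order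
  interpolation formula is applied, at the price of \<open>sq\<close>. In all other cases et <= 2 *
  be, and the second order expansion of X suffices.\<close>

lemma interp_defect:
 assumes k: "k < n" and t: "g k <= t" "t <= g (Suc k)"
 shows "norm (X t - X (g k) - (1 / 2) *\<^sub>R (\<Sum>j\<le>m. (b j t - b j (g k)) *\<^sub>R (V j (X (g k)) + V j (X (g (Suc k))))))
  <= (C2 + J * L * C1 + \<bar>cell.C7 be L m\<bar>) * TT * G ^ 4 * h powr et + L * sq k t" (is "norm ?q <= _")
proof -
 interpret ck: cell be T L G m V b X "g k" h N by (rule cell_k[OF k])
 have G4: "1 <= G ^ 4" "G ^ 3 <= G ^ 4" "G\<^sup>2 <= G ^ 4" using G by (auto intro: power_increasing)
 show ?thesis
 proof (cases "m = 1 \<and> L0 = 0")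
  case True
  have z: "V 0 y = 0" "i <= 1 ==> j <= 1 ==> i = 0 \<or> j = 0 ==> D i j y = 0" for y i j
   using third(1) third(3)[of i j] True by (auto simp: lipb_def)
  have "norm ?q <= L * ((b 1 t - b 1 (g k))\<^sup>2 + (b 1 (g (Suc k)) - b 1 (g k))\<^sup>2) + ck.C7 * G ^ 3 * h powr (3 * be)"
   using ck.interpolation_third_order[of D t, unfolded g_Suc, OF _ V_exp D_lipb] True z(1) z(2)[of 0 1] z(2)[of 0 0] z(2)[of 1 0] t by simp
  also have "ck.C7 * G ^ 3 * h powr (3 * be) <= (C2 + J * L * C1 + \<bar>ck.C7\<bar>) * G ^ 4 * (TT * h powr et)"
  proof (intro mult_mono h_powr_le)
   have "0 <= C2 + J * L * C1" using const_bounds L by (intro add_nonneg_nonneg mult_nonneg_nonneg) auto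
   then show "ck.C7 <= C2 + J * L * C1 + \<bar>ck.C7\<bar>" "0 <= C2 + J * L * C1 + \<bar>ck.C7\<bar>" by linarith+
   then show "0 <= (C2 + J * L * C1 + \<bar>ck.C7\<bar>) * G ^ 4" using G by simp
  next
   show "et <= 3 * be" using rate True be by linarith
  qed (use G G4 be in auto)
  finally show ?thesis using True unfolding sq_def by (simp add: mult_ac)
 next
  case False
  have q: "?q = (X t - X (g k) - germ m b (%j s. V j (X s)) (g k) t) + (1 / 2) *\<^sub>R (\<Sum>j\<le>m. (b j t - b j (g k)) *\<^sub>R (V j (X (g k)) - V j (X (g (Suc k)))))"
  proof -
   have "(\<Sum>j\<le>m. (b j t - b j (g k)) *\<^sub>R (V j (X (g k)) - V j (X (g (Suc k))))) =
    germ m b (%j s. V j (X s)) (g k) t + germ m b (%j s. V j (X s)) (g k) t - (\<Sum>j\<le>m. (b j t - b j (g k)) *\<^sub>R (V j (X (g k)) + V j (X (g (Suc k)))))"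
    unfolding germ_def sum.distrib[symmetric] sum_subtractf[symmetric]
    by (intro sum.cong refl) (simp add: scaleR_right_distrib scaleR_right_diff_distrib)
   then show ?thesis by (simp add: scaleR_right_diff_distrib)
  qed
  have "norm ?q <= C2 * G\<^sup>2 * h powr (2 * be) + 1 * (J * ((G * h powr be) * (L * (C1 * G * h powr be))))"
   unfolding q
  proof (intro norm_triangle_mono norm_scaleR_le)
   have "norm (X t - X (g k) - germ m b (%j s. V j (X s)) (g k) t) <= C2 * G\<^sup>2 * (t - g k) powr (2 * be)"
    using t k g_range[of k] g_range[of "Suc k"] ck.smallI[of "g k" t] g_Suc[of k] by (intro X_expand) auto
   also have "... <= C2 * G\<^sup>2 * h powr (2 * be)"
    using t be const_bounds g_Suc[of k] by (intro mult_left_mono powr_mono2) auto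
   finally show "norm (X t - X (g k) - germ m b (%j s. V j (X s)) (g k) t) <= C2 * G\<^sup>2 * h powr (2 * be)" .
   have "norm (\<Sum>j\<le>m. (b j t - b j (g k)) *\<^sub>R (V j (X (g k)) - V j (X (g (Suc k))))) <= (\<Sum>j\<le>m. (G * h powr be) * (L * (C1 * G * h powr be)))"
   proof (intro sum_norm_le norm_scaleR_le incr_bound k t)
    fix j assume j: "j \<in> {..m}"
    then show "j <= m" by simp
    have "norm (V j (X (g k)) - V j (X (g (Suc k)))) <= L * norm (X (g (Suc k)) - X (g k))"
     using V_lipb[of j] j by (simp add: lipb_def norm_minus_commute)
    also have "... <= L * (C1 * G * h powr be)"
     using Xg_hoelder[of k "Suc k"] k hd L by (intro mult_left_mono) auto
    finally show "norm (V j (X (g k)) - V j (X (g (Suc k)))) <= L * (C1 * G * h powr be)" .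
   qed
   then show "norm (\<Sum>j\<le>m. (b j t - b j (g k)) *\<^sub>R (V j (X (g k)) - V j (X (g (Suc k))))) <= J * ((G * h powr be) * (L * (C1 * G * h powr be)))"
    by (simp add: J_def)
  qed auto
  also have "... = (C2 + J * L * C1) * G\<^sup>2 * h powr (2 * be)" unfolding powr_double power2_eq_square by (simp add: algebra_simps)
  also have "... <= (C2 + J * L * C1 + \<bar>ck.C7\<bar>) * G ^ 4 * (TT * h powr et)"
  proof -
   have "et <= 2 * be" using rate False be L0 by (cases "m = 1") auto
   then show ?thesis using const_bounds L G4 TT1 be
    by (intro mult_mono h_powr_le) (auto intro!: mult_nonneg_nonneg add_nonneg_nonneg)
  qed
  finally have "norm ?q <= (C2 + J * L * C1 + \<bar>ck.C7\<bar>) * G ^ 4 * (TT * h powr et)" .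
  moreover have "sq k t = 0" using False unfolding sq_def by auto
  ultimately show ?thesis by (simp add: mult_ac)
 qed
qed

text \<open>The error has three parts: the one at the left grid point, the interpolation defect of
  X, and half an increment of the driver times the errors of V at both grid points. The last is at
  most another W, since 2 * (J * L * c) <= 1.\<close>

lemma good_error:
 assumes k: "k < n" and t: "g k <= t" "t <= g (Suc k)"
 shows "norm (X t - Y t) <= 2 powr (2 * T / d + 1) * (4 * (C8 * G ^ 4 * (Tht + h powr et)))
   + (C2 + J * L * C1 + \<bar>cell.C7 be L m\<bar>) * TT * G ^ 4 * h powr et + L * sq k t"
proof -
 define W where "W = 2 powr (2 * T / d + 1) * (2 * (C8 * G ^ 4 * (Tht + h powr et)))"
 define Z where "Z = (C2 + J * L * C1 + \<bar>cell.C7 be L m\<bar>) * TT * G ^ 4 * h powr et + L * sq k t"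
 have W: "norm (e i) <= W" if "i <= n" for i unfolding W_def by (rule grid_error[OF that])
 have W0: "0 <= W" using W[of 0] norm_ge_zero[of "e 0"] by linarith
 define q where "q = X t - X (g k) - (1 / 2) *\<^sub>R (\<Sum>j\<le>m. (b j t - b j (g k)) *\<^sub>R (V j (X (g k)) + V j (X (g (Suc k)))))"
 have Z: "norm q <= Z" unfolding q_def Z_def by (rule interp_defect[OF k t])
 have Z0: "0 <= Z" using Z norm_ge_zero[of q] by linarith
 have "norm (X t - Y t) <= 2 * W + Z"
 proof (cases "t = g (Suc k)")
  case True
  then show ?thesis using W[of "Suc k"] k W0 Z0 by (simp add: e_def)
 next
  case False
  have "Y t = Y (g k) + (1 / 2) *\<^sub>R (\<Sum>j\<le>m. (b j t - b j (g k)) *\<^sub>R (V j (Y (g k)) + V j (Y (g (Suc k)))))"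
   by (rule Y_interp[OF k]) (use t False in auto)
  moreover have "(\<Sum>j\<le>m. (b j t - b j (g k)) *\<^sub>R ((V j (X (g k)) - V j (Y (g k))) + (V j (X (g (Suc k))) - V j (Y (g (Suc k)))))) =
    (\<Sum>j\<le>m. (b j t - b j (g k)) *\<^sub>R (V j (X (g k)) + V j (X (g (Suc k))))) - (\<Sum>j\<le>m. (b j t - b j (g k)) *\<^sub>R (V j (Y (g k)) + V j (Y (g (Suc k)))))"
   unfolding sum_subtractf[symmetric] by (intro sum.cong refl) (simp add: algebra_simps)
  ultimately have dec: "X t - Y t = e k + q + (1 / 2) *\<^sub>R (\<Sum>j\<le>m. (b j t - b j (g k)) *\<^sub>R ((V j (X (g k)) - V j (Y (g k))) + (V j (X (g (Suc k))) - V j (Y (g (Suc k))))))"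
   by (simp add: e_def q_def scaleR_right_diff_distrib)
  have "norm (X t - Y t) <= W + Z + 1 * (\<Sum>j\<le>m. (c * (L * (W + W))))"
   unfolding dec
  proof (intro norm_triangle_mono norm_scaleR_le sum_norm_le)
   fix j assume j: "j \<in> {..m}"
   have "\<bar>b j t - b j (g k)\<bar> <= G * h powr be" using k t j by (intro incr_bound) auto
   then show "\<bar>b j t - b j (g k)\<bar> <= c" using small_d[of h] h0 hd by simp
   have lip: "norm (V j (X (g i)) - V j (Y (g i))) <= L * W" if "i <= n" for i
   proof -
    have "norm (V j (X (g i)) - V j (Y (g i))) <= L * norm (e i)" using V_lipb[of j] j by (simp add: lipb_def e_def)
    also have "... <= L * W" using W[OF that] L by (intro mult_left_mono) auto
    finally show ?thesis .
   qed
   show "norm (V j (X (g k)) - V j (Y (g k)) + (V j (X (g (Suc k))) - V j (Y (g (Suc k))))) <= L * (W + W)"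
    unfolding distrib_left by (intro norm_triangle_mono lip) (use k in auto)
  qed (use W[of k] k Z in auto)
  also have "(\<Sum>j\<le>m. (c * (L * (W + W)))) = 2 * (J * L * c) * W" by (simp add: J_def)
  also have "W + Z + 1 * (2 * (J * L * c) * W) <= W + Z + 1 * W"
  proof -
   have "0 <= \<kappa>2 + 2 * \<kappa>2 * C1" using k2 const_bounds by (intro add_nonneg_nonneg mult_nonneg_nonneg) auto
   then have "J * L * c * 1 <= J * L * c * (1 + \<kappa>2 + 2 * \<kappa>2 * C1)"
    using const_bounds L c by (intro mult_left_mono mult_nonneg_nonneg) auto
   then have "2 * (J * L * c) <= 1" using c(4) by linarith
   then have "2 * (J * L * c) * W <= 1 * W" using W0 by (rule mult_right_mono)
   then show ?thesis by linarith
  qed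
  finally show ?thesis by simp
 qed
 then show ?thesis by (simp add: W_def Z_def)
qed

end

text \<open>X moves by at most C1 over each interval of length d, because G * d powr be <= 1 there,
  and T / d + 1 such intervals suffice.\<close>

lemma X_bound:
 assumes t: "0 <= t" "t <= T"
 shows "norm (X t - x) <= C1 * (T / d + 1)"
proof -
 define M where "M = Suc (nat \<lfloor>T / d\<rfloor>)"
 have "0 <= \<lfloor>T / d\<rfloor>" using T d by (simp add: zero_le_floor)
 then have "real M = of_int \<lfloor>T / d\<rfloor> + 1" by (simp add: M_def)
 then have "T / d < real M" "real M <= T / d + 1" by linarith+
 define dlt where "dlt = t / real M"
 have M1: "1 <= M" by (simp add: M_def)
 have "T < real M * d" using \<open>T / d < real M\<close> d by (simp add: field_simps)
 then have dlt: "0 <= dlt" "dlt <= d" "real M * dlt = t" using t M1 by (auto simp: dlt_def field_simps)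
 have "norm (X (real i * dlt) - x) <= C1 * real i" if "i <= M" for i
  using that
 proof (induction i)
  case 0 then show ?case by (simp add: X0)
 next
  case (Suc i)
  have le: "real (Suc i) * dlt <= T"
   using mult_right_mono[of "real (Suc i)" "real M" dlt] Suc.prems dlt t by simp
  have "norm (X (real (Suc i) * dlt) - X (real i * dlt)) <= C1 * G * (real (Suc i) * dlt - real i * dlt) powr be"
   using dlt le small_d[of dlt] c by (intro X_hoelder) (auto simp: algebra_simps)
  also have "... = C1 * (G * dlt powr be)" by (simp add: algebra_simps)
  also have "... <= C1 * 1" using dlt small_d[of dlt] c const_bounds by (intro mult_left_mono) auto
  finally have "norm (X (real (Suc i) * dlt) - X (real i * dlt)) <= C1" by simp
  then have "norm ((X (real (Suc i) * dlt) - X (real i * dlt)) + (X (real i * dlt) - x)) <= C1 + C1 * real i"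
   using Suc by (intro norm_triangle_mono) auto
  then show ?case by (simp add: algebra_simps)
 qed
 from this[of M] have "norm (X t - x) <= C1 * real M" using dlt by simp
 also have "... <= C1 * (T / d + 1)" using \<open>real M <= _\<close> const_bounds by (intro mult_left_mono) auto
 finally show ?thesis .
qed

lemma scheme_step:
 assumes k: "k < n" and t: "g k <= t" "t <= g (Suc k)"
 shows "norm (Y t - Y (g k)) <= J * L * G * TT"
proof -
 have dec: "Y t - Y (g k) = (1 / 2) *\<^sub>R (\<Sum>j\<le>m. (b j t - b j (g k)) *\<^sub>R (V j (Y (g k)) + V j (Y (g (Suc k)))))"
 proof (cases "t = g (Suc k)")
  case True
  then show ?thesis using Y_rec[OF k] by (simp add: add.commute)
 next
  case False
  have e: "Y t = Y (g k) + (1 / 2) *\<^sub>R (\<Sum>j\<le>m. (b j t - b j (g k)) *\<^sub>R (V j (Y (g k)) + V j (Y (g (Suc k)))))"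
   by (rule Y_interp[OF k]) (use t False in auto)
  show ?thesis by (rule iffD2[OF diff_eq_eq trans[OF e add.commute]])
 qed
 have "norm (Y t - Y (g k)) <= (1 / 2) * (\<Sum>j\<le>m. (G * TT) * (L + L))"
  unfolding dec
 proof (intro norm_scaleR_le sum_norm_le norm_triangle_mono)
  fix j assume j: "j \<in> {..m}"
  have "\<bar>b j t - b j (g k)\<bar> <= G * (t - g k) powr be"
   using assms j g_range[of k] g_range[of "Suc k"] by (intro b_hoelder) auto
  also have "... <= G * T powr be"
   using assms G be g_Suc[of k] hT by (intro mult_left_mono powr_mono2) auto
  also have "... <= G * TT" using G be by (intro mult_left_mono T_powr_le) auto
  finally show "\<bar>b j t - b j (g k)\<bar> <= G * TT" .
  show "norm (V j (Y (g k))) <= L" "norm (V j (Y (g (Suc k)))) <= L" using V_lipb[of j] j by (auto simp: lipb_def)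
 qed auto
 also have "... = J * L * G * TT" by (simp add: J_def)
 finally show ?thesis .
qed

text \<open>For steps that are large compared with d only the boundedness of V is left, so the bound
  grows with n. It is applied when n is at most T / d.\<close>

lemma scheme_bound:
 assumes k: "k < n" and t: "g k <= t" "t <= g (Suc k)"
 shows "norm (Y t - x) <= J * L * G * TT * real n"
proof -
 have grid: "norm (Y (g i) - x) <= J * L * G * TT * real i" if "i <= n" for i
  using that
 proof (induction i)
  case 0 then show ?case using Y by (simp add: crank_nicolson_def grid_def)
 next
  case (Suc i)
  have "norm ((Y (g (Suc i)) - Y (g i)) + (Y (g i) - x)) <= J * L * G * TT + J * L * G * TT * real i"
   using Suc g_mono[of i "Suc i"] by (intro norm_triangle_mono scheme_step) auto
  then show ?case by (simp add: algebra_simps)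
 qed
 have "norm ((Y t - Y (g k)) + (Y (g k) - x)) <= J * L * G * TT + J * L * G * TT * real k"
  using grid[of k] k by (intro norm_triangle_mono scheme_step assms) auto
 also have "... = J * L * G * TT * real (Suc k)" by (simp add: algebra_simps)
 also have "... <= J * L * G * TT * real n"
  using k const_bounds L G TT1 by (intro mult_left_mono) (auto intro!: mult_nonneg_nonneg)
 finally show ?thesis by simp
qed

definition "A = 8 * \<bar>C8\<bar> + (C2 + J * L * C1 + \<bar>cell.C7 be L m\<bar>) * TT + L + (T + 1) * (C1 + J * L * TT)"
text \<open>With w = 1 / d = (G / c) powr (1 / be), the 2 * T comes from the doubling over the
  blocks, 2 powr (2 * T / d), and the 4 from G ^ 4 <= w ^ 4 <= exp (4 * w).\<close>

definition "Bx = (2 * T + 4) * (1 / c) powr (1 / be)"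

text \<open>If h <= d, stability applies with a bound exponential in w = 1 / d. Otherwise n <= T *
  w, so the crude bounds for X and Y are polynomial in w, and 1 <= (w * h) powr et supplies the
  factor h powr et at the price of at most w ^ 2. In both regimes powers of w go into the
  exponential.\<close>

theorem pathwise_error:
 assumes k: "k < n" and t: "g k <= t" "t <= g (Suc k)"
 shows "norm (X t - Y t) <= A * exp (Bx * G powr (1 / be)) * (Tht + (T / real n) powr et + sq k t)"
proof -
 define w where "w = 1 / d"
 have w: "1 <= w" using d by (simp add: w_def)
 have dw: "d powr (-1) = w" using d by (simp add: w_def powr_minus_divide)
 have Bw: "Bx * G powr (1 / be) = (2 * T + 4) * w"
  using G c unfolding Bx_def w_def d_def by (simp add: powr_divide)
 have Gw: "G <= w"
 proof -
  have "G = c * d powr (- be)" using d(2) d(1) by (simp add: powr_minus field_simps)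
  also have "... <= 1 * d powr (- 1)" using c d be by (intro mult_mono powr_mono') auto
  finally show ?thesis unfolding dw by simp
 qed
 define r where "r = h powr et"
 have r0: "0 <= r" by (simp add: r_def)
 have sq0: "0 <= sq k t" by (simp add: sq_def)
 define Ex where "Ex = exp ((2 * T + 4) * w)"
 have we: "w <= exp w" using exp_ge_add_one_self[of w] by linarith
 have w4: "w ^ 4 <= exp (4 * w)"
  using power_mono[OF we, of 4] w by (simp add: exp_of_nat_mult[symmetric])
 have E1: "exp (4 * w) <= Ex" using T w by (simp add: Ex_def)
 have E0: "1 <= Ex" using T w by (simp add: Ex_def)
 have C2J: "0 <= C2 + J * L * C1 + \<bar>cell.C7 be L m\<bar>" "0 <= C1 + J * L * TT"
  using const_bounds L TT1 by (auto intro!: add_nonneg_nonneg mult_nonneg_nonneg)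
 define a1 where "a1 = 8 * \<bar>C8\<bar>"
 define a2 where "a2 = (C2 + J * L * C1 + \<bar>cell.C7 be L m\<bar>) * TT"
 define a3 where "a3 = (T + 1) * (C1 + J * L * TT)"
 have a: "0 <= a1" "0 <= a2" "0 <= a3" "A = a1 + a2 + L + a3"
  using C2J TT1 T by (auto simp: a1_def a2_def a3_def A_def)
 have "norm (X t - Y t) <= A * Ex * (Tht + r + sq k t)"
 proof (cases "h <= d")
  case True
  have G4: "G ^ 4 <= w ^ 4" using Gw G by (intro power_mono) auto
  have "2 powr (2 * T / d + 1) = 2 * 2 powr (2 * T * w)" by (simp add: powr_add w_def)
  also have "2 powr (2 * T * w) <= exp 1 powr (2 * T * w)"
   using T w exp_ge_add_one_self[of 1] by (intro powr_mono2) auto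
  also have "... = exp (2 * T * w)" by (simp add: powr_def)
  finally have p: "2 powr (2 * T / d + 1) <= 2 * exp (2 * T * w)" by simp
  have pE: "2 powr (2 * T / d + 1) * G ^ 4 <= 2 * Ex"
  proof -
   have "2 powr (2 * T / d + 1) * G ^ 4 <= (2 * exp (2 * T * w)) * exp (4 * w)"
    using p G4 w4 G by (intro mult_mono) auto
   also have "... = 2 * Ex" by (simp add: Ex_def exp_add[symmetric] algebra_simps)
   finally show ?thesis .
  qed
  have "2 powr (2 * T / d + 1) * (4 * (C8 * G ^ 4 * (Tht + r))) = (2 powr (2 * T / d + 1) * G ^ 4) * ((4 * C8) * (Tht + r))" by (simp only: mult_ac)
  also have "... <= (2 powr (2 * T / d + 1) * G ^ 4) * ((4 * \<bar>C8\<bar>) * (Tht + r))"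
   using Th r0 G by (intro mult_left_mono mult_right_mono) auto
  also have "... <= (2 * Ex) * ((4 * \<bar>C8\<bar>) * (Tht + r))"
   using Th r0 by (intro mult_right_mono pE) auto
  finally have 1: "2 powr (2 * T / d + 1) * (4 * (C8 * G ^ 4 * (Tht + r))) <= Ex * (a1 * (Tht + r))" by (simp add: a1_def mult_ac)
  have 2: "(C2 + J * L * C1 + \<bar>cell.C7 be L m\<bar>) * TT * G ^ 4 * r <= Ex * (a2 * r)"
  proof -
   have "G ^ 4 <= Ex" using G4 w4 E1 by linarith
   then have "a2 * G ^ 4 * r <= a2 * Ex * r" using a r0 by (intro mult_right_mono mult_left_mono) auto
   then show ?thesis by (simp add: a2_def mult_ac)
  qed
  have 3: "L * sq k t <= Ex * (L * sq k t)"
   using mult_right_mono[OF E0, of "L * sq k t"] L sq0 by simp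
  have "norm (X t - Y t) <= Ex * (a1 * (Tht + r)) + Ex * (a2 * r) + Ex * (L * sq k t)"
   using good_error[OF True assms] 1 2 3 by (simp add: r_def)
  also have "... = Ex * (a1 * (Tht + r) + a2 * r + L * sq k t)" by (simp add: algebra_simps)
  also have "... <= Ex * (A * (Tht + r + sq k t))"
  proof (rule mult_left_mono)
   have "0 <= a1 * sq k t" "0 <= a2 * (Tht + sq k t)" "0 <= L * (Tht + r)" "0 <= a3 * (Tht + r + sq k t)"
    using a sq0 Th r0 L by (auto intro!: mult_nonneg_nonneg)
   then show "a1 * (Tht + r) + a2 * r + L * sq k t <= A * (Tht + r + sq k t)"
    unfolding a(4) by (simp only: distrib_left distrib_right)
  qed (use E0 in auto)
  finally show ?thesis by (simp add: mult_ac)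
 next
  case False
  have nw: "real n <= T * w"
  proof -
   have "real n * d <= real n * h" using False by (intro mult_left_mono) auto
   then show ?thesis using nh d by (simp add: w_def field_simps)
  qed
  have gT: "0 <= t" "t <= T" using t g_range[of k] g_range[of "Suc k"] k by auto
  have "norm (X t - x) <= C1 * (T * w + 1)" using X_bound[OF gT] by (simp add: w_def)
  from order_trans[OF norm_triangle_ineq4 add_mono[OF this scheme_bound[OF assms]]]
  have "norm ((X t - x) - (Y t - x)) <= C1 * (T * w + 1) + J * L * G * TT * real n" .
  also have "... <= C1 * ((T + 1) * w) + (J * L * w * TT) * (T * w)"
  proof (intro add_mono mult_left_mono mult_mono nw Gw)
   show "T * w + 1 <= (T + 1) * w" using w by (simp add: algebra_simps)
  qed (use const_bounds L G TT1 w in \<open>auto intro!: mult_nonneg_nonneg\<close>)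
  also have "... <= C1 * ((T + 1) * w ^ 2) + (J * L * TT) * ((T + 1) * w ^ 2)"
  proof (intro add_mono)
   have ww: "w <= w ^ 2" using w by (simp add: power2_eq_square)
   show "C1 * ((T + 1) * w) <= C1 * ((T + 1) * w ^ 2)"
    using ww const_bounds T by (intro mult_left_mono) auto
   have "(J * L * w * TT) * (T * w) = (J * L * TT) * (T * w ^ 2)" by (simp add: power2_eq_square mult_ac)
   also have "... <= (J * L * TT) * ((T + 1) * w ^ 2)"
    using const_bounds L TT1 by (intro mult_left_mono mult_right_mono mult_nonneg_nonneg) auto
   finally show "(J * L * w * TT) * (T * w) <= (J * L * TT) * ((T + 1) * w ^ 2)" .
  qed
  also have "... = a3 * w ^ 2" by (simp add: a3_def algebra_simps)
  also have "... <= a3 * (w ^ 4 * r)"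
  proof (rule mult_left_mono[OF _ a(3)])
   have "w powr et * r = (w * h) powr et" using w h0 by (simp add: r_def powr_mult)
   also have "1 powr et <= (w * h) powr et" using False d rate h0 by (intro powr_mono2) (auto simp: w_def field_simps)
   finally have "1 <= w powr et * r" by simp
   also have "... <= w powr 2 * r" using w rate r0 by (intro mult_right_mono powr_mono) auto
   also have "w powr 2 = w ^ 2" using w by (simp add: powr_numeral)
   finally have "w ^ 2 * 1 <= w ^ 2 * (w ^ 2 * r)" by (intro mult_left_mono) auto
   then show "w ^ 2 <= w ^ 4 * r" by (simp add: power2_eq_square power4_eq_xxxx mult_ac)
  qed
  also have "... <= a3 * (Ex * r)" using a r0 w4 E1 by (intro mult_left_mono mult_right_mono) auto
  also have "... = Ex * (a3 * r)" by simp
  also have "... <= Ex * (A * (Tht + r + sq k t))"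
  proof (rule mult_left_mono)
   have "a3 * r <= A * r" unfolding a(4) using a r0 L by (intro mult_right_mono) auto
   also have "... <= A * (Tht + r + sq k t)" using a L Th sq0 by (intro mult_left_mono) auto
   finally show "a3 * r <= A * (Tht + r + sq k t)" .
  qed (use E0 in auto)
  finally show ?thesis by (simp add: mult_ac)
 qed
 then show ?thesis by (simp add: Ex_def Bw r_def h_def)
qed

end

section \<open>Constants of the vector fields, Young solutions, and the moment estimate\<close>

lemma expands_mono: "expands m V L f Df ==> L <= L' ==> expands m V L' f Df"
 unfolding expands_def by (meson add_mono mult_right_mono norm_ge_zero order_trans zero_le_power2)

lemma lipb_mono: "lipb L f ==> L <= L' ==> lipb L' f"
 unfolding lipb_def by (meson mult_right_mono norm_ge_zero order_trans)

text \<open>Taylor at x, with the linear derivative evaluated on the part of y - x that the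
  combination of the fields leaves over.\<close>

lemma expands_exists:
 fixes f :: "real ^ 'd => real ^ 'd"
 assumes "Cb (Suc (Suc k)) f"
 shows "\<exists>L\<ge>0. expands m V L f (%i y. frechet_derivative f (at y) (V i y))"
proof -
 obtain L1 where L1: "0 <= L1" "!!x y. norm (f y - f x - frechet_derivative f (at x) (y - x)) <= L1 * (norm (y - x))\<^sup>2"
  using Cb_taylor[OF assms] by blast
 obtain L2 where L2: "0 <= L2" "!!y v. norm (frechet_derivative f (at y) v) <= L2 * norm v"
  using frechet_bound[OF assms] by blast
 have "norm (f y - f x - (\<Sum>i\<le>m. c i *\<^sub>R frechet_derivative f (at x) (V i x))) <= (L1 + L2) * (norm (y - x))\<^sup>2 + (L1 + L2) * norm (y - x - (\<Sum>i\<le>m. c i *\<^sub>R V i x))" for x y c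
 proof -
  have lin: "linear (frechet_derivative f (at x))"
   using Cb_Suc_has_derivative[OF assms] has_derivative_linear by blast
  have "frechet_derivative f (at x) (y - x - (\<Sum>i\<le>m. c i *\<^sub>R V i x)) = frechet_derivative f (at x) (y - x) - (\<Sum>i\<le>m. c i *\<^sub>R frechet_derivative f (at x) (V i x))"
   unfolding linear_diff[OF lin, of "y - x"] linear_sum[OF lin] linear_scale[OF lin] ..
  then have eq: "f y - f x - (\<Sum>i\<le>m. c i *\<^sub>R frechet_derivative f (at x) (V i x)) = (f y - f x - frechet_derivative f (at x) (y - x)) + frechet_derivative f (at x) (y - x - (\<Sum>i\<le>m. c i *\<^sub>R V i x))"
   by (simp only: diff_add_eq_diff_diff_swap add_diff_eq diff_add_cancel)
  have "norm (f y - f x - (\<Sum>i\<le>m. c i *\<^sub>R frechet_derivative f (at x) (V i x))) <= L1 * (norm (y - x))\<^sup>2 + L2 * norm (y - x - (\<Sum>i\<le>m. c i *\<^sub>R V i x))"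
   unfolding eq by (intro norm_triangle_mono L1 L2)
  also have "... <= (L1 + L2) * (norm (y - x))\<^sup>2 + (L1 + L2) * norm (y - x - (\<Sum>i\<le>m. c i *\<^sub>R V i x))"
   using L1 L2 by (intro add_mono mult_right_mono) auto
  finally show ?thesis .
 qed
 then show ?thesis using L1 L2 unfolding expands_def by (intro exI[of _ "L1 + L2"]) auto
qed

lemma lipb_exists:
 fixes f :: "real ^ 'd => real ^ 'd"
 assumes "Cb (Suc k) f" shows "\<exists>L\<ge>0. lipb L f"
proof -
 obtain L1 where L1: "0 <= L1" "!!x. norm (f x) <= L1" using Cb_bound[OF assms] by blast
 obtain L2 where L2: "0 <= L2" "!!x y. norm (f x - f y) <= L2 * norm (x - y)" using Cb_lipschitz[OF assms] by blast
 have "norm (f x - f y) <= max L1 L2 * norm (x - y)" for x y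
  by (rule order_trans[OF L2(2)]) (intro mult_right_mono, auto)
 then have "lipb (max L1 L2) f" unfolding lipb_def using L1 by (auto simp: le_max_iff_disj)
 then show ?thesis using L1 by (intro exI[of _ "max L1 L2"]) auto
qed

text \<open>Asking for validity at all larger constants allows the constants of several families to
  be merged afterwards by adding them.\<close>

lemma ex_uniform:
 fixes P :: "'i => real => bool"
 assumes "finite I" "!!i. i \<in> I ==> \<exists>L\<ge>0. P i L" and mono: "!!i L L'. P i L ==> L <= L' ==> P i L'"
 shows "\<exists>L\<ge>1. \<forall>i\<in>I. \<forall>L'\<ge>L. P i L'"
proof -
 have "\<forall>i\<in>I. \<exists>L\<ge>0. P i L" using assms(2) by blast
 from bchoice[OF this] obtain F where F: "\<forall>i\<in>I. 0 <= F i \<and> P i (F i)" by blast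
 have "F i <= 1 + (\<Sum>i\<in>I. F i)" if "i \<in> I" for i
  using member_le_sum[of i I F] F assms(1) that by auto
 moreover have "1 <= 1 + (\<Sum>i\<in>I. F i)" using F by (auto intro: sum_nonneg)
 ultimately show ?thesis using F mono by (intro exI[of _ "1 + (\<Sum>i\<in>I. F i)"]) (meson order_trans)
qed

text \<open>Here the three derivatives of V are spent: D is of class 2, which allows
  \<open>D 1 1\<close> to be expanded, and its derivative E is of class 1, hence Lipschitz.\<close>

lemma field_constants:
 fixes V :: "nat => real ^ 'd => real ^ 'd"
 assumes V: "!!j. j <= m ==> Cb 3 (V j)" and m: "1 <= m"
  and D: "D = (%i j y. frechet_derivative (V j) (at y) (V i y))" and E: "E = (%i y. frechet_derivative (D 1 1) (at y) (V i y))"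
 shows "\<exists>L\<ge>1. (\<forall>j\<le>m. lipb L (V j)) \<and> (\<forall>j\<le>m. expands m V L (V j) (%i. D i j)) \<and> (\<forall>i\<le>m. \<forall>j\<le>m. lipb L (D i j))
   \<and> (\<forall>j\<le>m. \<forall>a a' c c'. norm ((V j a - V j a') - (V j c - V j c')) <= L * norm ((a - a') - (c - c')) + L * norm (c - c') * (norm (a - c) + norm (a' - c')))
   \<and> expands m V L (D 1 1) E \<and> (\<forall>i\<le>m. lipb L (E i))"
proof -
 have V3: "Cb (Suc (Suc (Suc 0))) (V j)" if "j <= m" for j using V[OF that] by (simp only: numeral_3_eq_3)
 have D2: "Cb (Suc (Suc 0)) (D i j)" if "i <= m" "j <= m" for i j
  unfolding D using V3[OF that(2)] Cb_SucD[OF V3[OF that(1)]] by (rule Cb_dir)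
 have E1: "Cb (Suc 0) (E i)" if "i <= m" for i
  unfolding E using D2[OF m m] Cb_SucD[OF Cb_SucD[OF V3[OF that]]] by (rule Cb_dir)
 have "\<exists>L\<ge>1. \<forall>j\<in>{..m}. \<forall>L'\<ge>L. lipb L' (V j)"
  using lipb_exists[OF V3] lipb_mono by (intro ex_uniform) auto
 then obtain L1 where L1: "1 <= L1" "\<forall>j\<in>{..m}. \<forall>L'\<ge>L1. lipb L' (V j)" by blast
 have "\<exists>L\<ge>1. \<forall>j\<in>{..m}. \<forall>L'\<ge>L. expands m V L' (V j) (%i. D i j)"
  using expands_exists[OF V3] expands_mono unfolding D by (intro ex_uniform) auto
 then obtain L2 where L2: "1 <= L2" "\<forall>j\<in>{..m}. \<forall>L'\<ge>L2. expands m V L' (V j) (%i. D i j)" by blast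
 have "\<exists>L\<ge>1. \<forall>ij\<in>{..m} \<times> {..m}. \<forall>L'\<ge>L. lipb L' (D (fst ij) (snd ij))"
  using lipb_exists[OF D2] lipb_mono by (intro ex_uniform) auto
 then obtain L3 where L3: "1 <= L3" "\<forall>ij\<in>{..m} \<times> {..m}. \<forall>L'\<ge>L3. lipb L' (D (fst ij) (snd ij))" by blast
 have "\<exists>L\<ge>1. \<forall>j\<in>{..m}. \<forall>L'\<ge>L. \<forall>a a' c c'. norm ((V j a - V j a') - (V j c - V j c')) <= L' * norm ((a - a') - (c - c')) + L' * norm (c - c') * (norm (a - c) + norm (a' - c'))"
 proof (rule ex_uniform)
  fix j assume "j \<in> {..m}"
  then have j: "j <= m" by simp
  show "\<exists>L\<ge>0. \<forall>a a' c c'. norm ((V j a - V j a') - (V j c - V j c')) <= L * norm ((a - a') - (c - c')) + L * norm (c - c') * (norm (a - c) + norm (a' - c'))"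
   using Cb_four_point[OF V3[OF j]] by metis
 next
  fix j and L L' :: real
  assume *: "\<forall>a a' c c'. norm ((V j a - V j a') - (V j c - V j c')) <= L * norm ((a - a') - (c - c')) + L * norm (c - c') * (norm (a - c) + norm (a' - c'))" "L <= L'"
  show "\<forall>a a' c c'. norm ((V j a - V j a') - (V j c - V j c')) <= L' * norm ((a - a') - (c - c')) + L' * norm (c - c') * (norm (a - c) + norm (a' - c'))"
  proof (intro allI)
   fix a a' c c'
   have "norm ((V j a - V j a') - (V j c - V j c')) <= L * norm ((a - a') - (c - c')) + L * norm (c - c') * (norm (a - c) + norm (a' - c'))" using * by blast
   also have "... <= L' * norm ((a - a') - (c - c')) + L' * norm (c - c') * (norm (a - c) + norm (a' - c'))"
    using * by (intro add_mono mult_right_mono) auto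
   finally show "norm ((V j a - V j a') - (V j c - V j c')) <= L' * norm ((a - a') - (c - c')) + L' * norm (c - c') * (norm (a - c) + norm (a' - c'))" .
  qed
 qed simp
 then obtain L4 where L4: "1 <= L4" "\<forall>j\<in>{..m}. \<forall>L'\<ge>L4. \<forall>a a' c c'. norm ((V j a - V j a') - (V j c - V j c')) <= L' * norm ((a - a') - (c - c')) + L' * norm (c - c') * (norm (a - c) + norm (a' - c'))" by blast
 obtain L5 where L5: "0 <= L5" "expands m V L5 (D 1 1) E" using expands_exists[OF D2[OF m m], of m V] unfolding E by blast
 have "\<exists>L\<ge>1. \<forall>j\<in>{..m}. \<forall>L'\<ge>L. lipb L' (E j)"
  using lipb_exists[OF E1] lipb_mono by (intro ex_uniform) auto
 then obtain L6 where L6: "1 <= L6" "\<forall>j\<in>{..m}. \<forall>L'\<ge>L6. lipb L' (E j)" by blast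
 define L where "L = L1 + L2 + L3 + L4 + L5 + L6"
 have L: "L1 <= L" "L2 <= L" "L3 <= L" "L4 <= L" "L5 <= L" "L6 <= L" "1 <= L"
  using L1(1) L2(1) L3(1) L4(1) L5(1) L6(1) by (auto simp: L_def)
 have "\<forall>i\<le>m. \<forall>j\<le>m. lipb L (D i j)" using L3(2) L by force
 moreover have "expands m V L (D 1 1) E" using expands_mono[OF L5(2) L(5)] .
 ultimately show ?thesis using L1(2) L2(2) L4(2) L6(2) L by (intro exI[of _ L] conjI) auto
qed

lemma has_rs_integral_empty:
 assumes "has_rs_integral f g I 0 (0::real)" shows "I = 0"
proof (rule ccontr)
 assume "I ~= 0"
 then have "0 < norm I" by simp
 then obtain dlt where dlt: "0 < dlt" "!!p. p tagged_division_of {0..0} \<and> (\<forall>(\<xi>, K)\<in>p. diameter K < dlt) ==>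
   norm ((\<Sum>(\<xi>, K)\<in>p. (g (Sup K) - g (Inf K)) *\<^sub>R f \<xi>) - I) < norm I"
  using assms unfolding has_rs_integral_def by blast
 have "{(0, {0..0})} tagged_division_of {0..(0::real)}" by (rule tagged_division_of_self_real) auto
 from dlt(2)[OF conjI, OF this] dlt(1) show False by simp
qed

text \<open>A Young solution has some Hoelder exponent \<alpha> > 1 - H, but which one may depend on
  the path. The exponents offered for the driver increase to H, so one of them satisfies \<alpha> +
  be > 1; then \<open>rs_young\<close>, summed over the components, is the local expansion.\<close>

lemma young_solution_qual:
 fixes V :: "nat => real ^ 'd => real ^ 'd"
 assumes sol: "young_solution T H m V b x X" and H: "1 / 2 < H" "H < 1" and T: "0 < T" and V: "!!j. j <= m ==> lipb L (V j)" and L: "0 <= L"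
  and b: "!!k. \<exists>G\<ge>0. \<forall>j\<le>m. \<forall>s t. 0 <= s --> s <= t --> t <= T --> \<bar>b j t - b j s\<bar> <= G * (t - s) powr (H - (H - 1 / 2) / (real k + 2))"
 shows "X 0 = x" "\<exists>Q \<gamma>. 1 < \<gamma> \<and> 0 <= Q \<and> (\<forall>s t. 0 <= s \<and> s <= t \<and> t <= T -->
     norm (X t - X s - germ m b (%j s. V j (X s)) s t) <= Q * (t - s) powr \<gamma>)"
proof -
 have int: "\<exists>I. (\<forall>j\<le>m. has_rs_integral (%s. V j (X s)) (b j) (I j) 0 t) \<and> X t = x + (\<Sum>j\<le>m. I j)" if "t \<in> {0..T}" for t
  using sol that unfolding young_solution_def by blast
 show "X 0 = x"
 proof -
  obtain I where I: "\<forall>j\<le>m. has_rs_integral (%s. V j (X s)) (b j) (I j) 0 0" "X 0 = x + (\<Sum>j\<le>m. I j)" using int[of 0] T by auto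
  then have "I j = 0" if "j <= m" for j using has_rs_integral_empty that by blast
  then show ?thesis using I by simp
 qed
 obtain \<alpha> C where \<alpha>: "1 - H < \<alpha>" "\<forall>s\<in>{0..T}. \<forall>t\<in>{0..T}. norm (X t - X s) <= C * \<bar>t - s\<bar> powr \<alpha>"
  using sol unfolding young_solution_def by blast
 obtain k :: nat where k: "1 / (\<alpha> - (1 - H)) < real k" using reals_Archimedean2 by blast
 define be where "be = H - (H - 1 / 2) / (real k + 2)"
 have be: "0 < be" "1 < \<alpha> + be"
 proof -
  have "(H - 1 / 2) / (real k + 2) <= (H - 1 / 2) / 1" using H by (intro divide_left_mono) auto
  then show "0 < be" by (simp add: be_def)
  have a: "0 < \<alpha> - (1 - H)" using \<alpha> by simp
  then have "1 < real k * (\<alpha> - (1 - H))" using k by (simp add: field_simps)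
  also have "... <= (real k + 2) * (\<alpha> - (1 - H))" using a by (intro mult_right_mono) auto
  finally have "H - 1 / 2 < (real k + 2) * (\<alpha> - (1 - H))" using H by linarith
  then have "(H - 1 / 2) / (real k + 2) < \<alpha> - (1 - H)" by (simp add: divide_less_eq mult.commute)
  then show "1 < \<alpha> + be" by (simp add: be_def)
 qed
 obtain G where G: "0 <= G" "\<forall>j\<le>m. \<forall>s t. 0 <= s --> s <= t --> t <= T --> \<bar>b j t - b j s\<bar> <= G * (t - s) powr be" using b[of k] unfolding be_def by blast
 define Q where "Q = real (Suc m) * (sewc (\<alpha> + be) * (L * \<bar>C\<bar> * G))"
 have "norm (X t - X s - germ m b (%j s. V j (X s)) s t) <= Q * (t - s) powr (\<alpha> + be)" if st: "0 <= s" "s <= t" "t <= T" for s t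
 proof -
  obtain I where I: "\<forall>j\<le>m. has_rs_integral (%s. V j (X s)) (b j) (I j) 0 s" "X s = x + (\<Sum>j\<le>m. I j)" using int[of s] st by auto
  obtain I' where I': "\<forall>j\<le>m. has_rs_integral (%s. V j (X s)) (b j) (I' j) 0 t" "X t = x + (\<Sum>j\<le>m. I' j)" using int[of t] st by auto
  have eq: "X t - X s - germ m b (%j s. V j (X s)) s t = (\<Sum>j\<le>m. I' j - I j - (b j t - b j s) *\<^sub>R V j (X s))"
   by (simp add: I(2) I'(2) germ_def sum_subtractf)
  have "norm (\<Sum>j\<le>m. I' j - I j - (b j t - b j s) *\<^sub>R V j (X s)) <= (\<Sum>j\<le>m. sewc (\<alpha> + be) * (L * \<bar>C\<bar> * G) * (t - s) powr (\<alpha> + be))"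
  proof (rule sum_norm_le)
   fix j assume "j \<in> {..m}"
   then have j: "j <= m" by simp
   show "norm (I' j - I j - (b j t - b j s) *\<^sub>R V j (X s)) <= sewc (\<alpha> + be) * (L * \<bar>C\<bar> * G) * (t - s) powr (\<alpha> + be)"
   proof (rule rs_young[where f = "%s. V j (X s)" and g = "b j"])
    fix u v assume uv: "0 <= u" "u <= v" "v <= t"
    have "norm (V j (X v) - V j (X u)) <= L * norm (X v - X u)" using V[OF j] by (simp add: lipb_def)
    also have "... <= L * (\<bar>C\<bar> * (v - u) powr \<alpha>)"
    proof (rule mult_left_mono[OF _ L])
     have "norm (X v - X u) <= C * (v - u) powr \<alpha>" using \<alpha>(2)[rule_format, of u v] uv st by simp
     also have "... <= \<bar>C\<bar> * (v - u) powr \<alpha>" by (intro mult_right_mono) auto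
     finally show "norm (X v - X u) <= \<bar>C\<bar> * (v - u) powr \<alpha>" .
    qed
    finally show "norm (V j (X v) - V j (X u)) <= L * \<bar>C\<bar> * (v - u) powr \<alpha>" by simp
    show "\<bar>b j v - b j u\<bar> <= G * (v - u) powr be" using G(2) j uv st by auto
   qed (use I I' j st L G \<alpha> be H in auto)
  qed
  then show ?thesis unfolding eq by (simp add: Q_def mult_ac)
 qed
 moreover have "0 <= Q" using sewc_ge1(1)[OF be(2)] L G by (simp add: Q_def)
 ultimately show "\<exists>Q \<gamma>. 1 < \<gamma> \<and> 0 <= Q \<and> (\<forall>s t. 0 <= s \<and> s <= t \<and> t <= T -->
     norm (X t - X s - germ m b (%j s. V j (X s)) s t) <= Q * (t - s) powr \<gamma>)"
  using be by (intro exI[of _ Q] exI[of _ "\<alpha> + be"]) auto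
qed

lemma Lp_norm_le:
 assumes "(\<integral>\<^sup>+om. ennreal (norm (Z om) powr p) \<partial>M) <= ennreal c" "0 <= c" "1 <= p"
 shows "Lp_norm M p Z <= ennreal (c powr (1 / p))"
proof -
 let ?I = "\<integral>\<^sup>+om. ennreal (norm (Z om) powr p) \<partial>M"
 have fin: "?I ~= \<infinity>" using assms(1) by (auto simp: top_unique)
 have "enn2real ?I <= c" using assms by (intro enn2real_leI) auto
 then have "enn2real ?I powr (1 / p) <= c powr (1 / p)" using assms by (intro powr_mono2) auto
 then show ?thesis using fin by (simp add: Lp_norm_def Let_def ennreal_leI)
qed

text \<open>The inequality amounts to N powr (2 * be - 1) >= h powr (2 * be - 3), and the exponent
  of N is positive.\<close>

lemma fine_exists:
 assumes "0 < h" "1 / 2 < be" shows "\<exists>N\<ge>1. real N * (h / real N) powr (2 * be) <= h ^ 3"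
proof -
 obtain N0 :: nat where "h powr ((2 * be - 3) / (2 * be - 1)) <= real N0" using real_arch_simple by blast
 then have N: "h powr ((2 * be - 3) / (2 * be - 1)) <= real (Suc N0)" by simp
 define N where "N = Suc N0"
 have "(h powr ((2 * be - 3) / (2 * be - 1))) powr (2 * be - 1) <= real N powr (2 * be - 1)"
  using N assms unfolding N_def by (intro powr_mono2) auto
 then have 1: "h powr (2 * be - 3) <= real N powr (2 * be - 1)" using assms by (simp add: powr_powr)
 have "real N * (h / real N) powr (2 * be) = h powr (2 * be) / real N powr (2 * be - 1)"
  using assms by (simp add: N_def powr_divide powr_diff)
 also have "... <= h powr (2 * be) / h powr (2 * be - 3)" using 1 assms by (intro divide_left_mono) (auto simp: N_def)
 also have "... = h powr 3" using assms by (simp add: powr_diff[symmetric])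
 also have "... = h ^ 3" using assms by (simp add: powr_numeral)
 finally show ?thesis by (intro exI[of _ N]) (simp add: N_def)
qed

lemma power_sum4_le:
 fixes a b c d :: real
 assumes "0 <= a" "0 <= b" "0 <= c" "0 <= d"
 shows "(a + b + c + d) ^ k <= 4 ^ k * (a ^ k + b ^ k + c ^ k + d ^ k)"
proof -
 have two: "(x + y) ^ k <= 2 ^ k * (x ^ k + y ^ k)" if "0 <= x" "0 <= y" for x y :: real
  using abs_add_power_le[of x y k] that by simp
 have "(a + b + c + d) ^ k = ((a + b) + (c + d)) ^ k" by (simp add: add.assoc)
 also have "... <= 2 ^ k * ((a + b) ^ k + (c + d) ^ k)" using assms by (intro two) auto
 also have "... <= 2 ^ k * (2 ^ k * (a ^ k + b ^ k) + 2 ^ k * (c ^ k + d ^ k))"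
  using assms by (intro mult_left_mono add_mono two) auto
 also have "... = (2 * 2) ^ k * (a ^ k + b ^ k + c ^ k + d ^ k)" unfolding power_mult_distrib by (simp add: algebra_simps)
 finally show ?thesis by simp
qed

lemma ennreal_weighted_sum4:
 assumes "0 <= w" "0 <= a" "0 <= b" "0 <= c" "0 <= d"
 shows "ennreal w * (ennreal a + ennreal b + ennreal c + ennreal d) = ennreal (w * (a + b + c + d))"
 using assms by (simp add: ennreal_mult)

theorem theorem1p1:
  fixes M :: "'w measure"
    and H T p :: real
    and m :: nat
    and x :: "real ^ 'd"
    and V :: "nat \<Rightarrow> real ^ 'd \<Rightarrow> real ^ 'd"
    and B :: "nat \<Rightarrow> real \<Rightarrow> 'w \<Rightarrow> real"
    and X :: "real \<Rightarrow> 'w \<Rightarrow> real ^ 'd"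
    and Xn :: "nat \<Rightarrow> real \<Rightarrow> 'w \<Rightarrow> real ^ 'd"
  assumes "prob_space M"
    and "1 / 2 < H" "H < 1" "0 < T" "1 \<le> m"
    and "fbm_driver M T H m B"
    and "\<And>j. j \<le> m \<Longrightarrow> Cb 3 (V j)"
    and "\<And>t. t \<in> {0..T} \<Longrightarrow> X t \<in> borel_measurable M"
    and "AE \<omega> in M. young_solution T H m V (\<lambda>j t. B j t \<omega>) x (\<lambda>t. X t \<omega>)"
    and "\<And>n t. 1 \<le> n \<Longrightarrow> t \<in> {0..T} \<Longrightarrow> Xn n t \<in> borel_measurable M"
    and "\<And>n. 1 \<le> n \<Longrightarrow>
           AE \<omega> in M. crank_nicolson T n m V (\<lambda>j t. B j t \<omega>) x (\<lambda>t. Xn n t \<omega>)"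
    and "1 \<le> p"
  shows "\<exists>K\<ge>0. \<forall>n\<ge>1.
           (SUP t\<in>{0..T}. Lp_norm M p (\<lambda>\<omega>. X t \<omega> - Xn n t \<omega>)) \<le> ennreal (K / rate H m (V 0) n)"
proof -
 note H = assms(2,3) and T = assms(4) and m = assms(5) and V = assms(7) and sol = assms(9) and scheme = assms(11) and p = assms(12)
 interpret driver M H T m B
  using assms(1-6) by (simp add: driver_def driver_axioms_def)
 define D where "D = (%i j y. frechet_derivative (V j) (at y) (V i y))"
 define E where "E = (%i y. frechet_derivative (D 1 1) (at y) (V i y))"
 obtain L where L: "1 <= L" and V_lipb: "\<forall>j\<le>m. lipb L (V j)" and V_exp: "\<forall>j\<le>m. expands m V L (V j) (%i. D i j)"
  and D_lipb: "\<forall>i\<le>m. \<forall>j\<le>m. lipb L (D i j)"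
  and V4: "\<forall>j\<le>m. \<forall>a a' c c'. norm ((V j a - V j a') - (V j c - V j c')) <= L * norm ((a - a') - (c - c')) + L * norm (c - c') * (norm (a - c) + norm (a' - c'))"
  and E_exp: "expands m V L (D 1 1) E" and E_lipb: "\<forall>i\<le>m. lipb L (E i)"
  using field_constants[OF V m D_def E_def] by blast
 define dr where "dr = (\<exists>y. V 0 y ~= 0)"
 \<comment> \<open>Without drift \<open>V 0\<close> and every derivative along or of it vanish, so
   the constant 0 is valid for all quantities that \<open>L0\<close> has to bound.\<close>
 define L0 where "L0 = (if dr then L else 0)"
 have L0: "0 <= L0" "L0 <= L" "L0 ~= 0 \<longleftrightarrow> dr" using L by (auto simp: L0_def)
 have Cb_lin: "frechet_derivative f (at y) 0 = 0" if "Cb (Suc k) f" for f :: "real ^ 'd => real ^ 'd" and k y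
  using has_derivative_linear[OF Cb_Suc_has_derivative[OF that, of y]] by (rule linear_0)
 have V3: "Cb (Suc (Suc (Suc 0))) (V j)" if "j <= m" for j using V[OF that] by (simp only: numeral_3_eq_3)
 have zero: "V 0 = (%_. 0)" "j <= m ==> D 0 j = (%_. 0)" "D j 0 = (%_. 0)" "E 0 = (%_. 0)" if "~ dr" for j
 proof -
  show V0: "V 0 = (%_. 0)" using that by (auto simp: dr_def)
  show "j <= m ==> D 0 j = (%_. 0)" using Cb_lin[OF V3] by (simp add: D_def V0)
  show "D j 0 = (%_. 0)" by (simp add: D_def V0 frechet_derivative_const)
  have c: "Cb (Suc (Suc 0)) (D 1 1)" unfolding D_def using V3[OF m] Cb_SucD[OF V3[OF m]] by (rule Cb_dir)
  show "E 0 = (%_. 0)" unfolding E_def V0 by (rule ext) (rule Cb_lin[OF c])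
 qed
 have third_all: "lipb L0 (V 0) \<and> expands m V L0 (V 0) (%i. D i 0) \<and> (\<forall>i j. i <= m --> j <= m --> i = 0 \<or> j = 0 --> lipb L0 (D i j)) \<and> (\<forall>y. norm (E 0 y) <= L0)"
 proof (cases dr)
  case True
  then have eq: "L0 = L" by (simp add: L0_def)
  have "norm (E 0 y) <= L" for y using E_lipb by (simp add: lipb_def)
  with V_lipb V_exp D_lipb show ?thesis unfolding eq by auto
 next
  case False
  then have eq: "L0 = 0" by (simp add: L0_def)
  have z: "lipb 0 (%_. 0 :: real ^ 'd)" by (simp add: lipb_def)
  have "lipb 0 (D i j)" if "i <= m" "j <= m" "i = 0 \<or> j = 0" for i j
   using zero(2)[OF False that(2)] zero(3)[OF False, of i] that z by auto
  moreover have "expands m V 0 (V 0) (%i. D i 0)" by (simp add: expands_def zero(1)[OF False] zero(3)[OF False])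
  ultimately show ?thesis unfolding eq using zero(1)[OF False] zero(4)[OF False] z by auto
 qed
 have third: "lipb L0 (V 0)" "expands m V L0 (V 0) (%i. D i 0)" "!!i j. i <= m ==> j <= m ==> i = 0 \<or> j = 0 ==> lipb L0 (D i j)" "!!y. norm (E 0 y) <= L0"
  using third_all by blast+
 \<comment> \<open>The fractions make all conditions hold with margin: tht + be = 1 + 2/5
   \<epsilon>; 3 * be - 1 = 1/2 + 2.7 \<epsilon> against 2 * H - 1/2 = 1/2 + 2 \<epsilon>; 4 * be -
   1 = 1 + 3.6 \<epsilon> against 2 * H = 1 + 2 \<epsilon>; and 2 * be = 1 + 1.8 \<epsilon> against
   H + 1/2 = 1 + \<epsilon>.\<close>
 define \<epsilon> where "\<epsilon> = H - 1 / 2"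
 define be where "be = 1 / 2 + 9 / 10 * \<epsilon>"
 define tht where "tht = 1 / 2 - \<epsilon> / 2"
 define et where "et = (if m > 1 then 2 * H - 1 / 2 else if dr then H + 1 / 2 else 2 * H)"
 have eps: "0 < \<epsilon>" "\<epsilon> < 1 / 2" using H by (auto simp: \<epsilon>_def)
 have be: "1 / 2 < be" "be < H" "be < 1" using eps H by (auto simp: be_def \<epsilon>_def field_simps)
 have tht: "0 < tht" "tht < 1 / 2" "tht < be" "1 < tht + be" using eps by (auto simp: tht_def be_def)
 have et: "0 < et" "et <= 2" "m ~= 1 ==> et <= 3 * be - 1" "m = 1 ==> et <= 4 * be - 1" "m = 1 ==> L0 ~= 0 ==> et <= 2 * be" "m = 1 ==> L0 = 0 ==> et = 2 * H"
  using eps m H L0(3) by (auto simp: et_def be_def \<epsilon>_def field_simps split: if_splits)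
 define fl where "fl \<longleftrightarrow> (m = 1 --> L0 ~= 0)"
 have flags: "fl ==> et <= H + 1 / 2" "fl ==> m ~= 1 ==> et <= 2 * H - 1 / 2" "m = 1 ==> et <= 2 * H"
  using eps m H L0(3) by (auto simp: et_def fl_def)
 \<comment> \<open>Large enough for chaining with the gap 1/2 - tht = \<epsilon> / 2, and at least
   p, so that p-th moments are controlled by 2 * r-th ones.\<close>
 obtain r :: nat where r: "1 <= r" "2 <= 2 * real r * (1 / 2 - tht)" "p <= real r"
 proof -
  obtain r :: nat where r: "2 / \<epsilon> + p <= real r" using real_arch_simple by blast
  have e: "0 < 2 / \<epsilon>" using eps by simp
  have "p <= real r" "1 <= r" using r e p by linarith+
  moreover have "2 / \<epsilon> <= real r" using r p by linarith
  then have "2 <= 2 * real r * (1 / 2 - tht)" using eps by (simp add: tht_def field_simps)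
  ultimately show ?thesis using that by blast
 qed
 obtain G where G: "G \<in> borel_measurable M" "!!om. 1 <= G om"
  "AE om in M. \<forall>j\<le>m. \<forall>s t. 0 <= s --> s <= t --> t <= T --> \<bar>B j t om - B j s om\<bar> <= G om * (t - s) powr be"
  "!!lam. 0 <= lam ==> (\<integral>\<^sup>+om. ennreal (exp (lam * G om powr (1 / be))) \<partial>M) < \<infinity>"
  using driver_hoelder[OF be(1,2)] by blast
 \<comment> \<open>As the Hoelder exponent of the solution may depend on the path, driver exponents
   arbitrarily close to H must be available on one set of full measure; a sequence keeps the null
   sets countable.\<close>
 have seq: "AE om in M. \<forall>k. \<exists>G\<ge>0. \<forall>j\<le>m. \<forall>s t. 0 <= s --> s <= t --> t <= T --> \<bar>B j t om - B j s om\<bar> <= G * (t - s) powr (H - (H - 1 / 2) / (real k + 2))"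
 proof (rule AE_all_countable[THEN iffD2], rule allI)
  fix k :: nat
  define be' where "be' = H - (H - 1 / 2) / (real k + 2)"
  have "0 < (H - 1 / 2) / (real k + 2)" using H by simp
  moreover have "(H - 1 / 2) / (real k + 2) <= (H - 1 / 2) / 2" using H by (intro divide_left_mono) auto
  ultimately have "1 / 2 < be'" "be' < H" using H by (auto simp: be'_def)
  from driver_hoelder[OF this] obtain G' where "!!om. 1 <= G' om"
   "AE om in M. \<forall>j\<le>m. \<forall>s t. 0 <= s --> s <= t --> t <= T --> \<bar>B j t om - B j s om\<bar> <= G' om * (t - s) powr be'" by blast
  then show "AE om in M. \<exists>G\<ge>0. \<forall>j\<le>m. \<forall>s t. 0 <= s --> s <= t --> t <= T --> \<bar>B j t om - B j s om\<bar> <= G * (t - s) powr (H - (H - 1 / 2) / (real k + 2))"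
   unfolding be'_def[symmetric] by (elim eventually_mono) (meson order_trans zero_le_one)
 qed
 obtain C where CW: "0 <= C \<and> (\<forall>n\<ge>1. \<forall>N\<ge>1. \<exists>Tht. Tht \<in> borel_measurable M \<and> (\<forall>om. 0 <= Tht om)
   \<and> (\<forall>om i j k l. fl --> i < j --> j <= m --> k <= l --> l <= n --> \<bar>\<Sum>s=k..<l. cell_area (T / real n) N s i j om\<bar> <= Tht om * (real (l - k) * (T / real n)) powr tht)
   \<and> (\<forall>om k l. m = 1 --> k <= l --> l <= n --> \<bar>\<Sum>s=k..<l. (B 1 (real (Suc s) * (T / real n)) om - B 1 (real s * (T / real n)) om) ^ 3\<bar> <= Tht om * (real (l - k) * (T / real n)) powr tht)
   \<and> (\<integral>\<^sup>+om. ennreal (Tht om ^ (2 * r)) \<partial>M) <= ennreal (C * ((T / real n) powr et) ^ (2 * r)))"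
  using weights_exist[OF tht(1,2) r(1,2) et(1) flags] ..
 note C = conjunct1[OF CW] and weights = conjunct2[OF CW, rule_format]
 \<comment> \<open>The pathwise constants depend only on the parameters listed here, neither on the
   path nor on n; the absolute values make their signs irrelevant.\<close>
 define A where "A = \<bar>cn.A be T L m tht\<bar>"
 define Bx where "Bx = \<bar>cn.Bx be T L m tht\<bar>"
 define E1 where "E1 = enn2real (\<integral>\<^sup>+om. ennreal (exp (real (2 * r) * Bx * G om powr (1 / be))) \<partial>M)"
 have E1: "(\<integral>\<^sup>+om. ennreal (exp (real (2 * r) * Bx * G om powr (1 / be))) \<partial>M) = ennreal E1" "0 <= E1"
  using G(4)[of "real (2 * r) * Bx"] by (auto simp: E1_def Bx_def)
 \<comment> \<open>A bound for the 2 * r-th moment of the random factor \<Phi> divided by h powr et: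
   its four summands, namely the weight, h powr et itself and the two squared increments, contribute
   C, 1 and twice \<open>gmom (2 * r)\<close>.\<close>
 define C3 where "C3 = 4 ^ (2 * r) * (C + 1 + 2 * gmom (2 * r))"
 have C3: "0 <= C3" using C gmom_pos[of "2 * r"] by (simp add: C3_def)
 define Q where "Q = 1 + E1 + C3"
 have Q: "0 <= Q" using E1 C3 by (simp add: Q_def)
 define K where "K = A * T powr et * Q powr (1 / p)"
 have main: "Lp_norm M p (%om. X t om - Xn n t om) <= ennreal (K / real n powr et)" if n: "1 <= n" and t: "t \<in> {0..T}" for n t
 proof -
  define h where "h = T / real n"
  have h: "0 < h" "real n * h = T" using n T by (auto simp: h_def)
  obtain N where N: "1 <= N" "real N * (h / real N) powr (2 * be) <= h ^ 3" using fine_exists[OF h(1) be(1)] by blast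
  obtain Tht where TH: "Tht \<in> borel_measurable M \<and> (\<forall>om. 0 <= Tht om)
    \<and> (\<forall>om i j k l. fl --> i < j --> j <= m --> k <= l --> l <= n --> \<bar>\<Sum>s=k..<l. cell_area h N s i j om\<bar> <= Tht om * (real (l - k) * h) powr tht)
    \<and> (\<forall>om k l. m = 1 --> k <= l --> l <= n --> \<bar>\<Sum>s=k..<l. (B 1 (real (Suc s) * h) om - B 1 (real s * h) om) ^ 3\<bar> <= Tht om * (real (l - k) * h) powr tht)
    \<and> (\<integral>\<^sup>+om. ennreal (Tht om ^ (2 * r)) \<partial>M) <= ennreal (C * (h powr et) ^ (2 * r))"
   using weights[OF n N(1)] unfolding h_def[symmetric] ..
  note Th = conjunct1[OF TH] conjunct1[OF conjunct2[OF TH], rule_format] conjunct1[OF conjunct2[OF conjunct2[OF TH]], rule_format]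
   conjunct1[OF conjunct2[OF conjunct2[OF conjunct2[OF TH]]], rule_format] conjunct2[OF conjunct2[OF conjunct2[OF conjunct2[OF TH]]]]
  have gr: "grid T n k = real k * h" for k by (simp add: grid_def h_def)
  \<comment> \<open>Both inequalities are weak, so that t = T is served by the last cell.\<close>
  obtain k where k: "k < n" "grid T n k <= t" "t <= grid T n (Suc k)"
  proof (cases "t = T")
   case True
   show ?thesis using n h True by (intro that[of "n - 1"]) (auto simp: gr of_nat_diff algebra_simps)
  next
   case False
   define k where "k = nat \<lfloor>t / h\<rfloor>"
   have f0: "0 <= \<lfloor>t / h\<rfloor>" using t h by (simp add: zero_le_floor)
   have kr: "real k = of_int \<lfloor>t / h\<rfloor>" using f0 by (simp add: k_def)
   have "real k <= t / h" "t / h <= real k + 1" unfolding kr by linarith+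
   then have "real k * h <= t" "t <= (real k + 1) * h" using h by (auto simp: field_simps)
   moreover have "k < n"
   proof -
    have "real k * h < real n * h" using \<open>real k * h <= t\<close> False t h by simp
    then have "real k < real n" using h(1) by (simp only: mult_less_cancel_right_pos)
    then show ?thesis by simp
   qed
   ultimately show ?thesis by (intro that[of k]) (auto simp: gr add.commute)
  qed
  define s0 s1 where "s0 = grid T n k" and "s1 = grid T n (Suc k)"
  define SQ1 SQ2 where "SQ1 om = (if m = 1 \<and> L0 = 0 then (B 1 t om - B 1 s0 om)\<^sup>2 else 0)" and "SQ2 om = (if m = 1 \<and> L0 = 0 then (B 1 s1 om - B 1 s0 om)\<^sup>2 else 0)" for om
  define \<Phi> where "\<Phi> om = Tht om + h powr et + SQ1 om + SQ2 om" for om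
  have path: "AE om in M. norm (X t om - Xn n t om) <= A * exp (Bx * G om powr (1 / be)) * \<Phi> om"
   using sol scheme[OF n] G(3) seq AE_space
  proof eventually_elim
   case (elim om)
   have qual: "X 0 om = x" "\<exists>Q \<gamma>. 1 < \<gamma> \<and> 0 <= Q \<and> (\<forall>s t. 0 <= s \<and> s <= t \<and> t <= T -->
     norm (X t om - X s om - germ m (%j t. B j t om) (%j s. V j (X s om)) s t) <= Q * (t - s) powr \<gamma>)"
    using young_solution_qual[OF elim(1) H T, of L] V_lipb L elim(4) by auto
   interpret P: cn be T L "G om" m V "%j t. B j t om" "%t. X t om" tht et L0 "Tht om" D E x "%t. Xn n t om" n N
   proof
    show "!!i j k l. (m = 1 ==> L0 ~= 0) ==> i < j ==> j <= m ==> k <= l ==> l <= n ==>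
     \<bar>\<Sum>r=k..<l. area (%j t. B j t om) (grid T n r) (T / real n) N i j\<bar> <= Tht om * (real (l - k) * (T / real n)) powr tht"
     using Th(3) unfolding fl_def cell_area_def gr h_def[symmetric] by auto
    show "!!k l. m = 1 ==> k <= l ==> l <= n ==>
     \<bar>\<Sum>r=k..<l. (B 1 (grid T n (Suc r)) om - B 1 (grid T n r) om) ^ 3\<bar> <= Tht om * (real (l - k) * (T / real n)) powr tht"
     using Th(4) unfolding gr h_def[symmetric] by auto
    show "\<exists>Q \<gamma>. 1 < \<gamma> \<and> 0 <= Q \<and> (\<forall>s t. 0 <= s \<and> s <= t \<and> t <= T -->
     norm (X t om - X s om - germ m (%j t. B j t om) (%j s. V j (X s om)) s t) <= Q * (t - s) powr \<gamma>)" by (rule qual(2))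
    show "!!j s t. j <= m ==> 0 <= s ==> s <= t ==> t <= T ==> \<bar>B j t om - B j s om\<bar> <= G om * (t - s) powr be" using elim(3) by blast
    show "!!j. j <= m ==> expands m V L (V j) (%i. D i j)" using V_exp by blast
    show "!!j a a' c c'. j <= m ==> norm (V j a - V j a' - (V j c - V j c')) <= L * norm (a - a' - (c - c')) + L * norm (c - c') * (norm (a - c) + norm (a' - c'))"
     using V4 by blast
    show "expands m V L0 (V 0) (%i. D i 0)" by (rule third(2))
    show "expands m V L (D 1 1) E" by (rule E_exp)
    show "!!t. 0 <= t ==> t <= T ==> B 0 t om = t" using B_time elim(5) by auto
    show "crank_nicolson T n m V (%j t. B j t om) x (%t. Xn n t om)" by (rule elim(2))
    show "X 0 om = x" by (rule qual(1))
    show "real N * (T / real n / real N) powr (2 * be) <= (T / real n) ^ 3" using N(2) by (simp add: h_def)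
   qed (use be T L G(2) V_lipb tht D_lipb L0 third E_lipb et n N(1) Th(2) in auto)
   have "norm (X t om - Xn n t om) <= cn.A be T L m tht * exp (cn.Bx be T L m tht * G om powr (1 / be)) * (Tht om + (T / real n) powr et + P.sq k t)"
    by (rule P.pathwise_error[OF k])
   also have "Tht om + (T / real n) powr et + P.sq k t = \<Phi> om"
    unfolding \<Phi>_def P.sq_def SQ1_def SQ2_def h_def s0_def s1_def by auto
   also have "cn.A be T L m tht * exp (cn.Bx be T L m tht * G om powr (1 / be)) * \<Phi> om <= A * exp (Bx * G om powr (1 / be)) * \<Phi> om"
    using Th(2)[of om] by (intro mult_right_mono mult_mono) (auto simp: A_def Bx_def \<Phi>_def SQ1_def SQ2_def intro!: mult_right_mono)
   finally show ?case .
  qed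
  have inT: "s0 \<in> {0..T}" "s1 \<in> {0..T}"
  proof -
   have "real (Suc k) * h <= real n * h" using k h by (intro mult_right_mono) auto
   then show "s0 \<in> {0..T}" "s1 \<in> {0..T}" using h by (auto simp: s0_def s1_def gr algebra_simps)
  qed
  have SQ0: "0 <= SQ1 om" "0 <= SQ2 om" for om by (auto simp: SQ1_def SQ2_def)
  have ph: "0 < h powr et" using h by simp
  have Bm: "m = 1 ==> B 1 u \<in> borel_measurable M" if "u \<in> {0..T}" for u using B_meas that by simp
  have sqm: "(%om. if m = 1 \<and> L0 = 0 then (B 1 u om - B 1 s0 om)\<^sup>2 else 0) \<in> borel_measurable M" if u: "u \<in> {0..T}" for u
  proof (cases "m = 1 \<and> L0 = 0")
   case True
   have "B 1 u \<in> borel_measurable M" "B 1 s0 \<in> borel_measurable M" using Bm[OF u] Bm[OF inT(1)] True by blast+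
   then show ?thesis unfolding if_P[OF True] by measurable
  next
   case False
   show ?thesis unfolding if_not_P[OF False] by measurable
  qed
  have SQm[measurable]: "SQ1 \<in> borel_measurable M" "SQ2 \<in> borel_measurable M"
   unfolding SQ1_def[abs_def] SQ2_def[abs_def] by (rule sqm[OF t], rule sqm[OF inT(2)])
  have sqE: "(\<integral>\<^sup>+om. ennreal ((if m = 1 \<and> L0 = 0 then (B 1 u om - B 1 s0 om)\<^sup>2 else 0) ^ (2 * r)) \<partial>M) <= ennreal (gmom (2 * r) * (h powr et) ^ (2 * r))"
   if u: "u \<in> {0..T}" "\<bar>u - s0\<bar> <= h" for u
  proof (cases "m = 1 \<and> L0 = 0")
   case True
   then have m1: "1 \<in> {1..m}" by simp
   have "(\<integral>\<^sup>+om. ennreal ((if m = 1 \<and> L0 = 0 then (B 1 u om - B 1 s0 om)\<^sup>2 else 0) ^ (2 * r)) \<partial>M) = (\<integral>\<^sup>+om. ennreal ((B 1 u om - B 1 s0 om) ^ (2 * (2 * r))) \<partial>M)"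
    using True by (simp add: power_mult)
   also have "... = ennreal (gmom (2 * r) * (\<bar>u - s0\<bar> powr (2 * H)) ^ (2 * r))" by (rule inc_moment_nn[OF m1 inT(1) u(1)])
   also have "... <= ennreal (gmom (2 * r) * (h powr (2 * H)) ^ (2 * r))"
    using u gmom_pos[of "2 * r"] H by (intro ennreal_leI mult_left_mono power_mono powr_mono2) auto
   finally show ?thesis using et(6) True by simp
  next
   case False
   show ?thesis unfolding if_not_P[OF False] using r by (simp add: power_0_left)
  qed
  have E\<Phi>: "(\<integral>\<^sup>+om. ennreal ((\<Phi> om / h powr et) ^ (2 * r)) \<partial>M) <= ennreal C3"
  proof -
   define w where "w = 4 ^ (2 * r) / (h powr et) ^ (2 * r)"
   have w: "0 <= w" by (simp add: w_def)
   have "(\<integral>\<^sup>+om. ennreal ((\<Phi> om / h powr et) ^ (2 * r)) \<partial>M) <= (\<integral>\<^sup>+om. ennreal w * (ennreal (Tht om ^ (2 * r)) + ennreal ((h powr et) ^ (2 * r)) + ennreal (SQ1 om ^ (2 * r)) + ennreal (SQ2 om ^ (2 * r))) \<partial>M)"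
   proof (rule nn_integral_mono)
    fix om
    have "\<Phi> om ^ (2 * r) <= 4 ^ (2 * r) * (Tht om ^ (2 * r) + (h powr et) ^ (2 * r) + SQ1 om ^ (2 * r) + SQ2 om ^ (2 * r))"
     unfolding \<Phi>_def using Th(2) SQ0 by (intro power_sum4_le) auto
    then have "(\<Phi> om / h powr et) ^ (2 * r) <= w * (Tht om ^ (2 * r) + (h powr et) ^ (2 * r) + SQ1 om ^ (2 * r) + SQ2 om ^ (2 * r))"
     unfolding power_divide w_def by (simp add: divide_right_mono)
    then have "ennreal ((\<Phi> om / h powr et) ^ (2 * r)) <= ennreal (w * (Tht om ^ (2 * r) + (h powr et) ^ (2 * r) + SQ1 om ^ (2 * r) + SQ2 om ^ (2 * r)))" by (rule ennreal_leI)
    also have "... = ennreal w * (ennreal (Tht om ^ (2 * r)) + ennreal ((h powr et) ^ (2 * r)) + ennreal (SQ1 om ^ (2 * r)) + ennreal (SQ2 om ^ (2 * r)))"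
     using w Th(2)[of om] SQ0[of om] by (simp add: ennreal_mult)
    finally show "ennreal ((\<Phi> om / h powr et) ^ (2 * r)) <= ennreal w * (ennreal (Tht om ^ (2 * r)) + ennreal ((h powr et) ^ (2 * r)) + ennreal (SQ1 om ^ (2 * r)) + ennreal (SQ2 om ^ (2 * r)))" .
   qed
   also have "... = ennreal w * ((\<integral>\<^sup>+om. ennreal (Tht om ^ (2 * r)) \<partial>M) + ennreal ((h powr et) ^ (2 * r)) + (\<integral>\<^sup>+om. ennreal (SQ1 om ^ (2 * r)) \<partial>M) + (\<integral>\<^sup>+om. ennreal (SQ2 om ^ (2 * r)) \<partial>M))"
    using Th(1) by (simp add: nn_integral_cmult nn_integral_add emeasure_space_1)
   also have "... <= ennreal w * (ennreal (C * (h powr et) ^ (2 * r)) + ennreal ((h powr et) ^ (2 * r)) + ennreal (gmom (2 * r) * (h powr et) ^ (2 * r)) + ennreal (gmom (2 * r) * (h powr et) ^ (2 * r)))"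
   proof (intro mult_left_mono add_mono Th(5) order_refl)
    show "(\<integral>\<^sup>+om. ennreal (SQ1 om ^ (2 * r)) \<partial>M) <= ennreal (gmom (2 * r) * (h powr et) ^ (2 * r))"
     unfolding SQ1_def using t k by (intro sqE) (auto simp: s0_def gr algebra_simps)
    show "(\<integral>\<^sup>+om. ennreal (SQ2 om ^ (2 * r)) \<partial>M) <= ennreal (gmom (2 * r) * (h powr et) ^ (2 * r))"
     unfolding SQ2_def using inT h by (intro sqE) (auto simp: s0_def s1_def gr algebra_simps)
   qed auto
   also have "... = ennreal (w * (C * (h powr et) ^ (2 * r) + (h powr et) ^ (2 * r) + gmom (2 * r) * (h powr et) ^ (2 * r) + gmom (2 * r) * (h powr et) ^ (2 * r)))"
    using w C gmom_pos[of "2 * r"] by (intro ennreal_weighted_sum4) (auto intro!: mult_nonneg_nonneg)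
   also have "w * (C * (h powr et) ^ (2 * r) + (h powr et) ^ (2 * r) + gmom (2 * r) * (h powr et) ^ (2 * r) + gmom (2 * r) * (h powr et) ^ (2 * r)) = C3"
    using ph by (simp add: w_def C3_def field_simps)
   finally show ?thesis .
  qed
  have "(\<integral>\<^sup>+om. ennreal (norm (X t om - Xn n t om) powr p) \<partial>M) <= (\<integral>\<^sup>+om. ennreal ((A * h powr et) powr p) * (1 + ennreal (exp (real (2 * r) * Bx * G om powr (1 / be))) + ennreal ((\<Phi> om / h powr et) ^ (2 * r))) \<partial>M)"
  proof (rule nn_integral_mono_AE)
   show "AE om in M. ennreal (norm (X t om - Xn n t om) powr p) <= ennreal ((A * h powr et) powr p) * (1 + ennreal (exp (real (2 * r) * Bx * G om powr (1 / be))) + ennreal ((\<Phi> om / h powr et) ^ (2 * r)))"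
    using path
   proof eventually_elim
    case (elim om)
    define e where "e = exp (Bx * G om powr (1 / be))"
    define z where "z = \<Phi> om / h powr et"
    have z: "0 <= z" using Th(2)[of om] SQ0[of om] by (simp add: z_def \<Phi>_def)
    have e: "0 < e" by (simp add: e_def)
    have "norm (X t om - Xn n t om) <= (A * h powr et) * (e * z)" using elim ph by (simp add: e_def z_def mult_ac)
    then have "norm (X t om - Xn n t om) powr p <= ((A * h powr et) * (e * z)) powr p" using p by (intro powr_mono2) auto
    also have "... = (A * h powr et) powr p * (e * z) powr p" by (rule powr_mult)
    \<comment> \<open>This separates the exponential from \<Phi> pointwise: where the product
      exceeds 1, the exponent p is raised to r and the product of the r-th powers is bounded by the
      sum of their squares.\<close>
    also have "(e * z) powr p <= 1 + e ^ (2 * r) + z ^ (2 * r)"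
    proof (cases "e * z <= 1")
     case True
     then have a: "(e * z) powr p <= 1" using powr_mono2[of p "e * z" 1] e z p by simp
     have b: "0 <= e ^ (2 * r)" "0 <= z ^ (2 * r)" using e z by auto
     from a b show ?thesis by linarith
    next
     case False
     then have "(e * z) powr p <= (e * z) powr real r" using r by (intro powr_mono) auto
     also have "... = e ^ r * z ^ r" using False by (simp add: powr_realpow power_mult_distrib)
     also have "... <= (e ^ r)\<^sup>2 + (z ^ r)\<^sup>2"
      using sum_squares_bound[of "e ^ r" "z ^ r"] mult_nonneg_nonneg[OF zero_le_power[OF less_imp_le[OF e], of r] zero_le_power[OF z, of r]] by linarith
     also have "... = e ^ (2 * r) + z ^ (2 * r)" by (simp add: power_mult[symmetric] mult.commute)
     finally show ?thesis by simp
    qed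
    finally have "norm (X t om - Xn n t om) powr p <= (A * h powr et) powr p * (1 + e ^ (2 * r) + z ^ (2 * r))" by (simp add: mult_left_mono)
    then have "ennreal (norm (X t om - Xn n t om) powr p) <= ennreal ((A * h powr et) powr p * (1 + e ^ (2 * r) + z ^ (2 * r)))" by (rule ennreal_leI)
    also have "... = ennreal ((A * h powr et) powr p) * (1 + ennreal (e ^ (2 * r)) + ennreal (z ^ (2 * r)))"
     using e z by (simp add: ennreal_mult)
    also have "e ^ (2 * r) = exp (real (2 * r) * Bx * G om powr (1 / be))" unfolding e_def exp_of_nat_mult[symmetric] by (simp add: mult.assoc)
    finally show ?case by (simp add: z_def)
   qed
  qed
  also have "... = ennreal ((A * h powr et) powr p) * (1 + ennreal E1 + (\<integral>\<^sup>+om. ennreal ((\<Phi> om / h powr et) ^ (2 * r)) \<partial>M))"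
  proof -
   have [measurable]: "\<Phi> \<in> borel_measurable M" unfolding \<Phi>_def[abs_def] using Th(1) by measurable
   show ?thesis unfolding E1(1)[symmetric] using G(1) by (simp add: nn_integral_cmult nn_integral_add emeasure_space_1)
  qed
  also have "... <= ennreal ((A * h powr et) powr p) * (1 + ennreal E1 + ennreal C3)" by (intro mult_left_mono add_left_mono E\<Phi>) auto
  also have "... = ennreal ((A * h powr et) powr p * Q)" using E1(2) C3 by (simp add: Q_def ennreal_mult)
  finally have "Lp_norm M p (%om. X t om - Xn n t om) <= ennreal (((A * h powr et) powr p * Q) powr (1 / p))"
   by (rule Lp_norm_le) (use p Q in auto)
  also have "((A * h powr et) powr p * Q) powr (1 / p) = (A * h powr et) * Q powr (1 / p)"
  proof -
   have "((A * h powr et) powr p * Q) powr (1 / p) = ((A * h powr et) powr p) powr (1 / p) * Q powr (1 / p)" by (rule powr_mult)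
   also have "((A * h powr et) powr p) powr (1 / p) = A * h powr et" using p by (simp add: powr_powr A_def)
   finally show ?thesis .
  qed
  also have "... = K / real n powr et" using T n by (simp add: K_def h_def powr_divide)
  finally show ?thesis .
 qed
 have rate: "rate H m (V 0) n = real n powr et" for n by (simp add: rate_def et_def dr_def)
 show ?thesis
 proof (intro exI[of _ K] conjI allI impI SUP_least)
  show "0 <= K" by (simp add: K_def A_def)
  fix n t assume "(1::nat) <= n" "t \<in> {0..T}"
  then show "Lp_norm M p (%om. X t om - Xn n t om) <= ennreal (K / rate H m (V 0) n)" unfolding rate by (rule main)
 qed
qed

end
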